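(* Assume $q \neq 2$. For each positive integer $d \geq 1$ let $K_d$ be the subfield of $K_\infty$ generated over $K$ by all multizeta values of depth $1$ or depth $d$. Then for each $d \geq 2$, the transcendence degree of $K_d$ over $K_1$ is infinite.
   Context: Let $\mathbb{F}_q$ be the finite field with $q$ elements, $K = \mathbb{F}_q(\theta)$, $K_\infty = \mathbb{F}_q((\theta^{-1}))$. For positive integers $n_1,\dots,n_r$, the multizeta value of depth $r$ is $\zeta(n_1,\dots,n_r) = \sum \frac{1}{a_1^{n_1}\cdots a_r^{n_r}} \in K_\infty$, the sum over all monic polynomials $a_i \in \mathbb{F}_q[\theta]$ with $\deg a_1 > \cdots > \deg a_r \geq 0$. *)

theory Defs
  imports "HOL-Computational_Algebra.Polynomial" "HOL-Computational_Algebra.Formal_Laurent_Series"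
begin

text \<open>Conventions. The finite field F_q is a type 'a of class {field, finite}; q = CARD('a).
  K_infinity = F_q((1/theta)) is the field of formal Laurent series 'a fls in the variable
  X = 1/theta, so theta = fls_X_inv. It carries the (1/theta)-adic metric from the library.\<close>

definition theta :: "'a::field fls" where
  "theta = fls_X_inv"

definition poly_theta :: "'a::field poly \<Rightarrow> 'a fls" where
  "poly_theta a = (\<Sum>i\<le>degree a. fls_const (coeff a i) * theta ^ i)"

definition monic_deg :: "nat \<Rightarrow> 'a::field poly set" where
  "monic_deg k = {a. lead_coeff a = 1 \<and> degree a = k}"

definition power_sum :: "nat \<Rightarrow> nat \<Rightarrow> 'a::{field,finite} fls" where
  "power_sum k n = (\<Sum>a\<in>monic_deg k. inverse (poly_theta a ^ n))"

text \<open>Partial sums: mz_partial N [n1,...,nr] is the sum over N > d1 > ... > dr >= 0 of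
  prod_i S_{d_i}(n_i), i.e. the sum over monic a_i with deg a_1 > ... > deg a_r >= 0 and deg a_1 < N.\<close>
fun mz_partial :: "nat \<Rightarrow> nat list \<Rightarrow> 'a::{field,finite} fls" where
  "mz_partial N [] = 1"
| "mz_partial N (n # ns) = (\<Sum>d<N. power_sum d n * mz_partial d ns)"

definition multizeta :: "nat list \<Rightarrow> 'a::{field,finite} fls" where
  "multizeta ns = lim (\<lambda>N. mz_partial N ns)"

definition is_subfield :: "'a::field set \<Rightarrow> bool" where
  "is_subfield F \<longleftrightarrow> 0 \<in> F \<and> 1 \<in> F \<and> (\<forall>x\<in>F. \<forall>y\<in>F. x + y \<in> F \<and> x * y \<in> F)
     \<and> (\<forall>x\<in>F. - x \<in> F \<and> inverse x \<in> F)"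

definition gen_field :: "'a::field set \<Rightarrow> 'a set" where
  "gen_field S = \<Inter>{F. is_subfield F \<and> S \<subseteq> F}"

definition Kfield :: "'a::field fls set" where
  "Kfield = gen_field (range fls_const \<union> {theta})"

definition mzv_depth :: "nat \<Rightarrow> 'a::{field,finite} fls set" where
  "mzv_depth r = {multizeta ns | ns. length ns = r \<and> (\<forall>n\<in>set ns. n \<ge> 1)}"

definition K_gen :: "nat \<Rightarrow> 'a::{field,finite} fls set" where
  "K_gen d = gen_field (Kfield \<union> mzv_depth 1 \<union> mzv_depth d)"

text \<open>Algebraic independence over a subfield F of a finite family xs: no nontrivial polynomial
  relation with coefficients in F (a polynomial in length xs variables is written out as a
  finite set M of exponent vectors with coefficients c).\<close>
definition alg_indep_over :: "'a::field set \<Rightarrow> 'a list \<Rightarrow> bool" where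
  "alg_indep_over F xs \<longleftrightarrow>
     (\<forall>(M :: (nat \<Rightarrow> nat) set) c. finite M \<longrightarrow> (\<forall>e\<in>M. \<forall>i\<ge>length xs. e i = 0) \<longrightarrow>
        (\<forall>e\<in>M. c e \<in> F) \<longrightarrow>
        (\<Sum>e\<in>M. c e * (\<Prod>i<length xs. (xs ! i) ^ e i)) = 0 \<longrightarrow> (\<forall>e\<in>M. c e = 0))"

definition infinite_trdeg :: "'a::field set \<Rightarrow> 'a set \<Rightarrow> bool" where
  "infinite_trdeg L F \<longleftrightarrow> (\<forall>n. \<exists>xs. length xs = n \<and> set xs \<subseteq> L \<and> alg_indep_over F xs)"

end

theory Submission
  imports Defs
begin

text \<open>Let $\ell_d = \prod_{i=1}^d (\theta - \theta^{q^i})$. By Lagrange interpolation at the points $\theta^{q^i}$, the power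
  sums satisfy $S_d(n) = h_n(\theta^{q^d}) / \ell_d^n$ with $h_n \in K[Y]$, so the depth one values are $K$-combinations of
  the series $\sum_d \theta^{k q^d} / \ell_d^n$. For a power $P$ of $q$ a telescoping sum shows that, up to a factor in
  $K^\times$ and up to such combinations, $\zeta(1, P, (q-1)P, (q-1)qP, \dots, (q-1)q^{k-1}P)$ equals
  $\sum_{d > e} 1 / (\ell_d \ell_e^Q)$ with $Q = q^k P$.

  These numbers are values at $x = \theta^{q^N}$ of functions $\psi_{n,k}$ and $\chi_Q$ satisfying linear difference
  equations for $x \mapsto x^q$, and Mahler's method applies. The $\chi_Q$ are algebraically independent over the field
  generated by all $\psi_{n,k}$: a relation can be made additive, and its Hasse derivatives give coefficients whose
  symmetry forces them to vanish. The hypothesis $q \ne 2$ makes $\psi_{1,0}$ transcendental over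
  $K_\infty(x, \psi_{q-1,0})$. The independence carries over to the values: if the values of linearly
  independent functions lay in a space of smaller dimension, Siegel's lemma would provide relations between
  them with small coefficients for every $N$, and these contradict simultaneous Pad\'e approximation.\<close>

subsection \<open>Spans\<close>

text \<open>The relations between the functions \<open>psi n k\<close> are never determined. Instead
  a field E is chosen maximal among the fields stable under x \<mapsto> x^q over which psi_{1,0}
  stays transcendental; the algebraic closure of E(psi_{1,0}) then captures every psi_{n,k} at once.
  All that must be known in depth one is that psi_{1,0} is transcendental over the field of
  solutions of homogeneous equations. For q = 2 this fails: there psi_{1,0} is psi_{q-1,0}, which
  differs from such a solution by a rational function. The passage to values likewise needs no
  dimension of a space of depth one values: one and the same basis of products of functions bounds
  the spaces of values from above and the spaces of functions from below. The indices (q-1)P,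
  (q-1)qP, ... are taken because their nested sums telescope to a product, so that every depth
  collapses to two; the free parameter P supplies infinitely many exponents Q in each fixed depth.
  Exponents Q that are powers of q make y \<mapsto> y^Q additive, as the comparison of Taylor
  coefficients requires.\<close>

inductive_set spn :: "'l::comm_ring_1 set \<Rightarrow> 'l set \<Rightarrow> 'l set" for R S where
  zero: "0 \<in> spn R S"
| step: "r \<in> R \<Longrightarrow> s \<in> S \<Longrightarrow> t \<in> spn R S \<Longrightarrow> r * s + t \<in> spn R S"

lemma spn_add: "x \<in> spn R S \<Longrightarrow> y \<in> spn R S \<Longrightarrow> x + y \<in> spn R S"
  by (induction rule: spn.induct) (auto simp: add.assoc intro: spn.intros)

lemma spn_base: "r \<in> R \<Longrightarrow> s \<in> S \<Longrightarrow> r * s \<in> spn R S"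
  using spn.step[OF _ _ spn.zero, of r R s S] by simp

lemma spn_sum: "(\<And>i. i \<in> A \<Longrightarrow> f i \<in> spn R S) \<Longrightarrow> sum f A \<in> spn R S"
  by (induction A rule: infinite_finite_induct) (auto intro: spn.zero spn_add)

lemma spn_trans:
  assumes "x \<in> spn R S" and "\<And>r s. r \<in> R \<Longrightarrow> s \<in> S \<Longrightarrow> r * s \<in> spn R' S'"
  shows "x \<in> spn R' S'"
  using assms(1) by induction (auto intro: spn.zero spn_add assms(2))

lemma spn_mono: "x \<in> spn R S \<Longrightarrow> R \<subseteq> R' \<Longrightarrow> S \<subseteq> S' \<Longrightarrow> x \<in> spn R' S'"
  by (erule spn_trans) (auto intro: spn_base)

lemma spn_mult_left:
  assumes "x \<in> spn R S" and "\<And>r s. r \<in> R \<Longrightarrow> s \<in> S \<Longrightarrow> c * (r * s) \<in> spn R' S'"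
  shows "c * x \<in> spn R' S'"
  using assms(1) by induction (auto simp: distrib_left intro: spn.zero spn_add assms(2))

lemma spn_mult:
  assumes "x \<in> spn R S" "y \<in> spn R' S'"
    and "\<And>r r'. r \<in> R \<Longrightarrow> r' \<in> R' \<Longrightarrow> r * r' \<in> R''"
    and "\<And>s s'. s \<in> S \<Longrightarrow> s' \<in> S' \<Longrightarrow> s * s' \<in> S''"
  shows "x * y \<in> spn R'' S''"
proof -
  have "y * x \<in> spn R'' S''"
    using assms(1)
  proof (rule spn_mult_left)
    fix r s assume rs: "r \<in> R" "s \<in> S"
    have "(r * s) * y \<in> spn R'' S''"
      using assms(2)
    proof (rule spn_mult_left)
      fix r' s' assume "r' \<in> R'" "s' \<in> S'"
      then have "(r * r') * (s * s') \<in> spn R'' S''"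
        using rs by (intro spn_base assms(3,4))
      then show "r * s * (r' * s') \<in> spn R'' S''"
        by (simp add: mult_ac)
    qed
    then show "y * (r * s) \<in> spn R'' S''" by (simp add: mult_ac)
  qed
  then show ?thesis by (simp add: mult.commute)
qed

text \<open>Of \<open>R\<close> only additive closure is asked, so that it may later be a set of
  polynomials of bounded degree, which is not a ring.\<close>

lemma spn_explicit:
  assumes "x \<in> spn R S" "finite S" "0 \<in> R" "\<And>a b. a \<in> R \<Longrightarrow> b \<in> R \<Longrightarrow> a + b \<in> R"
  shows "\<exists>c. (\<forall>s\<in>S. c s \<in> R) \<and> x = (\<Sum>s\<in>S. c s * s)"
  using assms(1)
proof induction
  case zero
  then show ?case using assms(3) by (intro exI[of _ "\<lambda>_. 0"]) auto
next
  case (step r s t)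
  then obtain c where c: "\<forall>s\<in>S. c s \<in> R" "t = (\<Sum>s\<in>S. c s * s)" by blast
  have "(\<Sum>x\<in>S. (c(s := r + c s)) x * x) = (r + c s) * s + (\<Sum>x\<in>S - {s}. c x * x)"
    using step.hyps(2) assms(2) by (subst sum.remove[of _ s]) (auto intro!: sum.cong)
  also have "\<dots> = r * s + t"
    unfolding c(2) using step.hyps(2) assms(2)
    by (subst (2) sum.remove[of _ s]) (auto simp: algebra_simps)
  finally show ?case
    using c(1) step.hyps assms(4) by (intro exI[of _ "c(s := r + c s)"]) auto
qed

subsection \<open>Polynomials over subfields\<close>

lemma subfield_closed:
  assumes "is_subfield E"
  shows "0 \<in> E" "1 \<in> E" "x \<in> E \<Longrightarrow> y \<in> E \<Longrightarrow> x + y \<in> E" "x \<in> E \<Longrightarrow> y \<in> E \<Longrightarrow> x * y \<in> E"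
    "x \<in> E \<Longrightarrow> - x \<in> E" "x \<in> E \<Longrightarrow> inverse x \<in> E"
    "x \<in> E \<Longrightarrow> y \<in> E \<Longrightarrow> x - y \<in> E" "x \<in> E \<Longrightarrow> y \<in> E \<Longrightarrow> x / y \<in> E"
    "x \<in> E \<Longrightarrow> x ^ n \<in> E" "of_nat n \<in> E"
    "(\<And>i. i \<in> A \<Longrightarrow> f i \<in> E) \<Longrightarrow> sum f A \<in> E"
    "(\<And>i. i \<in> A \<Longrightarrow> f i \<in> E) \<Longrightarrow> prod f A \<in> E"
proof -
  have *: "0 \<in> E" "1 \<in> E" "\<And>x y. x \<in> E \<Longrightarrow> y \<in> E \<Longrightarrow> x + y \<in> E"
    "\<And>x y. x \<in> E \<Longrightarrow> y \<in> E \<Longrightarrow> x * y \<in> E" "\<And>x. x \<in> E \<Longrightarrow> - x \<in> E" "\<And>x. x \<in> E \<Longrightarrow> inverse x \<in> E"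
    using assms by (auto simp: is_subfield_def)
  show "0 \<in> E" "1 \<in> E" "x \<in> E \<Longrightarrow> y \<in> E \<Longrightarrow> x + y \<in> E" "x \<in> E \<Longrightarrow> y \<in> E \<Longrightarrow> x * y \<in> E"
    "x \<in> E \<Longrightarrow> - x \<in> E" "x \<in> E \<Longrightarrow> inverse x \<in> E" by (fact *)+
  show "x \<in> E \<Longrightarrow> y \<in> E \<Longrightarrow> x - y \<in> E" using *(3)[of x "-y"] *(5)[of y] by simp
  show "x \<in> E \<Longrightarrow> y \<in> E \<Longrightarrow> x / y \<in> E" using *(4)[of x "inverse y"] *(6)[of y] by (simp add: divide_inverse)
  show "x \<in> E \<Longrightarrow> x ^ n \<in> E" by (induction n) (auto intro: *)
  show "of_nat n \<in> E" by (induction n) (auto intro: *)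
  show "(\<And>i. i \<in> A \<Longrightarrow> f i \<in> E) \<Longrightarrow> sum f A \<in> E"
    by (induction A rule: infinite_finite_induct) (auto intro: *)
  show "(\<And>i. i \<in> A \<Longrightarrow> f i \<in> E) \<Longrightarrow> prod f A \<in> E"
    by (induction A rule: infinite_finite_induct) (auto intro: *)
qed

lemma is_subfield_gen_field: "is_subfield (gen_field S)"
  unfolding gen_field_def is_subfield_def by blast

lemma gen_field_superset: "S \<subseteq> gen_field S"
  by (auto simp: gen_field_def)

lemma gen_field_least: "is_subfield F \<Longrightarrow> S \<subseteq> F \<Longrightarrow> gen_field S \<subseteq> F"
  by (auto simp: gen_field_def)

lemma gen_field_mono: "S \<subseteq> S' \<Longrightarrow> gen_field S \<subseteq> gen_field S'"
  by (auto simp: gen_field_def)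

definition polyover :: "'l::field set \<Rightarrow> 'l poly \<Rightarrow> bool" where
  "polyover E p \<longleftrightarrow> (\<forall>i. coeff p i \<in> E)"

definition transcendental_over :: "'l::field set \<Rightarrow> 'l \<Rightarrow> bool" where
  "transcendental_over E t \<longleftrightarrow> (\<forall>p. polyover E p \<longrightarrow> poly p t = 0 \<longrightarrow> p = 0)"

text \<open>The field E(t), kept as explicit quotients because later arguments start from a
  numerator and a denominator.\<close>

definition adjoin :: "'l::field set \<Rightarrow> 'l \<Rightarrow> 'l set" where
  "adjoin E t = {poly p t / poly d t | p d. polyover E p \<and> polyover E d \<and> poly d t \<noteq> 0}"

lemma transcendental_over_mono: "transcendental_over F t \<Longrightarrow> E \<subseteq> F \<Longrightarrow> transcendental_over E t"
  by (auto simp: transcendental_over_def polyover_def)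

lemma polyover_mono: "polyover E p \<Longrightarrow> E \<subseteq> F \<Longrightarrow> polyover F p"
  by (auto simp: polyover_def)

context
  fixes E :: "'l::field set"
  assumes E: "is_subfield E"
begin

private lemmas sub = subfield_closed[OF E]

lemma polyover_0 [simp]: "polyover E 0" and polyover_const: "c \<in> E \<Longrightarrow> polyover E [:c:]"
  and polyover_1 [simp]: "polyover E 1"
  and polyover_monom: "c \<in> E \<Longrightarrow> polyover E (monom c n)"
  and polyover_pCons: "c \<in> E \<Longrightarrow> polyover E p \<Longrightarrow> polyover E (pCons c p)"
  and polyover_add: "polyover E p \<Longrightarrow> polyover E r \<Longrightarrow> polyover E (p + r)"
  and polyover_diff: "polyover E p \<Longrightarrow> polyover E r \<Longrightarrow> polyover E (p - r)"
  and polyover_uminus: "polyover E p \<Longrightarrow> polyover E (- p)"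
  and polyover_smult: "c \<in> E \<Longrightarrow> polyover E p \<Longrightarrow> polyover E (smult c p)"
  and polyover_mult: "polyover E p \<Longrightarrow> polyover E r \<Longrightarrow> polyover E (p * r)"
  unfolding polyover_def
  by (auto simp: sub coeff_pCons coeff_mult split: nat.splits)

lemma polyover_sum: "(\<And>i. i \<in> A \<Longrightarrow> polyover E (f i)) \<Longrightarrow> polyover E (sum f A)"
  by (induction A rule: infinite_finite_induct) (auto intro: polyover_add)

lemma polyover_pcompose: "polyover E p \<Longrightarrow> polyover E r \<Longrightarrow> polyover E (pcompose p r)"
proof (induction p)
  case (pCons a p)
  then have "a \<in> E" "polyover E p"
    unfolding polyover_def by (metis coeff_pCons_0) (metis coeff_pCons_Suc pCons.prems(1) polyover_def)
  then show ?case using pCons by (simp add: pcompose_pCons polyover_add polyover_mult polyover_pCons)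
qed auto

lemma poly_in_subfield: "polyover E p \<Longrightarrow> t \<in> E \<Longrightarrow> poly p t \<in> E"
  by (auto simp: polyover_def poly_altdef intro!: sub)

lemma adjoin_base: "c \<in> E \<Longrightarrow> c \<in> adjoin E t"
  unfolding adjoin_def by (rule CollectI, rule exI[of _ "[:c:]"], rule exI[of _ 1]) (auto intro: polyover_const)

lemma adjoin_poly: "polyover E p \<Longrightarrow> poly p t \<in> adjoin E t"
  unfolding adjoin_def by (rule CollectI, rule exI[of _ p], rule exI[of _ 1]) auto

lemma adjoin_gen: "t \<in> adjoin E t"
  using adjoin_poly[of "[:0,1:]" t] by (simp add: polyover_pCons sub)

lemma adjoin_subfield: "is_subfield (adjoin E t)"
  unfolding is_subfield_def
proof (intro conjI ballI)
  show "0 \<in> adjoin E t" "1 \<in> adjoin E t" by (auto intro: adjoin_base sub)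
next
  fix x y assume "x \<in> adjoin E t" "y \<in> adjoin E t"
  then obtain p d r e where *: "polyover E p" "polyover E d" "poly d t \<noteq> 0" "x = poly p t / poly d t"
    "polyover E r" "polyover E e" "poly e t \<noteq> 0" "y = poly r t / poly e t"
    unfolding adjoin_def by blast
  have "x + y = poly (p * e + r * d) t / poly (d * e) t" "poly (d * e) t \<noteq> 0"
    unfolding *(4,8) using *(3,7) by (auto simp: add_frac_eq)
  then show "x + y \<in> adjoin E t"
    unfolding adjoin_def using * by (blast intro: polyover_add polyover_mult)
  have "x * y = poly (p * r) t / poly (d * e) t" "poly (d * e) t \<noteq> 0" using * by auto
  then show "x * y \<in> adjoin E t"
    unfolding adjoin_def using * by (blast intro: polyover_mult)
next
  fix x assume "x \<in> adjoin E t"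
  then obtain p d where *: "polyover E p" "polyover E d" "poly d t \<noteq> 0" "x = poly p t / poly d t"
    unfolding adjoin_def by blast
  have "- x = poly (- p) t / poly d t" using * by simp
  then show "- x \<in> adjoin E t" unfolding adjoin_def using * by (blast intro: polyover_uminus)
  show "inverse x \<in> adjoin E t"
  proof (cases "poly p t = 0")
    case True
    then show ?thesis using * by (auto intro: adjoin_base sub)
  next
    case False
    then have "inverse x = poly d t / poly p t" using * by simp
    then show ?thesis unfolding adjoin_def using * False by blast
  qed
qed

text \<open>Induction on the equations: a nonzero pivot \<open>m p j0\<close> eliminates the unknown
  \<open>p\<close> from the remaining ones.\<close>

lemma homogeneous_system:
  fixes m :: "'i \<Rightarrow> 'j \<Rightarrow> 'l"
  assumes "finite J" "finite I" "card J < card I" "\<And>i j. i \<in> I \<Longrightarrow> j \<in> J \<Longrightarrow> m i j \<in> E"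
  shows "\<exists>c. (\<forall>i\<in>I. c i \<in> E) \<and> (\<exists>i\<in>I. c i \<noteq> 0) \<and> (\<forall>j\<in>J. (\<Sum>i\<in>I. c i * m i j) = 0)"
  using assms
proof (induction J arbitrary: I m rule: finite_induct)
  case empty
  then obtain i where "i \<in> I" by (metis card.empty card_gt_0_iff ex_in_conv)
  then show ?case by (intro exI[of _ "\<lambda>_. 1"]) (auto intro: sub)
next
  case (insert j0 J)
  show ?case
  proof (cases "\<forall>i\<in>I. m i j0 = 0")
    case True
    have "card J < card I" using insert by simp
    from insert.IH[OF insert.prems(1) this, of m] insert.prems(3)
    obtain c where c: "\<forall>i\<in>I. c i \<in> E" "\<exists>i\<in>I. c i \<noteq> 0" "\<forall>j\<in>J. (\<Sum>i\<in>I. c i * m i j) = 0"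
      by blast
    then show ?thesis using True by (intro exI[of _ c]) auto
  next
    case False
    then obtain p where p: "p \<in> I" "m p j0 \<noteq> 0" by blast
    define I' where "I' = I - {p}"
    have I': "finite I'" "card J < card I'" using insert p by (auto simp: I'_def)
    define m' where "m' = (\<lambda>i j. m i j - m i j0 / m p j0 * m p j)"
    have "m' i j \<in> E" if "i \<in> I'" "j \<in> J" for i j
      using that p insert.prems(3) by (auto simp: m'_def I'_def intro!: sub)
    from insert.IH[of I' m', OF I' this] obtain c where c: "\<forall>i\<in>I'. c i \<in> E" "\<exists>i\<in>I'. c i \<noteq> 0"
      "\<forall>j\<in>J. (\<Sum>i\<in>I'. c i * m' i j) = 0" by blast
    \<comment> \<open>The eliminated unknown receives the value that solves the equation
      \<open>j0\<close>.\<close>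
    define cp where "cp = - (\<Sum>i\<in>I'. c i * (m i j0 / m p j0))"
    define c' where "c' = c(p := cp)"
    have s: "(\<Sum>i\<in>I. c' i * m i j) = (\<Sum>i\<in>I'. c i * m' i j)" for j
    proof -
      have "(\<Sum>i\<in>I. c' i * m i j) = cp * m p j + (\<Sum>i\<in>I'. c i * m i j)"
        unfolding I'_def using p insert.prems(1) 
        by (subst sum.remove[of _ p]) (auto simp: c'_def intro!: sum.cong)
      also have "\<dots> = (\<Sum>i\<in>I'. c i * m' i j)"
        by (simp add: cp_def m'_def algebra_simps sum_subtractf sum_distrib_left)
      finally show ?thesis .
    qed
    have z: "(\<Sum>i\<in>I'. c i * m' i j0) = 0" using p by (simp add: m'_def)
    have "c' i \<in> E" if "i \<in> I" for i
      using that c(1) p insert.prems(3) by (auto simp: c'_def cp_def I'_def intro!: sub)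
    moreover have "\<exists>i\<in>I. c' i \<noteq> 0" using c(2) by (auto simp: c'_def I'_def)
    moreover have "\<forall>j\<in>insert j0 J. (\<Sum>i\<in>I. c' i * m i j) = 0" using s z c(3) by auto
    ultimately show ?thesis by blast
  qed
qed

definition algebraics :: "'l set" where
  "algebraics = {z. \<not> transcendental_over E z}"

end

text \<open>The span of \<open>S\<close> contains 1 and is stable under multiplication by
  \<open>x\<close>, so all powers of \<open>x\<close> lie in a space of dimension at most
  \<open>card S\<close>, and \<open>card S + 1\<close> of them are linearly dependent.\<close>

lemma algebraicI:
  assumes E: "is_subfield E" and S: "finite S" "1 \<in> spn E S" "\<And>s. s \<in> S \<Longrightarrow> x * s \<in> spn E S"
  shows "\<not> transcendental_over E x"
proof -
  note sub = subfield_closed[OF E]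
  have pw: "x ^ k \<in> spn E S" for k
  proof (induction k)
    case (Suc k)
    show ?case unfolding power_Suc
    proof (rule spn_mult_left[OF Suc])
      fix r s assume "r \<in> E" "s \<in> S"
      have "r * (x * s) \<in> spn E S"
        by (rule spn_mult_left[OF S(3)[OF \<open>s \<in> S\<close>]])
          (use \<open>r \<in> E\<close> in \<open>auto simp: mult.assoc[symmetric] intro!: spn_base sub\<close>)
      then show "x * (r * s) \<in> spn E S" by (simp add: mult_ac)
    qed
  qed (use S in auto)
  have "\<forall>k. \<exists>c. (\<forall>s\<in>S. c s \<in> E) \<and> x ^ k = (\<Sum>s\<in>S. c s * s)"
    using spn_explicit[OF pw S(1)] sub by blast
  then obtain c where c: "\<And>k s. s \<in> S \<Longrightarrow> c k s \<in> E" "\<And>k. x ^ k = (\<Sum>s\<in>S. c k s * s)" by metis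
  obtain b where b: "\<forall>k\<in>{..card S}. b k \<in> E" "\<exists>k\<in>{..card S}. b k \<noteq> 0"
      "\<forall>s\<in>S. (\<Sum>k\<in>{..card S}. b k * c k s) = 0"
    using homogeneous_system[OF E S(1), of "{..card S}" c] c(1) by auto
  define p where "p = (\<Sum>k\<le>card S. monom (b k) k)"
  have "coeff p k = (if k \<le> card S then b k else 0)" for k
    by (simp add: p_def coeff_sum)
  then have "polyover E p" "p \<noteq> 0" using b(1,2) sub(1) by (auto simp: polyover_def poly_eq_iff)
  moreover have "poly p x = 0"
  proof -
    have "poly p x = (\<Sum>k\<le>card S. b k * x ^ k)" by (simp add: p_def poly_sum poly_monom)
    also have "\<dots> = (\<Sum>k\<le>card S. \<Sum>s\<in>S. b k * c k s * s)"
      by (intro sum.cong refl, subst c(2)) (simp add: sum_distrib_left mult.assoc)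
    also have "\<dots> = (\<Sum>s\<in>S. (\<Sum>k\<le>card S. b k * c k s) * s)"
      by (subst sum.swap) (simp add: sum_distrib_right)
    also have "\<dots> = 0" using b(3) by simp
    finally show ?thesis .
  qed
  ultimately show ?thesis by (auto simp: transcendental_over_def)
qed

text \<open>The minimal polynomial. Its minimality is kept as a conclusion because later proofs
  compare it with its image under a twist, which has the same degree.\<close>

lemma monic_relation:
  assumes E: "is_subfield E" and z: "\<not> transcendental_over E z"
  obtains p where "polyover E p" "lead_coeff p = 1" "poly p z = 0" "degree p > 0"
    "\<And>r. polyover E r \<Longrightarrow> poly r z = 0 \<Longrightarrow> degree r < degree p \<Longrightarrow> r = 0"
proof -
  define P where "P = (\<lambda>p. polyover E p \<and> poly p z = 0 \<and> p \<noteq> 0)"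
  obtain p0 where p0: "P p0" using z by (auto simp: P_def transcendental_over_def)
  then obtain p where p: "P p" "\<And>r. P r \<Longrightarrow> degree p \<le> degree r"
    using ex_has_least_nat[of P p0 degree] by blast
  define p' where "p' = smult (inverse (lead_coeff p)) p"
  have lc: "lead_coeff p \<noteq> 0" "lead_coeff p \<in> E" using p(1) by (auto simp: P_def polyover_def)
  then have p': "polyover E p'" "lead_coeff p' = 1" "poly p' z = 0" "degree p' = degree p"
    using p(1) by (auto simp: p'_def P_def intro!: polyover_smult E subfield_closed[OF E])
  show ?thesis
  proof (rule that[of p'])
    show "degree p' > 0"
    proof (rule ccontr)
      assume "\<not> degree p' > 0"
      then have "p' = [:1:]" using p'(2) by (auto elim: degree_eq_zeroE)
      then show False using p'(3) by simp
    qed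
    fix r assume "polyover E r" "poly r z = 0" "degree r < degree p'"
    then show "r = 0" using p(2)[of r] p'(4) by (auto simp: P_def)
  qed (use p' in auto)
qed

lemma algebraic_power_reduce:
  assumes E: "is_subfield E" and z: "\<not> transcendental_over E z"
  obtains m c where "m > 0" "\<And>i. c i \<in> E" "z ^ m = (\<Sum>i<m. c i * z ^ i)"
proof -
  obtain p where p: "polyover E p" "lead_coeff p = 1" "poly p z = 0" "degree p > 0"
    using monic_relation[OF E z] by metis
  have "0 = (\<Sum>i\<le>degree p. coeff p i * z ^ i)" using p(3) by (simp add: poly_altdef)
  also have "\<dots> = z ^ degree p + (\<Sum>i<degree p. coeff p i * z ^ i)"
    using p(2) by (simp add: lessThan_Suc_atMost[symmetric])
  finally have "z ^ degree p = (\<Sum>i<degree p. (- coeff p i) * z ^ i)"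
    by (simp add: sum_negf eq_neg_iff_add_eq_0)
  then show ?thesis
    using p by (intro that[of "degree p" "\<lambda>i. - coeff p i"])
      (auto simp: polyover_def subfield_closed[OF E])
qed

text \<open>The products z^i w^j, with exponents below the degrees of monic relations, span a space
  stable under multiplication by z and by w.\<close>

lemma algebraics_ring:
  assumes E: "is_subfield E" and z: "\<not> transcendental_over E z" and w: "\<not> transcendental_over E w"
  shows "\<not> transcendental_over E (z + w)" "\<not> transcendental_over E (z * w)"
proof -
  note sub = subfield_closed[OF E]
  obtain m c where m: "m > 0" "\<And>i. c i \<in> E" "z ^ m = (\<Sum>i<m. c i * z ^ i)"
    using algebraic_power_reduce[OF E z] by blast
  obtain n d where n: "n > 0" "\<And>i. d i \<in> E" "w ^ n = (\<Sum>i<n. d i * w ^ i)"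
    using algebraic_power_reduce[OF E w] by blast
  define S where "S = (\<lambda>(i, j). z ^ i * w ^ j) ` ({..<m} \<times> {..<n})"
  have S: "finite S" by (simp add: S_def)
  have inS: "z ^ i * w ^ j \<in> S" if "i < m" "j < n" for i j using that by (force simp: S_def)
  have "z ^ 0 * w ^ 0 \<in> S" using inS m(1) n(1) by blast
  then have one: "1 \<in> spn E S" using spn_base[of 1 E 1 S] sub(2) by simp
  have zS: "z * s \<in> spn E S" if "s \<in> S" for s
  proof -
    obtain i j where ij: "s = z ^ i * w ^ j" "i < m" "j < n" using \<open>s \<in> S\<close> by (auto simp: S_def)
    show ?thesis
    proof (cases "Suc i < m")
      case True
      then show ?thesis using spn_base[of 1 E "z ^ Suc i * w ^ j" S] sub(2) inS[of "Suc i" j] ij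
        by (simp add: mult_ac)
    next
      case False
      then have "Suc i = m" using ij by simp
      then have "z * s = z ^ m * w ^ j" using ij by auto
      also have "\<dots> = (\<Sum>i<m. c i * (z ^ i * w ^ j))"
        by (simp add: m(3) sum_distrib_left sum_distrib_right mult_ac)
      finally have "z * s = (\<Sum>i<m. c i * (z ^ i * w ^ j))" .
      then show ?thesis using m(2) inS ij by (auto intro!: spn_sum spn_base)
    qed
  qed
  have wS: "w * s \<in> spn E S" if "s \<in> S" for s
  proof -
    obtain i j where ij: "s = z ^ i * w ^ j" "i < m" "j < n" using \<open>s \<in> S\<close> by (auto simp: S_def)
    show ?thesis
    proof (cases "Suc j < n")
      case True
      then show ?thesis using spn_base[of 1 E "z ^ i * w ^ Suc j" S] sub(2) inS[of i "Suc j"] ij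
        by (simp add: mult_ac)
    next
      case False
      then have "Suc j = n" using ij by simp
      then have "w * s = w ^ n * z ^ i" using ij by auto
      also have "\<dots> = (\<Sum>j<n. d j * (z ^ i * w ^ j))"
        by (simp add: n(3) sum_distrib_left sum_distrib_right mult_ac)
      finally show ?thesis using n(2) inS ij by (auto intro!: spn_sum spn_base)
    qed
  qed
  show "\<not> transcendental_over E (z + w)"
    by (rule algebraicI[OF E S one]) (auto simp: distrib_right intro: spn_add zS wS)
  show "\<not> transcendental_over E (z * w)"
  proof (rule algebraicI[OF E S one])
    fix s assume "s \<in> S"
    show "z * w * s \<in> spn E S"
      unfolding mult.assoc
    proof (rule spn_mult_left[OF wS[OF \<open>s \<in> S\<close>]])
      fix r s assume "r \<in> E" "s \<in> S"
      have "r * (z * s) \<in> spn E S"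
        by (rule spn_mult_left[OF zS[OF \<open>s \<in> S\<close>]])
          (use \<open>r \<in> E\<close> in \<open>auto simp: mult.assoc[symmetric] intro!: spn_base sub\<close>)
      then show "z * (r * s) \<in> spn E S" by (simp add: mult_ac)
    qed
  qed
qed

lemma algebraics_base: "is_subfield E \<Longrightarrow> E \<subseteq> algebraics E"
proof
  fix x assume E: "is_subfield E" "x \<in> E"
  have "polyover E [:-x, 1:]" using E by (intro polyover_pCons) (auto simp: subfield_closed)
  moreover have "poly [:-x, 1:] x = 0" "[:-x, 1:] \<noteq> 0" by auto
  ultimately show "x \<in> algebraics E"
    unfolding algebraics_def[OF E(1)] transcendental_over_def by blast
qed

lemma algebraics_subfield:
  assumes E: "is_subfield E"
  shows "is_subfield (algebraics E)"
proof -
  note def = algebraics_def[OF E]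
  note sub = subfield_closed[OF E]
  have base: "x \<in> E \<Longrightarrow> \<not> transcendental_over E x" for x
    using algebraics_base[OF E] by (auto simp: def)
  have "\<not> transcendental_over E (- x)" if "\<not> transcendental_over E x" for x
    using algebraics_ring(2)[OF E base that, of "-1"] by (auto simp: sub)
  moreover have "\<not> transcendental_over E (inverse x)" if x: "\<not> transcendental_over E x" for x
  proof (cases "x = 0")
    case False
    obtain p where p: "polyover E p" "poly p x = 0" "p \<noteq> 0"
      using x by (auto simp: transcendental_over_def)
    have "polyover E (reflect_poly p)" using p(1) sub(1) by (auto simp: polyover_def coeff_reflect_poly)
    moreover have "poly (reflect_poly p) (inverse x) = 0"
      using p(2) False by (subst poly_reflect_poly_nz) auto
    ultimately show ?thesis using p(3) by (auto simp: transcendental_over_def)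
  qed (use base sub in auto)
  ultimately show ?thesis
    unfolding is_subfield_def def using algebraics_ring[OF E] base sub by auto
qed

subsection \<open>Hasse derivatives\<close>

text \<open>The k-th derivative divided by k!, in the form that makes sense in positive
  characteristic.\<close>

definition hasse :: "nat \<Rightarrow> 'l::comm_ring_1 poly \<Rightarrow> 'l poly" where
  "hasse k p = (\<Sum>i\<le>degree p. monom (of_nat ((i + k) choose k) * coeff p (i + k)) i)"

lemma coeff_hasse: "coeff (hasse k p) i = of_nat ((i + k) choose k) * coeff p (i + k)"
  by (auto simp: hasse_def coeff_sum coeff_eq_0 not_le)

lemma coeff_linear_power:
  "coeff ([:t, 1::'l::comm_ring_1:] ^ i) k = of_nat (i choose k) * t ^ (i - k)"
proof (cases "k \<le> i")
  case False
  have "degree ([:t, 1:] ^ i) \<le> i"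
    using degree_power_le[of "[:t, 1:]" i] by simp
  then show ?thesis using False by (simp add: coeff_eq_0 binomial_eq_0)
qed (simp add: coeff_linear_poly_power)

lemma coeff_pcompose_shift:
  fixes p :: "'l::comm_ring_1 poly"
  shows "coeff (pcompose p [:t, 1:]) k = poly (hasse k p) t"
proof -
  define n where "n = degree p"
  have "pcompose p [:t, 1:] = (\<Sum>i\<le>n. smult (coeff p i) ([:t, 1:] ^ i))"
    unfolding pcompose_altdef poly_altdef n_def
    by (simp add: degree_map_poly coeff_map_poly)
  then have "coeff (pcompose p [:t, 1:]) k = (\<Sum>i\<le>n. coeff p i * of_nat (i choose k) * t ^ (i - k))"
    by (simp add: coeff_sum coeff_linear_power mult_ac)
  also have "\<dots> = (\<Sum>i\<in>{0 + k..n + k}. coeff p i * of_nat (i choose k) * t ^ (i - k))"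
    by (rule sum.mono_neutral_cong) (auto simp: n_def coeff_eq_0 binomial_eq_0)
  also have "\<dots> = (\<Sum>i\<in>{0..n}. coeff p (i + k) * of_nat ((i + k) choose k) * t ^ i)"
    by (subst sum.shift_bounds_cl_nat_ivl) simp
  also have "\<dots> = (\<Sum>i\<le>degree (hasse k p). coeff (hasse k p) i * t ^ i)"
  proof (rule sum.mono_neutral_cong_right)
    have "degree (hasse k p) \<le> n"
      by (rule degree_le) (auto simp: coeff_hasse n_def coeff_eq_0)
    then show "{..degree (hasse k p)} \<subseteq> {0..n}" by auto
    have "coeff (hasse k p) i = 0" if "i > degree (hasse k p)" for i using that by (rule coeff_eq_0)
    then show "\<forall>i\<in>{0..n} - {..degree (hasse k p)}. coeff p (i + k) * of_nat (i + k choose k) * t ^ i = 0"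
      by (auto simp: coeff_hasse mult_ac)
  qed (auto simp: coeff_hasse mult_ac)
  finally show ?thesis by (simp add: poly_altdef)
qed

text \<open>Over a field of characteristic p, a nonzero \<open>c\<close> would force
  \<open>k\<close> to be a power of p. Keeping the factor \<open>c\<close> covers zero coefficients
  too and avoids any mention of p.\<close>

lemma binomial_vanish_power:
  fixes s t :: "'l::comm_ring_1"
  assumes "k > 0" "\<And>i. 0 < i \<Longrightarrow> i < k \<Longrightarrow> c * of_nat (k choose i) = 0"
  shows "c * (s + t) ^ k = c * s ^ k + c * t ^ k"
proof -
  have "c * (s + t) ^ k = (\<Sum>i\<le>k. c * of_nat (k choose i) * s ^ i * t ^ (k - i))"
    by (simp add: binomial_ring sum_distrib_left mult.assoc)
  also have "\<dots> = (\<Sum>i\<in>{0, k}. c * of_nat (k choose i) * s ^ i * t ^ (k - i))"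
  proof (rule sum.mono_neutral_right)
    show "\<forall>i\<in>{..k} - {0, k}. c * of_nat (k choose i) * s ^ i * t ^ (k - i) = 0"
    proof
      fix i assume "i \<in> {..k} - {0, k}"
      then have "c * of_nat (k choose i) = 0" by (intro assms(2)) auto
      then show "c * of_nat (k choose i) * s ^ i * t ^ (k - i) = 0" by simp
    qed
  qed auto
  also have "\<dots> = c * s ^ k + c * t ^ k" using assms(1) by (simp add: add.commute)
  finally show ?thesis .
qed

lemma polyover_iff_coeffs: "0 \<in> E \<Longrightarrow> polyover E p \<longleftrightarrow> set (coeffs p) \<subseteq> E"
proof
  assume "0 \<in> E" "set (coeffs p) \<subseteq> E"
  then show "polyover E p"
    unfolding polyover_def by (metis coeff_in_coeffs coeff_0 le_degree subsetD)
qed (auto simp: polyover_def coeffs_def)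

lemma poly_eq_on_infinite:
  fixes p r :: "'l::idom poly"
  assumes "infinite S" "\<And>x. x \<in> S \<Longrightarrow> poly p x = poly r x"
  shows "p = r"
proof (rule ccontr)
  assume "p \<noteq> r"
  then have "finite {x. poly (p - r) x = 0}" by (intro poly_roots_finite) auto
  moreover have "S \<subseteq> {x. poly (p - r) x = 0}" using assms(2) by auto
  ultimately show False using assms(1) finite_subset by blast
qed

subsection \<open>Difference fields\<close>

text \<open>\<open>C\<close> takes the place of a field of constants: by the last hypothesis it
  contains the solutions of all equations \<tau> z = v^n z with n any integer. Two exponents i and j
  are used instead of n to avoid negative powers.\<close>

locale mahler =
  fixes \<tau> :: "'l::field \<Rightarrow> 'l" and v :: 'l and C :: "'l set"
  assumes tau_add: "\<tau> (a + b) = \<tau> a + \<tau> b" and tau_mult: "\<tau> (a * b) = \<tau> a * \<tau> b"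
    and tau_1: "\<tau> 1 = 1" and infinite_UNIV: "infinite (UNIV :: 'l set)"
    and C: "is_subfield C" and tau_C: "c \<in> C \<Longrightarrow> \<tau> c \<in> C" and v_C: "v \<in> C" and v_nz: "v \<noteq> 0"
    and homogeneous: "\<tau> z * v ^ i = v ^ j * z \<Longrightarrow> z \<in> C"
begin

lemma tau_0 [simp]: "\<tau> 0 = 0" using tau_add[of 0 0] by (metis add.right_neutral add_left_cancel)
lemma tau_minus: "\<tau> (- a) = - \<tau> a"
proof -
  have "\<tau> (- a) + \<tau> a = 0" by (simp flip: tau_add)
  then show ?thesis by (simp add: eq_neg_iff_add_eq_0)
qed
lemma tau_diff: "\<tau> (a - b) = \<tau> a - \<tau> b" using tau_add[of a "-b"] by (simp add: tau_minus)
lemma tau_power: "\<tau> (a ^ n) = \<tau> a ^ n" by (induction n) (auto simp: tau_1 tau_mult)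
lemma tau_sum: "\<tau> (sum f A) = (\<Sum>i\<in>A. \<tau> (f i))"
  by (induction A rule: infinite_finite_induct) (auto simp: tau_add)
lemma tau_nz: "a \<noteq> 0 \<Longrightarrow> \<tau> a \<noteq> 0"
  using tau_mult[of a "inverse a"] tau_1 by auto
lemma tau_eq_iff [simp]: "\<tau> a = \<tau> b \<longleftrightarrow> a = b"
  using tau_nz[of "a - b"] by (auto simp: tau_diff)
lemma tau_inverse: "\<tau> (inverse a) = inverse (\<tau> a)"
  using tau_mult[of a "inverse a"] tau_1 by (cases "a = 0") (auto simp: inverse_unique)
lemma tau_divide: "\<tau> (a / b) = \<tau> a / \<tau> b"
  by (simp add: divide_inverse tau_mult tau_inverse)

lemma infinite_range_tau: "infinite (range \<tau>)"
  using infinite_UNIV by (simp add: finite_image_iff inj_on_def)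

lemma tau_poly: "\<tau> (poly p s) = poly (map_poly \<tau> p) (\<tau> s)"
  by (induction p) (auto simp: map_poly_pCons tau_add tau_mult)

lemma degree_tau [simp]: "degree (map_poly \<tau> p) = degree p"
  using tau_nz by (cases "p = 0") (auto intro!: degree_map_poly)

lemma coeff_tau [simp]: "coeff (map_poly \<tau> p) k = \<tau> (coeff p k)"
  by (simp add: coeff_map_poly)

text \<open>Both sides are polynomials in \<tau> s, which runs through an infinite set, so their
  coefficients agree.\<close>

lemma coeff_hom:
  assumes "\<And>s r. \<tau> s = v ^ w * r \<Longrightarrow> \<tau> (poly g s) = v ^ W * poly h r"
  shows "\<tau> (coeff g k) * v ^ (w * k) = v ^ W * coeff h k"
proof -
  define H where "H = smult (v ^ W) (pcompose h [:0, inverse (v ^ w):])"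
  have "poly (map_poly \<tau> g) x = poly H x" if x: "x \<in> range \<tau>" for x
  proof -
    obtain s where s: "x = \<tau> s" using x by blast
    have "\<tau> s = v ^ w * (x * inverse (v ^ w))" using s v_nz by simp
    from assms[OF this] show ?thesis by (simp add: tau_poly s H_def poly_pcompose mult_ac)
  qed
  then have "map_poly \<tau> g = H" by (rule poly_eq_on_infinite[OF infinite_range_tau])
  then have "\<tau> (coeff g k) = v ^ W * (inverse (v ^ w) ^ k * coeff h k)"
    by (metis H_def coeff_pcompose_linear coeff_smult coeff_tau)
  then have "\<tau> (coeff g k) * v ^ (w * k) = v ^ W * coeff h k * (inverse (v ^ w) ^ k * (v ^ w) ^ k)"
    unfolding power_mult[of v w k] by (simp add: mult_ac)
  also have "inverse (v ^ w) ^ k * (v ^ w) ^ k = 1"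
    using v_nz by (simp flip: power_mult_distrib)
  finally show ?thesis by simp
qed

text \<open>Additive polynomials that carry equations of weight \<open>w\<close> to weight
  \<open>W\<close>: if \<tau> x = v^w (x + s), then A(x) solves the equation with \<open>W\<close>
  and A(s). Their coefficients solve homogeneous equations and so lie in \<open>C\<close>.\<close>

definition additive_map :: "nat \<Rightarrow> nat \<Rightarrow> 'l poly \<Rightarrow> bool" where
  "additive_map W w A \<longleftrightarrow> (\<forall>s t. poly A (s + t) = poly A s + poly A t) \<and>
     (\<forall>s r. \<tau> s = v ^ w * r \<longrightarrow> \<tau> (poly A s) = v ^ W * poly A r)"

lemma additive_map_add: "additive_map W w A \<Longrightarrow> poly A (s + t) = poly A s + poly A t"
  and additive_map_tau: "additive_map W w A \<Longrightarrow> \<tau> s = v ^ w * r \<Longrightarrow> \<tau> (poly A s) = v ^ W * poly A r"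
  by (auto simp: additive_map_def)

lemma additive_map_at_0: "additive_map W w A \<Longrightarrow> poly A 0 = 0"
  using additive_map_add[of W w A 0 0] by (metis add.right_neutral add_left_cancel)

lemma additive_map_coeff_0: "additive_map W w A \<Longrightarrow> coeff A 0 = 0"
  using additive_map_at_0 by (simp add: poly_0_coeff_0)

lemma additive_map_minus: "additive_map W w A \<Longrightarrow> poly A (s - t) = poly A s - poly A t"
  using additive_map_add[of W w A "s - t" t] by simp

lemma additive_map_sum: "additive_map W w A \<Longrightarrow> poly A (sum f I) = (\<Sum>i\<in>I. poly A (f i))"
  by (induction I rule: infinite_finite_induct) (auto simp: additive_map_at_0 additive_map_add)

lemma additive_map_zero: "additive_map W w 0" by (simp add: additive_map_def)

lemma additive_map_diff:
  assumes "additive_map W w A" "additive_map W w B"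
  shows "additive_map W w (A - B)"
  unfolding additive_map_def
proof (intro conjI allI impI)
  show "poly (A - B) (s + t) = poly (A - B) s + poly (A - B) t" for s t
    using additive_map_add[OF assms(1)] additive_map_add[OF assms(2)] by simp
  show "\<tau> (poly (A - B) s) = v ^ W * poly (A - B) r" if sr: "\<tau> s = v ^ w * r" for s r
    using additive_map_tau[OF assms(1) sr] additive_map_tau[OF assms(2) sr] by (simp add: tau_diff right_diff_distrib)
qed

lemma additive_map_pcompose: "additive_map W'' W A \<Longrightarrow> additive_map W w B \<Longrightarrow> additive_map W'' w (pcompose A B)"
  by (auto simp: additive_map_def poly_pcompose)

lemma additive_map_coeff: "additive_map W w A \<Longrightarrow> \<tau> (coeff A k) * v ^ (w * k) = v ^ W * coeff A k"
  by (rule coeff_hom) (auto simp: additive_map_tau)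

lemma additive_map_polyover: "additive_map W w A \<Longrightarrow> polyover C A"
  unfolding polyover_def using homogeneous[OF additive_map_coeff] by blast

lemma additive_map_apply:
  assumes "additive_map W w A" "\<tau> x = v ^ w * (x + s)"
  shows "\<tau> (poly A x) = v ^ W * (poly A x + poly A s)"
  using additive_map_tau[OF assms] additive_map_add[OF assms(1)] by simp

text \<open>Additivity says that the Taylor expansion of A at any s is A + A(s). Hence the k-th
  Hasse derivative is constant, and its coefficient at i - k vanishes.\<close>

lemma additive_map_binomial:
  assumes "additive_map W w A" "0 < k" "k < i"
  shows "of_nat (i choose k) * coeff A i = 0"
proof -
  have "poly (hasse k A) s = coeff A k" for s
  proof -
    have "pcompose A [:s, 1:] = A + [:poly A s:]"
      by (rule poly_eq_on_infinite[OF infinite_UNIV])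
        (simp add: poly_pcompose additive_map_add[OF assms(1)])
    then have "coeff (pcompose A [:s, 1:]) k = coeff A k" using assms(2) by (auto simp: coeff_pCons split: nat.split)
    then show ?thesis by (simp add: coeff_pcompose_shift)
  qed
  then have "hasse k A = [:coeff A k:]" by (intro poly_eq_on_infinite[OF infinite_UNIV]) auto
  then have "coeff (hasse k A) (i - k) = 0" using assms by (auto simp: coeff_pCons split: nat.split)
  then show ?thesis using assms by (simp add: coeff_hasse)
qed

lemma additive_map_I:
  assumes hom: "\<And>k. \<tau> (coeff A k) * v ^ (w * k) = v ^ W * coeff A k"
    and binom: "\<And>k i. 0 < k \<Longrightarrow> k < i \<Longrightarrow> of_nat (i choose k) * coeff A i = 0"
    and 0: "coeff A 0 = 0"
  shows "additive_map W w A"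
  unfolding additive_map_def
proof safe
  fix s t
  have "coeff A i * (s + t) ^ i = coeff A i * s ^ i + coeff A i * t ^ i" for i
    using 0 binom[of _ i] by (cases "i = 0") (auto intro!: binomial_vanish_power simp: mult.commute)
  then show "poly A (s + t) = poly A s + poly A t"
    by (simp add: poly_altdef sum.distrib)
next
  fix s r assume sr: "\<tau> s = v ^ w * r"
  have "\<tau> (coeff A i * s ^ i) = v ^ W * (coeff A i * r ^ i)" for i
    using hom[of i] by (simp add: tau_mult tau_power sr power_mult_distrib power_mult mult.assoc[symmetric])
  then show "\<tau> (poly A s) = v ^ W * poly A r"
    by (simp add: poly_altdef tau_sum sum_distrib_left)
qed

lemma additive_map_power:
  assumes "additive_map W w A" "k > 0"
  shows "coeff A k * (s + t) ^ k = coeff A k * s ^ k + coeff A k * t ^ k"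
  by (rule binomial_vanish_power[OF assms(2)]) (use additive_map_binomial[OF assms(1)] in \<open>auto simp: mult.commute\<close>)

section \<open>Stable fields and solutions of inhomogeneous equations\<close>

definition stable :: "'l set \<Rightarrow> bool" where
  "stable E \<longleftrightarrow> is_subfield E \<and> C \<subseteq> E \<and> (\<forall>z\<in>E. \<tau> z \<in> E)"

lemma stableD: "stable E \<Longrightarrow> is_subfield E" "stable E \<Longrightarrow> C \<subseteq> E" "stable E \<Longrightarrow> z \<in> E \<Longrightarrow> \<tau> z \<in> E"
    "stable E \<Longrightarrow> v \<in> E" "stable E \<Longrightarrow> v ^ n \<in> E" "stable E \<Longrightarrow> polyover E p \<Longrightarrow> polyover E (map_poly \<tau> p)"
  using v_C subfield_closed(9)[of E v n] by (auto simp: stable_def polyover_def)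

lemma stable_adjoin:
  assumes "stable E" "\<tau> t \<in> adjoin E t"
  shows "stable (adjoin E t)"
  unfolding stable_def
proof (intro conjI ballI)
  note sf = adjoin_subfield[OF stableD(1)[OF assms(1)]]
  show "is_subfield (adjoin E t)" by (rule sf)
  show "C \<subseteq> adjoin E t" using stableD[OF assms(1)] adjoin_base by blast
  fix z assume "z \<in> adjoin E t"
  then obtain p d where z: "polyover E p" "polyover E d" "z = poly p t / poly d t"
    unfolding adjoin_def by blast
  have "poly (map_poly \<tau> p) (\<tau> t) \<in> adjoin E t" if "polyover E p" for p
    using stableD(6)[OF assms(1) that] adjoin_base[OF stableD(1)[OF assms(1)]]
    by (intro poly_in_subfield[OF sf _ assms(2)]) (auto simp: polyover_def)
  then show "\<tau> z \<in> adjoin E t"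
    using z by (auto simp: tau_divide tau_poly intro!: subfield_closed(8)[OF sf])
qed

lemma stable_algebraics:
  assumes "stable E"
  shows "stable (algebraics E)"
  unfolding stable_def
proof (intro conjI ballI)
  note E = stableD(1)[OF assms]
  show "is_subfield (algebraics E)" by (rule algebraics_subfield[OF E])
  show "C \<subseteq> algebraics E" using algebraics_base[OF E] stableD(2)[OF assms] by blast
  fix z assume "z \<in> algebraics E"
  then obtain p where p: "polyover E p" "poly p z = 0" "p \<noteq> 0"
    by (auto simp: algebraics_def[OF E] transcendental_over_def)
  have "map_poly \<tau> p \<noteq> 0" using p(3) tau_nz by (auto simp: poly_eq_iff)
  then show "\<tau> z \<in> algebraics E"
    using tau_poly[of p z] p stableD(6)[OF assms p(1)]
    by (auto simp: algebraics_def[OF E] transcendental_over_def)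
qed

text \<open>The coefficients of the Taylor expansion of \<^term>\<open>f\<close> at \<^term>\<open>t\<close> solve homogeneous equations, so
  they lie in the base field and all higher Hasse derivatives of \<^term>\<open>f\<close> are constant.\<close>

lemma kolchin:
  assumes E: "stable E" and t: "\<tau> t = v ^ w * (t + \<rho>)" and f: "polyover E f"
    and id: "\<And>r. poly (map_poly \<tau> f) (v ^ w * (r + \<rho>)) = v ^ W * (poly f r + S)"
    and min: "\<And>g. polyover E g \<Longrightarrow> degree g < degree f \<Longrightarrow> poly g t = 0 \<Longrightarrow> g = 0"
  shows "additive_map W w (f - [:coeff f 0:])"
proof (cases "degree f = 0")
  case True
  then have "f - [:coeff f 0:] = 0" by (auto elim!: degree_eq_zeroE)
  then show ?thesis by (simp add: additive_map_zero)
next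
  case False
  define F where "F = pcompose f [:t, 1:]"
  have hom: "\<tau> (coeff F k) * v ^ (w * k) = v ^ W * coeff (F + [:S:]) k" for k
  proof (rule coeff_hom)
    fix s r assume "\<tau> s = v ^ w * r"
    then have "\<tau> (t + s) = v ^ w * ((t + r) + \<rho>)" by (simp add: tau_add t algebra_simps)
    then show "\<tau> (poly F s) = v ^ W * poly (F + [:S:]) r"
      using id[of "t + r"] by (simp add: F_def poly_pcompose tau_poly)
  qed
  \<comment> \<open>The inhomogeneous term \<open>S\<close> enters only the constant
    coefficient.\<close>
  have hom': "\<tau> (coeff F k) * v ^ (w * k) = v ^ W * coeff F k" if "k > 0" for k
    using hom[of k] that by (auto simp: coeff_pCons split: nat.splits)
  have hs: "hasse k f = [:coeff F k:]" if "k > 0" for k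
  proof -
    have "coeff F k \<in> E" using homogeneous[OF hom'[OF that]] stableD(2)[OF E] by blast
    then have "polyover E (hasse k f - [:coeff F k:])"
      using f by (intro polyover_diff polyover_const stableD(1)[OF E])
        (auto simp: polyover_def coeff_hasse intro!: subfield_closed(4,10) stableD(1)[OF E])
    \<comment> \<open>The constant is the value of the Hasse derivative at \<open>t\<close>; after
      subtracting it, a polynomial of degree below that of \<open>f\<close> vanishes at
      \<open>t\<close>, and minimality applies.\<close>
    moreover have "degree (hasse k f - [:coeff F k:]) < degree f"
      using False that by (intro degree_lessI) (auto simp: coeff_hasse coeff_pCons coeff_eq_0 split: nat.split)
    moreover have "poly (hasse k f - [:coeff F k:]) t = 0" by (simp add: F_def coeff_pcompose_shift)
    ultimately show ?thesis using min[of "hasse k f - [:coeff F k:]"] by simp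
  qed
  have ck: "coeff f k = coeff F k" if "k > 0" for k
    using arg_cong[OF hs[OF that], of "\<lambda>p. coeff p 0"] by (simp add: coeff_hasse)
  show ?thesis
  proof (rule additive_map_I)
    fix k
    show "\<tau> (coeff (f - [:coeff f 0:]) k) * v ^ (w * k) = v ^ W * coeff (f - [:coeff f 0:]) k"
      using hom'[of k] ck[of k] by (cases k) (auto simp: coeff_pCons)
  next
    fix k i :: nat assume "0 < k" "k < i"
    then show "of_nat (i choose k) * coeff (f - [:coeff f 0:]) i = 0"
      using arg_cong[OF hs[of k], of "\<lambda>p. coeff p (i - k)"]
      by (auto simp: coeff_hasse coeff_pCons split: nat.splits)
  qed auto
qed

text \<open>Twisting the minimal polynomial R of x by \<tau> gives a polynomial of the same degree
  that vanishes at x, hence a multiple of R. This is the hypothesis of \<open>kolchin\<close>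
  without inhomogeneous term, so A = R - R(0) is additive, and A(x) = - R(0) lies in
  \<open>E\<close>.\<close>

lemma algebraic_solution:
  assumes E: "stable E" and x: "\<not> transcendental_over E x" and tx: "\<tau> x = v ^ w * (x + S)" and S: "S \<in> E"
  obtains A n where "additive_map (w * n) w A" "lead_coeff A = 1" "degree A = n" "n > 0" "poly A x \<in> E"
proof -
  note sf = stableD(1)[OF E]
  obtain R where R: "polyover E R" "lead_coeff R = 1" "poly R x = 0" "degree R > 0"
    "\<And>r. polyover E r \<Longrightarrow> poly r x = 0 \<Longrightarrow> degree r < degree R \<Longrightarrow> r = 0"
    using monic_relation[OF sf x] by metis
  define n where "n = degree R"
  define P where "P = pcompose (map_poly \<tau> R) [:v ^ w * S, v ^ w:]"
  define G where "G = P - smult (v ^ (w * n)) R"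
  have "polyover E G"
    unfolding G_def P_def using R(1) S E
    by (intro polyover_diff polyover_smult polyover_pcompose polyover_pCons polyover_0 stableD(5,6) sf
      subfield_closed(4)[OF sf])
  moreover have "poly G x = 0"
    using tau_poly[of R x] R(3) by (simp add: G_def P_def poly_pcompose tx algebra_simps)
  moreover have "degree G < degree R"
  proof (rule degree_lessI)
    have d: "degree P = n" using v_nz by (simp add: P_def degree_pcompose n_def)
    have "lead_coeff P = v ^ (w * n)"
      unfolding P_def using v_nz R(2) by (subst lead_coeff_comp) (auto simp: n_def power_mult tau_1)
    then have "coeff P n = v ^ (w * n)" by (simp add: d)
    then show "\<forall>k\<ge>degree R. coeff G k = 0"
      using R(2) d by (auto simp: G_def le_less n_def coeff_eq_0)
  qed (use R in auto)
  ultimately have "G = 0" by (rule R(5))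
  then have PG: "P = smult (v ^ (w * n)) R" by (simp add: G_def)
  have id: "poly (map_poly \<tau> R) (v ^ w * (r + S)) = v ^ (w * n) * (poly R r + 0)" for r
    using arg_cong[OF PG, of "\<lambda>p. poly p r"] by (simp add: P_def poly_pcompose algebra_simps)
  have "additive_map (w * n) w (R - [:coeff R 0:])"
    by (rule kolchin[OF E tx R(1) id]) (use R(5) in auto)
  moreover have "degree (R - [:coeff R 0:]) = n"
    using R(4) by (metis add_uminus_conv_diff degree_add_eq_left degree_minus degree_pCons_0 n_def)
  moreover have "lead_coeff (R - [:coeff R 0:]) = 1"
    unfolding \<open>degree (R - [:coeff R 0:]) = n\<close> using R(2,4) by (auto simp: n_def coeff_pCons split: nat.splits)
  moreover have "poly (R - [:coeff R 0:]) x \<in> E"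
    using R(1,3) by (simp add: polyover_def subfield_closed(5)[OF sf])
  ultimately show ?thesis using R(4) unfolding n_def by (intro that) assumption+
qed

text \<open>A denominator of minimal degree is unique up to scalars, hence semi-invariant.\<close>

lemma minimal_denominator:
  assumes sf: "is_subfield E" and tE: "\<And>c. c \<in> E \<Longrightarrow> \<tau> c \<in> E" and vE: "v \<in> E"
    and tt: "\<tau> t = v ^ a * (t + \<rho>)" and rho: "\<rho> \<in> E"
    and z: "z \<in> adjoin E t" and tz: "\<tau> z = v ^ W * (z + poly s t)" and s: "polyover E s"
  obtains d p where "polyover E d" "lead_coeff d = 1" "polyover E p" "poly d t * z = poly p t"
    "pcompose (map_poly \<tau> d) [:v ^ a * \<rho>, v ^ a:] = smult (v ^ (a * degree d)) d"
proof -
  have mp: "polyover E p \<Longrightarrow> polyover E (map_poly \<tau> p)" for p using tE by (auto simp: polyover_def)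
  have vnE: "v ^ n \<in> E" for n using subfield_closed(9)[OF sf vE] .
  note po = polyover_diff[OF sf] polyover_smult[OF sf] polyover_pcompose[OF sf] polyover_pCons[OF sf]
    polyover_mult[OF sf] polyover_add[OF sf] polyover_const[OF sf] vnE mp subfield_closed(4)[OF sf] polyover_0[OF sf]
  define lift where "lift = (\<lambda>p. pcompose (map_poly \<tau> p) [:v ^ a * \<rho>, v ^ a:])"
  have lift: "polyover E (lift p)" if "polyover E p" for p
    unfolding lift_def using that rho by (intro po)
  have lift_t: "poly (lift p) t = \<tau> (poly p t)" for p
    by (simp add: lift_def poly_pcompose tau_poly tt algebra_simps)
  define P where "P = (\<lambda>d. polyover E d \<and> d \<noteq> 0 \<and> (\<exists>p. polyover E p \<and> poly d t * z = poly p t))"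
  obtain d0 where "P d0" using z unfolding P_def adjoin_def by fastforce
  then obtain d1 where d1: "P d1" "\<And>r. P r \<Longrightarrow> degree d1 \<le> degree r"
    using ex_has_least_nat[of P d0 degree] by blast
  define d where "d = smult (inverse (lead_coeff d1)) d1"
  have lc: "lead_coeff d1 \<noteq> 0" "lead_coeff d1 \<in> E" using d1(1) by (auto simp: P_def polyover_def)
  obtain p1 where p1: "polyover E p1" "poly d1 t * z = poly p1 t" using d1(1) by (auto simp: P_def)
  define p where "p = smult (inverse (lead_coeff d1)) p1"
  have d: "polyover E d" "lead_coeff d = 1" "degree d = degree d1" "polyover E p" "poly d t * z = poly p t"
    using d1(1) lc p1 by (auto simp: d_def p_def P_def intro!: po subfield_closed(6)[OF sf])
  define e where "e = degree d"
  \<comment> \<open>A nonzero \<open>G\<close> would be a denominator of lower degree: the equation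
    of \<open>z\<close> shows that \<open>lift d\<close> is a denominator as well, and the leading
    terms cancel.\<close>
  define G where "G = lift d - smult (v ^ (a * e)) d"
  have poG: "polyover E G" unfolding G_def using d lift by (intro po) auto
  have "G = 0"
  proof (rule ccontr)
    assume "G \<noteq> 0"
    have "poly (lift d) t * (v ^ W * (z + poly s t)) = poly (lift p) t"
      using arg_cong[OF d(5), of \<tau>] by (simp add: tau_mult lift_t tz)
    then have "v ^ W * (poly (lift d) t * z) = v ^ W * poly (smult (inverse (v ^ W)) (lift p) - lift d * s) t"
      using v_nz by (simp add: algebra_simps)
    then have "poly (lift d) t * z = poly (smult (inverse (v ^ W)) (lift p) - lift d * s) t"
      using v_nz by simp
    moreover have "poly G t * z = poly (lift d) t * z - v ^ (a * e) * (poly d t * z)"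
      by (simp add: G_def algebra_simps)
    ultimately have "poly G t * z = poly (smult (inverse (v ^ W)) (lift p) - lift d * s - smult (v ^ (a * e)) p) t"
      by (simp add: d(5))
    moreover have "polyover E (smult (inverse (v ^ W)) (lift p) - lift d * s - smult (v ^ (a * e)) p)"
      using d s lift by (intro po subfield_closed(6)[OF sf]) auto
    ultimately have "P G" unfolding P_def using poG \<open>G \<noteq> 0\<close> by blast
    then have "e \<le> degree G" using d1(2) d(3) e_def by simp
    have dl: "degree (lift d) = e" using v_nz by (simp add: lift_def degree_pcompose e_def)
    have "lead_coeff (lift d) = v ^ (a * e)"
      unfolding lift_def using v_nz d(2) by (subst lead_coeff_comp) (auto simp: e_def power_mult tau_1)
    then have "coeff G e = 0" using dl d(2) by (simp add: G_def e_def)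
    moreover have "degree G \<le> e"
      unfolding G_def using dl by (intro degree_diff_le) (auto simp: e_def)
    ultimately show False using \<open>e \<le> degree G\<close> \<open>G \<noteq> 0\<close> by (metis le_antisym leading_coeff_0_iff)
  qed
  then have "lift d = smult (v ^ (a * degree d)) d" by (simp add: G_def e_def)
  then show ?thesis using that[of d p] d by (simp add: lift_def)
qed

text \<open>The value at t of a minimal denominator solves a homogeneous equation and so lies in
  \<open>C\<close>; since t is transcendental, the denominator is 1. For the same reason the
  equation, known at t, holds identically in r.\<close>

lemma polynomial_solution:
  assumes E: "stable E" and t: "transcendental_over E t" and tt: "\<tau> t = v ^ a * (t + \<rho>)" and rho: "\<rho> \<in> E"
    and z: "z \<in> adjoin E t" and tz: "\<tau> z = v ^ W * (z + poly s t)" and s: "polyover E s"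
  obtains f where "polyover E f" "z = poly f t"
    "\<And>r. poly (map_poly \<tau> f) (v ^ a * (r + \<rho>)) = v ^ W * (poly f r + poly s r)"
proof -
  note sf = stableD(1)[OF E]
  note po = polyover_diff[OF sf] polyover_smult[OF sf] polyover_pcompose[OF sf] polyover_pCons[OF sf]
    polyover_add[OF sf] polyover_const[OF sf] stableD(5,6)[OF E] subfield_closed(4)[OF sf] polyover_0[OF sf]
  define lift where "lift = (\<lambda>p. pcompose (map_poly \<tau> p) [:v ^ a * \<rho>, v ^ a:])"
  have lift: "polyover E (lift p)" if "polyover E p" for p
    unfolding lift_def using that rho by (intro po)
  have lift_t: "poly (lift p) t = \<tau> (poly p t)" for p
    by (simp add: lift_def poly_pcompose tau_poly tt algebra_simps)
  have lift_r: "poly (lift p) r = poly (map_poly \<tau> p) (v ^ a * (r + \<rho>))" for p r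
    by (simp add: lift_def poly_pcompose algebra_simps)
  obtain d p where d: "polyover E d" "lead_coeff d = 1" "polyover E p" "poly d t * z = poly p t"
    "lift d = smult (v ^ (a * degree d)) d"
    unfolding lift_def
    by (rule minimal_denominator[OF sf stableD(3)[OF E] stableD(4)[OF E] tt rho z tz s])
  have "\<tau> (poly d t) = v ^ (a * degree d) * poly d t"
    using lift_t[of d] d(5) by simp
  then have "poly d t \<in> C" using homogeneous[of "poly d t" 0 "a * degree d"] by simp
  then have "polyover E (d - [:poly d t:])" using d stableD(2)[OF E] by (intro po) auto
  moreover have "poly (d - [:poly d t:]) t = 0" by simp
  ultimately have "d - [:poly d t:] = 0" using t by (auto simp: transcendental_over_def)
  then have "degree d = 0" by (metis degree_pCons_0 eq_iff_diff_eq_0)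
  then have "d = 1" using d(2) by (auto elim!: degree_eq_zeroE)
  then have zp: "z = poly p t" using d(4) by simp
  have "polyover E (lift p - smult (v ^ W) (p + s))" using d lift s by (intro po) auto
  moreover have "poly (lift p - smult (v ^ W) (p + s)) t = 0" using tz by (simp add: lift_t zp[symmetric])
  ultimately have "lift p - smult (v ^ W) (p + s) = 0" using t unfolding transcendental_over_def by blast
  then have "poly (lift p) r = v ^ W * (poly p r + poly s r)" for r
    by (metis eq_iff_diff_eq_0 poly_add poly_smult)
  then show ?thesis using that[of p] d(3) zp lift_r by metis
qed

end

section \<open>Maximal stable fields and the independence of functions\<close>

context mahler
begin

lemma stable_Union:
  assumes "\<C> \<noteq> {}" "subset.chain {E. stable E} \<C>"
  shows "stable (\<Union>\<C>)"
proof -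
  have st: "E \<in> \<C> \<Longrightarrow> stable E" for E using assms(2) by (auto simp: subset_chain_def)
  have two: "\<exists>E\<in>\<C>. x \<in> E \<and> y \<in> E" if "x \<in> \<Union>\<C>" "y \<in> \<Union>\<C>" for x y
    using that assms(2) unfolding subset_chain_def by blast
  have "is_subfield (\<Union>\<C>)"
    unfolding is_subfield_def
  proof (intro conjI ballI)
    obtain E where "E \<in> \<C>" using assms(1) by blast
    then show "0 \<in> \<Union>\<C>" "1 \<in> \<Union>\<C>" using subfield_closed(1,2)[OF stableD(1)[OF st]] by blast+
  next
    fix x y assume "x \<in> \<Union>\<C>" "y \<in> \<Union>\<C>"
    then obtain E where "E \<in> \<C>" "x \<in> E" "y \<in> E" using two by blast
    then show "x + y \<in> \<Union>\<C>" "x * y \<in> \<Union>\<C>" using subfield_closed(3,4)[OF stableD(1)[OF st]] by blast+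
  next
    fix x assume "x \<in> \<Union>\<C>"
    then obtain E where "E \<in> \<C>" "x \<in> E" by blast
    then show "- x \<in> \<Union>\<C>" "inverse x \<in> \<Union>\<C>" using subfield_closed(5,6)[OF stableD(1)[OF st]] by blast+
  qed
  moreover have "C \<subseteq> \<Union>\<C>" using assms(1) stableD(2)[OF st] by blast
  moreover have "\<forall>z\<in>\<Union>\<C>. \<tau> z \<in> \<Union>\<C>" using stableD(3)[OF st] by blast
  ultimately show ?thesis by (simp add: stable_def)
qed

text \<open>Zorn's lemma: a relation for t over the union of a chain has finitely many coefficients,
  so it already holds over a member of the chain.\<close>

lemma maximal_stable:
  assumes "stable C" "transcendental_over C t"
  obtains E where "stable E" "transcendental_over E t"
    "\<And>F. stable F \<Longrightarrow> transcendental_over F t \<Longrightarrow> E \<subseteq> F \<Longrightarrow> F = E"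
proof -
  define \<A> where "\<A> = {E. stable E \<and> transcendental_over E t}"
  have "\<exists>M\<in>\<A>. \<forall>X\<in>\<A>. M \<subseteq> X \<longrightarrow> X = M"
  proof (rule subset_Zorn_nonempty)
    show "\<A> \<noteq> {}" using assms by (auto simp: \<A>_def)
    fix \<C> assume \<C>: "\<C> \<noteq> {}" "subset.chain \<A> \<C>"
    then have ch: "subset.chain {E. stable E} \<C>" by (auto simp: \<A>_def subset_chain_def)
    have st: "stable (\<Union>\<C>)" by (rule stable_Union[OF \<C>(1) ch])
    have "p = 0" if p: "polyover (\<Union>\<C>) p" "poly p t = 0" for p
    proof -
      have "set (coeffs p) \<subseteq> \<Union>\<C>"
        using p(1) polyover_iff_coeffs[OF subfield_closed(1)[OF stableD(1)[OF st]]] by blast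
      then obtain E where E: "E \<in> \<C>" "set (coeffs p) \<subseteq> E"
        using finite_subset_Union_chain[of "set (coeffs p)" \<C> \<A>] \<C> by auto
      then have "E \<in> \<A>" using \<C>(2) by (auto simp: subset_chain_def)
      then have "stable E" "transcendental_over E t" by (auto simp: \<A>_def)
      then show ?thesis
        using polyover_iff_coeffs[OF subfield_closed(1)[OF stableD(1)]] E(2) p(2)
        by (auto simp: transcendental_over_def)
    qed
    then show "\<Union>\<C> \<in> \<A>" using st by (auto simp: \<A>_def transcendental_over_def)
  qed
  then show ?thesis using that by (auto simp: \<A>_def)
qed

text \<open>If g is transcendental over E, the stable field E(g) is strictly larger, so t is
  algebraic over it by maximality. The resulting element A(t) of E(g) is a polynomial in g, and this
  makes g algebraic over E(t).\<close>

lemma exchange: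
  assumes E: "stable E" "transcendental_over E t"
    "\<And>F. stable F \<Longrightarrow> transcendental_over F t \<Longrightarrow> E \<subseteq> F \<Longrightarrow> F = E"
    and t: "\<tau> t = v ^ w * (t + S)" "S \<in> E"
    and g: "\<tau> g = v ^ n * (g + \<rho>)" "\<rho> \<in> E"
  shows "g \<in> algebraics (adjoin E t)"
proof (cases "transcendental_over E g")
  case False
  note sf = stableD(1)[OF E(1)]
  have "E \<subseteq> adjoin E t" using adjoin_base[OF sf] by blast
  then show ?thesis
    using False transcendental_over_mono unfolding algebraics_def[OF adjoin_subfield[OF sf]] by blast
next
  case True
  note sf = stableD(1)[OF E(1)]
  note sub = subfield_closed[OF sf]
  let ?E = "adjoin E g"
  note sf' = adjoin_subfield[OF sf, of g]
  have Esub: "E \<subseteq> ?E" using adjoin_base[OF sf] by blast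
  have vE: "v ^ n \<in> ?E" using stableD(5)[OF E(1)] Esub by blast
  have stE: "stable ?E"
  proof (rule stable_adjoin[OF E(1)])
    show "\<tau> g \<in> ?E" unfolding g(1)
      using vE g(2) Esub adjoin_gen[OF sf] by (intro subfield_closed(3,4)[OF sf']) auto
  qed
  have "g \<notin> E"
  proof
    assume "g \<in> E"
    then have "polyover E [:-g, 1:]" by (intro polyover_pCons polyover_0 sf sub)
    then show False using True by (auto simp: transcendental_over_def)
  qed
  then have "\<not> transcendental_over ?E t"
    using E(3)[OF stE _ Esub] adjoin_gen[OF sf, of g] by blast
  then obtain A m where A: "additive_map (w * m) w A" "degree A = m" "m > 0" "poly A t \<in> ?E"
    using algebraic_solution[OF stE _ t(1)] t(2) Esub by blast
  have poA: "polyover E A" using additive_map_polyover[OF A(1)] stableD(2)[OF E(1)] polyover_mono by blast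
  have "polyover E [:poly A S:]" by (intro polyover_const[OF sf] poly_in_subfield[OF sf poA t(2)])
  then obtain f where f: "polyover E f" "poly A t = poly f g"
    using polynomial_solution[OF E(1) True g A(4), of "w * m" "[:poly A S:]"] additive_map_apply[OF A(1) t(1)] by auto
  let ?T = "adjoin E t"
  note sfT = adjoin_subfield[OF sf, of t]
  have "polyover ?T (f - [:poly A t:])"
    using f(1) poA adjoin_base[OF sf] adjoin_poly[OF sf]
    by (intro polyover_diff[OF sfT] polyover_const[OF sfT]) (auto simp: polyover_def)
  moreover have "poly (f - [:poly A t:]) g = 0" using f(2) by simp
  \<comment> \<open>Otherwise A(t) would lie in E, although t is transcendental over E.\<close>
  moreover have "f - [:poly A t:] \<noteq> 0"
  proof
    assume "f - [:poly A t:] = 0"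
    then have "poly A t = coeff f 0" by (metis coeff_pCons_0 eq_iff_diff_eq_0)
    then have "polyover E (A - [:poly A t:])"
      using poA f(1) by (intro polyover_diff[OF sf] polyover_const[OF sf]) (auto simp: polyover_def)
    moreover have "poly (A - [:poly A t:]) t = 0" by simp
    ultimately have "A - [:poly A t:] = 0" using E(2) unfolding transcendental_over_def by blast
    then show False using A(2,3) by (metis degree_pCons_0 eq_iff_diff_eq_0 less_numeral_extra(3))
  qed
  ultimately show ?thesis
    unfolding algebraics_def[OF sfT] transcendental_over_def by blast
qed

lemma stable_C: "stable C" using C tau_C by (auto simp: stable_def)

text \<open>The field generated by \<open>C\<close>, \<open>G\<close> and t is enlarged to the
  algebraic closure \<open>F 0\<close> of E(t), with E from \<open>maximal_stable\<close>;
  \<open>exchange\<close> places \<open>G\<close> inside it. Strong induction then shows that each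
  \<open>X m\<close> is transcendental over \<open>F m\<close>, which is \<open>F 0\<close> with the
  earlier \<open>X i\<close> adjoined.\<close>

theorem functional_independence:
  fixes Q :: "nat \<Rightarrow> nat" and X :: "nat \<Rightarrow> 'l"
  assumes t: "transcendental_over C t" "\<tau> t = v * (t - 1)"
    and G: "\<And>g. g \<in> G \<Longrightarrow> \<exists>n \<rho>. \<rho> \<in> C \<and> \<tau> g = v ^ n * (g + \<rho>)"
    and X: "\<And>j. \<tau> (X j) = v ^ (1 + Q j) * (X j - t + 1)"
    and Q: "inj Q" "\<And>j. Q j > 1" "\<And>j s t. (s + t :: 'l) ^ Q j = s ^ Q j + t ^ Q j"
  shows "transcendental_over (gen_field (C \<union> G \<union> {t} \<union> X ` {..<m})) (X m)"
proof -
  obtain E where E: "stable E" "transcendental_over E t"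
    "\<And>F. stable F \<Longrightarrow> transcendental_over F t \<Longrightarrow> E \<subseteq> F \<Longrightarrow> F = E"
    using maximal_stable[OF stable_C t(1)] by blast
  note sf = stableD(1)[OF E(1)]
  note sub = subfield_closed[OF sf]
  have t': "\<tau> t = v ^ 1 * (t + (-1))" using t(2) by simp
  have X': "\<tau> (X j) = v ^ (1 + Q j) * (X j + (1 - t))" for j using X[of j] by (simp add: algebra_simps)
  let ?T = "adjoin E t"
  note sfT = adjoin_subfield[OF sf, of t]
  have ET: "E \<subseteq> ?T" using adjoin_base[OF sf] by blast
  have stT: "stable ?T"
  proof (rule stable_adjoin[OF E(1)])
    show "\<tau> t \<in> ?T" unfolding t(2)
      using stableD(4)[OF E(1)] ET adjoin_gen[OF sf, of t]
      by (intro subfield_closed(4,7)[OF sfT] subfield_closed(2)[OF sfT]) auto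
  qed
  define F where "F = rec_nat (algebraics ?T) (\<lambda>i F. adjoin F (X i))"
  have F0: "F 0 = algebraics ?T" and FS: "F (Suc i) = adjoin (F i) (X i)" for i
    by (simp_all add: F_def)
  have TF0: "?T \<subseteq> F 0" unfolding F0 by (rule algebraics_base[OF sfT])
  have stF: "stable (F i) \<and> F 0 \<subseteq> F i" for i
  proof (induction i)
    case 0
    then show ?case using stable_algebraics[OF stT] by (simp add: F0)
  next
    case (Suc i)
    note sfi = stableD(1)[OF Suc[THEN conjunct1]]
    have sub': "F i \<subseteq> F (Suc i)" unfolding FS using adjoin_base[OF sfi] by blast
    have "t \<in> F i" using Suc TF0 adjoin_gen[OF sf] by blast
    then have "1 - t \<in> F (Suc i)" "v ^ (1 + Q i) \<in> F (Suc i)"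
      using sub' subfield_closed(2,7)[OF sfi] stableD(5)[OF Suc[THEN conjunct1]] by blast+
    then have "stable (F (Suc i))"
      unfolding FS by (intro stable_adjoin Suc[THEN conjunct1], subst X')
        (auto intro!: subfield_closed(3,4)[OF adjoin_subfield[OF sfi]] adjoin_gen[OF sfi])
    then show ?case using Suc sub' by blast
  qed
  note stF' = stF[THEN conjunct1] and sfF = stableD(1)[OF stF[THEN conjunct1]]
  have CF: "c \<in> C \<Longrightarrow> c \<in> F i" for c i using stableD(2)[OF stF'] by blast
  have tF: "t \<in> F i" for i using stF[of i] TF0 adjoin_gen[OF sf] by blast
  have tF1: "1 - t \<in> F i" for i using tF subfield_closed(2,7)[OF sfF] by blast
  have XF: "X i \<in> F (Suc i)" for i unfolding FS by (rule adjoin_gen[OF sfF])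
  have Fmono: "F i \<subseteq> F j" if "i \<le> j" for i j
    using that by (induction rule: dec_induct) (auto simp: FS intro: adjoin_base[OF sfF])
  have HF: "polyover (F i) A" if "additive_map W w A" for W w A i
    using additive_map_polyover[OF that] CF by (auto simp: polyover_def)
  have Xtr: "transcendental_over (F m) (X m)" for m
  proof (induction m rule: less_induct)
    case (less m)
    show ?case
    proof (rule ccontr)
      assume "\<not> transcendental_over (F m) (X m)"
      then obtain B n where B: "additive_map ((1 + Q m) * n) (1 + Q m) B" "lead_coeff B = 1" "poly B (X m) \<in> F m"
        using algebraic_solution[OF stF' _ X' tF1] by metis
      \<comment> \<open>Descent from \<open>F m\<close> to \<open>F 0\<close>. By induction
        \<open>X i\<close> is transcendental over \<open>F i\<close>, so the sum, an element of
        \<open>F (Suc i)\<close>, is a polynomial in \<open>X i\<close> whose nonconstant part is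
        additive and can be subtracted from the i-th summand. As i < m, the summand
        \<open>A m\<close> stays untouched.\<close>
      have peel: "\<exists>W A. (\<forall>j\<le>m. additive_map W (1 + Q j) (A j)) \<and> A m \<noteq> 0 \<and> (\<Sum>j\<le>m. poly (A j) (X j)) \<in> F (m - k)"
        if "k \<le> m" for k
        using that
      proof (induction k)
        case 0
        have "(\<Sum>j\<le>m. poly (((\<lambda>_. 0)(m := B)) j) (X j)) = (\<Sum>j\<in>{m}. poly B (X j))"
          by (rule sum.mono_neutral_cong_right) auto
        then show ?case using B additive_map_zero
          by (intro exI[of _ "(1 + Q m) * n"] exI[of _ "(\<lambda>_. 0)(m := B)"]) auto
      next
        case (Suc k)
        then obtain W A where A: "\<And>j. j \<le> m \<Longrightarrow> additive_map W (1 + Q j) (A j)" "A m \<noteq> 0"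
          "(\<Sum>j\<le>m. poly (A j) (X j)) \<in> F (m - k)" by auto
        define i where "i = m - Suc k"
        have i: "i < m" "m - k = Suc i" using Suc.prems by (auto simp: i_def)
        define z where "z = (\<Sum>j\<le>m. poly (A j) (X j))"
        define s where "s = (\<Sum>j\<le>m. poly (A j) (1 - t))"
        have tz: "\<tau> z = v ^ W * (z + s)"
          unfolding z_def s_def tau_sum sum.distrib[symmetric] sum_distrib_left
          using additive_map_apply[OF A(1) X'] by (intro sum.cong) auto
        have zF: "z \<in> adjoin (F i) (X i)" using A(3) by (simp add: z_def i FS)
        have "poly (A j) (1 - t) \<in> F i" if "j \<le> m" for j
          using poly_in_subfield[OF sfF HF[OF A(1)[OF that]] tF1] .
        then have sF: "s \<in> F i" unfolding s_def by (intro subfield_closed(11)[OF sfF]) auto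
        obtain f where f: "polyover (F i) f" "z = poly f (X i)"
          "\<And>r. poly (map_poly \<tau> f) (v ^ (1 + Q i) * (r + (1 - t))) = v ^ W * (poly f r + poly [:s:] r)"
          using polynomial_solution[OF stF' less[OF i(1)] X' tF1 zF _ polyover_const[OF sfF sF], of W] tz by auto
        define D where "D = f - [:coeff f 0:]"
        have D: "additive_map W (1 + Q i) D" unfolding D_def
          by (rule kolchin[OF stF' X' f(1), where S = s]) (use f(3) less[OF i(1)] in \<open>auto simp: transcendental_over_def\<close>)
        define A' where "A' = A(i := A i - D)"
        have "(\<Sum>j\<le>m. poly (A' j) (X j)) = (\<Sum>j\<le>m. poly (A j) (X j) - (if j = i then poly D (X i) else 0))"
          by (intro sum.cong) (auto simp: A'_def)
        also have "\<dots> = z - poly D (X i)" using i by (simp add: sum_subtractf z_def)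
        also have "\<dots> = coeff f 0" by (simp add: D_def f(2))
        also have "\<dots> \<in> F i" using f(1) by (simp add: polyover_def)
        finally have "(\<Sum>j\<le>m. poly (A' j) (X j)) \<in> F (m - Suc k)" by (simp add: i_def)
        moreover have "additive_map W (1 + Q j) (A' j)" if "j \<le> m" for j
          using A(1)[OF that] D additive_map_diff by (auto simp: A'_def)
        moreover have "A' m \<noteq> 0" using A(2) i by (auto simp: A'_def)
        ultimately show ?case by blast
      qed
      then obtain W0 A0 where A0: "\<And>j. j \<le> m \<Longrightarrow> additive_map W0 (1 + Q j) (A0 j)" "A0 m \<noteq> 0"
          "(\<Sum>j\<le>m. poly (A0 j) (X j)) \<in> F 0" by (metis diff_self_eq_0 le_refl)
      define z0 where "z0 = (\<Sum>j\<le>m. poly (A0 j) (X j))"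
      define s0 where "s0 = (\<Sum>j\<le>m. poly (A0 j) (1 - t))"
      have tz0: "\<tau> z0 = v ^ W0 * (z0 + s0)"
        unfolding z0_def s0_def tau_sum sum.distrib[symmetric] sum_distrib_left
        using additive_map_apply[OF A0(1) X'] by (intro sum.cong) auto
      have HT: "polyover ?T A" and HE: "polyover E A" if "additive_map W w A" for W w A
        using additive_map_polyover[OF that] stableD(2)[OF E(1)] ET by (auto simp: polyover_def)
      have tT1: "1 - t \<in> ?T" using adjoin_gen[OF sf] subfield_closed(2,7)[OF sfT] by blast
      have "poly (A0 j) (1 - t) \<in> ?T" if "j \<le> m" for j
        using poly_in_subfield[OF sfT HT[OF A0(1)[OF that]] tT1] .
      then have s0T: "s0 \<in> ?T" unfolding s0_def by (intro subfield_closed(11)[OF sfT]) auto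
      \<comment> \<open>The sum is so far only algebraic over E(t). Composing with one more additive
        polynomial \<open>R\<close> brings it into E(t) itself.\<close>
      have "\<not> transcendental_over ?T z0"
        using A0(3) unfolding z0_def F0 algebraics_def[OF sfT] by simp
      then obtain R n2 where R: "additive_map (W0 * n2) W0 R" "lead_coeff R = 1" "degree R = n2" "n2 > 0" "poly R z0 \<in> ?T"
        using algebraic_solution[OF stT _ tz0 s0T] by metis
      define W where "W = W0 * n2"
      define A where "A = (\<lambda>j. pcompose R (A0 j))"
      have A: "additive_map W (1 + Q j) (A j)" if "j \<le> m" for j
        unfolding A_def W_def by (rule additive_map_pcompose[OF R(1) A0(1)[OF that]])
      have Am: "A m \<noteq> 0"
      proof
        assume "A m = 0"
        then have "degree R * degree (A0 m) = 0" by (metis A_def degree_0 degree_pcompose)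
        then have "degree (A0 m) = 0" using R by simp
        then have "A0 m = 0" using additive_map_coeff_0[OF A0(1)[OF le_refl]] by (auto elim!: degree_eq_zeroE)
        then show False using A0(2) by simp
      qed
      define z where "z = poly R z0"
      have zsum: "z = (\<Sum>j\<le>m. poly (A j) (X j))"
        unfolding z_def z0_def A_def by (simp add: additive_map_sum[OF R(1)] poly_pcompose)
      define s where "s = (\<Sum>j\<le>m. pcompose (A j) [:1, -1:])"
      have tz: "\<tau> z = v ^ W * (z + poly s t)"
        unfolding zsum s_def poly_sum tau_sum sum.distrib[symmetric] sum_distrib_left
        using additive_map_apply[OF A X'] by (intro sum.cong) (auto simp: poly_pcompose)
      have sE: "polyover E s" unfolding s_def
        using HE[OF A] by (intro polyover_sum[OF sf] polyover_pcompose[OF sf] polyover_pCons[OF sf]) (auto simp: sub polyover_0[OF sf])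
      obtain f where f: "polyover E f" "z = poly f t"
        "\<And>r. poly (map_poly \<tau> f) (v ^ 1 * (r + (-1))) = v ^ W * (poly f r + poly s r)"
        using polynomial_solution[OF E(1,2) t' _ _ tz sE] R(5) sub unfolding z_def by blast
      \<comment> \<open>Taylor expansions at t of the polynomial f with z = f(t) and of the
        inhomogeneous term s.\<close>
      define f' where "f' = pcompose f [:t, 1:]"
      define s' where "s' = pcompose s [:t, 1:]"
      have hom: "\<tau> (coeff f' k) * v ^ (1 * k) = v ^ W * coeff (f' + s') k" for k
      proof (rule coeff_hom)
        fix x r assume "\<tau> x = v ^ 1 * r"
        then have "\<tau> (t + x) = v ^ 1 * ((t + r) + (-1))" by (simp add: tau_add t(2) algebra_simps)
        then show "\<tau> (poly f' x) = v ^ W * poly (f' + s') r"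
          using f(3)[of "t + r"] by (simp add: f'_def s'_def poly_pcompose tau_poly)
      qed
      have s'eq: "s' = [:\<Sum>j\<le>m. poly (A j) (1 - t):] - (\<Sum>j\<le>m. A j)"
      proof (rule poly_eq_on_infinite[OF infinite_UNIV])
        fix r
        have "poly (A j) (1 + (- t - r)) = poly (A j) (1 - t) - poly (A j) r" if "j \<le> m" for j
          using additive_map_minus[OF A[OF that], of "1 - t" r] by (simp add: algebra_simps)
        then show "poly s' r = poly ([:\<Sum>j\<le>m. poly (A j) (1 - t):] - (\<Sum>j\<le>m. A j)) r"
          by (simp add: s'_def s_def poly_pcompose poly_sum sum_subtractf[symmetric])
      qed
      have s'k: "coeff s' k = - (\<Sum>j\<le>m. coeff (A j) k)" if "k > 0" for k
        using that by (auto simp: s'eq coeff_sum coeff_pCons split: nat.splits)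
      \<comment> \<open>If the coefficient is nonzero, then y \<mapsto> y^k is additive, and so is y
        \<mapsto> y^(Q j * k).\<close>
      have pw: "coeff (A j) k * (t - 1) ^ (Q j * k) = coeff (A j) k * (t ^ (Q j * k) - 1)"
        if "j \<le> m" "k > 0" for j k
      proof (cases "coeff (A j) k = 0")
        case False
        have k: "(a + b) ^ k = a ^ k + b ^ k" for a b :: 'l
          using additive_map_power[OF A[OF that(1)] that(2), of a b] False by (simp flip: distrib_left)
        have m1: "(-1 :: 'l) ^ k = -1" using k[of 1 "-1"] that(2) by (simp add: eq_neg_iff_add_eq_0 add.commute power_0_left)
        have "(1 + (-1) :: 'l) ^ Q j = 1 ^ Q j + (-1) ^ Q j" by (rule Q(3))
        then have m2: "(-1 :: 'l) ^ Q j = -1" using Q(2)[of j] by (simp add: eq_neg_iff_add_eq_0 add.commute power_0_left)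
        have "(t - 1) ^ (Q j * k) = ((t + (-1)) ^ k) ^ Q j" by (simp add: mult.commute[of "Q j"] power_mult)
        also have "\<dots> = t ^ (Q j * k) - 1"
          unfolding k m1 Q(3) m2 by (simp add: mult.commute[of "Q j"] power_mult)
        finally show ?thesis by simp
      qed simp
      \<comment> \<open>An explicit solution: since the weight (1 + Q j) k splits as k + (Q j) k,
        the value h_k(t) solves the same inhomogeneous equation as the k-th Taylor coefficient of f
        at t. The two differ by a solution of a homogeneous equation, hence by an element of
        E.\<close>
      define h where "h = (\<lambda>k. \<Sum>j\<le>m. monom (coeff (A j) k) (Q j * k))"
      have hk: "hasse k f = h k + [:coeff f' k - poly (h k) t:]" if "k > 0" for k
      proof -
        have "\<tau> (poly (h k) t) * v ^ k = (\<Sum>j\<le>m. v ^ W * coeff (A j) k * (t ^ (Q j * k) - 1))"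
          unfolding h_def poly_sum tau_sum sum_distrib_right
        proof (intro sum.cong refl)
          fix j assume "j \<in> {..m}"
          then have j: "j \<le> m" by simp
          have "\<tau> (poly (monom (coeff (A j) k) (Q j * k)) t) * v ^ k
            = \<tau> (coeff (A j) k) * v ^ ((1 + Q j) * k) * (t - 1) ^ (Q j * k)"
            unfolding poly_monom tau_mult tau_power t(2) power_mult_distrib add_mult_distrib power_add
            by (simp add: mult_ac)
          also have "\<dots> = v ^ W * coeff (A j) k * (t ^ (Q j * k) - 1)"
            using additive_map_coeff[OF A[OF j], of k] pw[OF j that] by (simp add: mult.assoc)
          finally show "\<tau> (poly (monom (coeff (A j) k) (Q j * k)) t) * v ^ k
            = v ^ W * coeff (A j) k * (t ^ (Q j * k) - 1)" .
        qed
        also have "\<dots> = v ^ W * (poly (h k) t + coeff s' k)"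
          by (simp add: h_def s'k[OF that] poly_sum poly_monom sum_distrib_left sum_subtractf right_diff_distrib mult.assoc)
        finally have "\<tau> (coeff f' k - poly (h k) t) * v ^ k = v ^ W * (coeff f' k - poly (h k) t)"
          using hom[of k] by (simp add: tau_diff algebra_simps)
        then have "coeff f' k - poly (h k) t \<in> E" using homogeneous stableD(2)[OF E(1)] by blast
        moreover have "polyover E (h k)" unfolding h_def
          using HE[OF A] by (intro polyover_sum[OF sf] polyover_monom[OF sf]) (auto simp: polyover_def)
        moreover have "polyover E (hasse k f)" using f(1) by (auto simp: polyover_def coeff_hasse intro!: sub)
        ultimately have "polyover E (hasse k f - (h k + [:coeff f' k - poly (h k) t:]))"
          by (intro polyover_diff[OF sf] polyover_add[OF sf] polyover_const[OF sf])
        moreover have "poly (hasse k f - (h k + [:coeff f' k - poly (h k) t:])) t = 0"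
          by (simp add: f'_def coeff_pcompose_shift)
        ultimately have "hasse k f - (h k + [:coeff f' k - poly (h k) t:]) = 0"
          using E(2) unfolding transcendental_over_def by blast
        then show ?thesis by simp
      qed
      \<comment> \<open>The binomial coefficient on the left is symmetric in i and k, whereas the
        right side is not.\<close>
      have key: "of_nat (i + k choose k) * coeff f (i + k) = (\<Sum>j\<le>m. if Q j * k = i then coeff (A j) k else 0)"
        if "i > 0" "k > 0" for i k
        using arg_cong[OF hk[OF that(2)], of "\<lambda>p. coeff p i"] that(1)
        by (auto simp: coeff_hasse h_def coeff_sum coeff_pCons split: nat.splits)
      have "coeff (A m) k = 0" for k
      proof (cases "k = 0")
        case True
        then show ?thesis using additive_map_coeff_0[OF A] by simp
      next
        case False
        \<comment> \<open>For this pair only the summand j = m survives, as \<open>Q\<close> is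
          injective; with i and k exchanged none does, since Q j * i > k.\<close>
        define i where "i = Q m * k"
        have i: "i > 0" using False Q(2)[of m] by (simp add: i_def)
        have inj: "Q j * k = i \<longleftrightarrow> j = m" for j
          using False Q(1) by (auto simp: i_def inj_def)
        have ne: "Q j * i \<noteq> k" for j
        proof -
          have "1 * k < Q m * k" using False Q(2)[of m] by simp
          also have "\<dots> \<le> Q j * i" using Q(2)[of j] by (simp add: i_def)
          finally show ?thesis by simp
        qed
        have "coeff (A m) k = of_nat (i + k choose k) * coeff f (i + k)"
          using key[OF i, of k] False by (simp add: inj)
        also have "i + k choose k = (k + i choose i)" by (subst binomial_symmetric) (auto simp: add.commute)
        also have "of_nat \<dots> * coeff f (i + k) = 0"
          using key[of k i] i False ne by (simp add: add.commute)
        finally show ?thesis .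
      qed
      then have "A m = 0" by (simp add: poly_eq_iff)
      then show False using Am by simp
    qed
  qed
  have "g \<in> F 0" if g: "g \<in> G" for g
  proof -
    obtain n \<rho> where n: "\<rho> \<in> C" "\<tau> g = v ^ n * (g + \<rho>)" using G[OF g] by blast
    have "- 1 \<in> E" "\<rho> \<in> E" using n(1) stableD(2)[OF E(1)] sub by auto
    then show ?thesis
      unfolding F0 using exchange[OF E t' _ n(2)] by simp
  qed
  moreover have "X j \<in> F m" if "j < m" for j using XF[of j] Fmono[of "Suc j" m] that by auto
  ultimately have "gen_field (C \<union> G \<union> {t} \<union> X ` {..<m}) \<subseteq> F m"
    using CF tF stF by (intro gen_field_least sfF) blast
  then show ?thesis using Xtr[of m] transcendental_over_mono by blast
qed

end

unbundle fps_syntax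

subsection \<open>Evaluation of polynomials along a ring homomorphism\<close>

definition is_hom :: "('b::comm_ring_1 \<Rightarrow> 'c::comm_ring_1) \<Rightarrow> bool" where
  "is_hom c \<longleftrightarrow> c 0 = 0 \<and> c 1 = 1 \<and> (\<forall>a b. c (a + b) = c a + c b) \<and> (\<forall>a b. c (a * b) = c a * c b)"

lemma is_homD:
  assumes "is_hom c"
  shows "c 0 = 0" "c 1 = 1" "c (a + b) = c a + c b" "c (a * b) = c a * c b" "c (- a) = - c a"
    "c (a - b) = c a - c b" "c (a ^ n) = c a ^ n" "c (sum f A) = (\<Sum>i\<in>A. c (f i))"
    "c (prod f A) = (\<Prod>i\<in>A. c (f i))"
proof -
  show *: "c 0 = 0" "c 1 = 1" "c (a + b) = c a + c b" "c (a * b) = c a * c b" for a b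
    using assms by (auto simp: is_hom_def)
  show m: "c (- a) = - c a" for a
    using *(3)[of "-a" a] *(1) by (simp add: eq_neg_iff_add_eq_0)
  show "c (a - b) = c a - c b" using *(3)[of a "-b"] m by simp
  show "c (a ^ n) = c a ^ n" by (induction n) (auto simp: *)
  show "c (sum f A) = (\<Sum>i\<in>A. c (f i))"
    by (induction A rule: infinite_finite_induct) (auto simp: *)
  show "c (prod f A) = (\<Prod>i\<in>A. c (f i))"
    by (induction A rule: infinite_finite_induct) (auto simp: *)
qed

definition polyhom :: "('b::comm_ring_1 \<Rightarrow> 'c::comm_ring_1) \<Rightarrow> 'c \<Rightarrow> 'b poly \<Rightarrow> 'c" where
  "polyhom c t p = poly (map_poly c p) t"

lemma polyhom_0 [simp]: "polyhom c t 0 = 0"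
  by (simp add: polyhom_def)

lemma polyhom_pCons: "c 0 = 0 \<Longrightarrow> polyhom c t (pCons a p) = c a + t * polyhom c t p"
  by (simp add: polyhom_def map_poly_pCons)

lemma polyhom_altdef: "c 0 = 0 \<Longrightarrow> polyhom c t p = (\<Sum>i\<le>degree p. c (coeff p i) * t ^ i)"
  unfolding polyhom_def poly_altdef
  by (intro sum.mono_neutral_cong_left) (auto simp: coeff_map_poly map_poly_degree_leq intro!: le_degree)

lemma polyhom_hom: "is_hom c \<Longrightarrow> is_hom (polyhom c t)"
proof -
  assume c: "is_hom c"
  note c = c is_homD[OF c]
  have add: "polyhom c t (p + r) = polyhom c t p + polyhom c t r" for p r
  proof (induction p arbitrary: r)
    case (pCons a p)
    show ?case by (cases r, simp add: polyhom_pCons c pCons.IH, simp add: algebra_simps)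
  qed (simp add: polyhom_def)
  have smult: "polyhom c t (smult a r) = c a * polyhom c t r" for a r
    by (induction r) (auto simp: polyhom_pCons c algebra_simps)
  have mult: "polyhom c t (p * r) = polyhom c t p * polyhom c t r" for p r
    by (induction p) (auto simp: polyhom_pCons c add smult algebra_simps)
  show ?thesis
    unfolding is_hom_def using add mult c by (auto simp: polyhom_pCons one_pCons)
qed

lemma polyhom_X: "is_hom c \<Longrightarrow> polyhom c t [:0, 1:] = t"
  by (simp add: polyhom_pCons is_homD)

lemma is_hom_const: "is_hom (fls_const :: 'b::comm_ring_1 \<Rightarrow> 'b fls)"
  by (simp add: is_hom_def fls_plus_const)

lemma is_hom_comp: "is_hom f \<Longrightarrow> is_hom g \<Longrightarrow> is_hom (\<lambda>x. f (g x))"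
  by (simp add: is_hom_def)

subsection \<open>The valuation on Laurent series\<close>

text \<open>Stated by coefficients so that 0 satisfies every bound.\<close>

definition val_ge :: "int \<Rightarrow> 'b::comm_ring_1 fls \<Rightarrow> bool" where
  "val_ge m f \<longleftrightarrow> (\<forall>i<m. f $$ i = 0)"

lemma val_ge_iff: "val_ge m f \<longleftrightarrow> f = 0 \<or> fls_subdegree f \<ge> m"
  unfolding val_ge_def by (auto intro: fls_subdegree_geI)

lemma val_ge_0 [simp]: "val_ge m 0" by (simp add: val_ge_def)
lemma val_ge_add: "val_ge m f \<Longrightarrow> val_ge m g \<Longrightarrow> val_ge m (f + g)" by (simp add: val_ge_def)
lemma val_ge_diff: "val_ge m f \<Longrightarrow> val_ge m g \<Longrightarrow> val_ge m (f - g)" by (simp add: val_ge_def)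
lemma val_ge_uminus: "val_ge m f \<Longrightarrow> val_ge m (- f)" by (simp add: val_ge_def)
lemma val_ge_sum: "(\<And>i. i \<in> A \<Longrightarrow> val_ge m (f i)) \<Longrightarrow> val_ge m (sum f A)"
  by (induction A rule: infinite_finite_induct) (auto intro: val_ge_add)
lemma val_ge_mono: "val_ge m f \<Longrightarrow> n \<le> m \<Longrightarrow> val_ge n f" by (simp add: val_ge_def)

lemma val_ge_mult:
  assumes "val_ge m f" "val_ge n g"
  shows "val_ge (m + n) (f * g)"
  unfolding val_ge_def
proof (intro allI impI)
  fix i assume i: "i < m + n"
  show "(f * g) $$ i = 0"
    unfolding fls_times_nth(2)
  proof (rule sum.neutral, intro ballI)
    fix j show "f $$ j * g $$ (i - j) = 0"
      using assms i unfolding val_ge_def by (cases "j < m") auto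
  qed
qed

lemma val_ge_power: "val_ge m f \<Longrightarrow> val_ge (int n * m) (f ^ n)"
proof (induction n)
  case (Suc n)
  then have "val_ge (m + int n * m) (f * f ^ n)" by (intro val_ge_mult) auto
  then show ?case by (simp add: algebra_simps)
qed (auto simp: val_ge_def)

lemma val_ge_eq_0: "(\<And>m. val_ge m f) \<Longrightarrow> f = 0"
  unfolding val_ge_def by (intro fls_eqI) (metis fls_zero_nth less_add_one)

lemma val_ge_inverse:
  fixes f :: "'b::field fls"
  shows "fls_subdegree f = d \<Longrightarrow> val_ge (- d) (inverse f)"
  by (auto simp: val_ge_iff)

lemma fls_with_coeffs:
  assumes "\<And>n. n < N \<Longrightarrow> h n = 0"
  obtains f where "\<And>n. f $$ n = h n"
  using nth_Abs_fls_lower_bound[of N h] assms that by blast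

text \<open>Convergence for the valuation; \<open>fconv_LIMSEQ\<close> translates it into the metric
  limit behind \<open>multizeta\<close>.\<close>

definition fconv :: "(nat \<Rightarrow> 'b::comm_ring_1 fls) \<Rightarrow> 'b fls \<Rightarrow> bool" where
  "fconv s l \<longleftrightarrow> (\<forall>m. \<exists>N. \<forall>n\<ge>N. val_ge m (s n - l))"

lemma fconv_const: "fconv (\<lambda>_. c) c" by (auto simp: fconv_def)

lemma fconv_add:
  assumes "fconv s a" "fconv r b" shows "fconv (\<lambda>n. s n + r n) (a + b)"
  unfolding fconv_def
proof
  fix m
  obtain N M where "\<forall>n\<ge>N. val_ge m (s n - a)" "\<forall>n\<ge>M. val_ge m (r n - b)"
    using assms unfolding fconv_def by blast
  then have "\<forall>n\<ge>max N M. val_ge m ((s n - a) + (r n - b))" by (auto intro: val_ge_add)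
  then show "\<exists>N. \<forall>n\<ge>N. val_ge m (s n + r n - (a + b))"
    by (intro exI[of _ "max N M"]) (simp add: algebra_simps)
qed

lemma fconv_cmult:
  assumes "fconv s a" shows "fconv (\<lambda>n. c * s n) (c * a)"
  unfolding fconv_def
proof
  fix m
  obtain N where N: "\<forall>n\<ge>N. val_ge (m - fls_subdegree c) (s n - a)"
    using assms unfolding fconv_def by blast
  have "val_ge (fls_subdegree c) c" by (simp add: val_ge_iff)
  then have "val_ge (fls_subdegree c + (m - fls_subdegree c)) (c * (s n - a))" if "n \<ge> N" for n
    using N that by (intro val_ge_mult) auto
  then show "\<exists>N. \<forall>n\<ge>N. val_ge m (c * s n - c * a)"
    by (intro exI[of _ N]) (simp add: algebra_simps)
qed

lemma fconv_sum: "(\<And>i. i \<in> A \<Longrightarrow> fconv (s i) (l i)) \<Longrightarrow> fconv (\<lambda>n. \<Sum>i\<in>A. s i n) (\<Sum>i\<in>A. l i)"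
  by (induction A rule: infinite_finite_induct) (auto intro: fconv_const fconv_add)

lemma fconv_diff: "fconv s a \<Longrightarrow> fconv r b \<Longrightarrow> fconv (\<lambda>n. s n - r n) (a - b)"
  using fconv_add[of s a "\<lambda>n. (-1) * r n" "(-1) * b"] fconv_cmult[of r b "-1"] by simp

lemma fconv_unique:
  assumes "fconv s a" "fconv s b" shows "a = b"
proof -
  have "val_ge m (a - b)" for m
  proof -
    obtain N M where "\<forall>n\<ge>N. val_ge m (s n - a)" "\<forall>n\<ge>M. val_ge m (s n - b)"
      using assms unfolding fconv_def by blast
    then have "val_ge m ((s (max N M) - b) - (s (max N M) - a))" by (auto intro!: val_ge_diff[of m "s (max N M) - b" "s (max N M) - a", simplified])
    then show ?thesis by simp
  qed
  then have "a - b = 0" by (rule val_ge_eq_0)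
  then show ?thesis by simp
qed

lemma fconv_LIMSEQ:
  fixes l :: "'b::field fls"
  assumes "fconv s l"
  shows "s \<longlonglongrightarrow> l"
  unfolding tendsto_iff
proof (intro allI impI)
  fix e :: real assume "e > 0"
  then obtain k where k: "(1 / 2) ^ k < e" using real_arch_pow_inv[of e "1/2"] by auto
  obtain N where N: "\<forall>n\<ge>N. val_ge (int k) (s n - l)"
    using assms unfolding fconv_def by blast
  have "dist (s n) l < e" if "n \<ge> N" for n
  proof (cases "s n = l")
    case False
    then have sd: "fls_subdegree (s n - l) \<ge> int k" using N that by (auto simp: val_ge_iff)
    then have "dist (s n) l = (1 / 2) ^ nat (fls_subdegree (s n - l))"
      using False by (simp add: dist_fls_def power_one_over inverse_eq_divide)
    also have "\<dots> \<le> (1 / 2) ^ k" using sd by (intro power_decreasing) auto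
    finally show ?thesis using k by simp
  qed (use \<open>e > 0\<close> in auto)
  then show "\<forall>\<^sub>F n in sequentially. dist (s n) l < e"
    using eventually_sequentially by blast
qed

subsection \<open>Polynomials in $\theta$\<close>

lemma poly_theta_polyhom: "poly_theta = polyhom fls_const theta"
  by (rule ext) (simp add: poly_theta_def polyhom_altdef)

lemma is_hom_poly_theta: "is_hom poly_theta"
  unfolding poly_theta_polyhom by (rule polyhom_hom[OF is_hom_const])

lemmas poly_theta_hom = is_homD[OF is_hom_poly_theta]

lemma theta_eq: "poly_theta [:0, 1:] = theta"
  by (simp add: poly_theta_polyhom polyhom_X is_hom_const)

lemma poly_theta_pCons: "poly_theta (pCons a p) = fls_const a + theta * poly_theta p"
  by (simp add: poly_theta_polyhom polyhom_pCons)

lemma poly_theta_nth: "poly_theta p $$ n = (if n \<le> 0 then coeff p (nat (- n)) else 0)"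
proof (induction p arbitrary: n)
  case (pCons a p)
  show ?case
  proof (cases "n < 0")
    case True
    then have "nat (- n) = Suc (nat (- (n + 1)))" by auto
    then show ?thesis using True
      by (simp add: poly_theta_pCons theta_def fls_X_inv_times_conv_shift pCons.IH)
  qed (auto simp: poly_theta_pCons theta_def fls_X_inv_times_conv_shift pCons.IH)
qed (simp add: poly_theta_def)

lemma poly_theta_0 [simp]: "poly_theta 0 = 0" by (simp add: poly_theta_hom)

lemma poly_theta_eq_0_iff [simp]: "poly_theta p = 0 \<longleftrightarrow> p = 0"
proof
  assume "poly_theta p = 0"
  then have "coeff p i = 0" for i using poly_theta_nth[of p "- int i"] by simp
  then show "p = 0" by (simp add: poly_eq_iff)
qed simp

lemma poly_theta_eq_iff: "poly_theta p = poly_theta r \<longleftrightarrow> p = r"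
  using poly_theta_eq_0_iff[of "p - r"] by (simp add: poly_theta_hom)

lemma fls_subdegree_poly_theta: "p \<noteq> 0 \<Longrightarrow> fls_subdegree (poly_theta p) = - int (degree p)"
  by (rule fls_subdegree_eqI) (auto simp: poly_theta_nth coeff_eq_0)

lemma integral_small: "val_ge 1 (poly_theta p) \<Longrightarrow> p = 0"
  by (cases "p = 0") (auto simp: val_ge_iff fls_subdegree_poly_theta)

text \<open>A Laurent series over \<^typ>\<open>'a fls\<close> is read as a series in $1/x$, so that \<^term>\<open>fls_X_inv\<close> is $x$.
  The degree bounds below make its evaluation at $x = \theta^M$ converge for $M \ge 2$.\<close>

definition Ob :: "int \<Rightarrow> 'a::field fls set" where
  "Ob m = {poly_theta p | p. p = 0 \<or> int (degree p) \<le> m}"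

lemma Ob_0 [simp]: "0 \<in> Ob m" unfolding Ob_def by (rule CollectI, rule exI[of _ 0]) auto

lemma Ob_poly_theta: "int (degree p) \<le> m \<Longrightarrow> poly_theta p \<in> Ob m" by (auto simp: Ob_def)

lemma Ob_neg: "m < 0 \<Longrightarrow> x \<in> Ob m \<Longrightarrow> x = 0" by (auto simp: Ob_def)

lemma Ob_mono: "x \<in> Ob m \<Longrightarrow> m \<le> n \<Longrightarrow> x \<in> Ob n" by (auto simp: Ob_def)

lemma Ob_add: "x \<in> Ob m \<Longrightarrow> y \<in> Ob m \<Longrightarrow> x + y \<in> Ob m"
proof -
  assume "x \<in> Ob m" "y \<in> Ob m"
  then obtain p r where *: "x = poly_theta p" "y = poly_theta r" "p = 0 \<or> int (degree p) \<le> m"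
    "r = 0 \<or> int (degree r) \<le> m" by (auto simp: Ob_def)
  show ?thesis
  proof (cases "p = 0 \<or> r = 0")
    case False
    then have "int (degree (p + r)) \<le> m"
      using * degree_add_le_max[of p r] by linarith
    then show ?thesis unfolding *(1,2) poly_theta_hom(3)[symmetric] by (rule Ob_poly_theta)
  qed (use * \<open>x \<in> Ob m\<close> \<open>y \<in> Ob m\<close> in auto)
qed

lemma Ob_mult: "x \<in> Ob m \<Longrightarrow> y \<in> Ob n \<Longrightarrow> x * y \<in> Ob (m + n)"
proof -
  assume "x \<in> Ob m" "y \<in> Ob n"
  then obtain p r where *: "x = poly_theta p" "y = poly_theta r" "p = 0 \<or> int (degree p) \<le> m"
    "r = 0 \<or> int (degree r) \<le> n" by (auto simp: Ob_def)
  show ?thesis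
  proof (cases "p = 0 \<or> r = 0")
    case False
    then have "int (degree (p * r)) \<le> m + n"
      using * degree_mult_le[of p r] by linarith
    then show ?thesis unfolding *(1,2) poly_theta_hom(4)[symmetric] by (rule Ob_poly_theta)
  qed (use * in auto)
qed

lemma Ob_1 [simp]: "m \<ge> 0 \<Longrightarrow> 1 \<in> Ob m"
  using Ob_poly_theta[of 1 m] by (simp add: poly_theta_hom)

lemma Ob_theta_power: "int n \<le> m \<Longrightarrow> theta ^ n \<in> Ob m"
  using Ob_poly_theta[of "[:0, 1:] ^ n" m]
  by (simp add: poly_theta_hom theta_eq degree_linear_power)

lemma Ob_uminus: "x \<in> Ob m \<Longrightarrow> - x \<in> Ob m"
proof -
  assume "x \<in> Ob m"
  then obtain p where *: "x = poly_theta p" "p = 0 \<or> int (degree p) \<le> m" by (auto simp: Ob_def)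
  then have "- x = poly_theta (- p)" by (simp add: poly_theta_hom)
  then show ?thesis using * by (auto simp: Ob_def intro!: exI[of _ "- p"])
qed

lemma Ob_diff: "x \<in> Ob m \<Longrightarrow> y \<in> Ob m \<Longrightarrow> x - y \<in> Ob m"
  using Ob_add[of x m "-y"] Ob_uminus[of y m] by simp

lemma Ob_sum: "(\<And>i. i \<in> A \<Longrightarrow> f i \<in> Ob m) \<Longrightarrow> sum f A \<in> Ob m"
  by (induction A rule: infinite_finite_induct) (auto intro: Ob_add)

lemma Ob_power: "x \<in> Ob m \<Longrightarrow> x ^ n \<in> Ob (int n * m)"
proof (induction n)
  case (Suc n)
  have "x * x ^ n \<in> Ob (m + int n * m)" by (rule Ob_mult[OF Suc.prems Suc.IH[OF Suc.prems]])
  then show ?case by (simp add: algebra_simps)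
qed simp

lemma Ob_prod:
  assumes "\<And>i. i \<in> A \<Longrightarrow> f i \<in> Ob (m i)"
  shows "prod f A \<in> Ob (\<Sum>i\<in>A. m i)"
  using assms by (induction A rule: infinite_finite_induct) (auto intro: Ob_mult)

lemma Ob_val: "x \<in> Ob m \<Longrightarrow> val_ge (- m) x"
  unfolding Ob_def val_ge_iff using fls_subdegree_poly_theta by force

definition CC :: "int \<Rightarrow> 'a::field fls fls \<Rightarrow> bool" where
  "CC c f \<longleftrightarrow> (\<forall>j. f $$ j \<in> Ob (j + c))"

lemma CC_0 [simp]: "CC c 0" by (simp add: CC_def)
lemma CC_mono: "CC c f \<Longrightarrow> c \<le> d \<Longrightarrow> CC d f" unfolding CC_def by (meson Ob_mono add_left_mono)
lemma CC_add: "CC c f \<Longrightarrow> CC c g \<Longrightarrow> CC c (f + g)" by (simp add: CC_def Ob_add)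
lemma CC_diff: "CC c f \<Longrightarrow> CC c g \<Longrightarrow> CC c (f - g)" by (simp add: CC_def Ob_diff)
lemma CC_uminus: "CC c f \<Longrightarrow> CC c (- f)" by (simp add: CC_def Ob_uminus)
lemma CC_sum: "(\<And>i. i \<in> A \<Longrightarrow> CC c (f i)) \<Longrightarrow> CC c (sum f A)"
  by (induction A rule: infinite_finite_induct) (auto intro: CC_add)

lemma CC_mult:
  assumes "CC c f" "CC d g"
  shows "CC (c + d) (f * g)"
  unfolding CC_def fls_times_nth(2)
proof (intro allI Ob_sum)
  fix j i
  have "f $$ i * g $$ (j - i) \<in> Ob ((i + c) + ((j - i) + d))"
    using assms by (intro Ob_mult) (auto simp: CC_def)
  then show "f $$ i * g $$ (j - i) \<in> Ob (j + (c + d))" by (simp add: algebra_simps)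
qed

lemma CC_const: "a \<in> Ob c \<Longrightarrow> CC c (fls_const a)"
  by (simp add: CC_def)

lemma CC_1: "c \<ge> 0 \<Longrightarrow> CC c 1" using CC_const[of 1 c] by simp

lemma CC_power: "CC c f \<Longrightarrow> CC (int n * c) (f ^ n)"
proof (induction n)
  case (Suc n)
  have "CC (c + int n * c) (f * f ^ n)" by (rule CC_mult[OF Suc.prems Suc.IH[OF Suc.prems]])
  then show ?case by (simp add: algebra_simps)
qed (simp add: CC_1)

lemma CC_X: "CC 1 fls_X_inv"
  by (auto simp: CC_def fls_X_inv_nth)

lemma CC_X_power: "CC (int k) (fls_X_inv ^ k)"
  using CC_power[OF CC_X, of k] by simp

text \<open>Below index -c the degree bound is negative and forces the coefficient to be 0: f has no
  power of x beyond x^c.\<close>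

lemma CC_val: "CC c f \<Longrightarrow> val_ge (- c) f"
  unfolding CC_def val_ge_def by (metis Ob_neg add.commute less_minus_iff minus_less_iff neg_less_iff_less add_less_same_cancel1 add.left_inverse add_strict_right_mono)

subsection \<open>The Frobenius substitution\<close>

text \<open>The parameter \<open>ty\<close> only fixes the type of the finite field.\<close>

locale carlitz =
  fixes ty :: "'a::{field,finite} itself" and q :: nat
  assumes q_card: "q = card (UNIV :: 'a set)" and q_neq_2: "q \<noteq> 2"
begin

lemma q_ge_3: "q \<ge> 3"
proof -
  have "card {0, 1 :: 'a} \<le> q" unfolding q_card by (intro card_mono) auto
  then show ?thesis using q_neq_2 by simp
qed

lemma q_pos: "q > 0" "q > 1" "q \<ge> 2" "q \<ge> 1" using q_ge_3 by auto

text \<open>Multiplication by c permutes the nonzero elements; compare the products over all of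
  them.\<close>

lemma finite_field_power: "(c :: 'a) ^ q = c"
proof (cases "c = 0")
  case False
  define U where "U = UNIV - {0 :: 'a}"
  have fin: "finite U" by (simp add: U_def)
  have cU: "card U = q - 1" by (simp add: U_def q_card)
  have "prod (\<lambda>x. x) U = prod (\<lambda>x. c * x) U"
    by (rule prod.reindex_bij_witness[of _ "\<lambda>x. c * x" "\<lambda>x. x / c"]) (use False in \<open>auto simp: U_def\<close>)
  also have "\<dots> = c ^ (q - 1) * prod (\<lambda>x. x) U" by (simp add: prod.distrib cU)
  finally have "c ^ (q - 1) = 1" using fin by (simp add: U_def)
  then have "c ^ Suc (q - 1) = c" by simp
  then show ?thesis using q_pos by simp
qed (use q_pos in simp)

text \<open>The polynomial (1 + X)^q - X^q - 1 has degree below q and vanishes at all q elements of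
  the field. This gives the Frobenius identities without writing q as a power of a prime.\<close>

lemma binomial_q: "0 < i \<Longrightarrow> i < q \<Longrightarrow> of_nat (q choose i) = (0 :: 'a)"
proof -
  assume i: "0 < i" "i < q"
  define p :: "'a poly" where "p = [:1, 1:] ^ q - monom 1 q - 1"
  have c: "coeff p k = (if 0 < k \<and> k < q then of_nat (q choose k) else 0)" for k
    using q_pos by (auto simp: p_def coeff_linear_power binomial_eq_0 coeff_1 not_less le_less)
  have "p = 0"
  proof (rule ccontr)
    assume "p \<noteq> 0"
    have "poly p x = 0" for x
      by (simp add: p_def poly_power poly_monom finite_field_power)
    then have "card (UNIV :: 'a set) \<le> degree p"
      using card_poly_roots_bound[OF \<open>p \<noteq> 0\<close>] by simp
    moreover have "degree p < q" using q_pos by (intro degree_lessI) (auto simp: c)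
    ultimately show False by (simp add: q_card)
  qed
  then show ?thesis using c[of i] i by simp
qed

lemma frobenius_gen:
  fixes s t :: "'b::comm_ring_1"
  assumes "\<And>i. 0 < i \<Longrightarrow> i < q \<Longrightarrow> of_nat (q choose i) = (0 :: 'b)"
  shows "(s + t) ^ (q ^ j) = s ^ (q ^ j) + t ^ (q ^ j)"
proof (induction j)
  case (Suc j)
  have 1: "(x + y) ^ q = x ^ q + y ^ q" for x y :: 'b
    using binomial_vanish_power[of q 1 x y] q_pos assms by simp
  have "(s + t) ^ (q ^ Suc j) = ((s + t) ^ (q ^ j)) ^ q" by (simp add: power_mult[symmetric] mult.commute)
  also have "\<dots> = s ^ (q ^ Suc j) + t ^ (q ^ Suc j)"
    by (simp add: Suc 1 power_mult[symmetric] mult.commute)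
  finally show ?case .
qed simp

lemma binomial_q_fls: "0 < i \<Longrightarrow> i < q \<Longrightarrow> of_nat (q choose i) = (0 :: 'a fls)"
  by (simp add: fls_of_nat binomial_q)

lemma binomial_q_fls_fls: "0 < i \<Longrightarrow> i < q \<Longrightarrow> of_nat (q choose i) = (0 :: 'a fls fls)"
  by (simp add: fls_of_nat binomial_q)

lemmas frobenius = frobenius_gen[OF binomial_q_fls]
lemmas frobenius_L = frobenius_gen[OF binomial_q_fls_fls]

lemma frobenius_0 [simp]: "(0 :: 'b::comm_ring_1) ^ (q ^ j) = 0"
  using q_pos by (simp add: power_0_left)

lemma frobenius_minus: "(- x :: 'a fls) ^ (q ^ j) = - (x ^ (q ^ j))"
  using frobenius[of x "-x" j] by (simp add: eq_neg_iff_add_eq_0 add.commute)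

lemma frobenius_diff: "(x - y :: 'a fls) ^ (q ^ j) = x ^ (q ^ j) - y ^ (q ^ j)"
  using frobenius[of x "-y" j] by (simp add: frobenius_minus)

lemma frobenius_sum: "(sum f A :: 'a fls) ^ (q ^ j) = (\<Sum>i\<in>A. f i ^ (q ^ j))"
  by (induction A rule: infinite_finite_induct) (auto simp: frobenius)

text \<open>The substitution x \<mapsto> x^q with the coefficients left fixed; it is not the q-th
  power map.\<close>

definition tau :: "'a fls fls \<Rightarrow> 'a fls fls" where "tau f = fls_compose_power f q"

lemma tau_nth: "tau f $$ n = (if int q dvd n then f $$ (n div int q) else 0)"
  unfolding tau_def using q_pos by (simp add: fls_nth_compose_power)

lemma tau_simps [simp]: "tau (a + b) = tau a + tau b" "tau (a * b) = tau a * tau b" "tau 1 = 1"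
    "tau (a - b) = tau a - tau b" "tau (fls_const c) = fls_const c" "tau (a ^ n) = tau a ^ n" "tau 0 = 0"
  using q_pos by (simp_all add: tau_def)

definition xx :: "'a fls fls" where "xx = fls_X_inv"

lemma tau_xx [simp]: "tau xx = xx ^ q"
  using q_pos by (simp add: tau_def xx_def fls_X_inv_power_conv_shift_1)

lemma is_hom_tau: "is_hom tau" by (simp add: is_hom_def)

text \<open>The coefficient at i moves to q i, where q (i + c) is allowed; this is at least i + c
  unless i + c < 0, and then the coefficient is 0.\<close>

lemma CC_tau:
  assumes "CC c f" shows "CC (int q * c) (tau f)"
  unfolding CC_def
proof
  fix j
  show "tau f $$ j \<in> Ob (j + int q * c)"
  proof (cases "int q dvd j")
    case True
    then obtain i where i: "j = int q * i" by blast
    then have e: "tau f $$ j = f $$ i" using q_pos by (simp add: tau_nth)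
    have m: "f $$ i \<in> Ob (i + c)" using assms by (simp add: CC_def)
    show ?thesis
    proof (cases "i + c \<ge> 0")
      case True
      have "1 * (i + c) \<le> int q * (i + c)" using True q_pos by (intro mult_right_mono) auto
      then have "i + c \<le> j + int q * c" by (simp add: i algebra_simps)
      then show ?thesis using m e Ob_mono by auto
    next
      case False
      then show ?thesis using Ob_neg[OF _ m] e by simp
    qed
  qed (simp add: tau_nth)
qed

lemma val_ge_tau: "val_ge m f \<Longrightarrow> val_ge (int q * m) (tau f)"
  unfolding val_ge_def
proof (intro allI impI)
  fix i assume m: "\<forall>i<m. f $$ i = 0" and i: "i < int q * m"
  show "tau f $$ i = 0"
  proof (cases "int q dvd i")
    case True
    then obtain k where k: "i = int q * k" by blast
    then have "k < m" using i q_pos by simp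
    then show ?thesis using m k q_pos by (simp add: tau_nth)
  qed (simp add: tau_nth)
qed

definition vv :: "'a fls fls" where "vv = fls_const theta - xx ^ q"

lemma vv_nth: "vv $$ j = (if j = 0 then theta else if j = - int q then - 1 else 0)"
  using q_pos by (auto simp: vv_def xx_def)

lemma subdegree_vv: "fls_subdegree vv = - int q"
  by (rule fls_subdegree_eqI) (use q_pos in \<open>auto simp: vv_nth\<close>)

lemma vv_nz [simp]: "vv \<noteq> 0"
  using vv_nth[of "- int q"] q_pos by auto

lemma CC_vv: "CC (int q) vv"
  unfolding vv_def using q_pos CC_X_power[of q] Ob_theta_power[of 1 "int q"]
  by (intro CC_diff CC_const) (auto simp: xx_def)

text \<open>The recursion contained in v * (1/v) = 1; it encodes the geometric series of 1/v in
  theta / x^q.\<close>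

lemma vv_inverse_nth: "inverse vv $$ (j + int q) = theta * inverse vv $$ j - (if j = 0 then 1 else 0)"
proof -
  have "(vv * inverse vv) $$ j = theta * inverse vv $$ j - inverse vv $$ (j + int q)"
    unfolding vv_def xx_def by (simp add: left_diff_distrib fls_X_inv_power_times_conv_shift del: fls_const_mult_const)
  moreover have "(vv * inverse vv) $$ j = (if j = 0 then 1 else 0)" by simp
  ultimately show ?thesis by (simp add: algebra_simps)
qed

lemma CC_vv_inverse: "CC (- int q) (inverse vv)"
proof -
  have low: "inverse vv $$ j = 0" if "j < int q" for j
    using that by (intro fls_eq0_below_subdegree) (simp add: subdegree_vv)
  have "inverse vv $$ int j \<in> Ob (int j - int q)" for j
  proof (induction j rule: less_induct)
    case (less j)
    show ?case
    proof (cases "j < q")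
      case False
      define i where "i = j - q"
      have j: "j = i + q" "i < j" using False q_pos by (auto simp: i_def)
      have "theta * inverse vv $$ int i \<in> Ob (int i)"
      proof (cases "i < q")
        case False
        have "theta * inverse vv $$ int i \<in> Ob (1 + (int i - int q))"
          using Ob_theta_power[of 1 1] less[OF j(2)] by (intro Ob_mult) auto
        then show ?thesis using q_pos by (auto elim: Ob_mono)
      qed (simp add: low)
      then have "theta * inverse vv $$ int i - (if int i = 0 then 1 else 0) \<in> Ob (int i)"
        by (intro Ob_diff) auto
      then show ?thesis using vv_inverse_nth[of "int i"] by (simp add: j)
    qed (simp add: low)
  qed
  then show ?thesis
    unfolding CC_def using low by (metis Ob_0 diff_conv_add_uminus int_nat_eq less_imp_le not_le q_pos(1) nat_le_0 linorder_not_less of_nat_0_less_iff order_less_trans)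
qed

text \<open>Difference equations $\tau f = v^n (f - g)$ are solved by the convergent series
  $\sum_d \Phi^d g$ with $\Phi h = v^{-n} \tau h$.\<close>

lemma difference_equation:
  assumes g: "CC k g" and k: "(int q - 1) * k < int n * int q"
  shows "\<exists>f. CC k f \<and> tau f = vv ^ n * (f - g)"
proof -
  define w where "w = inverse vv ^ n"
  define \<Phi> where "\<Phi> = (\<lambda>h. w * tau h)"
  define G where "G = (\<lambda>d. (\<Phi> ^^ d) g)"
  have GS: "G (Suc d) = \<Phi> (G d)" for d by (simp add: G_def)
  have CCw: "CC (- int n * int q) w"
    using CC_power[OF CC_vv_inverse, of n] by (simp add: w_def)
  \<comment> \<open>The hypothesis \<open>k\<close> enters here: it says q k - n q < k, so each
    application of \<Phi> lowers the bound by at least one.\<close>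
  have step: "CC (k - int (Suc d)) (\<Phi> h)" if "CC (k - int d) h" for d h
  proof -
    have "CC (- int n * int q + int q * (k - int d)) (\<Phi> h)"
      unfolding \<Phi>_def by (intro CC_mult CCw CC_tau that)
    moreover have "- int n * int q + int q * (k - int d) \<le> k - int (Suc d)"
    proof -
      have "0 \<le> (int q - 1) * int d" using q_pos by (intro mult_nonneg_nonneg) auto
      then show ?thesis using k by (simp add: algebra_simps)
    qed
    ultimately show ?thesis by (rule CC_mono)
  qed
  have CG: "CC (k - int d) (G d)" for d
  proof (induction d)
    case (Suc d)
    show ?case unfolding GS by (rule step[OF Suc])
  qed (use g in \<open>simp add: G_def\<close>)
  have G0: "G d $$ j = 0" if "int d > j + k" for d j
    using CG[of d] that by (auto simp: CC_def intro!: Ob_neg[of "j + (k - int d)"])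
  have "(\<Sum>d\<le>nat (j + k). G d $$ j) = 0" if "j < - k" for j
    using that G0 by (intro sum.neutral) auto
  then obtain f where f: "\<And>j. f $$ j = (\<Sum>d\<le>nat (j + k). G d $$ j)"
    using fls_with_coeffs[of "-k" "\<lambda>j. \<Sum>d\<le>nat (j + k). G d $$ j"] by blast
  have "CC k f"
    unfolding CC_def f
  proof (intro allI Ob_sum)
    fix j d
    have "G d $$ j \<in> Ob (j + (k - int d))" using CG[of d] by (simp add: CC_def)
    then show "G d $$ j \<in> Ob (j + k)" by (rule Ob_mono) simp
  qed
  have r: "val_ge (int D - k) (f - (\<Sum>d<D. G d))" for D
    unfolding val_ge_def
  proof (intro allI impI)
    fix j assume j: "j < int D - k"
    have "(\<Sum>d<D. G d $$ j) = (\<Sum>d\<le>nat (j + k). G d $$ j)"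
    proof (cases "j + k < 0")
      case True
      then have "\<forall>d. G d $$ j = 0" using G0 by auto
      then show ?thesis by simp
    next
      case False
      then have "i \<le> nat (j + k)" if "G i $$ j \<noteq> 0" for i using that G0[of j i] by force
      then show ?thesis using False j by (intro sum.mono_neutral_right) auto
    qed
    then show "(f - (\<Sum>d<D. G d)) $$ j = 0" by (simp add: f fls_nth_sum)
  qed
  have "f - g - \<Phi> f = 0"
  proof (rule val_ge_eq_0)
    fix m
    define D where "D = nat (\<bar>m\<bar> + \<bar>k\<bar>)"
    have D: "int D - k \<ge> m" "int D - k \<ge> 0" by (auto simp: D_def)
    have "\<Phi> (\<Sum>d<D. G d) = (\<Sum>d<D. G (Suc d))"
      by (simp add: GS \<Phi>_def is_homD(8)[OF is_hom_tau] sum_distrib_left)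
    also have "\<dots> = (\<Sum>d<Suc D. G d) - g" 
      unfolding sum.lessThan_Suc_shift by (simp add: G_def)
    finally have e: "f - g - \<Phi> f = (f - (\<Sum>d<Suc D. G d)) - \<Phi> (f - (\<Sum>d<D. G d))"
      by (simp add: \<Phi>_def algebra_simps)
    have "val_ge (int n * int q + int q * (int D - k)) (\<Phi> (f - (\<Sum>d<D. G d)))"
      unfolding \<Phi>_def using CC_val[OF CCw] by (intro val_ge_mult val_ge_tau r) simp
    moreover have "m \<le> int n * int q + int q * (int D - k)"
    proof -
      have "1 * (int D - k) \<le> int q * (int D - k)" using D q_pos by (intro mult_right_mono) auto
      then have "m \<le> int q * (int D - k)" using D by simp
      also have "\<dots> \<le> int n * int q + int q * (int D - k)" by simp
      finally show ?thesis .
    qed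
    ultimately have "val_ge m (\<Phi> (f - (\<Sum>d<D. G d)))" by (rule val_ge_mono)
    moreover have "val_ge m (f - (\<Sum>d<Suc D. G d))" using r[of "Suc D"] D by (auto elim: val_ge_mono)
    ultimately show "val_ge m (f - g - \<Phi> f)" unfolding e by (rule val_ge_diff[rotated])
  qed
  then have "vv ^ n * \<Phi> f = vv ^ n * (f - g)" by simp
  then have "tau f = vv ^ n * (f - g)"
    by (simp add: \<Phi>_def w_def flip: mult.assoc power_mult_distrib)
  then show ?thesis using \<open>CC k f\<close> by blast
qed

text \<open>The values of $\psi_{n,k}$ and $\chi_Q$ at $x = \theta^{q^N}$ are essentially the tails, from $d = N$ on, of
  $\sum_d \theta^{k q^d} / \ell_d^n$ and $\sum_{d > e} 1 / (\ell_d \ell_e^Q)$, where $\ell_d = \prod_{i=1}^d (\theta - \theta^{q^i})$.\<close>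

definition psi :: "nat \<Rightarrow> nat \<Rightarrow> 'a fls fls" where
  "psi n k = (SOME f. CC (int k) f \<and> tau f = vv ^ n * (f - xx ^ k))"

lemma psi:
  assumes "k * (q - 1) < n * q"
  shows "CC (int k) (psi n k)" "tau (psi n k) = vv ^ n * (psi n k - xx ^ k)"
proof -
  have "int (k * (q - 1)) < int (n * q)" using assms by linarith
  then have "(int q - 1) * int k < int n * int q" using q_pos by (simp add: of_nat_diff mult.commute)
  from difference_equation[OF _ this, of "xx ^ k"] CC_X_power[of k]
  have "\<exists>f. CC (int k) f \<and> tau f = vv ^ n * (f - xx ^ k)" by (auto simp: xx_def)
  then show "CC (int k) (psi n k)" "tau (psi n k) = vv ^ n * (psi n k - xx ^ k)"
    unfolding psi_def by (metis (mono_tags, lifting) someI_ex)+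
qed

definition chi :: "nat \<Rightarrow> 'a fls fls" where
  "chi Q = (SOME f. CC 0 f \<and> tau f = vv ^ (1 + Q) * (f - (psi 1 0 - 1)))"

lemma chi: "CC 0 (chi Q)" "tau (chi Q) = vv ^ (1 + Q) * (chi Q - psi 1 0 + 1)"
proof -
  have "CC 0 (psi 1 0 - 1)" using psi(1)[of 0 1] q_pos by (intro CC_diff CC_1) auto
  from difference_equation[OF this, of "1 + Q"] q_pos
  have "\<exists>f. CC 0 f \<and> tau f = vv ^ (1 + Q) * (f - (psi 1 0 - 1))" by (simp add: add_pos_nonneg)
  then have "CC 0 (chi Q) \<and> tau (chi Q) = vv ^ (1 + Q) * (chi Q - (psi 1 0 - 1))"
    unfolding chi_def by (rule someI_ex)
  then show "CC 0 (chi Q)" "tau (chi Q) = vv ^ (1 + Q) * (chi Q - psi 1 0 + 1)"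
    by (auto simp: algebra_simps)
qed

end

subsection \<open>The base field\<close>

lemma adjoin_hom_stable:
  fixes f :: "'b::field \<Rightarrow> 'b"
  assumes f: "is_hom f" and E: "is_subfield E" "\<And>c. c \<in> E \<Longrightarrow> f c \<in> E" and t: "f t \<in> adjoin E t"
    and z: "z \<in> adjoin E t"
  shows "f z \<in> adjoin E t"
proof -
  note sf = adjoin_subfield[OF E(1), of t]
  obtain p d where pd: "polyover E p" "polyover E d" "z = poly p t / poly d t" "poly d t \<noteq> 0"
    using z unfolding adjoin_def by blast
  have "f (poly p t) \<in> adjoin E t" if "polyover E p" for p
    using that E(2) adjoin_base[OF E(1)] t
    by (auto simp: poly_altdef is_homD[OF f] polyover_def intro!: subfield_closed(4,9,11)[OF sf])
  moreover have "f (a / b) = f a / f b" if "b \<noteq> 0" for a b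
  proof -
    have 1: "f (a / b) * f b = f a" "f b * f (inverse b) = 1"
      using that is_homD(4)[OF f, of "a / b" b] is_homD(4)[OF f, of b "inverse b"] is_homD(2)[OF f] by auto
    from 1(2) have "f b \<noteq> 0" by auto
    then show ?thesis using 1(1) by (simp add: eq_divide_eq)
  qed
  ultimately show ?thesis using pd by (simp add: subfield_closed(8)[OF sf])
qed

lemma poly_split_at_0:
  fixes p :: "'b::idom poly"
  assumes "p \<noteq> 0"
  obtains k r where "p = [:0, 1:] ^ k * r" "poly r 0 \<noteq> 0"
proof -
  obtain r where "p = [:- 0, 1:] ^ order 0 p * r" "\<not> [:- 0, 1:] dvd r"
    using order_decomp[OF assms, of 0] by blast
  then show ?thesis using that[of "order 0 p" r] poly_eq_0_iff_dvd[of r 0] by simp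
qed

lemma poly_X_power_cancel:
  fixes p r :: "'b::idom poly"
  assumes "[:0, 1:] ^ i * p = [:0, 1:] ^ j * r" "poly p 0 \<noteq> 0" "poly r 0 \<noteq> 0"
  shows "p = r"
  using assms
proof (induction i j arbitrary: p r rule: linorder_wlog)
  case (le i j)
  then have "[:0, 1:] ^ i * p = [:0, 1:] ^ i * ([:0, 1:] ^ (j - i) * r)"
    by (simp add: mult.assoc[symmetric] power_add[symmetric])
  then have pr: "p = [:0, 1:] ^ (j - i) * r" by simp
  then have "j - i = 0" using le(3) by (intro ccontr[of "j - i = 0"]) (simp add: poly_power)
  then show ?case using pr by simp
next
  case (sym i j)
  then show ?case by metis
qed

text \<open>Reduced form of the fraction p / d. The common factor g is an element of least degree in
  the ideal generated by p and d.\<close>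

lemma poly_bezout:
  fixes p d :: "'b::field poly"
  assumes "d \<noteq> 0"
  obtains p' d' a b where "p * d' = p' * d" "a * p' + b * d' = 1" "d' \<noteq> 0"
proof -
  define S where "S = (\<lambda>g. g \<noteq> 0 \<and> (\<exists>a b. g = a * p + b * d))"
  have "S d" unfolding S_def using assms by (intro conjI exI[of _ 0] exI[of _ 1]) auto
  then obtain g where g: "S g" "\<And>r. S r \<Longrightarrow> degree g \<le> degree r"
    using ex_has_least_nat[of S d degree] by blast
  then obtain a b where ab: "g = a * p + b * d" "g \<noteq> 0" by (auto simp: S_def)
  have dvd: "g dvd r" if "r = a' * p + b' * d" for r a' b'
  proof (rule ccontr)
    assume "\<not> g dvd r"
    then have nz: "r mod g \<noteq> 0" by (simp add: dvd_eq_mod_eq_0)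
    have "r mod g = (a' - r div g * a) * p + (b' - r div g * b) * d"
      by (simp add: minus_div_mult_eq_mod[symmetric] that ab(1) algebra_simps)
    then have "S (r mod g)" using nz unfolding S_def by blast
    then show False using g(2)[of "r mod g"] degree_mod_less[OF ab(2), of r] nz by simp
  qed
  obtain p' where p': "p = g * p'" using dvd[of p 1 0] by auto
  obtain d' where d': "d = g * d'" using dvd[of d 0 1] by auto
  have "g * (a * p' + b * d') = g * 1" using ab(1) p' d' by (simp add: algebra_simps)
  then have "a * p' + b * d' = 1" using ab(2) by (simp only: mult_cancel_left) simp
  moreover have "p * d' = p' * d" using p' d' by simp
  ultimately show ?thesis using that d' assms by auto
qed

context carlitz
begin

abbreviation "konst \<equiv> (fls_const :: 'a fls \<Rightarrow> 'a fls fls)"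

lemma subfield_konst: "is_subfield (range konst)"
proof -
  have "konst a + konst b \<in> range konst" "konst a * konst b \<in> range konst" "- konst a \<in> range konst"
    "inverse (konst a) \<in> range konst" for a b
    by (auto simp: fls_plus_const fls_inverse_const simp flip: fls_const_uminus)
  moreover have "0 \<in> range konst" "1 \<in> range konst" by (metis fls_const_0 rangeI) (metis fls_const_1 rangeI)
  ultimately show ?thesis by (auto simp: is_subfield_def)
qed

text \<open>The rational functions in x over F_q((1/theta)).\<close>

definition K0 :: "'a fls fls set" where "K0 = adjoin (range konst) xx"

text \<open>Both are \<open>fls_X_inv\<close>, one level of coefficients higher: over
  \<open>'a fls\<close> the map \<open>poly_theta\<close> sends a polynomial to its value at x, so
  all its lemmas can be reused.\<close>

lemma xx_theta: "xx = theta" by (simp add: xx_def theta_def)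

lemma K0_cases:
  assumes "z \<in> K0"
  obtains p d where "d \<noteq> 0" "z = poly_theta p / poly_theta d"
proof -
  obtain P D where PD: "polyover (range konst) P" "polyover (range konst) D" "poly D xx \<noteq> 0"
    "z = poly P xx / poly D xx" using assms unfolding K0_def adjoin_def by blast
  have *: "\<exists>p. poly P xx = poly_theta p" if "polyover (range konst) P" for P
  proof -
    define c where "c = (\<lambda>x. x $$ 0 :: 'a fls)"
    have "konst (c x) = x" if "x \<in> range konst" for x using that by (auto simp: c_def)
    then have "map_poly konst (map_poly c P) = P"
      using that by (intro poly_eqI) (auto simp: coeff_map_poly c_def polyover_def)
    then have "poly_theta (map_poly c P) = poly P xx"
      by (simp add: poly_theta_polyhom polyhom_def xx_theta)
    then show ?thesis by metis
  qed
  obtain p d where "poly P xx = poly_theta p" "poly D xx = poly_theta d" using * PD by metis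
  then show ?thesis using PD(3,4) that[of d p] by auto
qed

lemma subfield_K0: "is_subfield K0"
  unfolding K0_def by (rule adjoin_subfield[OF subfield_konst])

lemma konst_K0: "konst c \<in> K0" and xx_K0: "xx \<in> K0" and vv_K0: "vv \<in> K0"
proof -
  show 1: "konst c \<in> K0" for c unfolding K0_def by (rule adjoin_base[OF subfield_konst]) auto
  show 2: "xx \<in> K0" unfolding K0_def by (rule adjoin_gen[OF subfield_konst])
  show "vv \<in> K0" unfolding vv_def using 1 2 by (intro subfield_closed[OF subfield_K0])
qed

lemma tau_K0: "z \<in> K0 \<Longrightarrow> tau z \<in> K0"
  unfolding K0_def
proof (rule adjoin_hom_stable[OF is_hom_tau subfield_konst])
  show "tau c \<in> range konst" if "c \<in> range konst" for c using that by auto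
  show "tau xx \<in> adjoin (range konst) xx" using subfield_closed(9)[OF subfield_K0 xx_K0, of q] by (simp add: K0_def)
qed

definition Vp :: "'a fls poly" where "Vp = [:theta:] - monom 1 q"
definition powq :: "'a fls poly \<Rightarrow> 'a fls poly" where "powq p = pcompose p (monom 1 q)"

lemma poly_theta_const: "poly_theta [:a:] = fls_const a"
  by (simp add: poly_theta_pCons)

lemma poly_theta_Vp: "poly_theta Vp = vv"
  using theta_eq[where 'a = "'a fls"]
  by (simp add: Vp_def vv_def poly_theta_hom monom_altdef poly_theta_const xx_theta)

lemma tau_poly_theta: "tau (poly_theta p) = poly_theta (powq p)"
proof (induction p)
  case (pCons a p)
  have "poly_theta (monom 1 q) = xx ^ q"
    using theta_eq[where 'a = "'a fls"] by (simp add: poly_theta_hom monom_altdef xx_theta)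
  then show ?case using pCons
    by (simp add: poly_theta_pCons powq_def pcompose_pCons poly_theta_hom xx_theta[symmetric])
qed (simp add: powq_def)

lemma powq_simps: "powq (p * r) = powq p * powq r" "powq (p + r) = powq p + powq r" "powq 1 = 1"
    "degree (powq p) = q * degree p" "powq p = 0 \<longleftrightarrow> p = 0" "powq ([:0, 1:] ^ k) = [:0, 1:] ^ (q * k)"
proof -
  show *: "powq (p * r) = powq p * powq r" "powq (p + r) = powq p + powq r" "powq 1 = 1" for p r
    by (simp_all add: powq_def pcompose_mult pcompose_add pcompose_1)
  show "degree (powq p) = q * degree p"
    by (simp add: powq_def degree_pcompose degree_monom_eq)
  show "powq p = 0 \<longleftrightarrow> p = 0"
    unfolding powq_def using q_pos by (subst pcompose_eq_0_iff) (auto simp: degree_monom_eq)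
  have "powq ([:0, 1:] ^ k) = powq [:0, 1:] ^ k" by (induction k) (simp_all only: power_0 power_Suc *)
  also have "powq [:0, 1:] = [:0, 1:] ^ q" by (simp add: powq_def pcompose_pCons monom_altdef)
  finally show "powq ([:0, 1:] ^ k) = [:0, 1:] ^ (q * k)" by (simp add: power_mult)
qed

lemma tau_eq_0_iff [simp]: "tau z = 0 \<longleftrightarrow> z = 0"
proof
  assume z: "tau z = 0"
  have "z $$ n = tau z $$ (int q * n)" for n using q_pos by (simp add: tau_nth)
  then show "z = 0" using z by (intro fls_eqI) simp
qed simp

lemma tau_divide: "tau (a / b) = tau a / tau b"
proof (cases "b = 0")
  case False
  then have "tau (a / b) * tau b = tau a" by (simp flip: tau_simps(2))
  then show ?thesis using False by (simp add: eq_divide_eq)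
qed simp

lemma theta_power_eq_iff: "(theta :: 'a fls) ^ k = theta ^ n \<longleftrightarrow> k = n"
proof
  assume "(theta :: 'a fls) ^ k = theta ^ n"
  then have "fls_subdegree ((theta :: 'a fls) ^ k) = fls_subdegree ((theta :: 'a fls) ^ n)" by simp
  then show "k = n" by (simp add: theta_def)
qed simp

text \<open>Compare the lowest coefficients at $x = 0$, where $v$ takes the value $\theta$.\<close>

lemma rational_homogeneous:
  assumes z: "z \<in> K0" "z \<noteq> 0" and eq: "tau z * vv ^ k = vv ^ W * z"
  shows "k = W"
proof -
  obtain p d where pd: "d \<noteq> 0" "z = poly_theta p / poly_theta d" using K0_cases[OF z(1)] by blast
  have "p \<noteq> 0" using z(2) pd by auto
  have "poly_theta (powq p * Vp ^ k * d) = poly_theta (Vp ^ W * p * powq d)"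
    using eq pd powq_simps(5)[of d]
    by (simp add: tau_divide tau_poly_theta poly_theta_hom poly_theta_Vp field_simps)
  then have e: "powq p * Vp ^ k * d = Vp ^ W * p * powq d" by (simp add: poly_theta_eq_iff)
  obtain i p' where p': "p = [:0, 1:] ^ i * p'" "poly p' 0 \<noteq> 0" using poly_split_at_0[OF \<open>p \<noteq> 0\<close>] by blast
  obtain j d' where d': "d = [:0, 1:] ^ j * d'" "poly d' 0 \<noteq> 0" using poly_split_at_0[OF \<open>d \<noteq> 0\<close>] by blast
  have V0: "poly Vp 0 = theta" using q_pos by (simp add: Vp_def poly_monom power_0_left)
  have powq0: "poly (powq r) 0 = poly r 0" for r
    using q_pos by (simp add: powq_def poly_pcompose poly_monom power_0_left)
  have thnz: "(theta :: 'a fls) \<noteq> 0" by (simp add: theta_def)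
  have "[:0, 1:] ^ (q * i + j) * (powq p' * Vp ^ k * d') = [:0, 1:] ^ (i + q * j) * (Vp ^ W * p' * powq d')"
    using e unfolding p'(1) d'(1) powq_simps by (simp add: power_add mult_ac)
  then have "powq p' * Vp ^ k * d' = Vp ^ W * p' * powq d'"
    by (rule poly_X_power_cancel) (use p'(2) d'(2) thnz in \<open>auto simp: powq0 V0 poly_power\<close>)
  then have "poly (powq p' * Vp ^ k * d') 0 = poly (Vp ^ W * p' * powq d') 0" by simp
  then have "(theta :: 'a fls) ^ k = theta ^ W" using p'(2) d'(2) by (simp add: powq0 V0 poly_power)
  then show ?thesis by (simp add: theta_power_eq_iff)
qed

lemma coprime_q: "coprime (q - 1) q"
proof -
  have "coprime (q - 1) (Suc (q - 1))" by (rule coprime_Suc_right_nat)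
  then show ?thesis using q_pos by simp
qed

lemma degree_Vp: "degree Vp = q"
  unfolding Vp_def diff_conv_add_uminus using q_pos by (subst degree_add_eq_right) (auto simp: degree_monom_eq)

text \<open>For z = p / d in lowest terms the equation makes d(x^q) divide d, so d is constant. For
  n > 0, comparing degrees in p(x^q) = v^n (p - d) gives (q - 1) deg p = q n.\<close>

lemma rational_inhomogeneous:
  assumes z: "z \<in> K0" and eq: "tau z = vv ^ n * (z - 1)"
  shows "(q - 1) dvd n"
proof -
  obtain p0 d0 where pd0: "d0 \<noteq> 0" "z = poly_theta p0 / poly_theta d0" using K0_cases[OF z(1)] by blast
  obtain p d a b where pd: "p0 * d = p * d0" "a * p + b * d = 1" "d \<noteq> 0"
    using poly_bezout[OF pd0(1)] by metis
  have "poly_theta p0 * poly_theta d = poly_theta p * poly_theta d0"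
    using pd(1) by (simp flip: poly_theta_hom)
  then have zz: "z = poly_theta p / poly_theta d"
    unfolding pd0(2) using pd0(1) pd(3) by (subst frac_eq_eq) auto
  have "z - 1 = (poly_theta p - poly_theta d) / poly_theta d"
    using zz pd(3) by (simp add: field_simps)
  then have "poly_theta (powq p * d) = poly_theta (Vp ^ n * (p - d) * powq d)"
    using eq pd(3) powq_simps(5)[of d] zz
    by (simp add: tau_divide tau_poly_theta poly_theta_hom poly_theta_Vp field_simps)
  then have e: "powq p * d = Vp ^ n * (p - d) * powq d" by (simp add: poly_theta_eq_iff)
  have "powq a * powq p + powq b * powq d = 1"
    using arg_cong[OF pd(2), of powq] by (simp add: powq_simps)
  then have "d = powq a * (powq p * d) + powq b * powq d * d" by (simp add: mult.assoc[symmetric] distrib_right[symmetric])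
  also have "\<dots> = powq d * (powq a * (Vp ^ n * (p - d)) + powq b * d)" unfolding e by (simp add: algebra_simps)
  finally have "powq d dvd d" by (metis dvd_triv_left)
  then have "q * degree d \<le> degree d" using dvd_imp_degree_le[OF _ pd(3)] by (metis powq_simps(4))
  then have dd: "degree d = 0"
    using q_pos mult_le_mono1[of 2 q "degree d"] by linarith
  then obtain c where c: "d = [:c:]" "c \<noteq> 0" using pd(3) by (auto elim: degree_eq_zeroE)
  have "powq d = d" by (simp add: c powq_def)
  then have e': "powq p = Vp ^ n * (p - d)" using e pd(3) by (simp add: mult.commute)
  show ?thesis
  proof (cases "n = 0")
    case False
    have "Vp \<noteq> 0" using degree_Vp q_pos by auto
    then have Vn: "Vp ^ n \<noteq> 0" "degree (Vp ^ n) = n * q"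
      using degree_Vp by (auto simp: degree_power_eq)
    have pnd: "p - d \<noteq> 0"
    proof
      assume "p - d = 0"
      then show False using e' pd(3) powq_simps(5)[of p] by simp
    qed
    then have deq: "q * degree p = n * q + degree (p - d)"
      using arg_cong[OF e', of degree] Vn by (simp add: powq_simps degree_mult_eq)
    have "degree p > 0" using deq q_pos False by (intro gr0I) auto
    then have "degree (p - d) = degree p"
      using dd degree_add_eq_left[of "- d" p] by simp
    then have "(q - 1) * degree p = q * n" using deq by (simp add: diff_mult_distrib algebra_simps)
    then have "(q - 1) dvd q * n" by (metis dvd_triv_left)
    then show ?thesis using coprime_q by (simp add: coprime_dvd_mult_right_iff)
  qed simp
qed

subsection \<open>The homogeneous solution\<close>

text \<open>The subtracted term is \<rho> = (theta^q - x^q) / (theta^q - theta), a rational solution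
  of the equation \<tau> \<rho> = v^(q-1) (\<rho> - 1) of psi_{q-1,0}. The difference therefore
  solves the homogeneous equation.\<close>

definition yy :: "'a fls fls" where
  "yy = psi (q - 1) 0 - konst (inverse (theta ^ q - theta)) * (konst (theta ^ q) - xx ^ q)"

lemma theta_q_neq: "(theta :: 'a fls) ^ q - theta \<noteq> 0"
  using theta_power_eq_iff[of q 1] q_pos by auto

lemma psi_q1: "CC 0 (psi (q - 1) 0)" "tau (psi (q - 1) 0) = vv ^ (q - 1) * (psi (q - 1) 0 - 1)"
  using psi[of 0 "q - 1"] q_pos by auto

lemma tau_yy: "tau yy = vv ^ (q - 1) * yy"
proof -
  define c where "c = inverse ((theta :: 'a fls) ^ q - theta)"
  have c: "c * (theta ^ q - theta) = 1" using theta_q_neq by (simp add: c_def)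
  define \<rho> where "\<rho> = konst c * (konst (theta ^ q) - xx ^ q)"
  have "vv ^ q = konst theta ^ q - (xx ^ q) ^ q"
  proof -
    have "konst theta ^ q = (vv + xx ^ q) ^ q" by (simp add: vv_def)
    also have "\<dots> = vv ^ q + (xx ^ q) ^ q" using frobenius_L[of vv "xx ^ q" 1] by simp
    finally show ?thesis by simp
  qed
  then have "tau \<rho> = konst c * vv ^ q" by (simp add: \<rho>_def fls_const_power)
  moreover have "\<rho> - 1 = konst c * vv"
  proof -
    have "1 = konst c * (konst (theta ^ q) - konst theta)"
      unfolding fls_minus_const fls_const_mult_const c by simp
    then have "\<rho> - 1 = konst c * (konst (theta ^ q) - xx ^ q) - konst c * (konst (theta ^ q) - konst theta)"
      by (simp add: \<rho>_def)
    also have "\<dots> = konst c * vv" by (simp add: vv_def right_diff_distrib)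
    finally show ?thesis .
  qed
  moreover have "vv ^ q = vv ^ (q - 1) * vv" using q_pos by (simp add: power_eq_if mult.commute)
  ultimately have "tau \<rho> = vv ^ (q - 1) * (\<rho> - 1)" by (simp add: mult_ac)
  moreover have yy: "yy = psi (q - 1) 0 - \<rho>" by (simp add: yy_def \<rho>_def c_def)
  ultimately have "tau yy = vv ^ (q - 1) * (psi (q - 1) 0 - 1) - vv ^ (q - 1) * (\<rho> - 1)"
    using psi_q1(2) by simp
  then show ?thesis by (simp add: yy algebra_simps)
qed

text \<open>The rational part has a nonzero coefficient at x^q, whereas psi_{q-1,0} has no positive
  power of x.\<close>

lemma yy_nz: "yy \<noteq> 0"
proof
  assume "yy = 0"
  then have "yy $$ (- int q) = 0" by simp
  moreover have "psi (q - 1) 0 $$ (- int q) = 0"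
    using CC_val[OF psi_q1(1)] q_pos by (auto simp: val_ge_def)
  ultimately show False using q_pos theta_q_neq by (simp add: yy_def xx_def)
qed

lemma subdegree_tau: "z \<noteq> 0 \<Longrightarrow> fls_subdegree (tau z) = int q * fls_subdegree z"
proof (rule fls_subdegree_eqI)
  assume "z \<noteq> 0"
  then show "tau z $$ (int q * fls_subdegree z) \<noteq> 0" using q_pos by (simp add: tau_nth)
  fix k assume k: "k < int q * fls_subdegree z"
  have "val_ge (int q * fls_subdegree z) (tau z)" by (rule val_ge_tau) (simp add: val_ge_iff)
  then show "tau z $$ k = 0" using k by (simp add: val_ge_def)
qed

text \<open>\<open>tau\<close> multiplies orders by q, so a nonzero fixed series has order 0;
  subtracting the constant coefficient rules this out.\<close>

lemma tau_fixed:
  assumes "tau z = z" shows "z \<in> range konst"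
proof -
  define d where "d = z - konst (z $$ 0)"
  have "d = 0"
  proof (rule ccontr)
    assume "d \<noteq> 0"
    have "tau d = d" using assms by (simp add: d_def)
    then have "int q * fls_subdegree d = fls_subdegree d" using subdegree_tau[OF \<open>d \<noteq> 0\<close>] by simp
    then have "fls_subdegree d = 0" using q_pos by simp
    moreover have "d $$ 0 = 0" by (simp add: d_def)
    ultimately show False using \<open>d \<noteq> 0\<close> by (metis nth_fls_subdegree_nonzero)
  qed
  then show ?thesis by (simp add: d_def)
qed

text \<open>Comparing orders shows that q - 1 divides a - b. Multiplying or dividing z by the
  matching power of \<open>yy\<close> gives a series fixed by \<open>tau\<close>, that is, a
  constant.\<close>

lemma homogeneous_cases:
  assumes z: "z \<noteq> 0" and eq: "tau z * vv ^ a = vv ^ b * z"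
  obtains m c where "z = konst c * yy ^ m" "b = a + (q - 1) * m"
  | m c where "z * yy ^ m = konst c" "a = b + (q - 1) * m"
proof -
  define s where "s = fls_subdegree z"
  have "fls_subdegree (tau z * vv ^ a) = fls_subdegree (vv ^ b * z)" by (simp add: eq)
  then have "int q * s - int a * int q = s - int b * int q"
    using z by (simp add: subdegree_tau fls_subdegree_pow subdegree_vv s_def)
  then have s: "(int q - 1) * s = int q * (int a - int b)" by (simp add: algebra_simps)
  show ?thesis
  proof (cases "a \<le> b")
    case True
    have "int (q * (b - a)) = int (q - 1) * (- s)"
      using s True q_pos by (simp add: of_nat_diff algebra_simps)
    then have "(q - 1) dvd q * (b - a)" by (metis dvd_triv_left int_dvd_int_iff)
    then have "(q - 1) dvd b - a" using coprime_q by (simp add: coprime_dvd_mult_right_iff)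
    then obtain m where m: "b - a = (q - 1) * m" by blast
    then have b: "b = a + (q - 1) * m" using True by simp
    define w where "w = z / yy ^ m"
    have "tau z = vv ^ ((q - 1) * m) * z"
      using eq unfolding b power_add by (simp add: mult_ac)
    then have "tau w = w" by (simp add: w_def tau_divide tau_yy power_mult_distrib power_mult)
    then obtain c where "w = konst c" using tau_fixed by blast
    then have "z = konst c * yy ^ m" using yy_nz by (simp add: w_def field_simps)
    then show ?thesis using that(1) b by blast
  next
    case False
    have "int (q * (a - b)) = int (q - 1) * s"
      using s False q_pos by (simp add: of_nat_diff algebra_simps)
    then have "(q - 1) dvd q * (a - b)" by (metis dvd_triv_left int_dvd_int_iff)
    then have "(q - 1) dvd a - b" using coprime_q by (simp add: coprime_dvd_mult_right_iff)
    then obtain m where m: "a - b = (q - 1) * m" by blast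
    then have a: "a = b + (q - 1) * m" using False by simp
    define w where "w = z * yy ^ m"
    have "tau z * vv ^ ((q - 1) * m) = z"
      using eq unfolding a power_add by (simp add: mult_ac)
    then have "tau w = w"
      by (simp add: w_def tau_yy power_mult_distrib mult.assoc[symmetric] flip: power_mult)
    then obtain c where "w = konst c" using tau_fixed by blast
    then show ?thesis using that(2) a by (simp add: w_def)
  qed
qed

text \<open>By \<open>homogeneous_cases\<close> this field contains all solutions of homogeneous
  equations, as \<open>mahler\<close> demands of \<open>C\<close>.\<close>

definition KC :: "'a fls fls set" where "KC = adjoin K0 yy"

lemma subfield_KC: "is_subfield KC" unfolding KC_def by (rule adjoin_subfield[OF subfield_K0])
lemma K0_KC: "z \<in> K0 \<Longrightarrow> z \<in> KC" unfolding KC_def by (rule adjoin_base[OF subfield_K0])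
lemma yy_KC: "yy \<in> KC" unfolding KC_def by (rule adjoin_gen[OF subfield_K0])

lemma tau_KC: "z \<in> KC \<Longrightarrow> tau z \<in> KC"
proof -
  note sf = adjoin_subfield[OF subfield_K0, of yy]
  assume "z \<in> KC"
  moreover have "tau yy \<in> adjoin K0 yy" unfolding tau_yy
    using vv_K0 by (intro subfield_closed(4)[OF sf] subfield_closed(9)[OF sf] adjoin_gen[OF subfield_K0] adjoin_base[OF subfield_K0])
  ultimately show ?thesis unfolding KC_def
    using adjoin_hom_stable[OF is_hom_tau subfield_K0 tau_K0] by blast
qed

end

sublocale carlitz \<subseteq> mahler tau vv KC
proof
  fix z i j assume eq: "tau z * vv ^ i = vv ^ j * z"
  show "z \<in> KC"
  proof (cases "z = 0")
    case False
    note sub = subfield_closed[OF subfield_KC]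
    from False eq show ?thesis
    proof (cases rule: homogeneous_cases)
      case (1 m c)
      then show ?thesis using konst_K0 K0_KC yy_KC by (auto intro!: sub)
    next
      case (2 m c)
      then have "z = konst c / yy ^ m" using yy_nz by (simp add: field_simps)
      then show ?thesis using konst_K0 K0_KC yy_KC by (auto intro!: sub)
    qed
  qed (simp add: subfield_closed(1)[OF subfield_KC])
next
  have "inj (\<lambda>n. xx ^ n)"
    by (rule injI) (metis fls_subdegree_fls_X_inv_pow neg_equal_iff_equal of_nat_eq_iff xx_def)
  then show "infinite (UNIV :: 'a fls fls set)"
    by (metis finite_imageD finite_subset infinite_UNIV_nat subset_UNIV)
qed (use subfield_KC tau_KC vv_K0 K0_KC in auto)

section \<open>Transcendence of psi_{1,0} over the base field\<close>

context carlitz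
begin

text \<open>Twisting a minimal polynomial by \<open>tau\<close> only multiplies it by a power of v,
  so its constant coefficient is a rational solution of a homogeneous equation of nonzero weight. By
  \<open>rational_homogeneous\<close> it is 0, and dividing by the variable contradicts
  minimality.\<close>

lemma yy_transcendental: "transcendental_over K0 yy"
proof (rule ccontr)
  assume "\<not> transcendental_over K0 yy"
  then obtain R where R: "polyover K0 R" "lead_coeff R = 1" "poly R yy = 0" "degree R > 0"
    "\<And>r. polyover K0 r \<Longrightarrow> poly r yy = 0 \<Longrightarrow> degree r < degree R \<Longrightarrow> r = 0"
    using monic_relation[OF subfield_K0] by metis
  define n where "n = degree R"
  define P where "P = pcompose (map_poly tau R) [:0, vv ^ (q - 1):]"
  define G where "G = P - smult (vv ^ ((q - 1) * n)) R"
  have mp: "polyover K0 (map_poly tau R)" using R(1) tau_K0 by (auto simp: polyover_def)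
  have "polyover K0 G"
    unfolding G_def P_def using R(1) mp vv_K0
    by (intro polyover_diff polyover_smult polyover_pcompose polyover_pCons polyover_0 subfield_K0
      subfield_closed(1,9)[OF subfield_K0])
  moreover have "poly G yy = 0"
    using tau_poly[of R yy] R(3) by (simp add: G_def P_def poly_pcompose tau_yy algebra_simps)
  moreover have "degree G < degree R"
  proof (rule degree_lessI)
    have d: "degree P = n" by (simp add: P_def degree_pcompose n_def)
    have "lead_coeff P = vv ^ ((q - 1) * n)"
      unfolding P_def using R(2) by (subst lead_coeff_comp) (auto simp: n_def power_mult)
    then have "coeff P n = vv ^ ((q - 1) * n)" by (simp add: d)
    then show "\<forall>k\<ge>degree R. coeff G k = 0"
      using R(2) d by (auto simp: G_def le_less n_def coeff_eq_0)
  qed (use R in auto)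
  ultimately have "G = 0" by (rule R(5))
  then have "coeff G 0 = 0" by simp
  then have e: "tau (coeff R 0) * vv ^ 0 = vv ^ ((q - 1) * n) * coeff R 0"
    by (simp add: G_def P_def coeff_pcompose_linear poly_0_coeff_0)
  have "coeff R 0 = 0"
  proof (rule ccontr)
    assume "coeff R 0 \<noteq> 0"
    then have "0 = (q - 1) * n"
      using rational_homogeneous[OF _ _ e] R(1) by (auto simp: polyover_def)
    then show False using R(4) q_pos by (simp add: n_def)
  qed
  then obtain R' where R': "R = pCons 0 R'" by (cases R) auto
  have "polyover K0 R'" using R(1) by (auto simp: R' polyover_def coeff_pCons split: nat.splits)
  moreover have "poly R' yy = 0" using R(3) yy_nz by (simp add: R')
  moreover have "R' \<noteq> 0" using R(4) by (auto simp: R')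
  moreover have "degree R' < degree R" using \<open>R' \<noteq> 0\<close> by (simp add: R')
  ultimately show False using R(5) by blast
qed

text \<open>If q - 1 divided n, every nonzero constant would have n-th power 1. For a constant c
  other than 0 and -1, additivity would then give 1 = 1 + 1. Such a c exists because q \<ge> 3; here
  q \<noteq> 2 is essential.\<close>

lemma additive_degree:
  assumes n: "n > 0" and add: "\<And>s t :: 'a fls fls. (s + t) ^ n = s ^ n + t ^ n"
  shows "\<not> (q - 1) dvd n"
proof
  assume dvd: "(q - 1) dvd n"
  have pw: "c ^ n = 1" if "c \<noteq> 0" for c :: 'a
  proof -
    have "c ^ (q - 1) * c = c"
      using finite_field_power[of c] q_pos by (simp add: power_eq_if mult.commute)
    then have "c ^ (q - 1) = 1" using that by simp
    then show ?thesis using dvd by (auto simp: power_mult)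
  qed
  have "\<not> UNIV \<subseteq> {0, -1 :: 'a}"
  proof
    assume "UNIV \<subseteq> {0, -1 :: 'a}"
    then have "q \<le> card {0, -1 :: 'a}" unfolding q_card by (intro card_mono) auto
    also have "\<dots> \<le> 2" by (simp add: card_insert_if)
    finally show False using q_ge_3 by simp
  qed
  then obtain c :: 'a where c: "c \<noteq> 0" "c \<noteq> -1" by blast
  let ?k = "\<lambda>c :: 'a. konst (fls_const c)"
  have "?k ((c + 1) ^ n) = ?k (c ^ n + 1)"
    using add[of "?k c" 1] by (simp add: fls_const_power fls_plus_const[symmetric])
  then have "(c + 1) ^ n = c ^ n + 1" by (metis fls_const_nth)
  moreover have "c + 1 \<noteq> 0" using c(2) by (simp add: eq_neg_iff_add_eq_0)
  ultimately have "1 + 1 = (1 :: 'a)" using pw[OF c(1)] pw[of "c + 1"] by metis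
  then show False by (metis add_cancel_left_right zero_neq_one)
qed

lemma psi_1: "CC 0 (psi 1 0)" "tau (psi 1 0) = vv * (psi 1 0 - 1)"
  using psi[of 0 1] q_pos by auto

text \<open>A relation yields a monic additive A of degree n with z = A(t) in K0(yy), where t is
  psi_{1,0}. The lower coefficients of A are constants times positive powers of \<open>yy\<close>,
  so the inhomogeneous term A(-1) is a polynomial in \<open>yy\<close> with constant term -1.
  Extracting one coefficient with respect to \<open>yy\<close> leaves a rational solution c of
  \<tau> c = v^n (c - 1); this forces q - 1 to divide n, against
  \<open>additive_degree\<close>.\<close>

lemma psi_transcendental: "transcendental_over KC (psi 1 0)"
proof (rule ccontr)
  define t where "t = psi 1 0"
  have tt: "tau t = vv ^ 1 * (t + (-1))" using psi_1 by (simp add: t_def)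
  assume "\<not> transcendental_over KC (psi 1 0)"
  then have nt: "\<not> transcendental_over KC t" by (simp add: t_def)
  have m1: "-1 \<in> KC" by (intro subfield_closed(2,5)[OF subfield_KC])
  obtain A n where A: "additive_map (1 * n) 1 A" "lead_coeff A = 1" "degree A = n" "n > 0" "poly A t \<in> KC"
    using algebraic_solution[OF stable_C nt tt m1] by blast
  have ndvd: "\<not> (q - 1) dvd n"
    using additive_map_power[OF A(1,4)] A(2,3) by (intro additive_degree[OF A(4)]) auto
  have "\<exists>r. polyover K0 r \<and> coeff A k = poly r yy \<and> coeff r 0 = (if k = n then 1 else 0)" if "k \<le> n" for k
  proof (cases "k = n")
    case True
    then show ?thesis using A(2,3) by (intro exI[of _ 1]) (auto intro: polyover_1 subfield_K0)
  next
    case False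
    show ?thesis
    proof (cases "coeff A k = 0")
      case True
      then show ?thesis using False by (intro exI[of _ 0]) (auto intro: polyover_0 subfield_K0)
    next
      case nz: False
      have "tau (coeff A k) * vv ^ k = vv ^ n * coeff A k" using additive_map_coeff[OF A(1), of k] by simp
      with nz show ?thesis
      proof (cases rule: homogeneous_cases)
        case (1 m c)
        then have "m > 0" using False that by (intro gr0I) auto
        then show ?thesis using 1 False konst_K0
          by (intro exI[of _ "monom (konst c) m"]) (auto simp: poly_monom intro: polyover_monom subfield_K0)
      next
        case (2 m c)
        then show ?thesis using that False by simp
      qed
    qed
  qed
  then obtain rf where rf: "\<And>k. k \<le> n \<Longrightarrow> polyover K0 (rf k)" "\<And>k. k \<le> n \<Longrightarrow> coeff A k = poly (rf k) yy"
    "\<And>k. k \<le> n \<Longrightarrow> coeff (rf k) 0 = (if k = n then 1 else 0)" by metis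
  define s where "s = - (\<Sum>k\<le>n. rf k)"
  have s: "polyover K0 s" unfolding s_def using rf(1)
    by (intro polyover_uminus polyover_sum subfield_K0) auto
  have s0: "coeff s 0 = -1" by (simp add: s_def coeff_sum rf(3))
  have sy: "poly s yy = poly A (-1)"
  proof -
    have "poly A (-1) = - poly A 1" using additive_map_minus[OF A(1), of 0 1] additive_map_at_0[OF A(1)] by simp
    also have "poly A 1 = (\<Sum>k\<le>n. poly (rf k) yy)" using rf(2) A(3) by (simp add: poly_altdef)
    finally show ?thesis by (simp add: s_def poly_sum)
  qed
  define z where "z = poly A t"
  have tz: "tau z = vv ^ n * (z + poly s yy)" using additive_map_apply[OF A(1) tt] by (simp add: z_def sy)
  have tyy: "tau yy = vv ^ (q - 1) * (yy + 0)" using tau_yy by simp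
  have zK: "z \<in> adjoin K0 yy" using A(5) by (simp add: z_def KC_def)
  obtain d p where d: "polyover K0 d" "lead_coeff d = 1" "polyover K0 p" "poly d yy * z = poly p yy"
    "pcompose (map_poly tau d) [:vv ^ (q - 1) * 0, vv ^ (q - 1):] = smult (vv ^ ((q - 1) * degree d)) d"
    by (rule minimal_denominator[OF subfield_K0 tau_K0 vv_K0 tyy subfield_closed(1)[OF subfield_K0] zK tz s])
  define e where "e = degree d"
  \<comment> \<open>The denominator is semi-invariant, and by \<open>rational_homogeneous\<close> it
    has a single nonzero coefficient. It is thus a power of the variable, and the coefficient of the
    numerator at the same exponent e plays the role of the constant term of z.\<close>
  have dk: "coeff d k = 0" if "k \<noteq> e" for k
  proof (rule ccontr)
    assume nz: "coeff d k \<noteq> 0"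
    have h: "tau (coeff d k) * vv ^ ((q - 1) * k) = vv ^ ((q - 1) * e) * coeff d k"
      using arg_cong[OF d(5), of "\<lambda>p. coeff p k"]
      unfolding coeff_pcompose_linear power_mult[of vv "q - 1" k]
      by (simp add: coeff_pcompose_linear e_def mult.commute)
    then have "(q - 1) * k = (q - 1) * e"
      using rational_homogeneous[OF _ nz h] d(1) by (auto simp: polyover_def)
    then show False using that q_pos by simp
  qed
  have dm: "d = monom 1 e" using dk d(2) by (intro poly_eqI) (auto simp: e_def)
  define P where "P = pcompose (map_poly tau p) [:0, vv ^ (q - 1):] - smult (vv ^ ((q - 1) * e + n)) (p + monom 1 e * s)"
  have mp: "polyover K0 (map_poly tau p)" using d(3) tau_K0 by (auto simp: polyover_def)
  have "polyover K0 P"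
    unfolding P_def using d(3) s mp vv_K0
    by (intro polyover_diff polyover_smult polyover_pcompose polyover_pCons polyover_0 polyover_add polyover_mult polyover_monom
      subfield_K0 subfield_closed(1,2,9)[OF subfield_K0])
  moreover have "poly P yy = 0"
  proof -
    have py: "poly p yy = yy ^ e * z" using d(4) by (simp add: dm poly_monom)
    have "tau (poly p yy) = vv ^ ((q - 1) * e + n) * (poly p yy + yy ^ e * poly s yy)"
      unfolding py tau_simps tau_yy tz power_mult_distrib power_add power_mult[of vv "q - 1" e]
      by (simp add: distrib_left mult_ac)
    then show ?thesis by (simp add: P_def poly_pcompose tau_poly tau_yy poly_monom algebra_simps)
  qed
  ultimately have "P = 0" using yy_transcendental unfolding transcendental_over_def by blast
  then have "coeff P e = 0" by simp
  then have "tau (coeff p e) * vv ^ ((q - 1) * e) = vv ^ ((q - 1) * e) * (vv ^ n * (coeff p e - 1))"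
    using coeff_monom_mult[of 1 e s e] unfolding P_def power_add power_mult[of vv "q - 1" e]
    by (simp add: coeff_pcompose_linear s0 mult.commute mult.left_commute[of "vv ^ n"])
  then have "tau (coeff p e) = vv ^ n * (coeff p e - 1)" by (simp add: mult.commute)
  then have "(q - 1) dvd n"
    using rational_inhomogeneous d(3) by (auto simp: polyover_def)
  then show False using ndvd by simp
qed

text \<open>\<open>functional_independence\<close> with Q j = q^(j+1); the shift of the exponent
  ensures Q j > 1.\<close>

theorem chi_transcendental:
  assumes G: "G \<subseteq> range konst \<union> {xx} \<union> {psi n k | n k. k * (q - 1) < n * q} \<union> (\<lambda>j. chi (q ^ Suc j)) ` {..<m}"
  shows "transcendental_over (gen_field G) (chi (q ^ Suc m))"
proof -
  let ?P = "{psi n k | n k. k * (q - 1) < n * q}"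
  have inj: "inj (\<lambda>j. q ^ Suc j)" using q_pos by (intro injI) (simp add: power_inject_exp)
  have Qgt: "1 < q ^ Suc j" for j using one_less_power[of q "Suc j"] q_pos by simp
  have "transcendental_over (gen_field (KC \<union> ?P \<union> {psi 1 0} \<union> (\<lambda>j. chi (q ^ Suc j)) ` {..<m})) (chi (q ^ Suc m))"
  proof (rule functional_independence[OF psi_transcendental psi_1(2) _ chi(2) inj Qgt frobenius_L])
    fix g assume "g \<in> ?P"
    then obtain n k where g: "g = psi n k" "k * (q - 1) < n * q" by blast
    have "- (xx ^ k) \<in> KC" using K0_KC[OF xx_K0] by (intro subfield_closed(5,9)[OF subfield_KC])
    then show "\<exists>n \<rho>. \<rho> \<in> KC \<and> tau g = vv ^ n * (g + \<rho>)"
      using psi(2)[OF g(2)] g(1) by (intro exI[of _ n] exI[of _ "- (xx ^ k)"]) auto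
  qed
  moreover have "gen_field G \<subseteq> gen_field (KC \<union> ?P \<union> {psi 1 0} \<union> (\<lambda>j. chi (q ^ Suc j)) ` {..<m})"
    using G konst_K0 xx_K0 K0_KC by (intro gen_field_mono) blast
  ultimately show ?thesis by (rule transcendental_over_mono)
qed

end

subsection \<open>Evaluation at $x = \theta^M$\<close>

lemma fconv_Cauchy:
  assumes "\<And>n n'. c \<le> n \<Longrightarrow> n \<le> n' \<Longrightarrow> val_ge (int n - int c) (s n' - s n)"
  shows "\<exists>l. fconv s l"
proof -
  define N where "N = (\<lambda>i :: int. nat \<bar>i\<bar> + c + 1)"
  define h where "h = (\<lambda>i. s (N i) $$ i)"
  have st: "s n $$ i = s m $$ i" if "c \<le> m" "m \<le> n" "i < int m - int c" for m n i
    using assms[OF that(1,2)] that(3) by (auto simp: val_ge_def)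
  have h0: "h i = 0" if "i < min 0 (fls_subdegree (s c))" for i
  proof -
    have "h i = s c $$ i" unfolding h_def using that by (intro st) (auto simp: N_def)
    then show ?thesis using that by simp
  qed
  then obtain l where l: "\<And>i. l $$ i = h i" using fls_with_coeffs by blast
  have "val_ge m (s n - l)" if n: "n \<ge> nat \<bar>m\<bar> + c + 1" for m n
    unfolding val_ge_def
  proof (intro allI impI)
    fix i assume i: "i < m"
    have "s n $$ i = h i"
    proof (cases "i < 0")
      case True
      then have "s n $$ i = s c $$ i" using n by (intro st) auto
      moreover have "h i = s c $$ i" unfolding h_def using True by (intro st) (auto simp: N_def)
      ultimately show ?thesis by simp
    next
      case False
      then show ?thesis unfolding h_def using n i by (intro st) (auto simp: N_def)
    qed
    then show "(s n - l) $$ i = 0" by (simp add: l)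
  qed
  then show ?thesis unfolding fconv_def by blast
qed

lemma fconv_val_ge:
  assumes "fconv s l" "\<And>n. val_ge m (s n)" shows "val_ge m l"
proof -
  obtain N where "val_ge m (s N - l)" using assms(1) unfolding fconv_def by blast
  then have "val_ge m (s N - (s N - l))" by (rule val_ge_diff[OF assms(2)])
  then show ?thesis by simp
qed

lemma fconv_cong_diff:
  assumes "fconv s l" "\<And>m. \<exists>N. \<forall>n\<ge>N. val_ge m (r n - s n)" shows "fconv r l"
  unfolding fconv_def
proof
  fix m
  obtain N M where "\<forall>n\<ge>N. val_ge m (s n - l)" "\<forall>n\<ge>M. val_ge m (r n - s n)"
    using assms unfolding fconv_def by blast
  then have "val_ge m ((r n - s n) + (s n - l))" if "n \<ge> max N M" for n
    using that by (intro val_ge_add) simp_all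
  then show "\<exists>N. \<forall>n\<ge>N. val_ge m (r n - l)" by (intro exI[of _ "max N M"]) (simp del: max.bounded_iff)
qed

text \<open>The j-th term of f at x = theta^M: the shift multiplies by theta^(- M j).\<close>

definition tterm :: "nat \<Rightarrow> 'a::field fls fls \<Rightarrow> int \<Rightarrow> 'a fls" where
  "tterm M f j = fls_shift (- (int M * j)) (f $$ j)"

definition psum :: "nat \<Rightarrow> 'a::field fls fls \<Rightarrow> nat \<Rightarrow> 'a fls" where
  "psum M f n = (\<Sum>j=-int n..int n. tterm M f j)"

definition ev :: "nat \<Rightarrow> 'a::field fls fls \<Rightarrow> 'a fls" where
  "ev M f = (SOME l. fconv (psum M f) l)"

lemma ev_eqI: "fconv (psum M f) l \<Longrightarrow> ev M f = l"
  unfolding ev_def by (metis fconv_unique someI)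

lemma val_ge_shift: "val_ge m f \<Longrightarrow> val_ge (m - k) (fls_shift k f)"
  by (auto simp: val_ge_def)

lemma tterm_val:
  assumes "CC c f" "M \<ge> 1" "j \<ge> m"
  shows "val_ge ((int M - 1) * m - c) (tterm M f j)"
proof -
  have "val_ge (- (j + c)) (f $$ j)" using assms(1) by (intro Ob_val) (auto simp: CC_def)
  then have v: "val_ge (- (j + c) + int M * j) (tterm M f j)"
    unfolding tterm_def using val_ge_shift[of "- (j + c)" "f $$ j" "- (int M * j)"] by simp
  have "(int M - 1) * m \<le> (int M - 1) * j" using assms by (intro mult_left_mono) auto
  then show ?thesis using v by (elim val_ge_mono) (simp add: algebra_simps)
qed

lemma tterm_0: "CC c f \<Longrightarrow> j < - c \<Longrightarrow> tterm M f j = 0"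
  using CC_val[of c f] by (auto simp: tterm_def val_ge_def)

lemma sum_diff_symmetric:
  fixes f :: "'i \<Rightarrow> 'b::ab_group_add"
  assumes "finite A" "finite B"
  shows "sum f A - sum f B = sum f (A - B) - sum f (B - A)"
proof -
  have "sum f A = sum f (A - B) + sum f (A \<inter> B)" "sum f B = sum f (B - A) + sum f (A \<inter> B)"
    using sum.Int_Diff[OF assms(1), of f B] sum.Int_Diff[OF assms(2), of f A]
    by (simp_all add: add.commute Int_commute)
  then show ?thesis by simp
qed

lemma ev_fconv:
  assumes "CC c f" "M \<ge> 2"
  shows "fconv (psum M f) (ev M f)"
proof -
  define d where "d = nat \<bar>c\<bar>"
  have C: "CC (int d) f" using assms(1) by (rule CC_mono) (simp add: d_def)
  have "\<exists>l. fconv (psum M f) l"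
  proof (rule fconv_Cauchy[of d])
    fix n n' :: nat assume n: "d \<le> n" "n \<le> n'"
    have "psum M f n' - psum M f n = sum (tterm M f) ({-int n'..int n'} - {-int n..int n})"
      unfolding psum_def using n by (subst sum_diff) auto
    also have "val_ge (int n - int d) \<dots>"
    proof (rule val_ge_sum)
      fix j assume "j \<in> {-int n'..int n'} - {-int n..int n}"
      then consider "j < - int d" | "j \<ge> int n" using n by fastforce
      then show "val_ge (int n - int d) (tterm M f j)"
      proof cases
        case 2
        have "1 * int n \<le> (int M - 1) * int n" using assms(2) by (intro mult_right_mono) auto
        then show ?thesis using tterm_val[OF C _ 2, of M] assms(2) by (auto elim: val_ge_mono)
      qed (simp add: tterm_0[OF C])
    qed
    finally show "val_ge (int n - int d) (psum M f n' - psum M f n)" .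
  qed
  then show ?thesis using ev_eqI by blast
qed

lemma tterm_add: "tterm M (f + g) j = tterm M f j + tterm M g j"
  by (simp add: tterm_def)

lemma psum_add: "psum M (f + g) = (\<lambda>n. psum M f n + psum M g n)"
  by (simp add: fun_eq_iff psum_def tterm_add sum.distrib)

lemma ev_add: "CC c f \<Longrightarrow> CC d g \<Longrightarrow> M \<ge> 2 \<Longrightarrow> ev M (f + g) = ev M f + ev M g"
  by (rule ev_eqI) (simp add: psum_add fconv_add ev_fconv)

lemma psum_konst: "psum M (fls_const a * f) = (\<lambda>n. a * psum M f n)"
proof
  fix n
  have "fls_shift k (a * b) = a * fls_shift k b" for k and b :: "'a fls"
    by (simp add: fls_shifted_times_simps)
  then show "psum M (fls_const a * f) n = a * psum M f n"
    by (simp add: psum_def tterm_def sum_distrib_left)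
qed

lemma ev_konst_mult: "CC c f \<Longrightarrow> M \<ge> 2 \<Longrightarrow> ev M (fls_const a * f) = a * ev M f"
  by (rule ev_eqI) (simp add: psum_konst fconv_cmult ev_fconv)

lemma ev_diff: "CC c f \<Longrightarrow> CC d g \<Longrightarrow> M \<ge> 2 \<Longrightarrow> ev M (f - g) = ev M f - ev M g"
  using ev_add[of c f d "- g" M] ev_konst_mult[of d g M "-1"] by (simp add: CC_uminus)

lemma ev_0 [simp]: "ev M 0 = 0"
  by (rule ev_eqI) (simp add: psum_def[abs_def] tterm_def fconv_const)

lemma ev_sum:
  "(\<And>i. i \<in> A \<Longrightarrow> CC c (f i)) \<Longrightarrow> M \<ge> 2 \<Longrightarrow> ev M (sum f A) = (\<Sum>i\<in>A. ev M (f i))"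
  by (induction A rule: infinite_finite_induct) (auto simp: ev_add[of c _ c] CC_sum)

lemma ev_1: "ev M 1 = (1 :: 'a::field fls)"
proof (rule ev_eqI)
  have "psum M 1 n = (\<Sum>j\<in>{0}. tterm M (1 :: 'a fls fls) j)" for n :: nat
    unfolding psum_def by (rule sum.mono_neutral_right) (auto simp: tterm_def)
  then have "psum M 1 = (\<lambda>n. 1 :: 'a fls)" by (simp add: fun_eq_iff tterm_def)
  then show "fconv (psum M 1) (1 :: 'a fls)" by (simp add: fconv_const)
qed

lemma ev_konst: "M \<ge> 2 \<Longrightarrow> ev M (fls_const a) = a"
  using ev_konst_mult[OF CC_1[of 0], of M a] by (simp add: ev_1)

text \<open>Multiplication by x^k moves the window of summation by k. The two windows differ by
  terms that are 0 at the lower end and of large valuation at the upper end.\<close>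

lemma ev_shift:
  assumes "CC c f" "M \<ge> 2"
  shows "ev M (fls_shift k f) = fls_shift (int M * k) (ev M f)"
proof (rule ev_eqI)
  define d where "d = nat \<bar>c\<bar>"
  have C: "CC (int d) f" using assms(1) by (rule CC_mono) (simp add: d_def)
  have sh: "fls_shift (int M * k) b = fls_shift (int M * k) 1 * b" for b :: "'a fls"
    by (simp add: fls_shifted_times_simps)
  have ps: "psum M (fls_shift k f) n = fls_shift (int M * k) (\<Sum>j=-int n+k..int n+k. tterm M f j)" for n
  proof -
    have "psum M (fls_shift k f) n = (\<Sum>j=-int n..int n. fls_shift (int M * k) (tterm M f (j + k)))"
      unfolding psum_def by (intro sum.cong refl) (simp add: tterm_def algebra_simps)
    also have "\<dots> = (\<Sum>j=-int n+k..int n+k. fls_shift (int M * k) (tterm M f j))"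
      by (rule sum.reindex_bij_witness[of _ "\<lambda>j. j - k" "\<lambda>j. j + k"]) auto
    also have "\<dots> = fls_shift (int M * k) (\<Sum>j=-int n+k..int n+k. tterm M f j)"
      by (subst (1 2) sh) (simp add: sum_distrib_left)
    finally show ?thesis .
  qed
  have "fconv (\<lambda>n. fls_shift (int M * k) 1 * (\<Sum>j=-int n+k..int n+k. tterm M f j)) (fls_shift (int M * k) 1 * ev M f)"
  proof (rule fconv_cmult, rule fconv_cong_diff[OF ev_fconv[OF assms]])
    fix m
    define N where "N = nat \<bar>m\<bar> + nat \<bar>k\<bar> + d"
    have "val_ge m ((\<Sum>j=-int n+k..int n+k. tterm M f j) - psum M f n)" if n: "n \<ge> N" for n
    proof -
      have big: "val_ge m (tterm M f j)" if "j \<ge> int n - \<bar>k\<bar> \<or> j < - int d" for j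
      proof (cases "j < - int d")
        case False
        then have j: "j \<ge> int n - \<bar>k\<bar>" using that by simp
        have "1 * (int n - \<bar>k\<bar>) \<le> (int M - 1) * (int n - \<bar>k\<bar>)"
          using assms(2) n by (intro mult_right_mono) (auto simp: N_def)
        moreover have "m \<le> int n - \<bar>k\<bar> - int d" using n by (auto simp: N_def)
        ultimately have "m \<le> (int M - 1) * (int n - \<bar>k\<bar>) - int d"
          by (simp only: mult_1 le_diff_eq)
        then show ?thesis using tterm_val[OF C _ j, of M] assms(2) by (auto elim: val_ge_mono)
      qed (simp add: tterm_0[OF C])
      show ?thesis
        unfolding psum_def
        by (subst sum_diff_symmetric, simp, simp, intro val_ge_diff val_ge_sum big) (use n in \<open>auto simp: N_def\<close>)
    qed
    then show "\<exists>N. \<forall>n\<ge>N. val_ge m ((\<Sum>j=-int n+k..int n+k. tterm M f j) - psum M f n)" by blast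
  qed
  moreover have "psum M (fls_shift k f) = (\<lambda>n. fls_shift (int M * k) 1 * (\<Sum>j=-int n+k..int n+k. tterm M f j))"
    by (rule ext) (subst ps, rule sh)
  ultimately show "fconv (psum M (fls_shift k f)) (fls_shift (int M * k) (ev M f))"
    using sh[of "ev M f"] by simp
qed

text \<open>Later applied to Pade remainders, whose values must beat the coefficients supplied by
  Siegel's lemma.\<close>

lemma ev_bound:
  assumes "CC c f" "val_ge m f" "M \<ge> 2"
  shows "val_ge ((int M - 1) * m - c) (ev M f)"
proof (rule fconv_val_ge[OF ev_fconv[OF assms(1,3)]])
  fix n
  have "val_ge ((int M - 1) * m - c) (tterm M f j)" for j
  proof (cases "j < m")
    case True
    then show ?thesis using assms(2) by (auto simp: val_ge_def tterm_def)
  next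
    case False
    then show ?thesis using tterm_val[OF assms(1), of M m j] assms(3) by simp
  qed
  then show "val_ge ((int M - 1) * m - c) (psum M f n)" unfolding psum_def by (intro val_ge_sum)
qed

lemma CC_tail:
  assumes "CC d g"
  defines "gt \<equiv> \<lambda>n. \<Sum>j=-int n..int n. fls_shift (- j) (fls_const (g $$ j))"
  shows "CC d (g - gt n)" "d \<le> int n \<Longrightarrow> val_ge (int n) (g - gt n)"
proof -
  have nth: "gt n $$ i = (if - int n \<le> i \<and> i \<le> int n then g $$ i else 0)" for i
    by (auto simp: gt_def fls_nth_sum sum.delta if_distrib cong: if_cong)
  show "CC d (g - gt n)" using assms(1) by (auto simp: CC_def nth)
  assume "d \<le> int n"
  then show "val_ge (int n) (g - gt n)"
    using CC_val[OF assms(1)] by (auto simp: val_ge_def nth)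
qed

text \<open>For a truncation \<open>gt n\<close> of g the product formula follows from linearity and
  \<open>ev_shift\<close>; the error f * (g - gt n) has high order, so its value is small by
  \<open>ev_bound\<close>.\<close>

lemma ev_mult:
  assumes f: "CC c f" and g: "CC d g" and M: "M \<ge> 2"
  shows "ev M (f * g) = ev M f * ev M g"
proof -
  define gt where "gt = (\<lambda>n :: nat. \<Sum>j=-int n..int n. fls_shift (- j) (fls_const (g $$ j)))"
  have evgt: "ev M (f * gt n) = ev M f * psum M g n" for n
  proof -
    have CCj: "CC (c + d) (fls_shift (- j) (fls_const (g $$ j) * f))" for j
      unfolding CC_def
    proof
      fix i
      have "g $$ j * f $$ (i - j) \<in> Ob ((j + d) + (i - j + c))"
        using f g by (intro Ob_mult) (auto simp: CC_def)
      then show "fls_shift (- j) (fls_const (g $$ j) * f) $$ i \<in> Ob (i + (c + d))" by (simp add: algebra_simps)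
    qed
    have CCk: "CC (j + d + c) (fls_const (g $$ j) * f)" for j
      using g by (intro CC_mult f CC_const) (auto simp: CC_def)
    have sh: "fls_shift k b = fls_shift k 1 * b" for k and b :: "'a fls"
      by (simp add: fls_shifted_times_simps)
    have "f * gt n = (\<Sum>j=-int n..int n. fls_shift (- j) (fls_const (g $$ j) * f))"
      unfolding gt_def sum_distrib_left by (intro sum.cong refl) (simp add: fls_shifted_times_simps mult.commute)
    then have "ev M (f * gt n) = (\<Sum>j=-int n..int n. ev M (fls_shift (- j) (fls_const (g $$ j) * f)))"
      by (simp add: ev_sum[OF CCj M])
    also have "\<dots> = (\<Sum>j=-int n..int n. tterm M g j * ev M f)"
      by (intro sum.cong refl)
        (simp add: ev_shift[OF CCk M] ev_konst_mult[OF f M] tterm_def fls_shifted_times_simps)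
    also have "\<dots> = ev M f * psum M g n" by (simp add: psum_def sum_distrib_left mult.commute)
    finally show ?thesis .
  qed
  have "fconv (\<lambda>n. ev M f * psum M g n) (ev M f * ev M g)"
    by (intro fconv_cmult ev_fconv[OF g M])
  moreover have "fconv (\<lambda>n. ev M f * psum M g n) (ev M (f * g))"
    unfolding fconv_def
  proof
    fix m
    define N where "N = nat \<bar>m\<bar> + 2 * nat \<bar>c\<bar> + nat \<bar>d\<bar>"
    have "val_ge m (ev M f * psum M g n - ev M (f * g))" if n: "n \<ge> N" for n
    proof -
      have gn: "CC d (g - gt n)" "val_ge (int n) (g - gt n)"
        using CC_tail[OF g, of n] n by (auto simp: gt_def N_def)
      have CCgt: "CC d (gt n)" using CC_diff[OF g gn(1)] by simp
      have "val_ge (- c + int n) (f * (g - gt n))" by (intro val_ge_mult CC_val f gn)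
      then have "val_ge ((int M - 1) * (- c + int n) - (c + d)) (ev M (f * (g - gt n)))"
        by (intro ev_bound M CC_mult f gn)
      moreover have "m \<le> (int M - 1) * (- c + int n) - (c + d)"
      proof -
        have "1 * (- c + int n) \<le> (int M - 1) * (- c + int n)"
          using M n by (intro mult_right_mono) (auto simp: N_def)
        moreover have "m \<le> (- c + int n) - (c + d)" using n by (auto simp: N_def)
        ultimately show ?thesis by (simp only: mult_1 le_diff_eq)
      qed
      ultimately have "val_ge m (- ev M (f * (g - gt n)))" by (intro val_ge_uminus) (rule val_ge_mono)
      moreover have "ev M (f * (g - gt n)) = ev M (f * g) - ev M f * psum M g n"
        unfolding evgt[symmetric] right_diff_distrib by (rule ev_diff[OF CC_mult[OF f g] CC_mult[OF f CCgt] M])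
      ultimately show ?thesis by simp
    qed
    then show "\<exists>N. \<forall>n\<ge>N. val_ge m (ev M f * psum M g n - ev M (f * g))" by blast
  qed
  ultimately show ?thesis using fconv_unique by blast
qed

lemma ev_power:
  assumes "CC c f" "M \<ge> 2" shows "ev M (f ^ n) = ev M f ^ n"
proof (induction n)
  case (Suc n)
  then show ?case using ev_mult[OF assms(1) CC_power[OF assms(1), of n] assms(2)] by simp
qed (simp add: ev_1)

lemma ev_X: "M \<ge> 2 \<Longrightarrow> ev M fls_X_inv = theta ^ M"
  using ev_shift[OF CC_1[of 0], of M 1]
  by (simp add: ev_1 fls_X_inv_conv_shift_1 theta_def fls_shifted_pow)

text \<open>The inner polynomials are in theta and the outer variable is x: \<open>emb\<close>
  embeds F_q[theta][x] into the series, and \<open>evp M\<close> evaluates at x = theta^M.\<close>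

definition emb :: "'a::field poly poly \<Rightarrow> 'a fls fls" where
  "emb = polyhom (\<lambda>p. fls_const (poly_theta p)) fls_X_inv"

definition evp :: "nat \<Rightarrow> 'a::field poly poly \<Rightarrow> 'a fls" where
  "evp M = polyhom poly_theta (theta ^ M)"

lemma is_hom_emb: "is_hom emb" and is_hom_evp: "is_hom (evp M)"
  unfolding emb_def evp_def
  using polyhom_hom[OF is_hom_comp[OF is_hom_const is_hom_poly_theta]] polyhom_hom[OF is_hom_poly_theta]
  by blast+

lemma emb_pCons: "emb (pCons a p) = fls_const (poly_theta a) + fls_X_inv * emb p"
  and evp_pCons: "evp M (pCons a p) = poly_theta a + theta ^ M * evp M p"
  by (simp_all add: emb_def evp_def polyhom_pCons)

lemma emb_nth: "emb p $$ n = (if n \<le> 0 then poly_theta (coeff p (nat (- n))) else 0)"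
proof (induction p arbitrary: n)
  case (pCons a p)
  show ?case
  proof (cases "n < 0")
    case True
    then have "nat (- n) = Suc (nat (- (n + 1)))" by auto
    then show ?thesis using True
      by (simp add: emb_pCons fls_X_inv_times_conv_shift pCons.IH)
  qed (auto simp: emb_pCons fls_X_inv_times_conv_shift pCons.IH)
qed (simp add: emb_def)

lemma CC_emb: "\<exists>c. CC c (emb p)"
proof (induction p)
  case (pCons a p)
  then obtain c where c: "CC c (emb p)" by blast
  define m where "m = max (int (degree a)) (1 + c)"
  have "CC m (fls_const (poly_theta a))" by (intro CC_const Ob_poly_theta) (simp add: m_def)
  moreover have "CC m (fls_X_inv * emb p)"
    using CC_mult[OF CC_X c] by (rule CC_mono) (simp add: m_def)
  ultimately show ?case unfolding emb_pCons by (blast intro: CC_add)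
qed (auto simp: emb_def)

lemma ev_emb: "M \<ge> 2 \<Longrightarrow> ev M (emb p) = evp M p"
proof (induction p)
  case (pCons a p)
  obtain c where c: "CC c (emb p)" using CC_emb by blast
  have "CC (int (degree a)) (fls_const (poly_theta a))" by (intro CC_const Ob_poly_theta) simp
  from ev_add[OF this CC_mult[OF CC_X c]] show ?case
    using pCons by (simp add: emb_pCons evp_pCons ev_konst ev_mult[OF CC_X c] ev_X)
qed (simp add: emb_def evp_def)

lemma emb_eq_0_iff: "emb p = 0 \<longleftrightarrow> p = 0"
proof
  assume "emb p = 0"
  then have "coeff p i = 0" for i using emb_nth[of p "- int i"] by simp
  then show "p = 0" by (simp add: poly_eq_iff)
qed (simp add: emb_def)

section \<open>Values at x = theta^(q^N)\<close>

context carlitz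
begin

lemma ev_tau:
  assumes "CC c f" "M \<ge> 2"
  shows "ev M (tau f) = ev (M * q) f"
proof (rule ev_eqI)
  have ps: "psum M (tau f) n = psum (M * q) f (n div q)" for n
  proof -
    have "psum M (tau f) n = (\<Sum>j\<in>{j \<in> {-int n..int n}. int q dvd j}. tterm M (tau f) j)"
      unfolding psum_def by (rule sum.mono_neutral_right) (auto simp: tterm_def tau_nth)
    also have "\<dots> = (\<Sum>i=-int (n div q)..int (n div q). tterm (M * q) f i)"
    proof (rule sum.reindex_bij_witness[of _ "\<lambda>i. int q * i" "\<lambda>j. j div int q"])
      have q0: "int q > 0" using q_pos by simp
      fix j assume j: "j \<in> {j \<in> {-int n..int n}. int q dvd j}"
      then obtain i where i: "j = int q * i" by blast
      then show "int q * (j div int q) = j" using q0 by simp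
      have "i \<le> int n div int q"
        using j i q0 zdiv_mono1[of "int q * i" "int n" "int q"] by simp
      moreover have "int q * (- i) div int q \<le> int n div int q"
        using j i q0 by (intro zdiv_mono1) auto
      then have "- i \<le> int n div int q"
        using q0 nonzero_mult_div_cancel_left[of "int q" "- i"] by simp
      ultimately have "i \<le> int n div int q" "- i \<le> int n div int q" by blast+
      then show "j div int q \<in> {- int (n div q)..int (n div q)}"
        using i q0 by (auto simp: zdiv_int)
      show "tterm (M * q) f (j div int q) = tterm M (tau f) j"
        using i q0 by (simp add: tterm_def tau_nth mult.assoc)
    next
      fix i assume "i \<in> {- int (n div q)..int (n div q)}"
      then have i: "\<bar>i\<bar> \<le> int (n div q)" by auto
      have "int q * \<bar>i\<bar> \<le> int q * int (n div q)" using i by (intro mult_left_mono) auto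
      also have "\<dots> \<le> int n" by (metis mult.commute of_nat_le_iff of_nat_mult times_div_less_eq_dividend)
      finally have "\<bar>int q * i\<bar> \<le> int n" by (simp add: abs_mult)
      then show "int q * i \<in> {j \<in> {-int n..int n}. int q dvd j}" by auto
      show "int q * i div int q = i" using q_pos by simp
    qed
    finally show ?thesis by (simp add: psum_def)
  qed
  have "fconv (psum (M * q) f) (ev (M * q) f)"
    using assms q_pos by (intro ev_fconv[OF assms(1)]) (metis le_trans mult.right_neutral mult_le_mono2)
  then have "fconv (\<lambda>n. psum (M * q) f (n div q)) (ev (M * q) f)"
    unfolding fconv_def
  proof (intro allI)
    fix m assume "\<forall>m. \<exists>N. \<forall>n\<ge>N. val_ge m (psum (M * q) f n - ev (M * q) f)"
    then obtain N where N: "\<forall>n\<ge>N. val_ge m (psum (M * q) f n - ev (M * q) f)" by blast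
    have "n div q \<ge> N" if "n \<ge> N * q" for n using that q_pos by (simp add: div_le_mono less_eq_div_iff_mult_less_eq)
    then show "\<exists>N. \<forall>n\<ge>N. val_ge m (psum (M * q) f (n div q) - ev (M * q) f)" using N by blast
  qed
  moreover have "psum M (tau f) = (\<lambda>n. psum (M * q) f (n div q))" using ps by (rule ext)
  ultimately show "fconv (psum M (tau f)) (ev (M * q) f)" by simp
qed

lemma q_power_ge: "N \<ge> 1 \<Longrightarrow> q ^ N \<ge> 2"
  using q_pos by (cases N) (auto intro: order_trans[of 2 q])

abbreviation "evN N \<equiv> ev (q ^ N)"

lemma evN_tau: "CC c f \<Longrightarrow> N \<ge> 1 \<Longrightarrow> evN N (tau f) = evN (Suc N) f"
  using ev_tau[of c f "q ^ N"] q_power_ge by (simp add: mult.commute)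

definition lam :: "nat \<Rightarrow> 'a fls" where "lam i = theta - theta ^ (q ^ i)"

lemma evN_vv: "N \<ge> 1 \<Longrightarrow> evN N vv = lam (Suc N)"
proof -
  assume N: "N \<ge> 1"
  have "CC 1 (fls_const (theta :: 'a fls))" using Ob_theta_power[of 1 1] by (intro CC_const) simp
  then have "evN N vv = evN N (fls_const theta) - evN N (xx ^ q)"
    unfolding vv_def using CC_X_power[of q] q_power_ge[OF N] by (intro ev_diff) (auto simp: xx_def)
  then show ?thesis
    using q_power_ge[OF N] ev_power[OF CC_X, of "q ^ N" q]
    by (simp add: ev_konst ev_X xx_def lam_def power_mult[symmetric] mult.commute)
qed

definition ell :: "nat \<Rightarrow> 'a fls" where "ell d = (\<Prod>i=1..d. lam i)"

lemma ell_0 [simp]: "ell 0 = 1" and ell_Suc: "ell (Suc d) = ell d * lam (Suc d)"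
  by (simp_all add: ell_def)

lemma theta_power_neq: "i \<noteq> j \<Longrightarrow> (theta :: 'a fls) ^ (q ^ i) \<noteq> theta ^ (q ^ j)"
  using theta_power_eq_iff q_pos by (simp add: power_inject_exp)

lemma lam_nz: "i \<ge> 1 \<Longrightarrow> lam i \<noteq> 0"
  unfolding lam_def using theta_power_neq[of 0 i] by simp

lemma ell_nz [simp]: "ell d \<noteq> 0" by (simp add: ell_def lam_nz)

lemma subdegree_lam: "i \<ge> 1 \<Longrightarrow> fls_subdegree (lam i) = - int (q ^ i)"
proof -
  assume i: "i \<ge> 1"
  have "fls_subdegree (- (theta ^ (q ^ i)) + theta :: 'a fls) = fls_subdegree (- (theta ^ (q ^ i)) :: 'a fls)"
    using q_power_ge[OF i] by (intro fls_subdegree_add_eq1) (auto simp: theta_def simp flip: of_nat_power)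
  then show ?thesis by (simp add: lam_def theta_def)
qed

lemma subdegree_ell: "fls_subdegree (ell d) = - (\<Sum>i=1..d. int (q ^ i))"
  by (induction d) (simp_all add: ell_Suc lam_nz subdegree_lam)

lemma Ob_lam: "lam i \<in> Ob (int (q ^ i))"
  unfolding lam_def using q_pos Ob_theta_power[of 1 "int (q ^ i)"] by (intro Ob_diff Ob_theta_power) auto

lemma sum_q_powers: "(int q - 1) * (\<Sum>i=1..d. int (q ^ i)) = int q * int (q ^ d) - int q"
proof (induction d)
  case (Suc d)
  have "(\<Sum>i=1..Suc d. int (q ^ i)) = (\<Sum>i=1..d. int (q ^ i)) + int q * int (q ^ d)" by simp
  then show ?case using Suc by (simp only: distrib_left) (simp add: algebra_simps)
qed simp

lemma sum_q_powers_le: "(\<Sum>i=1..d. int (q ^ i)) \<le> int q * int (q ^ d)"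
proof -
  have "1 * (\<Sum>i=1..d. int (q ^ i)) \<le> (int q - 1) * (\<Sum>i=1..d. int (q ^ i))"
    using q_pos by (intro mult_right_mono sum_nonneg) auto
  then show ?thesis unfolding sum_q_powers by simp
qed

lemma sum_q_powers_ge: "int d \<le> (\<Sum>i=1..d. int (q ^ i))"
proof -
  have "(\<Sum>i=1..d. 1) \<le> (\<Sum>i=1..d. int (q ^ i))" using q_pos by (intro sum_mono) (simp add: one_le_power)
  then show ?thesis by simp
qed

text \<open>The quotient is the product of the \<open>lam i\<close> with d < i \<le> N. Bounds of
  this size, O(q^N), are what the transfer to values can afford.\<close>

lemma Ob_ell_quotient: "d \<le> N \<Longrightarrow> ell N / ell d \<in> Ob (int q * int (q ^ N))"
proof -
  assume d: "d \<le> N"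
  have "ell N = ell d * (\<Prod>i\<in>{d+1..N}. lam i)"
    unfolding ell_def using d prod.ub_add_nat[of 1 d lam "N - d"] by simp
  then have "ell N / ell d = (\<Prod>i\<in>{d+1..N}. lam i)" by simp
  also have "\<dots> \<in> Ob (\<Sum>i\<in>{d+1..N}. int (q ^ i))" by (intro Ob_prod Ob_lam)
  finally have "ell N / ell d \<in> Ob (\<Sum>i\<in>{d+1..N}. int (q ^ i))" .
  moreover have "(\<Sum>i\<in>{d+1..N}. int (q ^ i)) \<le> (\<Sum>i=1..N. int (q ^ i))"
    by (intro sum_mono2) auto
  ultimately show ?thesis using sum_q_powers_le[of N] Ob_mono order_trans by blast
qed

lemma val_ell_inverse: "val_ge (int N) (inverse (ell N))"
  using val_ge_inverse[OF subdegree_ell[of N]] sum_q_powers_ge[of N] by (auto elim: val_ge_mono)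

subsection \<open>Depth one and depth two values\<close>

definition zpart :: "nat \<Rightarrow> nat \<Rightarrow> nat \<Rightarrow> 'a fls" where
  "zpart n k N = (\<Sum>d<N. theta ^ (k * q ^ d) / ell d ^ n)"

text \<open>Defined through N = 1, because evaluation needs exponents M \<ge> 2 and N = 0 would mean
  x = theta. By \<open>ev_psi\<close> every N \<ge> 1 gives the same number.\<close>

definition zval :: "nat \<Rightarrow> nat \<Rightarrow> 'a fls" where
  "zval n k = evN 1 (psi n k) / ell 1 ^ n + zpart n k 1"

text \<open>The difference equation at x = theta^(q^N), divided by the power of \<open>ell\<close>,
  says that psi / ell_N^n plus the partial sum does not depend on N.\<close>

lemma ev_psi:
  assumes k: "k * (q - 1) < n * q" and "N \<ge> 1"
  shows "evN N (psi n k) = ell N ^ n * (zval n k - zpart n k N)"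
proof -
  have "zval n k = evN N (psi n k) / ell N ^ n + zpart n k N"
    using assms(2)
  proof (induction N rule: nat_induct_at_least)
    case (Suc N)
    note C = psi(1)[OF k] and M = q_power_ge[OF Suc(1)]
    have xk: "evN N (xx ^ k) = theta ^ (k * q ^ N)"
      unfolding xx_def by (simp only: ev_power[OF CC_X M] ev_X[OF M] power_mult[symmetric] mult.commute)
    have "evN (Suc N) (psi n k) = evN N (vv ^ n * (psi n k - xx ^ k))"
      using evN_tau[OF C Suc(1)] by (simp add: psi(2)[OF k])
    also have "\<dots> = lam (Suc N) ^ n * (evN N (psi n k) - theta ^ (k * q ^ N))"
      using ev_mult[OF CC_power[OF CC_vv, of n] CC_diff[OF C CC_X_power[of k]] M]
        ev_power[OF CC_vv M, of n] ev_diff[OF C CC_X_power[of k] M] evN_vv[OF Suc(1)]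
        xk
      by (simp add: xx_def)
    finally have "evN (Suc N) (psi n k) / ell (Suc N) ^ n = (evN N (psi n k) - theta ^ (k * q ^ N)) / ell N ^ n"
      using lam_nz[of "Suc N"] by (simp add: ell_Suc power_mult_distrib)
    then show ?case using Suc(2) by (simp add: zpart_def diff_divide_distrib)
  qed (simp add: zval_def)
  then have "zval n k - zpart n k N = evN N (psi n k) / ell N ^ n" by simp
  then show ?thesis by simp
qed

text \<open>Here r is q, x is q^N and S is the sum of q^i for 1 \<le> i \<le> N. Multiplied by r -
  1, the exponent becomes x (n r - (r - 1) k) - n r, which grows with x because (r - 1) k < n
  r.\<close>

lemma exponent_estimate:
  fixes a k n r S m x :: int
  assumes a: "0 < r - 1" and k: "(r - 1) * k + 1 \<le> n * r" and S: "(r - 1) * S = r * x - r"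
    and x: "(r - 1) * \<bar>m\<bar> + n * r \<le> x" and "0 \<le> x"
  shows "m \<le> ((x - 1) * (- k) - k) + n * S"
proof -
  have "x * 1 \<le> x * (n * r - (r - 1) * k)" using k assms(5) by (intro mult_left_mono) auto
  moreover have "x * (n * r - (r - 1) * k) - n * r = n * ((r - 1) * S) - (r - 1) * (k * x)"
    unfolding S by (simp add: algebra_simps)
  moreover have "n * ((r - 1) * S) - (r - 1) * (k * x) = (r - 1) * (((x - 1) * (- k) - k) + n * S)"
    by (simp add: algebra_simps)
  moreover have "(r - 1) * m \<le> (r - 1) * \<bar>m\<bar>" using a by (intro mult_left_mono) auto
  ultimately have "(r - 1) * m \<le> (r - 1) * (((x - 1) * (- k) - k) + n * S)" using x by linarith
  then show ?thesis using a by (simp only: mult_le_cancel_left_pos)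
qed

lemma zpart_conv:
  assumes k: "k * (q - 1) < n * q"
  shows "fconv (zpart n k) (zval n k)"
  unfolding fconv_def
proof
  fix m
  define N0 where "N0 = Suc (nat ((int q - 1) * \<bar>m\<bar>) + n * q)"
  have "val_ge m (zpart n k N - zval n k)" if N: "N \<ge> N0" for N
  proof -
    have N1: "N \<ge> 1" using N by (simp add: N0_def)
    note M = q_power_ge[OF N1]
    define S where "S = (\<Sum>i=1..N. int (q ^ i))"
    have "val_ge ((int (q ^ N) - 1) * (- int k) - int k) (evN N (psi n k))"
      using psi(1)[OF k] by (intro ev_bound M CC_val)
    moreover have "val_ge (int n * S) (inverse (ell N) ^ n)"
      using val_ge_power[OF val_ge_inverse[OF subdegree_ell[of N]], of n] by (simp add: S_def)
    ultimately have v: "val_ge (((int (q ^ N) - 1) * (- int k) - int k) + int n * S) (evN N (psi n k) * inverse (ell N) ^ n)"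
      by (rule val_ge_mult)
    have "m \<le> ((int (q ^ N) - 1) * (- int k) - int k) + int n * S"
    proof (rule exponent_estimate)
      show "0 < int q - 1" using q_pos by simp
      have "int (k * (q - 1) + 1) \<le> int (n * q)" using k by (simp only: of_nat_le_iff)
      then show "(int q - 1) * int k + 1 \<le> int n * int q" using q_pos by (simp add: of_nat_diff mult.commute)
      show "(int q - 1) * S = int q * int (q ^ N) - int q" unfolding S_def by (rule sum_q_powers)
      show "0 \<le> int (q ^ N)" by simp
      have "N < q ^ N" by (rule less_le_trans[OF less_exp power_mono]) (use q_pos in auto)
      then have "nat ((int q - 1) * \<bar>m\<bar>) + n * q \<le> q ^ N" using N unfolding N0_def by simp
      then have "int (nat ((int q - 1) * \<bar>m\<bar>) + n * q) \<le> int (q ^ N)" by (simp only: of_nat_le_iff)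
      moreover have "(int q - 1) * \<bar>m\<bar> \<ge> 0" using q_pos by (intro mult_nonneg_nonneg) auto
      ultimately show "(int q - 1) * \<bar>m\<bar> + int n * int q \<le> int (q ^ N)"
        by (simp only: of_nat_add nat_0_le of_nat_mult)
    qed
    then have "val_ge m (- (evN N (psi n k) * inverse (ell N) ^ n))"
      using v by (intro val_ge_uminus) (rule val_ge_mono)
    moreover have "zpart n k N - zval n k = - (evN N (psi n k) * inverse (ell N) ^ n)"
    proof -
      have g: "l * d * inverse l = d" if "l \<noteq> 0" for l d :: "'a fls"
        using that by (simp add: mult.commute[of l] mult.assoc)
      show ?thesis unfolding ev_psi[OF k N1] power_inverse by (subst g) auto
    qed
    ultimately show ?thesis by simp
  qed
  then show "\<exists>N. \<forall>i\<ge>N. val_ge m (zpart n k i - zval n k)" by blast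
qed

definition upart :: "nat \<Rightarrow> nat \<Rightarrow> 'a fls" where "upart Q N = (\<Sum>e<N. 1 / ell e ^ Q)"

definition xpart :: "nat \<Rightarrow> nat \<Rightarrow> 'a fls" where "xpart Q N = (\<Sum>d<N. 1 / ell d * upart Q d)"

text \<open>The terms with d \<le> e in the product of the sums of 1/ell_e^Q and 1/ell_d,
  complementary to the terms with d > e in \<open>xpart\<close>.\<close>

definition wpart :: "nat \<Rightarrow> nat \<Rightarrow> 'a fls" where "wpart Q N = (\<Sum>e<N. 1 / ell e ^ Q * zpart 1 0 (Suc e))"

definition xval :: "nat \<Rightarrow> 'a fls" where
  "xval Q = evN 1 (chi Q) / ell 1 ^ (1 + Q) + upart Q 1 * zval 1 0 - wpart Q 1"

text \<open>For e < N the sum of 1/ell_d over d > e is \<open>zval 1 0\<close> minus a partial sum.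
  The bracket is therefore the tail of the double series over d > e \<ge> N.\<close>

lemma ev_chi:
  assumes "N \<ge> 1"
  shows "evN N (chi Q) = ell N ^ (1 + Q) * (xval Q - upart Q N * zval 1 0 + wpart Q N)"
proof -
  have k: "0 * (q - 1) < 1 * q" using q_pos by simp
  have "xval Q = evN N (chi Q) / ell N ^ (1 + Q) + upart Q N * zval 1 0 - wpart Q N"
    using assms
  proof (induction N rule: nat_induct_at_least)
    case (Suc N)
    note C = chi(1)[of Q] and C1 = psi_1(1) and M = q_power_ge[OF Suc(1)]
    have C2: "CC 0 (chi Q - psi 1 0)" by (rule CC_diff[OF C C1])
    have "evN (Suc N) (chi Q) = evN N (vv ^ (1 + Q) * ((chi Q - psi 1 0) + 1))"
      using evN_tau[OF C Suc(1)] by (simp add: chi(2))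
    also have "\<dots> = lam (Suc N) ^ (1 + Q) * (evN N (chi Q) - evN N (psi 1 0) + 1)"
      using ev_mult[OF CC_power[OF CC_vv, of "1 + Q"] CC_add[OF C2 CC_1[of 0]] M]
        ev_power[OF CC_vv M, of "1 + Q"] ev_add[OF C2 CC_1[of 0] M] ev_diff[OF C C1 M] evN_vv[OF Suc(1)]
      by (simp add: ev_1)
    also have "evN N (psi 1 0) = ell N * (zval 1 0 - zpart 1 0 N)"
      using ev_psi[OF k Suc(1)] by simp
    finally have "evN (Suc N) (chi Q) / ell (Suc N) ^ (1 + Q)
        = (evN N (chi Q) - ell N * (zval 1 0 - zpart 1 0 N) + 1) / ell N ^ (1 + Q)"
      using lam_nz[of "Suc N"] unfolding ell_Suc power_mult_distrib by simp
    also have "\<dots> = evN N (chi Q) / ell N ^ (1 + Q) - 1 / ell N ^ Q * (zval 1 0 - zpart 1 0 (Suc N))"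
    proof -
      have g: "(e - l * x + 1) / (l * b) = e / (l * b) - 1 / b * (x - 1 / l)" if "l \<noteq> 0" "b \<noteq> 0" for e l b x :: "'a fls"
        using that by (simp add: field_simps)
      have "zval 1 0 - zpart 1 0 (Suc N) = zval 1 0 - zpart 1 0 N - 1 / ell N" by (simp add: zpart_def)
      then show ?thesis using g[of "ell N" "ell N ^ Q"] by simp
    qed
    finally have e: "evN (Suc N) (chi Q) / ell (Suc N) ^ (1 + Q)
      = evN N (chi Q) / ell N ^ (1 + Q) - 1 / ell N ^ Q * (zval 1 0 - zpart 1 0 (Suc N))" .
    have "upart Q (Suc N) = upart Q N + 1 / ell N ^ Q"
      "wpart Q (Suc N) = wpart Q N + 1 / ell N ^ Q * zpart 1 0 (Suc N)"
      by (simp_all add: upart_def wpart_def)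
    moreover have alg: "a + u * z - w = (a - i * (z - p)) + (u + i) * z - (w + i * p)" for a u z w i p :: "'a fls"
      by (simp add: algebra_simps)
    ultimately show ?case unfolding e Suc(2)
      using alg[of "evN N (chi Q) / ell N ^ (1 + Q)" "upart Q N" "zval 1 0" "wpart Q N" "1 / ell N ^ Q"
        "zpart 1 0 (Suc N)"] by (simp only:)
  qed (simp add: xval_def)
  then have "xval Q - upart Q N * zval 1 0 + wpart Q N = evN N (chi Q) / ell N ^ (1 + Q)" by simp
  then show ?thesis by simp
qed

lemma xpart_eq: "xpart Q N = upart Q N * zpart 1 0 N - wpart Q N"
proof (induction N)
  case (Suc N)
  have "upart Q (Suc N) = upart Q N + 1 / ell N ^ Q" "zpart 1 0 (Suc N) = zpart 1 0 N + 1 / ell N"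
    "wpart Q (Suc N) = wpart Q N + 1 / ell N ^ Q * zpart 1 0 (Suc N)"
    "xpart Q (Suc N) = xpart Q N + 1 / ell N * upart Q N"
    by (simp_all add: upart_def wpart_def zpart_def xpart_def)
  moreover have "(u * p - w) + l * u = (u + i) * (p + l) - (w + i * (p + l))" for u p w l i :: "'a fls"
    by (simp add: algebra_simps)
  ultimately show ?case unfolding Suc by (simp only:)
qed (simp add: xpart_def upart_def wpart_def)

lemma xpart_conv: "fconv (xpart Q) (xval Q)"
  unfolding fconv_def
proof
  fix m
  have "val_ge m (xpart Q N - xval Q)" if N: "N \<ge> Suc (nat \<bar>m\<bar>)" for N
  proof -
    have N1: "N \<ge> 1" and mN: "m \<le> int N" using N by auto
    note M = q_power_ge[OF N1]
    have k: "0 * (q - 1) < 1 * q" using q_pos by simp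
    have e0: "val_ge 0 (evN N f)" if "CC 0 f" for f
      using ev_bound[OF that CC_val[OF that] M] by simp
    have i0: "val_ge 0 (inverse (ell d))" for d using val_ell_inverse[of d] by (rule val_ge_mono) simp
    have ip: "val_ge 0 (inverse (ell d) ^ j)" for d j using val_ge_power[OF i0, of j d] by simp
    have "val_ge 0 (upart Q N)"
      unfolding upart_def using ip[of _ Q] by (intro val_ge_sum) (simp add: power_inverse divide_inverse)
    then have "val_ge (0 + (0 + int N)) (upart Q N * (evN N (psi 1 0) * inverse (ell N)))"
      by (intro val_ge_mult e0 psi_1(1) val_ell_inverse)
    moreover have "val_ge (0 + (0 + int N)) (evN N (chi Q) * (inverse (ell N) ^ Q * inverse (ell N)))"
      by (intro val_ge_mult e0 chi(1) val_ell_inverse ip)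
    ultimately have "val_ge m (- (evN N (chi Q) * (inverse (ell N) ^ Q * inverse (ell N)) + upart Q N * (evN N (psi 1 0) * inverse (ell N))))"
      using mN by (intro val_ge_uminus val_ge_add) (auto elim: val_ge_mono)
    moreover have "xpart Q N - xval Q = - (evN N (chi Q) * (inverse (ell N) ^ Q * inverse (ell N)) + upart Q N * (evN N (psi 1 0) * inverse (ell N)))"
    proof -
      have g: "u * p - w - x = - ((l * b) * (x - u * z + w) * (inverse b * inverse l) + u * ((l * (z - p)) * inverse l))"
        if "l \<noteq> 0" "b \<noteq> 0" for u p w x l b z :: "'a fls"
      proof -
        have e1: "(l * b) * c * (inverse b * inverse l) = c" for c
        proof -
          have "(l * b) * c * (inverse b * inverse l) = (l * inverse l) * (b * inverse b) * c" by (simp only: mult_ac)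
          then show ?thesis using that by simp
        qed
        have e2: "(l * c) * inverse l = c" for c
        proof -
          have "(l * c) * inverse l = (l * inverse l) * c" by (simp only: mult_ac)
          then show ?thesis using that by simp
        qed
        show ?thesis unfolding e1 e2 by (simp add: algebra_simps)
      qed
      show ?thesis
        unfolding ev_chi[OF N1] ev_psi[OF k N1] xpart_eq power_inverse
        using g[of "ell N" "ell N ^ Q"] by simp
    qed
    ultimately show ?thesis by simp
  qed
  then show "\<exists>N. \<forall>n\<ge>N. val_ge m (xpart Q n - xval Q)" by blast
qed

end

subsection \<open>Elimination\<close>

inductive_set modspan :: "('i \<Rightarrow> 'r::comm_ring_1) set \<Rightarrow> ('i \<Rightarrow> 'r) set" for S where
  zero: "(\<lambda>_. 0) \<in> modspan S"
| step: "s \<in> S \<Longrightarrow> t \<in> modspan S \<Longrightarrow> (\<lambda>i. c * s i + t i) \<in> modspan S"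

lemma modspan_add: "x \<in> modspan S \<Longrightarrow> y \<in> modspan S \<Longrightarrow> (\<lambda>i. x i + y i) \<in> modspan S"
proof (induction rule: modspan.induct)
  case (step s t c)
  then show ?case using modspan.step[of s S "\<lambda>i. t i + y i" c] by (simp add: add.assoc)
qed simp

lemma modspan_scale: "x \<in> modspan S \<Longrightarrow> (\<lambda>i. a * x i) \<in> modspan S"
proof (induction rule: modspan.induct)
  case (step s t c)
  then show ?case using modspan.step[of s S "\<lambda>i. a * t i" "a * c"] by (simp add: algebra_simps)
qed (simp add: modspan.zero)

lemma modspan_sum: "(\<And>k. k \<in> A \<Longrightarrow> f k \<in> modspan S) \<Longrightarrow> (\<lambda>i. \<Sum>k\<in>A. f k i) \<in> modspan S"
  by (induction A rule: infinite_finite_induct) (auto intro: modspan.zero modspan_add)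

text \<open>The hypothesis says that the vectors in \<open>S\<close> have full rank. Gauss
  elimination without division then produces a common nonzero multiple of all unit vectors.\<close>

lemma elimination:
  fixes S :: "('i \<Rightarrow> 'r::idom) set"
  assumes "finite I" and "\<And>r. (\<And>s. s \<in> S \<Longrightarrow> (\<Sum>i\<in>I. r i * s i) = 0) \<Longrightarrow> \<forall>i\<in>I. r i = 0"
  shows "\<exists>d. d \<noteq> 0 \<and> (\<forall>i\<in>I. \<exists>p\<in>modspan S. p i = d \<and> (\<forall>j\<in>I - {i}. p j = 0))"
  using assms
proof (induction I arbitrary: S rule: finite_induct)
  case empty
  show ?case by (intro exI[of _ 1]) auto
next
  case (insert l I)
  have "\<exists>s\<in>S. s l \<noteq> 0"
  proof (rule ccontr)
    assume "\<not> ?thesis"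
    then have "(\<Sum>i\<in>insert l I. (if i = l then 1 else 0) * s i) = 0" if "s \<in> S" for s
      using that insert.hyps by (simp add: sum.neutral)
    from insert.prems[OF this] show False by auto
  qed
  then obtain s0 where s0: "s0 \<in> S" "s0 l \<noteq> 0" by blast
  define S' where "S' = {\<lambda>j. s0 l * s j - s l * s0 j | s. s \<in> S}"
  have S'S: "p \<in> modspan S \<and> p l = 0" if "p \<in> modspan S'" for p
    using that
  proof induction
    case (step s' t c)
    then obtain s where s: "s \<in> S" "s' = (\<lambda>j. s0 l * s j - s l * s0 j)" by (auto simp: S'_def)
    have "(\<lambda>i. (c * s0 l) * s i + ((- (c * s l)) * s0 i + t i)) \<in> modspan S"
      using step s0(1) s(1) by (intro modspan.step) auto
    then show ?case using step s by (simp add: algebra_simps)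
  qed (simp add: modspan.zero)
  have "\<forall>i\<in>I. r i = 0" if r: "\<And>s. s \<in> S' \<Longrightarrow> (\<Sum>i\<in>I. r i * s i) = 0" for r
  proof -
    \<comment> \<open>Extends an annihilator of the reduced vectors; the entry at \<open>l\<close>
      is chosen so that \<open>s0\<close> is annihilated too.\<close>
    define r' where "r' = (\<lambda>i. if i = l then - (\<Sum>j\<in>I. r j * s0 j) else s0 l * r i)"
    have "(\<Sum>i\<in>insert l I. r' i * s i) = 0" if s: "s \<in> S" for s
    proof -
      have "(\<Sum>i\<in>I. r' i * s i) = (\<Sum>i\<in>I. s0 l * r i * s i)"
        using insert.hyps by (intro sum.cong) (auto simp: r'_def)
      then have "(\<Sum>i\<in>insert l I. r' i * s i) = (\<Sum>i\<in>I. r i * (s0 l * s i - s l * s0 i))"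
        using insert.hyps
        by (simp add: r'_def right_diff_distrib sum_subtractf sum_distrib_left sum_distrib_right mult_ac)
      also have "\<dots> = 0" by (rule r) (use s in \<open>auto simp: S'_def\<close>)
      finally show ?thesis .
    qed
    from insert.prems[OF this] show ?thesis using s0(2) insert.hyps by (auto simp: r'_def split: if_splits)
  qed
  from insert.IH[OF this] obtain d where d: "d \<noteq> 0"
    "\<forall>i\<in>I. \<exists>p\<in>modspan S'. p i = d \<and> (\<forall>j\<in>I - {i}. p j = 0)" by blast
  then obtain P where P: "\<And>i. i \<in> I \<Longrightarrow> P i \<in> modspan S'" "\<And>i. i \<in> I \<Longrightarrow> P i i = d"
    "\<And>i j. i \<in> I \<Longrightarrow> j \<in> I \<Longrightarrow> j \<noteq> i \<Longrightarrow> P i j = 0" by (metis Diff_iff singletonD)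
  define D where "D = d * s0 l"
  have "\<exists>p\<in>modspan S. p i = D \<and> (\<forall>j\<in>insert l I - {i}. p j = 0)" if i: "i \<in> insert l I" for i
  proof (cases "i = l")
    case False
    then have iI: "i \<in> I" using i by simp
    have "(\<lambda>j. s0 l * P i j) \<in> modspan S" using S'S[OF P(1)[OF iI]] by (intro modspan_scale) simp
    then show ?thesis
      using P(2)[OF iI] P(3)[OF iI] S'S[OF P(1)[OF iI]] by (intro bexI[of _ "\<lambda>j. s0 l * P i j"]) (auto simp: D_def mult.commute)
  next
    case True
    define p where "p = (\<lambda>j. d * s0 j + (\<Sum>i\<in>I. (- s0 i) * P i j))"
    have "p \<in> modspan S" unfolding p_def
      using S'S[OF P(1)] by (intro modspan.step s0(1) modspan_sum modspan_scale) auto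
    moreover have "p l = D" using S'S[OF P(1)] by (simp add: p_def D_def sum.neutral)
    moreover have "p j = 0" if "j \<in> I" for j
    proof -
      have "(\<Sum>i\<in>I. (- s0 i) * P i j) = (\<Sum>i\<in>{j}. (- s0 i) * P i j)"
        using that insert.hyps P(3) by (intro sum.mono_neutral_right) auto
      then show ?thesis using P(2)[OF that] by (simp add: p_def)
    qed
    ultimately show ?thesis using True insert.hyps by (intro bexI[of _ p]) auto
  qed
  moreover have "D \<noteq> 0" using d(1) s0(2) by (simp add: D_def)
  ultimately show ?case by blast
qed

subsection \<open>Siegel's lemma over a polynomial ring\<close>

lemma card_polys_le:
  "finite {p :: 'a::{field,finite} poly. degree p \<le> D}"
  "card {p :: 'a::{field,finite} poly. degree p \<le> D} = card (UNIV :: 'a set) ^ Suc D"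
proof -
  let ?P = "{p :: 'a poly. degree p \<le> D}" and ?F = "PiE {..D} (\<lambda>_. UNIV :: 'a set)"
  have b: "bij_betw (\<lambda>p. restrict (coeff p) {..D}) ?P ?F"
  proof (rule bij_betwI')
    fix p r :: "'a poly" assume pr: "p \<in> ?P" "r \<in> ?P"
    show "restrict (coeff p) {..D} = restrict (coeff r) {..D} \<longleftrightarrow> p = r"
    proof
      assume e: "restrict (coeff p) {..D} = restrict (coeff r) {..D}"
      show "p = r"
      proof (rule poly_eqI)
        fix n show "coeff p n = coeff r n"
          using fun_cong[OF e, of n] pr by (cases "n \<le> D") (auto simp: coeff_eq_0)
      qed
    qed simp
  next
    fix f assume f: "f \<in> ?F"
    define p where "p = (\<Sum>i\<le>D. monom (f i) i)"
    have c: "coeff p n = (if n \<le> D then f n else 0)" for n by (simp add: p_def coeff_sum)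
    have "degree p \<le> D" by (rule degree_le) (simp add: c)
    moreover have "f = restrict (coeff p) {..D}"
      using f by (auto simp: fun_eq_iff c PiE_def extensional_def)
    ultimately show "\<exists>p\<in>?P. f = restrict (coeff p) {..D}" by blast
  qed auto
  have fF: "finite ?F" by (intro finite_PiE) auto
  show "finite ?P" using bij_betw_finite[OF b] fF by simp
  show "card ?P = card (UNIV :: 'a set) ^ Suc D"
    using bij_betw_same_card[OF b] by (simp add: card_PiE)
qed

text \<open>Pigeonhole principle: for degrees up to D = card J * B there are more vectors than
  possible images, since (D + B + 1) card J < (D + 1) (card J + 1). The difference of two vectors
  with equal image is the solution.\<close>

lemma siegel:
  fixes A :: "'i \<Rightarrow> 'j \<Rightarrow> 'a::{field,finite} poly"
  assumes fin: "finite I" "finite J" and card: "card J < card I"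
    and A: "\<And>i j. i \<in> I \<Longrightarrow> j \<in> J \<Longrightarrow> degree (A i j) \<le> B"
  shows "\<exists>u. (\<exists>i\<in>I. u i \<noteq> 0) \<and> (\<forall>i\<in>I. degree (u i) \<le> card J * B) \<and> (\<forall>j\<in>J. (\<Sum>i\<in>I. u i * A i j) = 0)"
proof -
  define D where "D = card J * B"
  define P where "P = (\<lambda>D. {p :: 'a poly. degree p \<le> D})"
  define \<Phi> where "\<Phi> = (\<lambda>u. restrict (\<lambda>j. \<Sum>i\<in>I. u i * A i j) J)"
  define X where "X = PiE I (\<lambda>_. P D)"
  define Y where "Y = PiE J (\<lambda>_. P (D + B))"
  let ?q = "card (UNIV :: 'a set)"
  have q: "?q > 1"
    using card_mono[of "UNIV :: 'a set" "{0, 1}"] by simp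
  have "\<Phi> u \<in> Y" if u: "u \<in> X" for u
  proof -
    have "degree (\<Sum>i\<in>I. u i * A i j) \<le> D + B" if j: "j \<in> J" for j
    proof (rule degree_sum_le[OF fin(1)])
      fix i assume i: "i \<in> I"
      have "degree (u i) \<le> D" using u i by (auto simp: X_def P_def PiE_def)
      then show "degree (u i * A i j) \<le> D + B"
        using degree_mult_le[of "u i" "A i j"] A[OF i j] by linarith
    qed
    then show ?thesis by (auto simp: \<Phi>_def Y_def P_def)
  qed
  then have "\<Phi> ` X \<subseteq> Y" by blast
  moreover have "finite Y" unfolding Y_def P_def using fin card_polys_le(1) by (intro finite_PiE) auto
  ultimately have "card (\<Phi> ` X) \<le> card Y" by (intro card_mono)
  also have "card Y = ?q ^ (Suc (D + B) * card J)"
    by (simp add: Y_def P_def card_PiE fin card_polys_le(2) power_mult[symmetric] del: power_Suc)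
  also have "\<dots> < ?q ^ (Suc D * card I)"
  proof (rule power_strict_increasing[OF _ q])
    have "Suc (D + B) * card J < Suc D * Suc (card J)" by (simp add: D_def algebra_simps)
    also have "\<dots> \<le> Suc D * card I" using card by (intro mult_le_mono2) simp
    finally show "Suc (D + B) * card J < Suc D * card I" .
  qed
  also have "\<dots> = card X"
    by (simp add: X_def P_def card_PiE fin card_polys_le(2) power_mult[symmetric] del: power_Suc)
  finally have "\<not> inj_on \<Phi> X" by (rule pigeonhole)
  then obtain u1 u2 where u: "u1 \<in> X" "u2 \<in> X" "\<Phi> u1 = \<Phi> u2" "u1 \<noteq> u2" by (auto simp: inj_on_def)
  define u where "u = (\<lambda>i. u1 i - u2 i)"
  have "\<exists>i\<in>I. u i \<noteq> 0"
  proof (rule ccontr)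
    assume "\<not> ?thesis"
    then have "u1 = u2" using u(1,2) by (intro PiE_ext[of u1 I "\<lambda>_. P D" u2]) (auto simp: X_def u_def)
    then show False using u(4) by simp
  qed
  moreover have "degree (u i) \<le> card J * B" if "i \<in> I" for i
    using u(1,2) that unfolding u_def D_def[symmetric] by (intro degree_diff_le) (auto simp: X_def P_def PiE_def)
  moreover have "(\<Sum>i\<in>I. u i * A i j) = 0" if "j \<in> J" for j
    using fun_cong[OF u(3), of j] that by (simp add: \<Phi>_def u_def left_diff_distrib sum_subtractf)
  ultimately show ?thesis by blast
qed

subsection \<open>Simultaneous Pad\'e approximation\<close>

lemma emb_subdegree:
  assumes "p \<noteq> 0" shows "fls_subdegree (emb p) = - int (degree p)"
  by (rule fls_subdegree_eqI) (use assms in \<open>auto simp: emb_nth coeff_eq_0\<close>)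

lemma emb_val: "int (degree p) \<le> n \<Longrightarrow> val_ge (- n) (emb p)"
  by (auto simp: val_ge_def emb_nth coeff_eq_0)

lemma emb_monom: "emb (monom c k) = fls_const (poly_theta c) * fls_X_inv ^ k"
  by (induction k) (simp_all add: monom_0 monom_Suc emb_pCons mult_ac emb_eq_0_iff)

lemma emb_hom: "emb (a + b) = emb a + emb b" "emb (a * b) = emb a * emb b" "emb (- a) = - emb a"
    "emb 0 = 0" "emb 1 = 1" "emb (sum f A) = (\<Sum>i\<in>A. emb (f i))"
  by (auto simp: is_homD[OF is_hom_emb])

lemma evp_hom: "evp M (a + b) = evp M a + evp M b" "evp M (a * b) = evp M a * evp M b"
    "evp M 0 = 0" "evp M 1 = 1" "evp M (sum f A) = (\<Sum>i\<in>A. evp M (f i))"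
  by (auto simp: is_homD[OF is_hom_evp])

lemma polynomial_part:
  assumes "CC c f" shows "\<exists>P. val_ge 1 (f - emb P)"
proof -
  have "\<forall>j. \<exists>p. f $$ j = poly_theta p" using assms by (auto simp: CC_def Ob_def)
  then obtain p where p: "\<And>j. f $$ j = poly_theta (p j)" by metis
  define P where "P = (\<Sum>k\<le>nat c. monom (p (- int k)) k)"
  have P: "coeff P k = (if k \<le> nat c then p (- int k) else 0)" for k by (simp add: P_def coeff_sum)
  have "(f - emb P) $$ j = 0" if "j < 1" for j
  proof (cases "- j \<le> c")
    case True
    then show ?thesis using that by (simp add: emb_nth P p)
  next
    case False
    then have "f $$ j = 0" using CC_val[OF assms] by (simp add: val_ge_def)
    moreover from this have "p j = 0" using p[of j] by simp
    ultimately show ?thesis using that by (simp add: emb_nth P)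
  qed
  then show ?thesis unfolding val_ge_def by blast
qed

text \<open>The unknowns are the coefficients of Q at x^s, ..., x^(s+n-1); the equations make the
  coefficients of Q F_i at x^(-j) vanish for 0 < j < m. Starting at x^s forces deg Q \<ge>
  s.\<close>

lemma pade_exists:
  fixes F :: "'i \<Rightarrow> 'a::{field,finite} fls fls"
  assumes fin: "finite I" and F: "\<And>i. i \<in> I \<Longrightarrow> CC c (F i)"
  shows "\<exists>Q P. Q \<noteq> 0 \<and> degree Q \<ge> s \<and> (\<forall>i\<in>I. val_ge (int m) (emb Q * F i - emb (P i)))"
proof -
  define n where "n = Suc (card I * m)"
  define J where "J = I \<times> {0<..<m}"
  have "\<forall>i\<in>I. \<forall>j. \<exists>p. F i $$ j = poly_theta p \<and> (p = 0 \<or> int (degree p) \<le> j + c)"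
    using F by (auto simp: CC_def Ob_def)
  then obtain p where p: "\<And>i j. i \<in> I \<Longrightarrow> F i $$ j = poly_theta (p i j)"
    "\<And>i j. i \<in> I \<Longrightarrow> p i j = 0 \<or> int (degree (p i j)) \<le> j + c" by metis
  define A where "A = (\<lambda>a (i, j). p i (int j + int (s + a)))"
  define B where "B = nat (int m + int (s + n) + \<bar>c\<bar>)"
  have "card J \<le> card I * m" by (simp add: J_def card_cartesian_product)
  then have cJ: "card J < card {..<n}" by (simp add: n_def)
  have degA: "degree (A a x) \<le> B" if ax: "a \<in> {..<n}" "x \<in> J" for a x
  proof -
    obtain i j where x: "x = (i, j)" "i \<in> I" "j < m" using ax(2) by (auto simp: J_def)
    show ?thesis using p(2)[OF x(2), of "int j + int (s + a)"] x(3) ax(1) by (auto simp: A_def x(1) B_def)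
  qed
  obtain u where u: "\<exists>a\<in>{..<n}. u a \<noteq> 0" "\<forall>x\<in>J. (\<Sum>a\<in>{..<n}. u a * A a x) = 0"
  proof -
    have "finite J" using fin by (simp add: J_def)
    from siegel[of "{..<n}" J A B, OF finite_lessThan this cJ degA] show ?thesis using that by blast
  qed
  define Q where "Q = (\<Sum>a<n. monom (u a) (s + a))"
  have cQ: "coeff Q k = (if s \<le> k \<and> k < s + n then u (k - s) else 0)" for k
  proof (cases "s \<le> k \<and> k < s + n")
    case True
    then have "(\<Sum>a<n. coeff (monom (u a) (s + a)) k) = (\<Sum>a\<in>{k - s}. coeff (monom (u a) (s + a)) k)"
      by (intro sum.mono_neutral_right) auto
    then show ?thesis using True by (simp add: Q_def coeff_sum del: coeff_monom) simp
  next
    case False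
    then have "\<And>a. a < n \<Longrightarrow> coeff (monom (u a) (s + a)) k = 0" by auto
    then show ?thesis using False by (auto simp: Q_def coeff_sum)
  qed
  obtain a where a: "a < n" "u a \<noteq> 0" using u(1) by auto
  have ca: "coeff Q (s + a) \<noteq> 0" using a by (simp add: cQ)
  then have "Q \<noteq> 0" "degree Q \<ge> s" using le_degree[OF ca] by auto
  moreover have "\<exists>P. val_ge (int m) (emb Q * F i - emb P)" if i: "i \<in> I" for i
  proof -
    obtain cQ where "CC cQ (emb Q)" using CC_emb by blast
    from polynomial_part[OF CC_mult[OF this F[OF i]]]
    obtain P where P: "val_ge 1 (emb Q * F i - emb P)" by blast
    have "(emb Q * F i - emb P) $$ j = 0" if j: "j < int m" for j
    proof (cases "j < 1")
      case False
      then obtain j' where j': "j = int j'" "0 < j'" "j' < m" using j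
        by (metis nat_eq_iff2 not_less of_nat_less_iff zero_less_imp_eq_int int_one_le_iff_zero_less of_nat_0_less_iff)
      have "(emb Q * F i) $$ j = (\<Sum>a<n. poly_theta (u a) * F i $$ (j + int (s + a)))"
      proof -
        have "(emb (monom (u a) (s + a)) * F i) $$ j = poly_theta (u a) * F i $$ (j + int (s + a))" for a
          by (simp only: emb_monom mult.assoc fls_X_inv_power_times_conv_shift(1) fls_mult_const_nth fls_shift_nth)
        then show ?thesis by (simp add: Q_def emb_hom sum_distrib_right fls_nth_sum)
      qed
      also have "\<dots> = poly_theta (\<Sum>a<n. u a * A a (i, j'))"
        by (simp add: poly_theta_hom p(1)[OF i] A_def j')
      also have "\<dots> = 0" using u(2) i j' by (simp add: J_def)
      finally show ?thesis using False by (simp add: emb_nth)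
    qed (use P in \<open>simp add: val_ge_def\<close>)
    then show ?thesis by (auto simp: val_ge_def)
  qed
  then obtain P where "\<forall>i\<in>I. val_ge (int m) (emb Q * F i - emb (P i))" by metis
  ultimately show ?thesis by blast
qed

text \<open>Approximations $P / Q$ with arbitrarily large $\deg Q$ exist, whereas a common annihilator $R$ of all
  numerators $P$ would bound $\deg Q$ through $Q \cdot (R \cdot F) = R \cdot (Q F - P)$.\<close>

lemma pade_no_annihilator:
  fixes F :: "'i \<Rightarrow> 'a::{field,finite} fls fls"
  assumes fin: "finite I" and F: "\<And>i. i \<in> I \<Longrightarrow> CC c (F i)"
    and indep: "\<And>R. (\<Sum>i\<in>I. emb (R i) * F i) = 0 \<Longrightarrow> \<forall>i\<in>I. R i = 0"
    and ann: "\<And>Q P. (\<forall>i\<in>I. val_ge (int m) (emb Q * F i - emb (P i))) \<Longrightarrow> (\<Sum>i\<in>I. R i * P i) = 0"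
  shows "\<forall>i\<in>I. R i = 0"
proof (rule indep, rule ccontr)
  define g where "g = (\<Sum>i\<in>I. emb (R i) * F i)"
  assume "(\<Sum>i\<in>I. emb (R i) * F i) \<noteq> 0"
  then have g: "g \<noteq> 0" by (simp add: g_def)
  define r where "r = (\<Sum>i\<in>I. degree (R i))"
  have r: "degree (R i) \<le> r" if "i \<in> I" for i unfolding r_def using fin that by (intro member_le_sum) auto
  \<comment> \<open>So large that the order of Q g, which is the order of g minus deg Q, stays below
    m - r.\<close>
  define s where "s = nat (\<bar>fls_subdegree g\<bar> + int r + int m + 1)"
  obtain Q P where QP: "Q \<noteq> 0" "degree Q \<ge> s" "\<forall>i\<in>I. val_ge (int m) (emb Q * F i - emb (P i))"
    using pade_exists[of I c F s m, OF fin F] by blast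
  have "(\<Sum>i\<in>I. emb (R i) * emb (P i)) = emb (\<Sum>i\<in>I. R i * P i)" by (simp only: emb_hom)
  then have "(\<Sum>i\<in>I. emb (R i) * emb (P i)) = 0" by (simp only: ann[OF QP(3)] emb_hom)
  then have "emb Q * g = (\<Sum>i\<in>I. emb (R i) * (emb Q * F i - emb (P i)))"
    by (simp add: g_def right_diff_distrib sum_subtractf sum_distrib_left mult_ac)
  also have "val_ge (- int r + int m) \<dots>"
    using QP(3) r by (intro val_ge_sum val_ge_mult emb_val) auto
  finally have "fls_subdegree (emb Q * g) \<ge> - int r + int m"
    using g QP(1) by (auto simp: val_ge_iff emb_eq_0_iff)
  then have "- int (degree Q) + fls_subdegree g \<ge> - int r + int m"
    using g QP(1) by (simp add: emb_subdegree emb_eq_0_iff)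
  then show False using QP(2) unfolding s_def by linarith
qed

lemma evp_integral: "\<exists>r. evp M p = poly_theta r"
proof (induction p)
  case (pCons a p)
  then obtain r where "evp M p = poly_theta r" by blast
  then have "evp M (pCons a p) = poly_theta (a + [:0, 1:] ^ M * r)"
    by (simp add: evp_pCons poly_theta_hom theta_eq)
  then show ?case by blast
qed (auto simp: evp_hom intro: exI[of _ 0])

context carlitz
begin

text \<open>The points theta^(q^N) are distinct, and only finitely many of them can be
  roots.\<close>

lemma evp_nonzero_eventually:
  assumes "d \<noteq> (0 :: 'a poly poly)"
  shows "\<forall>\<^sub>F N in sequentially. evp (q ^ N) d \<noteq> 0"
proof -
  define p where "p = map_poly poly_theta d"
  have "p \<noteq> 0" using assms by (auto simp: p_def poly_eq_iff coeff_map_poly)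
  then have fin: "finite {x. poly p x = 0}" by (rule poly_roots_finite)
  have inj: "inj (\<lambda>N. theta ^ (q ^ N) :: 'a fls)"
    using theta_power_neq by (auto intro!: injI)
  have "finite {N. poly p (theta ^ (q ^ N)) = 0}"
    using finite_vimageI[OF fin inj] by (simp add: vimage_def)
  then show ?thesis
    unfolding evp_def polyhom_def p_def[symmetric]
    by (simp flip: cofinite_eq_sequentially add: eventually_cofinite)
qed

text \<open>For every N Siegel's lemma gives polynomials u_i in theta, not all 0 and of degree
  O(q^N), with sum of u_i F_i(theta^(q^N)) equal to 0. For a vector P of Pade numerators and large
  N, the sum of u_i P_i(theta^(q^N)) is a polynomial in theta of positive valuation, hence 0. These
  P have full rank by \<open>pade_no_annihilator\<close>, so all u_i would vanish for large
  N.\<close>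

theorem values_not_in_small_span:
  fixes F :: "'i \<Rightarrow> 'a fls fls"
  assumes fin: "finite I" and F: "\<And>i. i \<in> I \<Longrightarrow> CC c (F i)"
    and indep: "\<And>R. (\<Sum>i\<in>I. emb (R i) * F i) = 0 \<Longrightarrow> \<forall>i\<in>I. R i = 0"
    and W: "finite W" "card W < card I"
    and ev: "\<And>N i. N \<ge> 1 \<Longrightarrow> i \<in> I \<Longrightarrow> evN N (F i) \<in> spn (Ob (int C * int (q ^ N))) W"
  shows False
proof -
  \<comment> \<open>One more than the growth rate of the degrees of the u_i. With constants absorbed
    in e, the valuation of the products below is then at least q^N - m - e, which tends to
    infinity.\<close>
  define m where "m = Suc (card W * C)"
  define S where "S = {P. \<exists>Q. \<forall>i\<in>I. val_ge (int m) (emb Q * F i - emb (P i))}"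
  define U where "U = (\<lambda>N u. (\<exists>i\<in>I. u i \<noteq> 0) \<and> (\<forall>i\<in>I. degree (u i) \<le> card W * (C * q ^ N)) \<and>
      (\<Sum>i\<in>I. poly_theta (u i) * evN N (F i)) = 0)"
  have "\<exists>u. U N u" if N: "N \<ge> 1" for N
  proof -
    have "\<forall>i\<in>I. \<exists>a. (\<forall>w\<in>W. a w \<in> Ob (int C * int (q ^ N))) \<and> evN N (F i) = (\<Sum>w\<in>W. a w * w)"
      using spn_explicit[OF ev[OF N] W(1) Ob_0 Ob_add] by blast
    then obtain a where a: "\<And>i w. i \<in> I \<Longrightarrow> w \<in> W \<Longrightarrow> a i w \<in> Ob (int C * int (q ^ N))"
      "\<And>i. i \<in> I \<Longrightarrow> evN N (F i) = (\<Sum>w\<in>W. a i w * w)" by metis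
    have "\<exists>p. a i w = poly_theta p \<and> degree p \<le> C * q ^ N" if iw: "i \<in> I" "w \<in> W" for i w
    proof -
      obtain p where p: "a i w = poly_theta p" "p = 0 \<or> int (degree p) \<le> int C * int (q ^ N)"
        using a(1)[OF iw] by (auto simp: Ob_def)
      have "degree p \<le> C * q ^ N"
        using p(2) by (metis degree_0 le0 of_nat_le_iff of_nat_mult)
      then show ?thesis using p(1) by blast
    qed
    then obtain A where A: "\<And>i w. i \<in> I \<Longrightarrow> w \<in> W \<Longrightarrow> a i w = poly_theta (A i w)"
      "\<And>i w. i \<in> I \<Longrightarrow> w \<in> W \<Longrightarrow> degree (A i w) \<le> C * q ^ N" by metis
    obtain u where u: "\<exists>i\<in>I. u i \<noteq> 0" "\<forall>i\<in>I. degree (u i) \<le> card W * (C * q ^ N)"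
      "\<forall>w\<in>W. (\<Sum>i\<in>I. u i * A i w) = 0"
      using siegel[of I W A "C * q ^ N", OF fin W(1,2) A(2)] by blast
    have "(\<Sum>i\<in>I. poly_theta (u i) * evN N (F i)) = (\<Sum>i\<in>I. \<Sum>w\<in>W. poly_theta (u i * A i w) * w)"
    proof (rule sum.cong[OF refl])
      fix i assume i: "i \<in> I"
      have "evN N (F i) = (\<Sum>w\<in>W. poly_theta (A i w) * w)" unfolding a(2)[OF i] using A(1)[OF i] by simp
      then show "poly_theta (u i) * evN N (F i) = (\<Sum>w\<in>W. poly_theta (u i * A i w) * w)"
        by (simp only: sum_distrib_left poly_theta_hom mult.assoc)
    qed
    also have "\<dots> = (\<Sum>w\<in>W. poly_theta (\<Sum>i\<in>I. u i * A i w) * w)"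
      by (subst sum.swap) (simp add: poly_theta_hom sum_distrib_right)
    also have "\<dots> = 0" using u(3) by simp
    finally show ?thesis unfolding U_def using u(1,2) by blast
  qed
  then obtain u where "\<And>N. N \<ge> 1 \<Longrightarrow> U N (u N)" by metis
  then have u: "\<And>N. N \<ge> 1 \<Longrightarrow> \<exists>i\<in>I. u N i \<noteq> 0"
    "\<And>N i. N \<ge> 1 \<Longrightarrow> i \<in> I \<Longrightarrow> degree (u N i) \<le> card W * (C * q ^ N)"
    "\<And>N. N \<ge> 1 \<Longrightarrow> (\<Sum>i\<in>I. poly_theta (u N i) * evN N (F i)) = 0" unfolding U_def by blast+
  have base: "\<forall>\<^sub>F N in sequentially. (\<Sum>i\<in>I. poly_theta (u N i) * evp (q ^ N) (P i)) = 0" if "P \<in> S" for P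
  proof -
    obtain Q where Q: "\<And>i. i \<in> I \<Longrightarrow> val_ge (int m) (emb Q * F i - emb (P i))"
      using \<open>P \<in> S\<close> by (auto simp: S_def)
    obtain cQ where cQ: "CC cQ (emb Q)" using CC_emb by blast
    have "\<forall>i\<in>I. \<exists>b. CC b (emb (P i))" using CC_emb by blast
    then obtain b where b: "\<And>i. i \<in> I \<Longrightarrow> CC (b i) (emb (P i))" by metis
    define e where "e = nat (\<bar>cQ + c\<bar> + (\<Sum>i\<in>I. \<bar>b i\<bar>))"
    have be: "b i \<le> int e" "cQ + c \<le> int e" if "i \<in> I" for i
    proof -
      have "\<bar>b i\<bar> \<le> (\<Sum>i\<in>I. \<bar>b i\<bar>)" using fin that by (intro member_le_sum) auto
      then show "b i \<le> int e" "cQ + c \<le> int e" unfolding e_def by linarith+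
    qed
    have CC1: "CC (int e) (emb Q * F i)" "CC (int e) (emb (P i))" if "i \<in> I" for i
      using CC_mono[OF CC_mult[OF cQ F[OF that]]] CC_mono[OF b[OF that]] be[OF that] by auto
    show ?thesis
      unfolding eventually_sequentially
    proof (intro exI[of _ "Suc (m + e)"] allI impI)
      fix N assume N: "Suc (m + e) \<le> N"
      then have N1: "N \<ge> 1" by simp
      note M = q_power_ge[OF N1]
      define s where "s = (\<Sum>i\<in>I. poly_theta (u N i) * evp (q ^ N) (P i))"
      have evi: "evN N (emb Q * F i - emb (P i)) = evp (q ^ N) Q * evN N (F i) - evp (q ^ N) (P i)" if "i \<in> I" for i
        using ev_diff[OF CC1[OF that] M] ev_mult[OF cQ F[OF that] M] by (simp add: ev_emb[OF M])
      have "(\<Sum>i\<in>I. poly_theta (u N i) * evN N (emb Q * F i - emb (P i)))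
          = evp (q ^ N) Q * (\<Sum>i\<in>I. poly_theta (u N i) * evN N (F i)) - s"
        unfolding s_def sum_distrib_left sum_subtractf[symmetric]
        by (intro sum.cong refl) (simp only: evi right_diff_distrib mult.left_commute)
      then have s: "s = - (\<Sum>i\<in>I. poly_theta (u N i) * evN N (emb Q * F i - emb (P i)))"
        using u(3)[OF N1] by simp
      have "val_ge 1 (\<Sum>i\<in>I. poly_theta (u N i) * evN N (emb Q * F i - emb (P i)))"
      proof (rule val_ge_sum)
        fix i assume i: "i \<in> I"
        have "poly_theta (u N i) \<in> Ob (int (card W * (C * q ^ N)))"
          using u(2)[OF N1 i] by (intro Ob_poly_theta) linarith
        then have "val_ge (- int (card W * (C * q ^ N)) + ((int (q ^ N) - 1) * int m - int e))
            (poly_theta (u N i) * evN N (emb Q * F i - emb (P i)))"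
          using CC_diff[OF CC1[OF i]] Q[OF i] M by (intro val_ge_mult Ob_val ev_bound) auto
        moreover have "- int (card W * (C * q ^ N)) + ((int (q ^ N) - 1) * int m - int e) \<ge> 1"
        proof -
          have "- int (card W * (C * q ^ N)) + ((int (q ^ N) - 1) * int m - int e) = int (q ^ N) - int m - int e"
            by (simp add: m_def algebra_simps)
          moreover have "int N < int (q ^ N)"
            using less_le_trans[OF less_exp[of N] power_mono[of 2 q N]] q_pos by simp
          ultimately show ?thesis using N by linarith
        qed
        ultimately show "val_ge 1 (poly_theta (u N i) * evN N (emb Q * F i - emb (P i)))" by (rule val_ge_mono)
      qed
      then have v: "val_ge 1 s" unfolding s by (rule val_ge_uminus)
      have "\<exists>p. s = poly_theta p"
      proof -
        have "\<forall>i. \<exists>r. evp (q ^ N) (P i) = poly_theta r" using evp_integral by blast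
        then obtain r where "\<And>i. evp (q ^ N) (P i) = poly_theta (r i)" by metis
        then have "s = poly_theta (\<Sum>i\<in>I. u N i * r i)" by (simp add: s_def poly_theta_hom)
        then show ?thesis by blast
      qed
      then show "s = 0" using v integral_small by fastforce
    qed
  qed
  have span: "\<forall>\<^sub>F N in sequentially. (\<Sum>i\<in>I. poly_theta (u N i) * evp (q ^ N) (P i)) = 0" if "P \<in> modspan S" for P
    using that
  proof induction
    case (step s t c)
    from base[OF step(1)] step(3) show ?case
    proof eventually_elim
      case (elim N)
      have "(\<Sum>i\<in>I. poly_theta (u N i) * evp (q ^ N) (c * s i + t i))
        = evp (q ^ N) c * (\<Sum>i\<in>I. poly_theta (u N i) * evp (q ^ N) (s i)) + (\<Sum>i\<in>I. poly_theta (u N i) * evp (q ^ N) (t i))"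
        by (simp add: evp_hom sum_distrib_left distrib_left sum.distrib mult_ac)
      then show ?case using elim by simp
    qed
  qed (simp add: evp_hom)
  obtain d where d: "d \<noteq> 0" "\<forall>i\<in>I. \<exists>p\<in>modspan S. p i = d \<and> (\<forall>j\<in>I - {i}. p j = 0)"
  proof -
    have "\<forall>i\<in>I. R i = 0" if "\<And>s. s \<in> S \<Longrightarrow> (\<Sum>i\<in>I. R i * s i) = 0" for R
      by (rule pade_no_annihilator[of I c F m R, OF fin F indep]) (use that in \<open>auto simp: S_def\<close>)
    from elimination[OF fin this] show ?thesis using that by blast
  qed
  have "\<forall>\<^sub>F N in sequentially. poly_theta (u N i) * evp (q ^ N) d = 0" if i: "i \<in> I" for i
  proof -
    obtain p where p: "p \<in> modspan S" "p i = d" "\<forall>j\<in>I - {i}. p j = 0" using d(2) i by blast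
    have "(\<Sum>j\<in>I. poly_theta (u N j) * evp (q ^ N) (p j)) = poly_theta (u N i) * evp (q ^ N) d" for N
      using p(2,3) i fin by (subst sum.remove[of _ i]) (auto simp: evp_hom)
    then show ?thesis using span[OF p(1)] by simp
  qed
  then have "\<forall>\<^sub>F N in sequentially. \<forall>i\<in>I. poly_theta (u N i) * evp (q ^ N) d = 0"
    using fin by (intro eventually_ball_finite) auto
  with evp_nonzero_eventually[OF d(1)] eventually_ge_at_top[of 1]
  have "\<forall>\<^sub>F N in sequentially. False"
  proof eventually_elim
    case (elim N)
    then show ?case using u(1)[of N] by auto
  qed
  then show False by simp
qed

end

subsection \<open>Fractions\<close>

definition subring :: "'l::field set \<Rightarrow> bool" where
  "subring R \<longleftrightarrow> 0 \<in> R \<and> 1 \<in> R \<and> (\<forall>x\<in>R. \<forall>y\<in>R. x + y \<in> R \<and> x * y \<in> R) \<and> (\<forall>x\<in>R. - x \<in> R)"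

definition fractions :: "'l::field set \<Rightarrow> 'l set" where
  "fractions R = {a / b | a b. a \<in> R \<and> b \<in> R \<and> b \<noteq> 0}"

lemma subringD:
  assumes "subring R"
  shows "0 \<in> R" "1 \<in> R" "x \<in> R \<Longrightarrow> y \<in> R \<Longrightarrow> x + y \<in> R" "x \<in> R \<Longrightarrow> y \<in> R \<Longrightarrow> x * y \<in> R"
    "x \<in> R \<Longrightarrow> - x \<in> R"
  using assms by (auto simp: subring_def)

lemma fractionsI: "a \<in> R \<Longrightarrow> b \<in> R \<Longrightarrow> b \<noteq> 0 \<Longrightarrow> x = a / b \<Longrightarrow> x \<in> fractions R"
  by (auto simp: fractions_def)

lemma fractions_base: "subring R \<Longrightarrow> x \<in> R \<Longrightarrow> x \<in> fractions R"
  by (rule fractionsI[of x R 1]) (auto simp: subringD)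

lemma is_subfield_fractions:
  assumes R: "subring R" shows "is_subfield (fractions R)"
proof -
  note D = subringD[OF R]
  have "x + y \<in> fractions R \<and> x * y \<in> fractions R" if xy: "x \<in> fractions R" "y \<in> fractions R" for x y
  proof -
    obtain a b c d where e: "a \<in> R" "b \<in> R" "b \<noteq> 0" "x = a / b" "c \<in> R" "d \<in> R" "d \<noteq> 0" "y = c / d"
      using xy by (auto simp: fractions_def)
    have "x + y = (a * d + c * b) / (b * d)" using e by (simp add: add_frac_eq)
    moreover have "x * y = (a * c) / (b * d)" using e by simp
    moreover have "a * d + c * b \<in> R" "a * c \<in> R" "b * d \<in> R" "b * d \<noteq> 0" using e D by simp_all
    ultimately show ?thesis using fractionsI by metis
  qed
  moreover have "- x \<in> fractions R \<and> inverse x \<in> fractions R" if x: "x \<in> fractions R" for x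
  proof -
    obtain a b where e: "a \<in> R" "b \<in> R" "b \<noteq> 0" "x = a / b" using x by (auto simp: fractions_def)
    have "- x \<in> fractions R" using e D by (intro fractionsI[of "- a" R b]) auto
    moreover have "inverse x \<in> fractions R"
    proof (cases "a = 0")
      case True
      then show ?thesis using e D fractions_base[OF R D(1)] by simp
    qed (use e D in \<open>auto intro: fractionsI[of b R a]\<close>)
    ultimately show ?thesis by blast
  qed
  ultimately show ?thesis using fractions_base[OF R] D unfolding is_subfield_def by blast
qed

lemma common_denominator:
  assumes R: "subring R" and "finite S" "S \<subseteq> fractions R"
  shows "\<exists>d\<in>R. d \<noteq> 0 \<and> (\<forall>s\<in>S. d * s \<in> R)"
  using assms(2,3)
proof (induction S rule: finite_induct)
  case empty
  then show ?case using subringD(2)[OF R] by (intro bexI[of _ 1]) auto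
next
  case (insert s S)
  then obtain d where d: "d \<in> R" "d \<noteq> 0" "\<forall>s\<in>S. d * s \<in> R" by auto
  obtain a b where e: "a \<in> R" "b \<in> R" "b \<noteq> 0" "s = a / b" using insert.prems by (auto simp: fractions_def)
  have "b * d * x \<in> R" if "x \<in> insert s S" for x
  proof (cases "x = s")
    case True
    have "b * d * x = d * a" unfolding True e(4) using e(3) by simp
    then show ?thesis using subringD(4)[OF R d(1) e(1)] by (simp only:)
  next
    case False
    then show ?thesis using that d(3) subringD(4)[OF R e(2)] by (simp add: mult.assoc)
  qed
  then show ?case using e d subringD(4)[OF R e(2) d(1)] by (intro bexI[of _ "b * d"]) auto
qed

lemma subring_poly_theta: "subring (range poly_theta :: 'a::field fls set)"
proof -
  have "0 \<in> range (poly_theta :: 'a poly \<Rightarrow> _)" "1 \<in> range (poly_theta :: 'a poly \<Rightarrow> _)"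
    using poly_theta_hom(1,2) by (metis rangeI)+
  moreover have "poly_theta a + poly_theta b \<in> range poly_theta" "poly_theta a * poly_theta b \<in> range poly_theta"
    "- poly_theta a \<in> range poly_theta" for a b :: "'a poly"
    by (simp_all flip: poly_theta_hom)
  ultimately show ?thesis unfolding subring_def by blast
qed

lemma Kfield_fractions: "Kfield = (fractions (range poly_theta) :: 'a::field fls set)"
proof
  show "Kfield \<subseteq> (fractions (range poly_theta) :: 'a fls set)"
    unfolding Kfield_def
  proof (rule gen_field_least[OF is_subfield_fractions[OF subring_poly_theta]])
    have "fls_const c \<in> range (poly_theta :: 'a poly \<Rightarrow> _)" for c :: 'a
      by (rule image_eqI[of _ _ "[:c:]"]) (simp_all add: poly_theta_pCons)
    moreover have "theta \<in> range (poly_theta :: 'a poly \<Rightarrow> _)" unfolding theta_eq[symmetric] by simp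
    ultimately show "range fls_const \<union> {theta} \<subseteq> (fractions (range poly_theta) :: 'a fls set)"
      using fractions_base[OF subring_poly_theta] by blast
  qed
next
  have sub: "is_subfield (Kfield :: 'a fls set)" unfolding Kfield_def by (rule is_subfield_gen_field)
  have "range fls_const \<union> {theta} \<subseteq> (Kfield :: 'a fls set)"
    unfolding Kfield_def by (rule gen_field_superset)
  then have "poly_theta p \<in> Kfield" for p :: "'a poly"
    unfolding poly_theta_def by (intro subfield_closed(4,9,11)[OF sub]) auto
  then show "fractions (range poly_theta) \<subseteq> (Kfield :: 'a fls set)"
    using subfield_closed(8)[OF sub] by (auto simp: fractions_def)
qed

lemma subfield_Kfield: "is_subfield (Kfield :: 'a::field fls set)"
  unfolding Kfield_def by (rule is_subfield_gen_field)

lemma poly_theta_Kfield: "poly_theta p \<in> Kfield"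
  unfolding Kfield_fractions by (rule fractions_base[OF subring_poly_theta]) simp

subsection \<open>Words\<close>

primrec mon :: "'l::comm_ring_1 set \<Rightarrow> nat \<Rightarrow> 'l set" where
  "mon A 0 = {1}"
| "mon A (Suc k) = {a * m | a m. a \<in> insert 1 A \<and> m \<in> mon A k}"

lemma mon_step: "a \<in> insert 1 A \<Longrightarrow> m \<in> mon A k \<Longrightarrow> a * m \<in> mon A (Suc k)" by auto

lemma finite_mon: "finite A \<Longrightarrow> finite (mon A k)"
proof (induction k)
  case (Suc k)
  have "mon A (Suc k) = (\<lambda>(a, m). a * m) ` (insert 1 A \<times> mon A k)" by auto
  then show ?case using Suc by simp
qed simp

lemma mon_mult: "x \<in> mon A j \<Longrightarrow> y \<in> mon A k \<Longrightarrow> x * y \<in> mon A (j + k)"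
proof (induction j arbitrary: x)
  case (Suc j)
  then obtain a m where "x = a * m" "a \<in> insert 1 A" "m \<in> mon A j" by auto
  then show ?case using mon_step[of a A "m * y" "j + k"] Suc by (simp add: mult.assoc)
qed simp

lemma mon_mono: "x \<in> mon A j \<Longrightarrow> A \<subseteq> B \<Longrightarrow> j \<le> k \<Longrightarrow> x \<in> mon B k"
proof -
  have "1 \<in> mon B i" for i
  proof (induction i)
    case (Suc i)
    then show ?case using mon_step[of 1 B 1 i] by simp
  qed simp
  moreover have "x \<in> mon B j" if "x \<in> mon A j" "A \<subseteq> B"
    using that by (induction j arbitrary: x) (simp, fastforce)
  ultimately show "x \<in> mon A j \<Longrightarrow> A \<subseteq> B \<Longrightarrow> j \<le> k \<Longrightarrow> x \<in> mon B k"
    using mon_mult[of x B j 1 "k - j"] by simp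
qed

lemma mon_one: "1 \<in> mon A k"
  using mon_mono[of 1 A 0 A k] by simp

lemma mon_power: "x \<in> A \<Longrightarrow> x ^ i \<in> mon A i"
  by (induction i) (auto simp del: mon.simps(2) intro: mon_step)

lemma mon_insert: "w \<in> mon (insert e E) k \<Longrightarrow> \<exists>i\<le>k. \<exists>m\<in>mon E (k - i). w = e ^ i * m"
proof (induction k arbitrary: w)
  case (Suc k)
  then obtain a w' where w: "w = a * w'" "a \<in> insert 1 (insert e E)" "w' \<in> mon (insert e E) k" by auto
  from Suc.IH[OF w(3)] obtain i m where im: "i \<le> k" "m \<in> mon E (k - i)" "w' = e ^ i * m" by blast
  show ?case
  proof (cases "a = e")
    case True
    then show ?thesis using im w by (intro exI[of _ "Suc i"] conjI bexI[of _ m]) auto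
  next
    case False
    then have "a * m \<in> mon E (Suc (k - i))" using w(2) im(2) by (intro mon_step) auto
    then show ?thesis using im w by (intro exI[of _ i] conjI bexI[of _ "a * m"]) (auto simp: Suc_diff_le mult_ac)
  qed
qed simp

text \<open>The sets \<open>R k\<close> are graded: k factors with coefficients in
  \<open>R 1\<close> give coefficients in \<open>R k\<close>. This serves both for a constant field
  and for degree bounds proportional to k.\<close>

lemma mon_spn:
  assumes "w \<in> mon S k" and S: "\<And>x. x \<in> S \<Longrightarrow> x \<in> spn (R 1) (insert 1 A)"
    and R: "\<And>i x y. x \<in> R 1 \<Longrightarrow> y \<in> R i \<Longrightarrow> x * y \<in> R (Suc i)" "1 \<in> R 0" "1 \<in> R 1"
  shows "w \<in> spn (R k) (mon A k)"
  using assms(1)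
proof (induction k arbitrary: w)
  case 0
  then show ?case using spn_base[of 1 "R 0" 1 "mon A 0"] R(2) by simp
next
  case (Suc k)
  then obtain a w' where w: "w = a * w'" "a \<in> insert 1 S" "w' \<in> mon S k" by auto
  have "a \<in> spn (R 1) (insert 1 A)" using w(2) S spn_base[of 1 "R 1" 1 "insert 1 A"] R(3) by auto
  then show ?case unfolding w(1)
    by (rule spn_mult[OF _ Suc.IH[OF w(3)]]) (use R(1) in \<open>auto simp del: mon.simps(2) intro: mon_step\<close>)
qed

lemma mon_hom_image:
  assumes "\<And>k x y. x \<in> insert 1 A \<Longrightarrow> y \<in> mon A k \<Longrightarrow> h (x * y) = h x * h y" "h 1 = 1"
  shows "mon (h ` A) k = h ` mon A k"
proof (induction k)
  case (Suc k)
  have im: "mon A (Suc k) = (\<lambda>(a, m). a * m) ` (insert 1 A \<times> mon A k)" for A :: "'x::comm_ring_1 set" by auto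
  have "insert 1 (h ` A) \<times> mon (h ` A) k = (\<lambda>(a, m). (h a, h m)) ` (insert 1 A \<times> mon A k)"
    unfolding Suc using assms(2) by (force simp: image_iff)
  then have "mon (h ` A) (Suc k) = (\<lambda>p. h (fst p) * h (snd p)) ` (insert 1 A \<times> mon A k)"
    unfolding im by (simp add: image_image split_def)
  also have "\<dots> = (\<lambda>p. h (fst p * snd p)) ` (insert 1 A \<times> mon A k)"
  proof (rule image_cong[OF refl])
    fix p assume "p \<in> insert 1 A \<times> mon A k"
    then show "h (fst p) * h (snd p) = h (fst p * snd p)" by (metis assms(1) mem_Times_iff)
  qed
  also have "\<dots> = h ` mon A (Suc k)" unfolding im by (simp add: image_image split_def)
  finally show ?case .
qed (simp add: assms(2))

subsection \<open>Bases of finite sets\<close>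

context
  fixes E :: "'l::field set"
  assumes E: "is_subfield E"
begin

private lemmas closed = subfield_closed[OF E]

lemma spn_subfield_explicit: "x \<in> spn E S \<Longrightarrow> finite S \<Longrightarrow> \<exists>c. (\<forall>s\<in>S. c s \<in> E) \<and> x = (\<Sum>s\<in>S. c s * s)"
  by (rule spn_explicit) (auto intro: closed)

lemma spn_subfield_base: "s \<in> S \<Longrightarrow> s \<in> spn E S"
  using spn_base[of 1 E s S] closed by simp

lemma spn_subfield_scale: "x \<in> spn E S \<Longrightarrow> a \<in> E \<Longrightarrow> a * x \<in> spn E S"
  by (rule spn_mult_left) (auto simp: closed mult.assoc[symmetric] intro: spn_base)

lemma spn_subfield_trans: "x \<in> spn E S \<Longrightarrow> (\<And>s. s \<in> S \<Longrightarrow> s \<in> spn E T) \<Longrightarrow> x \<in> spn E T"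
  by (erule spn_trans) (auto intro: spn_subfield_scale)

lemma spn_subfield_solve:
  assumes "finite S" "s0 \<in> S" "c s0 \<noteq> 0" "\<And>s. s \<in> S \<Longrightarrow> c s \<in> E" "(\<Sum>s\<in>S. c s * f s) = 0"
  shows "f s0 \<in> spn E (f ` (S - {s0}))"
proof -
  have "c s0 * f s0 = - (\<Sum>s\<in>S - {s0}. c s * f s)"
    using assms(5) sum.remove[OF assms(1,2), of "\<lambda>s. c s * f s"] by (simp add: eq_neg_iff_add_eq_0)
  then have "f s0 = - (\<Sum>s\<in>S - {s0}. c s * f s) / c s0"
    using assms(3) by (metis nonzero_mult_div_cancel_left)
  also have "\<dots> = (\<Sum>s\<in>S - {s0}. (- (c s / c s0)) * f s)"
    by (simp add: sum_divide_distrib sum_negf)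
  also have "\<dots> \<in> spn E (f ` (S - {s0}))"
    using assms(2,4) by (intro spn_sum spn_base closed) auto
  finally show ?thesis .
qed

end

text \<open>Take a largest subset independent over F_q[theta][x]; adding any other element of
  \<open>M\<close> creates a relation in which its coefficient is nonzero.\<close>

lemma emb_basis:
  fixes M :: "'a::{field,finite} fls fls set"
  assumes "finite M"
  shows "\<exists>B\<subseteq>M. (\<forall>R. (\<Sum>b\<in>B. emb (R b) * b) = 0 \<longrightarrow> (\<forall>b\<in>B. R b = 0)) \<and>
    (\<forall>m\<in>M. \<exists>r R. r \<noteq> 0 \<and> emb r * m = (\<Sum>b\<in>B. emb (R b) * b))"
proof -
  define I where "I = (\<lambda>B. B \<subseteq> M \<and> (\<forall>R. (\<Sum>b\<in>B. emb (R b) * b) = 0 \<longrightarrow> (\<forall>b\<in>B. R b = 0)))"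
  have "I {}" by (simp add: I_def)
  moreover have "card B < Suc (card M)" if "I B" for B using that assms card_mono[of M B] by (auto simp: I_def)
  ultimately obtain B where B: "I B" "\<And>B'. I B' \<Longrightarrow> card B' \<le> card B"
    using ex_has_greatest_nat[of I "{}" card "Suc (card M)"] by blast
  have fB: "finite B" using B(1) assms finite_subset by (auto simp: I_def)
  have "\<exists>r R. r \<noteq> 0 \<and> emb r * m = (\<Sum>b\<in>B. emb (R b) * b)" if m: "m \<in> M" for m
  proof (cases "m \<in> B")
    case True
    have "(\<Sum>b\<in>B. emb (if b = m then 1 else 0) * b) = (\<Sum>b\<in>{m}. emb (if b = m then 1 else 0) * b)"
      using fB True by (intro sum.mono_neutral_right) (auto simp: emb_hom)
    then show ?thesis by (intro exI[of _ 1] exI[of _ "\<lambda>b. if b = m then 1 else 0"]) (simp add: emb_hom)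
  next
    case False
    have "\<not> I (insert m B)" using B(2)[of "insert m B"] fB False by auto
    then obtain R where R: "(\<Sum>b\<in>insert m B. emb (R b) * b) = 0" "\<exists>b\<in>insert m B. R b \<noteq> 0"
      using m B(1) by (auto simp: I_def)
    have s: "emb (R m) * m + (\<Sum>b\<in>B. emb (R b) * b) = 0" using R(1) fB False by simp
    have "R m \<noteq> 0"
    proof
      assume "R m = 0"
      then show False using s R(2) B(1) by (auto simp: I_def emb_hom)
    qed
    moreover have "emb (R m) * m = (\<Sum>b\<in>B. emb (- R b) * b)"
      using s by (simp add: emb_hom sum_negf eq_neg_iff_add_eq_0)
    ultimately show ?thesis by (intro exI[of _ "R m"] exI[of _ "\<lambda>b. - R b"]) simp
  qed
  then show ?thesis using B(1) by (auto simp: I_def)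
qed

lemma Kfield_bounded_denominator:
  assumes "finite S" "S \<subseteq> (Kfield :: 'a::field fls set)"
  shows "\<exists>d e. d \<noteq> 0 \<and> (\<forall>s\<in>S. d * s \<in> Ob (int e))"
proof -
  obtain d where d: "d \<noteq> 0" "\<And>s. s \<in> S \<Longrightarrow> d * s \<in> range poly_theta"
    using common_denominator[OF subring_poly_theta assms[unfolded Kfield_fractions]] by blast
  then have "\<forall>s\<in>S. \<exists>p. d * s = poly_theta p" by blast
  then obtain p where p: "\<And>s. s \<in> S \<Longrightarrow> d * s = poly_theta (p s)" by metis
  have "d * s \<in> Ob (int (\<Sum>s\<in>S. degree (p s)))" if "s \<in> S" for s
  proof -
    have "degree (p s) \<le> (\<Sum>s\<in>S. degree (p s))" using assms(1) that by (intro member_le_sum) auto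
    then show ?thesis unfolding p[OF that] by (intro Ob_poly_theta) (simp only: of_nat_le_iff)
  qed
  then show ?thesis using d(1) by blast
qed

text \<open>A common denominator d of all coefficients is absorbed into the spanning set by
  replacing t with t / d.\<close>

lemma spn_bounded_denominator:
  assumes fin: "finite M" "finite T" and M: "\<And>w. w \<in> M \<Longrightarrow> w \<in> spn (Kfield :: 'a::field fls set) T"
  shows "\<exists>W e. finite W \<and> card W \<le> card T \<and> (\<forall>w\<in>M. w \<in> spn (Ob (int e)) W)"
proof -
  have "\<forall>w\<in>M. \<exists>a. (\<forall>t\<in>T. a t \<in> Kfield) \<and> w = (\<Sum>t\<in>T. a t * t)"
    using spn_subfield_explicit[OF subfield_Kfield M fin(2)] by blast
  then obtain a where a: "\<And>w t. w \<in> M \<Longrightarrow> t \<in> T \<Longrightarrow> a w t \<in> Kfield" "\<And>w. w \<in> M \<Longrightarrow> w = (\<Sum>t\<in>T. a w t * t)"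
    by metis
  have "finite ((\<lambda>(w, t). a w t) ` (M \<times> T))" "(\<lambda>(w, t). a w t) ` (M \<times> T) \<subseteq> Kfield"
    using fin a(1) by auto
  from Kfield_bounded_denominator[OF this] obtain d e where
    d: "d \<noteq> 0" "\<And>w t. w \<in> M \<Longrightarrow> t \<in> T \<Longrightarrow> d * a w t \<in> Ob (int e)" by auto
  have "w \<in> spn (Ob (int e)) ((\<lambda>t. t / d) ` T)" if w: "w \<in> M" for w
  proof -
    have "w = (\<Sum>t\<in>T. (d * a w t) * (t / d))" using a(2)[OF w] d(1) by simp
    also have "\<dots> \<in> spn (Ob (int e)) ((\<lambda>t. t / d) ` T)"
      using d(2)[OF w] by (intro spn_sum spn_base) auto
    finally show ?thesis .
  qed
  then show ?thesis using fin(2) card_image_le[OF fin(2)] by blast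
qed

text \<open>The ring generated by \<open>Z\<close> over K, filtered by the number of
  factors.\<close>

definition words :: "'a::field fls set \<Rightarrow> 'a fls set" where
  "words Z = (\<Union>k. spn Kfield (mon Z k))"

lemma spn_mon_mono: "x \<in> spn E (mon Z j) \<Longrightarrow> j \<le> k \<Longrightarrow> x \<in> spn E (mon Z k)"
  by (erule spn_mono) (simp_all add: subset_iff mon_mono[OF _ subset_refl])

lemma subring_words: "subring (words Z)"
  unfolding subring_def
proof (intro conjI ballI)
  note K = subfield_closed[OF subfield_Kfield]
  show "0 \<in> words Z" "1 \<in> words Z"
    unfolding words_def using spn.zero[of Kfield "mon Z 0"] spn_base[of 1 Kfield 1 "mon Z 0"] K(2)
    by (metis UN_iff UNIV_I, metis UN_iff UNIV_I mon_one mult_1)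
  fix x assume x: "x \<in> words Z"
  then obtain i where i: "x \<in> spn Kfield (mon Z i)" by (auto simp: words_def)
  show "- x \<in> words Z"
    using spn_subfield_scale[OF subfield_Kfield i, of "- 1"] K(5)[OF K(2)] by (auto simp: words_def)
  fix y assume "y \<in> words Z"
  then obtain j where j: "y \<in> spn Kfield (mon Z j)" by (auto simp: words_def)
  have "x + y \<in> spn Kfield (mon Z (i + j))"
    by (intro spn_add spn_mon_mono[OF i] spn_mon_mono[OF j]) simp_all
  then show "x + y \<in> words Z" by (auto simp: words_def)
  have "x * y \<in> spn Kfield (mon Z (i + j))"
    using i j K(4) mon_mult by (rule spn_mult)
  then show "x * y \<in> words Z" by (auto simp: words_def)
qed

lemma gen_field_words: "gen_field (Kfield \<union> Z) \<subseteq> fractions (words Z)"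
proof (rule gen_field_least[OF is_subfield_fractions[OF subring_words]])
  have "k \<in> spn Kfield (mon Z 0)" if "k \<in> Kfield" for k using spn_base[OF that, of 1 "mon Z 0"] by simp
  moreover have "z \<in> spn Kfield (mon Z 1)" if "z \<in> Z" for z
    using spn_subfield_base[OF subfield_Kfield, of z "mon Z 1"] mon_step[of z Z 1 0] that by simp
  ultimately have "Kfield \<union> Z \<subseteq> words Z" unfolding words_def by blast
  then show "Kfield \<union> Z \<subseteq> fractions (words Z)"
    using fractions_base[OF subring_words] by blast
qed

text \<open>A nontrivial relation of degree $m$ with coefficients of weight $k_0$ makes the words of weight
  $k_0 + m$ in $Z \cup \{x\}$ span a space strictly smaller than $\sum_i \dim V_{k_0 + m - i}$, the dimension expected
  for transcendental $x$.\<close>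

lemma algebraic_relation_span:
  assumes alg: "\<not> transcendental_over (gen_field (Kfield \<union> Z)) (x :: 'a::field fls)"
  shows "\<exists>n. \<forall>B. (\<forall>k\<le>n. finite (B k) \<and> (\<forall>w\<in>mon Z k. w \<in> spn Kfield (B k))) \<longrightarrow>
    (\<exists>T. finite T \<and> card T < (\<Sum>i\<le>n. card (B (n - i))) \<and> (\<forall>w\<in>mon (insert x Z) n. w \<in> spn Kfield T))"
proof -
  obtain p where p: "polyover (gen_field (Kfield \<union> Z)) p" "poly p x = 0" "p \<noteq> 0"
    using alg by (auto simp: transcendental_over_def)
  define m where "m = degree p"
  have "coeff p ` {..m} \<subseteq> fractions (words Z)"
    using p(1) gen_field_words by (auto simp: polyover_def)
  from common_denominator[OF subring_words _ this] obtain d where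
    d: "d \<noteq> 0" "\<And>i. i \<le> m \<Longrightarrow> d * coeff p i \<in> words Z" by auto
  define P where "P = (\<lambda>i. d * coeff p i)"
  have Pm: "P m \<noteq> 0" using d(1) p(3) by (simp add: P_def m_def)
  have "(\<Sum>i\<le>m. P i * x ^ i) = d * poly p x"
    by (simp add: P_def poly_altdef m_def sum_distrib_left mult.assoc)
  then have rel: "(\<Sum>i\<le>m. P i * x ^ i) = 0" using p(2) by simp
  have "\<forall>i\<le>m. \<exists>k. P i \<in> spn Kfield (mon Z k)" using d(2) by (auto simp: words_def P_def)
  then obtain k where k: "\<And>i. i \<le> m \<Longrightarrow> P i \<in> spn Kfield (mon Z (k i))" by metis
  define k0 where "k0 = (\<Sum>i\<le>m. k i)"
  have Pk: "P i \<in> spn Kfield (mon Z j)" if "i \<le> m" "k0 \<le> j" for i j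
  proof (rule spn_mon_mono[OF k[OF that(1)]])
    have "k i \<le> k0" unfolding k0_def using that(1) by (intro member_le_sum) auto
    then show "k i \<le> j" using that(2) by simp
  qed
  define n where "n = k0 + m"
  have "\<exists>T. finite T \<and> card T < (\<Sum>i\<le>n. card (B (n - i))) \<and> (\<forall>w\<in>mon (insert x Z) n. w \<in> spn Kfield T)"
    if B: "\<And>k. k \<le> n \<Longrightarrow> finite (B k)" "\<And>k w. k \<le> n \<Longrightarrow> w \<in> mon Z k \<Longrightarrow> w \<in> spn Kfield (B k)" for B
  proof -
    note tr = spn_subfield_trans[OF subfield_Kfield]
    define J where "J = (SIGMA i:{..n}. B (n - i))"
    define g where "g = (\<lambda>(i, c). x ^ i * c)"
    have fJ: "finite J" unfolding J_def by (intro finite_SigmaI) (auto intro: B)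
    have cJ: "card J = (\<Sum>i\<le>n. card (B (n - i)))" unfolding J_def by (intro card_SigmaI) (auto intro: B)
    have gJ: "w \<in> spn Kfield (g ` J)" if w: "w \<in> mon (insert x Z) n" for w
    proof -
      obtain i v where iv: "i \<le> n" "v \<in> mon Z (n - i)" "w = x ^ i * v" using mon_insert[OF w] by blast
      have "v \<in> spn Kfield (B (n - i))" using B(2)[of "n - i"] iv by simp
      then show ?thesis unfolding iv(3)
      proof (rule spn_mult_left)
        fix r s :: "'a fls" assume rs: "r \<in> Kfield" "s \<in> B (n - i)"
        have "x ^ i * s = g (i, s)" by (simp add: g_def)
        then have "x ^ i * s \<in> g ` J" using rs(2) iv(1) by (auto simp: J_def)
        from spn_base[OF rs(1) this] show "x ^ i * (r * s) \<in> spn Kfield (g ` J)" by (simp add: mult_ac)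
      qed
    qed
    have "\<forall>i\<in>{..m}. \<exists>a. (\<forall>c\<in>B (n - i). a c \<in> Kfield) \<and> P i = (\<Sum>c\<in>B (n - i). a c * c)"
    proof
      fix i assume i: "i \<in> {..m}"
      have "P i \<in> spn Kfield (B (n - i))"
        using i by (intro tr[OF Pk[of i "n - i"]] B(2)) (auto simp: n_def)
      then show "\<exists>a. (\<forall>c\<in>B (n - i). a c \<in> Kfield) \<and> P i = (\<Sum>c\<in>B (n - i). a c * c)"
        by (rule spn_subfield_explicit[OF subfield_Kfield]) (simp add: B(1))
    qed
    then obtain a where a: "\<And>i c. i \<le> m \<Longrightarrow> c \<in> B (n - i) \<Longrightarrow> a i c \<in> Kfield"
      "\<And>i. i \<le> m \<Longrightarrow> P i = (\<Sum>c\<in>B (n - i). a i c * c)" by (metis atMost_iff)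
    \<comment> \<open>The leading coefficient \<open>P m\<close> is nonzero, so some basis element
      \<open>c0\<close> occurs in it. Solving the relation for x^m * c0 removes this one product
      from the spanning set.\<close>
    obtain c0 where c0: "c0 \<in> B (n - m)" "a m c0 \<noteq> 0"
    proof (rule ccontr)
      assume "\<not> thesis"
      then have "\<forall>c\<in>B (n - m). a m c = 0" using that by blast
      then show False using a(2)[of m] Pm by simp
    qed
    define h where "h = (\<lambda>(i, c). if i \<le> m then a i c else 0)"
    have "(\<Sum>j\<in>J. h j * g j) = (\<Sum>i\<le>n. \<Sum>c\<in>B (n - i). h (i, c) * g (i, c))"
      unfolding J_def by (subst sum.Sigma) (auto simp: B(1))
    also have "\<dots> = (\<Sum>i\<le>m. \<Sum>c\<in>B (n - i). h (i, c) * g (i, c))"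
      by (intro sum.mono_neutral_right) (auto simp: n_def h_def)
    also have "\<dots> = (\<Sum>i\<le>m. P i * x ^ i)"
    proof (rule sum.cong[OF refl])
      fix i assume "i \<in> {..m}"
      then show "(\<Sum>c\<in>B (n - i). h (i, c) * g (i, c)) = P i * x ^ i"
        by (simp add: h_def g_def a(2) sum_distrib_right mult.assoc) (simp add: mult.commute)
    qed
    also have "\<dots> = 0" by (rule rel)
    finally have "(\<Sum>j\<in>J. h j * g j) = 0" .
    moreover have j0: "(m, c0) \<in> J" using c0(1) by (simp add: J_def n_def)
    moreover have "h j \<in> Kfield" if "j \<in> J" for j
      using that a(1) subfield_closed(1)[OF subfield_Kfield] by (auto simp: h_def J_def)
    ultimately have s: "g (m, c0) \<in> spn Kfield (g ` (J - {(m, c0)}))"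
      using c0(2) by (intro spn_subfield_solve[OF subfield_Kfield fJ, where c = h]) (auto simp: h_def)
    have "w \<in> spn Kfield (g ` (J - {(m, c0)}))" if "w \<in> mon (insert x Z) n" for w
      using gJ[OF that]
    proof (rule tr)
      fix v assume "v \<in> g ` J"
      then obtain j where j: "v = g j" "j \<in> J" by blast
      show "v \<in> spn Kfield (g ` (J - {(m, c0)}))"
      proof (cases "j = (m, c0)")
        case False
        then show ?thesis unfolding j(1) using j(2) by (intro spn_subfield_base[OF subfield_Kfield]) auto
      qed (use s j in simp)
    qed
    moreover have "card (g ` (J - {(m, c0)})) < card J"
      using card_image_le[of "J - {(m, c0)}" g] fJ j0 card_Diff1_less[OF fJ j0] by simp
    ultimately show ?thesis
      unfolding cJ[symmetric] by (intro exI[of _ "g ` (J - {(m, c0)})"] conjI ballI finite_imageI finite_Diff fJ)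
  qed
  then show ?thesis by (intro exI[of _ n] allI impI) simp
qed

context carlitz
begin

lemma CC_mon:
  assumes "\<And>a. a \<in> A \<Longrightarrow> CC c a" "c \<ge> 0" "m \<in> mon A k"
  shows "CC (int k * c) m"
  using assms(3)
proof (induction k arbitrary: m)
  case (Suc k)
  then obtain a m' where m: "m = a * m'" "a \<in> insert 1 A" "m' \<in> mon A k" by auto
  have "CC c a" using m(2) assms(1) CC_1[OF assms(2)] by auto
  from CC_mult[OF this Suc.IH[OF m(3)]] show ?case by (simp add: m(1) distrib_right)
qed (simp add: CC_1)

lemma ev_mon:
  assumes "\<And>a. a \<in> A \<Longrightarrow> CC c a" "c \<ge> 0" "M \<ge> 2"
  shows "mon (ev M ` A) k = ev M ` mon A k"
proof (rule mon_hom_image)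
  fix k x y assume xy: "x \<in> insert 1 A" "y \<in> mon A k"
  have "CC c x" using xy(1) assms(1) CC_1[OF assms(2)] by auto
  then show "ev M (x * y) = ev M x * ev M y" by (rule ev_mult[OF _ CC_mon[OF assms(1,2) xy(2)] assms(3)])
qed (rule ev_1)

lemma emb_in: "emb p \<in> gen_field (range konst \<union> {xx} \<union> S)"
proof (induction p)
  case 0
  show ?case using subfield_closed(1)[OF is_subfield_gen_field] by (simp add: emb_hom)
next
  case (pCons a p)
  have "range konst \<union> {xx} \<subseteq> gen_field (range konst \<union> {xx} \<union> S)" using gen_field_superset[of "range konst \<union> {xx} \<union> S"] by blast
  then show ?case unfolding emb_pCons xx_def[symmetric]
    using pCons by (intro subfield_closed(3,4)[OF is_subfield_gen_field]) auto
qed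

end

section \<open>Transfer of transcendence from functions to values\<close>

context carlitz
begin

text \<open>Let \<open>B k\<close> be a basis over F_q[theta][x] of the products of at most k
  functions u. Evaluated at one large N it spans the products of at most k values z over K, so a
  relation for \<open>zX\<close> confines the words of weight n to a space of dimension below the
  sum of the \<open>card (B (n - i))\<close>. But the X^i b with b in \<open>B (n - i)\<close> are
  exactly that many functions, independent since \<open>X\<close> is transcendental, and for all N
  their values lie in this space with coefficients of degree O(q^N).\<close>

theorem value_transcendental:
  fixes u :: "'g \<Rightarrow> 'a fls fls" and z :: "'g \<Rightarrow> 'a fls"
  assumes fin: "finite \<Gamma>" and c: "c \<ge> 0" "\<And>\<gamma>. \<gamma> \<in> \<Gamma> \<Longrightarrow> CC c (u \<gamma>)" "CC c X"
    and evu: "\<And>N \<gamma>. N \<ge> 1 \<Longrightarrow> \<gamma> \<in> \<Gamma> \<Longrightarrow> evN N (u \<gamma>) \<in> spn (Ob (int C * int (q ^ N))) (insert 1 (insert zX (z ` \<Gamma>)))"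
    and evX: "\<And>N. N \<ge> 1 \<Longrightarrow> evN N X \<in> spn (Ob (int C * int (q ^ N))) (insert 1 (insert zX (z ` \<Gamma>)))"
    and inv: "\<And>N \<gamma>. N \<ge> 1 \<Longrightarrow> \<gamma> \<in> \<Gamma> \<Longrightarrow> z \<gamma> \<in> spn Kfield (insert 1 (evN N ` u ` \<Gamma>))"
    and tr: "transcendental_over (gen_field (range konst \<union> {xx} \<union> u ` \<Gamma>)) X"
  shows "transcendental_over (gen_field (Kfield \<union> z ` \<Gamma>)) zX"
proof (rule ccontr)
  let ?U = "u ` \<Gamma>" and ?Z = "z ` \<Gamma>" and ?G = "gen_field (range konst \<union> {xx} \<union> u ` \<Gamma>)"
  note K = subfield_closed[OF subfield_Kfield]
  assume "\<not> ?thesis"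
  from algebraic_relation_span[OF this] obtain n where
    n: "\<And>B. (\<forall>k\<le>n. finite (B k) \<and> (\<forall>w\<in>mon ?Z k. w \<in> spn Kfield (B k))) \<Longrightarrow>
    \<exists>T. finite T \<and> card T < (\<Sum>i\<le>n. card (B (n - i))) \<and> (\<forall>w\<in>mon (insert zX ?Z) n. w \<in> spn Kfield T)"
    by blast
  have fU: "finite (mon ?U k)" for k using fin by (intro finite_mon) simp
  define \<Phi> where "\<Phi> = (\<lambda>k B. B \<subseteq> mon ?U k \<and> (\<forall>R. (\<Sum>b\<in>B. emb (R b) * b) = 0 \<longrightarrow> (\<forall>b\<in>B. R b = 0)) \<and>
    (\<forall>m\<in>mon ?U k. \<exists>r R. r \<noteq> 0 \<and> emb r * m = (\<Sum>b\<in>B. emb (R b) * b)))"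
  have "\<forall>k. \<exists>B. \<Phi> k B" using emb_basis[OF fU] unfolding \<Phi>_def by blast
  then obtain B where "\<And>k. \<Phi> k (B k)" by metis
  then have B: "\<And>k. B k \<subseteq> mon ?U k"
    "\<And>k R. (\<Sum>b\<in>B k. emb (R b) * b) = 0 \<Longrightarrow> \<forall>b\<in>B k. R b = 0"
    "\<And>k m. m \<in> mon ?U k \<Longrightarrow> \<exists>r R. r \<noteq> 0 \<and> emb r * m = (\<Sum>b\<in>B k. emb (R b) * b)"
    unfolding \<Phi>_def by blast+
  have fB: "finite (B k)" for k using B(1) fU by (rule finite_subset)
  define \<Psi> where "\<Psi> = (\<lambda>k m r R. r \<noteq> 0 \<and> emb r * m = (\<Sum>b\<in>B k. emb (R b) * b))"
  have "\<forall>k m. \<exists>r R. m \<in> mon ?U k \<longrightarrow> \<Psi> k m r R" using B(3) unfolding \<Psi>_def by blast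
  then obtain r R where "\<And>k m. m \<in> mon ?U k \<Longrightarrow> \<Psi> k m (r k m) (R k m)" by metis
  then have r: "\<And>k m. m \<in> mon ?U k \<Longrightarrow> r k m \<noteq> 0"
    "\<And>k m. m \<in> mon ?U k \<Longrightarrow> emb (r k m) * m = (\<Sum>b\<in>B k. emb (R k m b) * b)"
    unfolding \<Psi>_def by blast+
  have "\<forall>\<^sub>F N in sequentially. \<forall>k\<in>{..n}. \<forall>m\<in>mon ?U k. evp (q ^ N) (r k m) \<noteq> 0"
    using fU r(1) by (intro eventually_ball_finite ballI evp_nonzero_eventually) auto
  then obtain N0 where N0: "\<And>N. N \<ge> N0 \<Longrightarrow> \<forall>k\<in>{..n}. \<forall>m\<in>mon ?U k. evp (q ^ N) (r k m) \<noteq> 0"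
    unfolding eventually_sequentially by blast
  \<comment> \<open>A single point at which none of the finitely many factors \<open>r k m\<close>
    vanishes.\<close>
  define N where "N = Suc N0"
  have N1: "N \<ge> 1" by (simp add: N_def)
  note M = q_power_ge[OF N1]
  have rN: "evp (q ^ N) (r k m) \<noteq> 0" if "k \<le> n" "m \<in> mon ?U k" for k m
    using N0[of N] that by (simp add: N_def)
  have CCU: "CC (int k * c) m" if "m \<in> mon ?U k" for k m
    by (rule CC_mon[OF _ c(1) that]) (use c(2) in auto)
  have evU: "evN N m \<in> spn Kfield (evN N ` B k)" if "k \<le> n" "m \<in> mon ?U k" for k m
  proof -
    have e: "evN N (emb p * w) = evp (q ^ N) p * evN N w" if "w \<in> mon ?U k" for p w
      using CC_emb[of p] ev_mult[OF _ CCU[OF that] M, of _ "emb p"] ev_emb[OF M, of p] by auto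
    have "evp (q ^ N) (r k m) * evN N m = evN N (\<Sum>b\<in>B k. emb (R k m b) * b)"
      using e[OF that(2), of "r k m"] r(2)[OF that(2)] by simp
    also have "\<dots> = (\<Sum>b\<in>B k. evp (q ^ N) (R k m b) * evN N b)"
    proof -
      have "\<forall>b. \<exists>d. CC d (emb (R k m b))" using CC_emb by blast
      then obtain d where d: "\<And>b. CC (d b) (emb (R k m b))" by metis
      define D where "D = (\<Sum>b\<in>B k. \<bar>d b\<bar>) + int k * c"
      have "CC D (emb (R k m b) * b)" if b: "b \<in> B k" for b
      proof (rule CC_mono[OF CC_mult[OF d CCU]])
        show "b \<in> mon ?U k" using b B(1) by blast
        have "\<bar>d b\<bar> \<le> (\<Sum>b\<in>B k. \<bar>d b\<bar>)" using fB b by (intro member_le_sum) auto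
        then show "d b + int k * c \<le> D" by (simp add: D_def)
      qed
      then have "evN N (\<Sum>b\<in>B k. emb (R k m b) * b) = (\<Sum>b\<in>B k. evN N (emb (R k m b) * b))"
        by (rule ev_sum[OF _ M])
      also have "\<dots> = (\<Sum>b\<in>B k. evp (q ^ N) (R k m b) * evN N b)"
        using B(1) by (intro sum.cong refl e) auto
      finally show ?thesis .
    qed
    finally have s: "evp (q ^ N) (r k m) * evN N m = (\<Sum>b\<in>B k. evp (q ^ N) (R k m b) * evN N b)" .
    have evpK: "evp (q ^ N) p \<in> Kfield" for p using evp_integral[of "q ^ N" p] poly_theta_Kfield by auto
    have "evN N m = inverse (evp (q ^ N) (r k m)) * (\<Sum>b\<in>B k. evp (q ^ N) (R k m b) * evN N b)"
      using rN[OF that] unfolding s[symmetric] by simp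
    also have "\<dots> \<in> spn Kfield (evN N ` B k)"
      by (intro spn_subfield_scale[OF subfield_Kfield] spn_sum spn_base K evpK) auto
    finally show ?thesis .
  qed
  have "w \<in> spn Kfield (evN N ` B k)" if "k \<le> n" "w \<in> mon ?Z k" for k w
  proof -
    have "w \<in> spn Kfield (mon (evN N ` ?U) k)"
      by (rule mon_spn[OF that(2), where R = "\<lambda>_. Kfield"]) (use inv[OF N1] K in auto)
    also have "mon (evN N ` ?U) k = evN N ` mon ?U k" by (rule ev_mon[OF _ c(1) M]) (use c(2) in auto)
    finally show ?thesis
      by (rule spn_subfield_trans[OF subfield_Kfield]) (use evU[OF that(1)] in auto)
  qed
  then obtain T where T: "finite T" "card T < (\<Sum>i\<le>n. card (evN N ` B (n - i)))"
    "\<And>w. w \<in> mon (insert zX ?Z) n \<Longrightarrow> w \<in> spn Kfield T"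
    using n[of "\<lambda>k. evN N ` B k"] fB by blast
  have "finite (mon (insert zX ?Z) n)" using fin by (intro finite_mon) simp
  from spn_bounded_denominator[OF this T(1,3)] obtain W e where
    W: "finite W" "card W \<le> card T" "\<And>w. w \<in> mon (insert zX ?Z) n \<Longrightarrow> w \<in> spn (Ob (int e)) W" by blast
  define I where "I = (SIGMA i:{..n}. B (n - i))"
  define F where "F = (\<lambda>(i, b). X ^ i * b)"
  have cI: "card I = (\<Sum>i\<le>n. card (B (n - i)))" unfolding I_def by (intro card_SigmaI) (auto intro: fB)
  have Fmon: "F j \<in> mon (insert X ?U) n" if "j \<in> I" for j
  proof -
    obtain i b where j: "j = (i, b)" "i \<le> n" "b \<in> B (n - i)" using \<open>j \<in> I\<close> by (auto simp: I_def)
    have "X ^ i \<in> mon (insert X ?U) i" by (rule mon_power) simp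
    moreover have "b \<in> mon (insert X ?U) (n - i)"
      by (rule mon_mono[OF subsetD[OF B(1) j(3)]]) auto
    ultimately show ?thesis using mon_mult[of "X ^ i" _ i b "n - i"] j by (simp add: F_def)
  qed
  show False
  \<comment> \<open>\<open>n * C\<close> accounts for the coefficients of a product of n values, and
    \<open>e\<close> for those of the words over \<open>W\<close>.\<close>
  proof (rule values_not_in_small_span[of I "int n * c" F W "n * C + e"])
    show "finite I" unfolding I_def by (intro finite_SigmaI) (auto intro: fB)
    show "CC (int n * c) (F j)" if "j \<in> I" for j
      by (rule CC_mon[OF _ c(1) Fmon[OF that]]) (use c in auto)
    show "finite W" by fact
    have "(\<Sum>i\<le>n. card (evN N ` B (n - i))) \<le> card I" unfolding cI by (intro sum_mono card_image_le fB)
    then show "card W < card I" using W(2) T(2) by linarith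
    show "\<forall>j\<in>I. R j = 0" if R: "(\<Sum>j\<in>I. emb (R j) * F j) = 0" for R
    proof -
      define f where "f = (\<lambda>i. \<Sum>b\<in>B (n - i). emb (R (i, b)) * b)"
      define P where "P = (\<Sum>i\<le>n. monom (f i) i)"
      have cP: "coeff P i = (if i \<le> n then f i else 0)" for i by (simp add: P_def coeff_sum)
      have "(\<Sum>j\<in>I. emb (R j) * F j) = (\<Sum>i\<le>n. \<Sum>b\<in>B (n - i). emb (R (i, b)) * F (i, b))"
        unfolding I_def by (subst sum.Sigma) (auto simp: fB)
      also have "\<dots> = (\<Sum>i\<le>n. f i * X ^ i)"
        by (intro sum.cong refl) (simp add: f_def F_def sum_distrib_right mult.assoc, simp add: mult.commute)
      also have "\<dots> = poly P X" by (simp add: P_def poly_sum poly_monom)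
      finally have "poly P X = 0" using R by simp
      moreover have "polyover ?G P"
      proof -
        note G = subfield_closed[OF is_subfield_gen_field]
        have "?U \<subseteq> ?G" using gen_field_superset[of "range konst \<union> {xx} \<union> ?U"] by blast
        then have mG: "m \<in> ?G" if "m \<in> mon ?U k" for m k
          using that
        proof (induction k arbitrary: m)
          case (Suc k)
          then obtain a m' where m: "m = a * m'" "a \<in> insert 1 ?U" "m' \<in> mon ?U k" by auto
          have "a \<in> ?G" using m(2) Suc.prems(1) G(2) by blast
          then show ?case unfolding m(1) by (rule G(4)) (rule Suc.IH[OF Suc.prems(1) m(3)])
        qed (simp only: mon.simps singleton_iff G(2))
        have fG: "f i \<in> ?G" for i
          unfolding f_def
        proof (rule G(11))
          fix b assume "b \<in> B (n - i)"
          then show "emb (R (i, b)) * b \<in> ?G" by (intro G(4) emb_in mG[OF subsetD[OF B(1)]])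
        qed
        show ?thesis unfolding polyover_def
        proof
          fix i show "coeff P i \<in> ?G"
            unfolding cP using fG[of i] G(1) by (cases "i \<le> n") (simp_all only: if_True if_False)
        qed
      qed
      ultimately have "P = 0" using tr by (auto simp: transcendental_over_def)
      then have f0: "f i = 0" if "i \<le> n" for i using cP[of i] that by simp
      show ?thesis
      proof
        fix j assume "j \<in> I"
        then obtain i b where j: "j = (i, b)" "i \<le> n" "b \<in> B (n - i)" by (auto simp: I_def)
        have "(\<Sum>b\<in>B (n - i). emb (R (i, b)) * b) = 0" using f0[OF j(2)] by (simp only: f_def)
        from B(2)[OF this] show "R j = 0" using j(1,3) by (simp only:)
      qed
    qed
    fix N :: nat and j assume N: "N \<ge> 1" and j: "j \<in> I"
    have "mon (evN N ` insert X ?U) n = evN N ` mon (insert X ?U) n"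
    proof (rule ev_mon[OF _ c(1) q_power_ge[OF N]])
      fix a assume "a \<in> insert X ?U"
      then show "CC c a" using c(2,3) by blast
    qed
    then have "evN N (F j) \<in> mon (evN N ` insert X ?U) n" using imageI[OF Fmon[OF j], of "evN N"] by (simp only:)
    moreover define D where "D = int C * int (q ^ N)"
    ultimately have "evN N (F j) \<in> spn (Ob (int n * D)) (mon (insert zX ?Z) n)"
    proof (intro mon_spn[where R = "\<lambda>i. Ob (int i * D)"])
      fix x assume "x \<in> evN N ` insert X ?U"
      then have "x = evN N X \<or> (\<exists>\<gamma>\<in>\<Gamma>. x = evN N (u \<gamma>))" by auto
      then show "x \<in> spn (Ob (int 1 * D)) (insert 1 (insert zX ?Z))"
        using evu[OF N] evX[OF N] by (auto simp: D_def)
    next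
      fix i and x y :: "'a fls" assume "x \<in> Ob (int 1 * D)" "y \<in> Ob (int i * D)"
      then have "x * y \<in> Ob (int 1 * D + int i * D)" by (rule Ob_mult)
      then show "x * y \<in> Ob (int (Suc i) * D)" by (simp add: distrib_right)
    next
      show "1 \<in> Ob (int 0 * D)" "1 \<in> Ob (int 1 * D)" by (simp_all add: D_def)
    qed
    then show "evN N (F j) \<in> spn (Ob (int (n * C + e) * int (q ^ N))) W"
    proof (rule spn_trans)
      fix r s :: "'a fls" assume rs: "r \<in> Ob (int n * D)" "s \<in> mon (insert zX ?Z) n"
      show "r * s \<in> spn (Ob (int (n * C + e) * int (q ^ N))) W"
        using W(3)[OF rs(2)]
      proof (rule spn_mult_left)
        fix r' t :: "'a fls" assume rt: "r' \<in> Ob (int e)" "t \<in> W"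
        have "int e * 1 \<le> int e * int (q ^ N)" using q_pos by (intro mult_left_mono) simp_all
        then have "r * r' \<in> Ob (int (n * C + e) * int (q ^ N))"
          using Ob_mult[OF rs(1) rt(1)] by (elim Ob_mono) (simp add: D_def distrib_right mult.assoc)
        from spn_base[OF this rt(2)] show "r * (r' * t) \<in> spn (Ob (int (n * C + e) * int (q ^ N))) W"
          by (simp add: mult.assoc)
      qed
    qed
  qed
qed

end

subsection \<open>Power sums\<close>

context carlitz
begin

abbreviation tt :: "nat \<Rightarrow> 'a fls" where "tt i \<equiv> theta ^ (q ^ i)"

text \<open>The leading coefficient of the i-th Lagrange basis polynomial for the nodes theta^(q^j),
  j \<le> d.\<close>

definition lagrange_coeff :: "nat \<Rightarrow> nat \<Rightarrow> 'a fls" where "lagrange_coeff d i = inverse (\<Prod>j\<in>{..d} - {i}. tt i - tt j)"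

lemma inj_tt: "inj_on tt S"
  using theta_power_neq by (auto intro: inj_onI)

lemma lagrange_coeff_nz: "lagrange_coeff d i \<noteq> 0"
  using theta_power_neq by (auto simp: lagrange_coeff_def)

text \<open>The sum is the coefficient at X^d of the polynomial of degree at most d that
  interpolates X^k at the nodes, and this polynomial is X^k itself.\<close>

lemma lagrange_top:
  assumes "k \<le> d" shows "(\<Sum>i\<le>d. lagrange_coeff d i * tt i ^ k) = (if k = d then 1 else 0)"
proof -
  define B where "B = (\<lambda>i. \<Prod>j\<in>{..d} - {i}. [:- tt j, 1:])"
  define L where "L = (\<Sum>i\<le>d. smult (lagrange_coeff d i * tt i ^ k) (B i))"
  have dB: "degree (B i) = d" and lB: "coeff (B i) d = 1" if "i \<le> d" for i
  proof -
    show dg: "degree (B i) = d" unfolding B_def using that by (subst degree_prod_eq_sum_degree) auto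
    have "lead_coeff (B i) = 1" unfolding B_def by (simp add: lead_coeff_prod)
    then show "coeff (B i) d = 1" using dg by simp
  qed
  have "L = monom 1 k"
  proof (rule poly_eqI_degree[where A = "tt ` {..d}"])
    fix x assume "x \<in> tt ` {..d}"
    then obtain l where l: "l \<le> d" "x = tt l" by auto
    have "poly L x = (\<Sum>i\<le>d. lagrange_coeff d i * tt i ^ k * poly (B i) (tt l))" by (simp add: L_def poly_sum l)
    also have "\<dots> = (\<Sum>i\<in>{l}. lagrange_coeff d i * tt i ^ k * poly (B i) (tt l))"
      using l by (intro sum.mono_neutral_right) (auto simp: B_def poly_prod)
    also have "\<dots> = tt l ^ k * (lagrange_coeff d l * (\<Prod>j\<in>{..d} - {l}. tt l - tt j))" by (simp add: B_def poly_prod)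
    also have "lagrange_coeff d l * (\<Prod>j\<in>{..d} - {l}. tt l - tt j) = 1"
      using lagrange_coeff_nz[of d l] unfolding lagrange_coeff_def by simp
    finally show "poly L x = poly (monom 1 k) x" by (simp add: l poly_monom)
  next
    have c: "card (tt ` {..d}) = Suc d" by (simp add: card_image inj_tt)
    have "degree L \<le> d" unfolding L_def
      by (intro degree_sum_le) (auto intro!: order.trans[OF degree_smult_le] simp: dB)
    then show "degree L < card (tt ` {..d})" using c by simp
    show "degree (monom (1 :: 'a fls) k) < card (tt ` {..d})" using c assms by (simp add: degree_monom_eq)
  qed
  then have "coeff L d = (if k = d then 1 else 0)" by simp
  moreover have "coeff L d = (\<Sum>i\<le>d. lagrange_coeff d i * tt i ^ k)" by (simp add: L_def coeff_sum lB)
  ultimately show ?thesis by simp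
qed

lemma fls_const_frobenius: "(fls_const c :: 'a fls) ^ (q ^ i) = fls_const c"
proof -
  have "c ^ (q ^ i) = c" by (induction i) (simp_all add: finite_field_power power_mult power_Suc2 del: power_Suc)
  then show ?thesis using is_homD(7)[OF is_hom_const, of c "q ^ i"] by simp
qed

lemma poly_theta_frobenius:
  assumes "degree a \<le> d" shows "poly_theta (a :: 'a poly) ^ (q ^ i) = (\<Sum>k\<le>d. fls_const (coeff a k) * tt i ^ k)"
proof -
  have "poly_theta a = (\<Sum>k\<le>d. fls_const (coeff a k) * theta ^ k)"
    unfolding poly_theta_def using assms by (intro sum.mono_neutral_left) (auto simp: coeff_eq_0)
  then show ?thesis
    by (simp add: frobenius_sum power_mult_distrib fls_const_frobenius power_mult[symmetric] mult.commute)
qed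

text \<open>As a^(q^i) is a(theta^(q^i)), the sum is the leading coefficient of the polynomial
  interpolating a at the nodes.\<close>

lemma carlitz_monic:
  assumes a: "a \<in> monic_deg d" shows "(\<Sum>i\<le>d. lagrange_coeff d i * poly_theta (a :: 'a poly) ^ (q ^ i)) = 1"
proof -
  have ad: "degree a \<le> d" "coeff a d = 1" using a by (auto simp: monic_deg_def)
  have "(\<Sum>i\<le>d. lagrange_coeff d i * poly_theta a ^ (q ^ i)) = (\<Sum>i\<le>d. \<Sum>k\<le>d. fls_const (coeff a k) * (lagrange_coeff d i * tt i ^ k))"
    by (simp only: poly_theta_frobenius[OF ad(1)] sum_distrib_left mult.left_commute)
  also have "\<dots> = (\<Sum>k\<le>d. fls_const (coeff a k) * (\<Sum>i\<le>d. lagrange_coeff d i * tt i ^ k))"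
    by (subst sum.swap) (simp only: sum_distrib_left)
  also have "\<dots> = (\<Sum>k\<le>d. fls_const (coeff a k) * (if k = d then 1 else 0))"
    by (intro sum.cong refl) (simp only: lagrange_top atMost_iff)
  also have "\<dots> = (\<Sum>k\<in>{d}. fls_const (coeff a k) * (if k = d then 1 else 0))"
    by (intro sum.mono_neutral_right) auto
  finally show ?thesis using ad(2) by simp
qed

lemma card_monic_deg: "finite (monic_deg d :: 'a poly set)" "card (monic_deg d :: 'a poly set) = q ^ d"
proof -
  have "finite (monic_deg d :: 'a poly set) \<and> card (monic_deg d :: 'a poly set) = q ^ d"
  proof (cases d)
    case 0
    have "a = 1" if "lead_coeff a = 1" "degree a = 0" for a :: "'a poly"
      using degree_eq_zeroE[OF that(2)] that by (metis lead_coeff_pCons(2) one_pCons)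
    then have "(monic_deg 0 :: 'a poly set) = {1}" by (auto simp: monic_deg_def)
    then show ?thesis using 0 by simp
  next
    case (Suc D)
    let ?P = "{p :: 'a poly. degree p \<le> D}"
    have "monic_deg d = (\<lambda>p. p + monom 1 d) ` ?P"
    proof (intro equalityI subsetI)
      fix a :: "'a poly" assume a: "a \<in> monic_deg d"
      have "degree (a - monom 1 d) \<le> D"
      proof (rule degree_le, intro allI impI)
        fix i assume "D < i"
        then show "coeff (a - monom 1 d) i = 0"
          using a Suc by (cases "i = d") (auto simp: monic_deg_def coeff_eq_0)
      qed
      then show "a \<in> (\<lambda>p. p + monom 1 d) ` ?P" by (intro image_eqI[of _ _ "a - monom 1 d"]) auto
    next
      fix a :: "'a poly" assume "a \<in> (\<lambda>p. p + monom 1 d) ` ?P"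
      then obtain p where p: "degree p \<le> D" "a = p + monom 1 d" by auto
      have c: "coeff a d = 1" using p Suc by (simp add: coeff_eq_0)
      have "degree a \<le> d" unfolding p(2) using p(1) Suc by (intro degree_add_le) (simp_all add: degree_monom_eq)
      then have "degree a = d" using le_degree[of a d] c by simp
      then show "a \<in> monic_deg d" using c by (simp add: monic_deg_def)
    qed
    moreover have "inj_on (\<lambda>p. p + monom 1 d) ?P" by (intro inj_onI) simp
    ultimately show ?thesis using card_polys_le[of D, where 'a = 'a] by (simp add: card_image q_card Suc)
  qed
  then show "finite (monic_deg d :: 'a poly set)" "card (monic_deg d :: 'a poly set) = q ^ d" by auto
qed

lemma of_nat_q_power: "i \<ge> 1 \<Longrightarrow> of_nat (q ^ i) = (0 :: 'a fls)"
proof -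
  have "of_nat q = (0 :: 'a fls)" using binomial_q_fls[of 1] q_pos by simp
  then show "i \<ge> 1 \<Longrightarrow> of_nat (q ^ i) = (0 :: 'a fls)" by simp
qed

text \<open>Division by X - a from the lowest coefficient upwards; it brings in the inverse powers
  of the root, which become power sums.\<close>

lemma root_quotient_coeff:
  fixes f g :: "'b::field poly"
  assumes "f = [:- a, 1:] * g" "a \<noteq> 0"
  shows "coeff g k = - (\<Sum>j\<le>k. coeff f j * inverse (a ^ (Suc k - j)))"
proof (induction k)
  case 0
  have "coeff f 0 = - a * coeff g 0" unfolding assms(1) by simp
  then show ?case using assms(2) by simp
next
  case (Suc k)
  have c: "coeff f (Suc k) = coeff g k - a * coeff g (Suc k)" unfolding assms(1) by simp
  have "(\<Sum>j\<le>Suc k. coeff f j * inverse (a ^ (Suc (Suc k) - j)))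
      = inverse a * (\<Sum>j\<le>k. coeff f j * inverse (a ^ (Suc k - j))) + coeff f (Suc k) * inverse a"
    by (simp add: sum_distrib_left Suc_diff_le mult_ac)
  also have "\<dots> = inverse a * (- coeff g k + coeff f (Suc k))" using Suc by (simp add: algebra_simps)
  also have "\<dots> = - coeff g (Suc k)" unfolding c using assms(2) by (simp add: algebra_simps)
  finally show ?case by simp
qed

text \<open>Newton's identities for $1 - \sum_i e_i z^{q^i}$, whose roots are the monic polynomials of degree $d$
  and whose derivative is constant.\<close>

lemma power_sum_rec:
  "(power_sum d (Suc m) :: 'a fls) = (if m = 0 then lagrange_coeff d 0 else 0)
    + (\<Sum>i | i \<le> d \<and> q ^ i \<le> m. lagrange_coeff d i * power_sum d (Suc m - q ^ i))"
proof -
  let ?S = "\<lambda>n. power_sum d n :: 'a fls"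
  define A where "A = (poly_theta ` monic_deg d :: 'a fls set)"
  have fA: "finite A" using card_monic_deg(1) by (simp add: A_def)
  have inj: "inj_on poly_theta (monic_deg d :: 'a poly set)" by (auto intro: inj_onI simp: poly_theta_eq_iff)
  have cA: "card A = q ^ d" unfolding A_def by (simp add: card_image inj card_monic_deg)
  have A0: "a \<noteq> 0" if "a \<in> A" for a using that by (auto simp: A_def monic_deg_def)
  have S: "?S n = (\<Sum>a\<in>A. inverse (a ^ n))" for n
    unfolding A_def power_sum_def by (subst sum.reindex[OF inj]) simp
  define f where "f = 1 - (\<Sum>i\<le>d. monom (lagrange_coeff d i) (q ^ i))"
  have inq: "q ^ i = q ^ j \<longleftrightarrow> i = j" for i j using q_pos by (simp add: power_inject_exp)
  have cf: "coeff f j = (if j = 0 then 1 else 0) - (\<Sum>i\<le>d. if q ^ i = j then lagrange_coeff d i else 0)" for j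
    by (simp add: f_def coeff_sum)
  have top: "coeff f (q ^ d) = - lagrange_coeff d d"
    using q_pos by (simp add: cf inq)
  define F where "F = smult (- lagrange_coeff d d) (\<Prod>a\<in>A. [:- a, 1:])"
  have dF: "degree (\<Prod>a\<in>A. [:- a, 1:]) = q ^ d" using cA by (subst degree_prod_eq_sum_degree) auto
  have lF: "coeff F (q ^ d) = - lagrange_coeff d d"
    using lead_coeff_prod[of "\<lambda>a. [:- a, 1:]" A] dF by (simp add: F_def)
  have "f - F = 0"
  proof (rule poly_eqI_degree[of A])
    fix x assume x: "x \<in> A"
    then obtain a where a: "a \<in> monic_deg d" "x = poly_theta a" by (auto simp: A_def)
    have "poly f x = 0" using carlitz_monic[OF a(1)] by (simp add: f_def poly_sum poly_monom a(2))
    moreover have "poly F x = 0" using x fA by (auto simp: F_def poly_prod)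
    ultimately show "poly (f - F) x = poly 0 x" by simp
  next
    have "degree (f - F) \<le> q ^ d - 1"
    proof (rule degree_le, intro allI impI)
      fix i assume "q ^ d - 1 < i"
      then consider "i = q ^ d" | "q ^ d < i" by linarith
      then show "coeff (f - F) i = 0"
      proof cases
        case 2
        have "q ^ l \<noteq> i" if "l \<le> d" for l using 2 power_increasing[OF that q_pos(4)] by linarith
        then have "coeff f i = 0" using 2 q_pos by (auto simp: cf)
        moreover have "coeff F i = 0" using 2 dF by (simp add: F_def coeff_eq_0)
        ultimately show ?thesis by simp
      qed (simp add: top lF)
    qed
    moreover have "q ^ d > 0" using q_pos by simp
    ultimately show "degree (f - F) < card A" "degree (0 :: 'a fls poly) < card A"
      unfolding cA degree_0 by linarith+
  qed
  then have fF: "f = F" by simp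
  define g where "g = (\<lambda>a. smult (- lagrange_coeff d d) (\<Prod>b\<in>A - {a}. [:- b, 1:]))"
  have fg: "f = [:- a, 1:] * g a" if "a \<in> A" for a
    unfolding fF F_def g_def using prod.remove[OF fA that, of "\<lambda>a. [:- a, 1:]"] by simp
  \<comment> \<open>Logarithmic derivative: f' is the sum over the roots a of f / (X - a).\<close>
  have "pderiv f = (\<Sum>a\<in>A. g a)"
    unfolding fF F_def g_def pderiv_smult pderiv_prod
    by (rule poly_eqI) (simp add: pderiv_pCons coeff_sum sum_distrib_left sum_negf)
  then have "coeff (pderiv f) m = (\<Sum>a\<in>A. - (\<Sum>j\<le>m. coeff f j * inverse (a ^ (Suc m - j))))"
    using root_quotient_coeff[OF fg A0] by (simp add: coeff_sum)
  also have "\<dots> = - (\<Sum>j\<le>m. coeff f j * ?S (Suc m - j))"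
    by (simp only: sum_negf S sum_distrib_left) (subst sum.swap, rule refl)
  finally have 1: "(\<Sum>j\<le>m. coeff f j * ?S (Suc m - j)) = - coeff (pderiv f) m" by simp
  \<comment> \<open>Apart from the constant term, f has only exponents q^i, and q = 0 in the field:
    only the linear term survives.\<close>
  have 2: "coeff (pderiv f) m = (if m = 0 then - lagrange_coeff d 0 else 0)"
  proof (cases "m = 0")
    case True
    have "(q ^ i = 1) = (i = 0)" for i using q_pos by auto
    then show ?thesis using True by (simp add: coeff_pderiv cf)
  next
    case False
    have "of_nat (Suc m) * (if q ^ i = Suc m then lagrange_coeff d i else 0) = 0" for i
    proof (cases "q ^ i = Suc m")
      case True
      then have "i \<ge> 1" using False by (cases i) auto
      then show ?thesis using of_nat_q_power[of i] True by simp
    qed simp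
    then have "of_nat (Suc m) * (\<Sum>i\<le>d. if q ^ i = Suc m then lagrange_coeff d i else 0) = 0"
      unfolding sum_distrib_left by (intro sum.neutral) blast
    then show ?thesis using False by (simp only: coeff_pderiv cf) simp
  qed
  have "(\<Sum>j\<le>m. coeff f j * ?S (Suc m - j)) = ?S (Suc m) - (\<Sum>j\<le>m. \<Sum>i\<le>d. (if q ^ i = j then lagrange_coeff d i else 0) * ?S (Suc m - j))"
  proof -
    have "(\<Sum>j\<le>m. (if j = 0 then 1 else 0) * ?S (Suc m - j)) = (\<Sum>j\<in>{0}. (if j = 0 then 1 else 0) * ?S (Suc m - j))"
      by (intro sum.mono_neutral_right) auto
    then show ?thesis by (simp only: cf left_diff_distrib sum_subtractf sum_distrib_right) simp
  qed
  also have "(\<Sum>j\<le>m. \<Sum>i\<le>d. (if q ^ i = j then lagrange_coeff d i else 0) * ?S (Suc m - j))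
      = (\<Sum>i\<le>d. \<Sum>j\<le>m. (if q ^ i = j then lagrange_coeff d i else 0) * ?S (Suc m - j))" by (rule sum.swap)
  also have "\<dots> = (\<Sum>i\<le>d. if q ^ i \<le> m then lagrange_coeff d i * ?S (Suc m - q ^ i) else 0)"
  proof (rule sum.cong[OF refl])
    fix i
    have "(\<Sum>j\<le>m. (if q ^ i = j then lagrange_coeff d i else 0) * ?S (Suc m - j))
      = (\<Sum>j\<le>m. if j = q ^ i then lagrange_coeff d i * ?S (Suc m - q ^ i) else 0)"
      by (intro sum.cong) auto
    then show "(\<Sum>j\<le>m. (if q ^ i = j then lagrange_coeff d i else 0) * ?S (Suc m - j))
      = (if q ^ i \<le> m then lagrange_coeff d i * ?S (Suc m - q ^ i) else 0)" by simp
  qed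
  also have "\<dots> = (\<Sum>i | i \<le> d \<and> q ^ i \<le> m. lagrange_coeff d i * ?S (Suc m - q ^ i))"
    by (simp add: sum.inter_filter[symmetric])
  finally show ?thesis using 1 2 by (simp add: algebra_simps split: if_splits)
qed

lemma lagrange_coeff_0: "lagrange_coeff d 0 = 1 / ell d"
proof -
  have "{..d} - {0} = {1..d}" by auto
  then show ?thesis by (simp add: lagrange_coeff_def ell_def lam_def inverse_eq_divide)
qed

lemma power_sum_small: "1 \<le> n \<Longrightarrow> n \<le> q \<Longrightarrow> (power_sum d n :: 'a fls) = 1 / ell d ^ n"
proof (induction n rule: nat_induct_at_least)
  case base
  have e: "{i. i \<le> d \<and> q ^ i \<le> 0} = {}" using q_pos by simp
  show ?case using power_sum_rec[of d 0, unfolded e] by (simp add: lagrange_coeff_0)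
next
  case (Suc n)
  have "i = 0" if "q ^ i \<le> n" for i
    using that Suc power_increasing[of 1 i q] q_pos by (cases "i = 0") auto
  then have "{i. i \<le> d \<and> q ^ i \<le> n} = {0}" using Suc by auto
  then show ?case using power_sum_rec[of d n] Suc by (simp add: lagrange_coeff_0)
qed

text \<open>Built so that its value at theta^(q^d) is
  \<open>lagrange_coeff d i * ell d ^ (q ^ i)\<close>. This is possible because ell_d^(q^i) is the
  product of theta^(q^i) - theta^(q^j) over i < j \<le> d + i, most of which cancels.\<close>

definition carlitz_poly :: "nat \<Rightarrow> 'a fls poly" where
  "carlitz_poly i = smult (inverse (\<Prod>j<i. tt i - tt j)) (\<Prod>s=1..i. [:tt i:] - monom 1 (q ^ s))"

lemma lagrange_coeff_ell: "i \<le> d \<Longrightarrow> lagrange_coeff d i * ell d ^ (q ^ i) = poly (carlitz_poly i) (tt d)"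
proof -
  assume i: "i \<le> d"
  have split: "{..d} - {i} = {..<i} \<union> {i<..d}" using i by auto
  have "(\<Prod>j\<in>{..d} - {i}. tt i - tt j) = (\<Prod>j<i. tt i - tt j) * (\<Prod>j\<in>{i<..d}. tt i - tt j)"
    unfolding split by (rule prod.union_disjoint) auto
  moreover have "ell d ^ (q ^ i) = (\<Prod>j\<in>{i<..d + i}. tt i - tt j)"
  proof -
    have "ell d ^ (q ^ i) = (\<Prod>j=1..d. tt i - tt (j + i))"
      by (simp add: ell_def prod_power_distrib lam_def frobenius_diff power_mult[symmetric] power_add mult.commute)
    also have "\<dots> = (\<Prod>j\<in>{i<..d + i}. tt i - tt j)"
      by (rule prod.reindex_bij_witness[of _ "\<lambda>j. j - i" "\<lambda>j. j + i"]) auto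
    finally show ?thesis .
  qed
  moreover have "(\<Prod>j\<in>{i<..d + i}. tt i - tt j) = (\<Prod>j\<in>{i<..d}. tt i - tt j) * (\<Prod>s=1..i. tt i - tt (d + s))"
  proof -
    have "{i<..d + i} = {i<..d} \<union> {d<..d + i}" using i by auto
    then have "(\<Prod>j\<in>{i<..d + i}. tt i - tt j) = (\<Prod>j\<in>{i<..d}. tt i - tt j) * (\<Prod>j\<in>{d<..d + i}. tt i - tt j)"
      by (simp only:) (rule prod.union_disjoint, auto)
    also have "(\<Prod>j\<in>{d<..d + i}. tt i - tt j) = (\<Prod>s=1..i. tt i - tt (d + s))"
      by (rule prod.reindex_bij_witness[of _ "\<lambda>s. d + s" "\<lambda>j. j - d"]) auto
    finally show ?thesis .
  qed
  moreover have "(\<Prod>j\<in>{i<..d}. tt i - tt j) \<noteq> 0" using theta_power_neq by auto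
  moreover have "poly (carlitz_poly i) (tt d) = inverse (\<Prod>j<i. tt i - tt j) * (\<Prod>s=1..i. tt i - tt (d + s))"
    by (simp add: carlitz_poly_def poly_prod poly_monom power_mult[symmetric] power_add)
  ultimately show ?thesis unfolding lagrange_coeff_def by simp
qed

text \<open>This zero lets the sum over i in the recursion run over a range independent of
  d.\<close>

lemma carlitz_poly_vanish: "d < i \<Longrightarrow> poly (carlitz_poly i) (tt d) = 0"
proof -
  assume "d < i"
  then have "i - d \<in> {1..i}" "tt i - tt d ^ q ^ (i - d) = 0"
    by (auto simp flip: power_mult power_add)
  then have "(\<Prod>s=1..i. tt i - tt d ^ q ^ s) = 0" by (intro prod_zero) auto
  then show ?thesis by (simp add: carlitz_poly_def poly_prod poly_monom)
qed

lemma degree_GD: "degree (carlitz_poly i) * (q - 1) + q \<le> q * q ^ i"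
proof -
  have "degree (carlitz_poly i) \<le> degree (\<Prod>s=1..i. [:tt i:] - monom 1 (q ^ s))" unfolding carlitz_poly_def by (rule degree_smult_le)
  also have "\<dots> \<le> (\<Sum>s=1..i. degree ([:tt i:] - monom 1 (q ^ s)))" using degree_prod_sum_le[of "{1..i}" "\<lambda>s. [:tt i:] - monom 1 (q ^ s)"] by (simp add: o_def)
  also have "\<dots> \<le> (\<Sum>s=1..i. q ^ s)"
    by (intro sum_mono degree_diff_le) (auto simp: degree_monom_eq)
  finally have "degree (carlitz_poly i) * (q - 1) \<le> (\<Sum>s=1..i. q ^ s) * (q - 1)" by simp
  moreover have "(\<Sum>s=1..i. q ^ s) * (q - 1) + q = q * q ^ i"
  proof (induction i)
    case (Suc i)
    have "q ^ Suc i * (q - 1) + q * q ^ i = q * q ^ Suc i"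
      using q_pos by (cases q) simp_all
    with Suc show ?case by (simp add: distrib_right)
  qed simp
  ultimately show ?thesis by linarith
qed

lemma theta_Kfield: "(theta :: 'a fls) \<in> Kfield"
  using poly_theta_Kfield[of "[:0, 1:]"] by (simp only: theta_eq)

lemma polyover_GD: "polyover Kfield (carlitz_poly i)"
proof -
  note K = subfield_closed[OF subfield_Kfield] and P = subfield_Kfield
  have t: "tt j \<in> Kfield" for j by (intro K(9) theta_Kfield)
  have "polyover Kfield (\<Prod>s\<in>S. [:tt i:] - monom 1 (q ^ s))" if "finite S" for S
    using that by (induction S rule: finite_induct)
      (simp_all add: polyover_mult[OF P] polyover_diff[OF P] polyover_const[OF P] polyover_monom[OF P] polyover_1[OF P] t K(2))
  then show ?thesis unfolding carlitz_poly_def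
    by (intro polyover_smult[OF P] K(6,12) K(7) t) auto
qed

text \<open>For n > 1 the recursion gives h_n as the sum of \<open>carlitz_poly i\<close> times h_{n
  - q^i}. The degree bound is the condition under which psi_{n,k} exists for all exponents k
  occurring in h_n.\<close>

lemma power_sum_poly:
  assumes "n \<ge> 1"
  shows "\<exists>h. polyover Kfield h \<and> degree h * (q - 1) < n * q \<and>
    (\<forall>d. (power_sum d n :: 'a fls) = poly h (tt d) / ell d ^ n)"
  using assms
proof (induction n rule: less_induct)
  case (less n)
  show ?case
  proof (cases "n = 1")
    case True
    then show ?thesis using q_pos power_sum_small[of 1]
      by (intro exI[of _ 1]) (simp add: polyover_1[OF subfield_Kfield])
  next
    case False
    then obtain m where m: "n = Suc m" "m \<ge> 1" using less.prems by (cases n) auto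
    define I where "I = {i. q ^ i \<le> m}"
    have iq: "i < q ^ i" for i by (rule less_le_trans[OF less_exp power_mono]) (use q_pos in auto)
    have fI: "finite I" using iq by (intro finite_subset[of I "{..m}"]) (auto simp: I_def intro: less_imp_le less_le_trans)
    have "\<forall>i\<in>I. \<exists>h. polyover Kfield h \<and> degree h * (q - 1) < (n - q ^ i) * q \<and>
      (\<forall>d. (power_sum d (n - q ^ i) :: 'a fls) = poly h (tt d) / ell d ^ (n - q ^ i))"
      using less.IH q_pos by (auto simp: I_def m)
    then obtain h where h: "\<And>i. i \<in> I \<Longrightarrow> polyover Kfield (h i)"
      "\<And>i. i \<in> I \<Longrightarrow> degree (h i) * (q - 1) < (n - q ^ i) * q"
      "\<And>i d. i \<in> I \<Longrightarrow> (power_sum d (n - q ^ i) :: 'a fls) = poly (h i) (tt d) / ell d ^ (n - q ^ i)"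
      by metis
    define H where "H = (\<Sum>i\<in>I. carlitz_poly i * h i)"
    have "polyover Kfield H" unfolding H_def
      using h(1) by (intro polyover_sum[OF subfield_Kfield] polyover_mult[OF subfield_Kfield] polyover_GD)
    moreover have "degree H * (q - 1) < n * q"
    proof -
      have "degree (carlitz_poly i * h i) \<le> (n * q - 1) div (q - 1)" if i: "i \<in> I" for i
      proof -
        have "degree (carlitz_poly i * h i) * (q - 1) \<le> degree (carlitz_poly i) * (q - 1) + degree (h i) * (q - 1)"
          using degree_mult_le[of "carlitz_poly i" "h i"] by (metis add_mult_distrib mult_le_mono1)
        also have "\<dots> < q * q ^ i + (n - q ^ i) * q" using degree_GD[of i] h(2)[OF i] by linarith
        also have "q * q ^ i + (n - q ^ i) * q = (q ^ i + (n - q ^ i)) * q" by (simp add: distrib_right)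
        also have "\<dots> = n * q" using i by (simp add: I_def m)
        finally have "degree (carlitz_poly i * h i) * (q - 1) \<le> n * q - 1" by simp
        then show ?thesis using q_pos by (simp add: less_eq_div_iff_mult_less_eq)
      qed
      then have "degree H \<le> (n * q - 1) div (q - 1)" unfolding H_def using fI by (intro degree_sum_le)
      then have "degree H * (q - 1) \<le> n * q - 1" using q_pos by (simp add: less_eq_div_iff_mult_less_eq)
      moreover have "n * q > 0" using m q_pos by simp
      ultimately show ?thesis by linarith
    qed
    moreover have "(power_sum d n :: 'a fls) = poly H (tt d) / ell d ^ n" for d
    proof -
      have "ell d ^ n * power_sum d n = (\<Sum>i | i \<le> d \<and> q ^ i \<le> m. poly (carlitz_poly i) (tt d) * poly (h i) (tt d))"
      proof -
        have "(power_sum d n :: 'a fls) = (\<Sum>i | i \<le> d \<and> q ^ i \<le> m. lagrange_coeff d i * power_sum d (n - q ^ i))"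
          using power_sum_rec[of d m] m by simp
        then have "ell d ^ n * power_sum d n = (\<Sum>i | i \<le> d \<and> q ^ i \<le> m. ell d ^ n * (lagrange_coeff d i * power_sum d (n - q ^ i)))"
          by (simp add: sum_distrib_left)
        also have "\<dots> = (\<Sum>i | i \<le> d \<and> q ^ i \<le> m. poly (carlitz_poly i) (tt d) * poly (h i) (tt d))"
        proof (rule sum.cong[OF refl])
          fix i assume i: "i \<in> {i. i \<le> d \<and> q ^ i \<le> m}"
          then have iI: "i \<in> I" and id: "i \<le> d" and iq: "q ^ i \<le> n" by (auto simp: I_def m)
          have s: "ell d ^ n = ell d ^ (q ^ i) * ell d ^ (n - q ^ i)" using iq by (simp flip: power_add)
          have "ell d ^ n * (lagrange_coeff d i * power_sum d (n - q ^ i))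
            = (lagrange_coeff d i * ell d ^ (q ^ i)) * (ell d ^ (n - q ^ i) * power_sum d (n - q ^ i))"
            unfolding s by (simp only: mult_ac)
          also have "\<dots> = poly (carlitz_poly i) (tt d) * poly (h i) (tt d)"
            unfolding lagrange_coeff_ell[OF id] h(3)[OF iI] by simp
          finally show "ell d ^ n * (lagrange_coeff d i * power_sum d (n - q ^ i)) = poly (carlitz_poly i) (tt d) * poly (h i) (tt d)" .
        qed
        finally show ?thesis .
      qed
      also have "\<dots> = (\<Sum>i\<in>I. poly (carlitz_poly i) (tt d) * poly (h i) (tt d))"
      proof (rule sum.mono_neutral_left[OF fI])
        show "\<forall>i\<in>I - {i. i \<le> d \<and> q ^ i \<le> m}. poly (carlitz_poly i) (tt d) * poly (h i) (tt d) = 0"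
        proof
          fix i assume "i \<in> I - {i. i \<le> d \<and> q ^ i \<le> m}"
          then have "d < i" by (auto simp: I_def)
          from carlitz_poly_vanish[OF this] show "poly (carlitz_poly i) (tt d) * poly (h i) (tt d) = 0" by simp
        qed
      qed (auto simp: I_def)
      also have "\<dots> = poly H (tt d)" by (simp add: H_def poly_sum)
      finally show ?thesis by (metis ell_nz nonzero_mult_div_cancel_left power_not_zero)
    qed
    ultimately show ?thesis by blast
  qed
qed

end

subsection \<open>Multizeta values in terms of the values of $\psi$ and $\chi$\<close>

context carlitz
begin

definition zvals :: "'a fls set" where "zvals = {zval n k | n k. k * (q - 1) < n * q}"

lemma zval_combination:
  assumes "polyover Kfield P" "degree P * (q - 1) < n * q"
  shows "\<exists>z\<in>spn Kfield zvals. fconv (\<lambda>N. \<Sum>d<N. poly P (tt d) / ell d ^ n) z"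
proof (rule bexI)
  let ?z = "\<Sum>k\<le>degree P. coeff P k * zval n k"
  have k: "k * (q - 1) < n * q" if "k \<le> degree P" for k
    using mult_le_mono1[OF that, of "q - 1"] assms(2) by linarith
  have "(\<Sum>d<N. poly P (tt d) / ell d ^ n) = (\<Sum>k\<le>degree P. coeff P k * zpart n k N)" for N
  proof -
    have "(\<Sum>d<N. poly P (tt d) / ell d ^ n) = (\<Sum>d<N. \<Sum>k\<le>degree P. coeff P k * (theta ^ (k * q ^ d) / ell d ^ n))"
      by (simp add: poly_altdef sum_divide_distrib power_mult[symmetric] mult.commute[of "q ^ _"])
    then show ?thesis by (subst (asm) sum.swap) (simp only: zpart_def sum_distrib_left)
  qed
  moreover have "fconv (\<lambda>N. \<Sum>k\<le>degree P. coeff P k * zpart n k N) ?z"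
    using k by (intro fconv_sum fconv_cmult zpart_conv) auto
  ultimately show "fconv (\<lambda>N. \<Sum>d<N. poly P (tt d) / ell d ^ n) ?z" by (simp only:)
  show "?z \<in> spn Kfield zvals"
    using assms(1) k by (intro spn_sum spn_base) (auto simp: polyover_def zvals_def)
qed

lemma fconv_multizeta: "fconv (\<lambda>N. mz_partial N ns) l \<Longrightarrow> multizeta ns = l"
  unfolding multizeta_def by (rule limI) (rule fconv_LIMSEQ)

lemma multizeta_depth_1:
  assumes "n \<ge> 1" shows "multizeta [n] \<in> spn Kfield zvals"
proof -
  obtain h where h: "polyover Kfield h" "degree h * (q - 1) < n * q"
    "\<And>d. (power_sum d n :: 'a fls) = poly h (tt d) / ell d ^ n" using power_sum_poly[OF assms] by blast
  obtain z where z: "z \<in> spn Kfield zvals" "fconv (\<lambda>N. \<Sum>d<N. poly h (tt d) / ell d ^ n) z"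
    using zval_combination[OF h(1,2)] by blast
  have "fconv (\<lambda>N. mz_partial N [n]) z" using z(2) by (simp add: h(3))
  then show ?thesis using z(1) by (simp add: fconv_multizeta)
qed

lemma power_sum_frobenius: "(power_sum d (n * q ^ j) :: 'a fls) = power_sum d n ^ (q ^ j)"
  by (simp add: power_sum_def frobenius_sum power_mult power_inverse)

lemma mz_partial_frobenius: "(mz_partial N (map (\<lambda>n. n * q ^ j) ns) :: 'a fls) = mz_partial N ns ^ (q ^ j)"
  by (induction ns arbitrary: N) (simp_all add: power_sum_frobenius frobenius_sum power_mult_distrib)

text \<open>The list q - 1, (q - 1) q, ..., (q - 1) q^(k-1).\<close>

primrec tail_indices :: "nat \<Rightarrow> nat list" where
  "tail_indices 0 = []"
| "tail_indices (Suc k) = (q - 1) # map (\<lambda>n. n * q) (tail_indices k)"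

text \<open>For k \<le> D this is ell_D / ell_(D-k)^(q^k). The product form also yields 0 for D < k,
  through the factor \<open>lam 0\<close> at h = D.\<close>

definition tail_product :: "nat \<Rightarrow> nat \<Rightarrow> 'a fls" where
  "tail_product k D = ell D / ell D ^ (q ^ k) * (\<Prod>h<k. lam (D - h) ^ (q ^ k))"

lemma lam_0 [simp]: "lam 0 = 0" by (simp add: lam_def)

lemma lam_power: "lam i ^ (q ^ k) = tt k - tt (i + k)"
  by (simp add: lam_def frobenius_diff power_mult[symmetric] power_add)

lemma tail_product_zero:
  assumes "D < k" shows "tail_product k D = 0"
proof -
  have "(\<Prod>h<k. lam (D - h) ^ (q ^ k)) = 0" using assms q_pos by (intro prod_zero) (auto intro: bexI[of _ D])
  then show ?thesis by (simp add: tail_product_def)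
qed

text \<open>For k \<le> D both terms on the left share a factor; the remaining ones,
  \<open>lam (Suc D)\<close> and theta^(q^(k+1)) - theta^(q^(D+1)), differ by the constant
  \<open>lam (Suc k)\<close>.\<close>

lemma tail_product_telescope: "tail_product (Suc k) (Suc D) - tail_product (Suc k) D = lam (Suc k) * (1 / ell D ^ (q - 1) * tail_product k D ^ q)"
proof (cases "D < k")
  case True
  then show ?thesis using q_pos by (simp add: tail_product_zero)
next
  case False
  define L where "L = ell D"
  define P where "P = (\<Prod>h<k. lam (D - h))"
  define Q where "Q = q ^ Suc k"
  have L: "L \<noteq> 0" by (simp add: L_def)
  have l: "lam (Suc D) \<noteq> 0" by (simp add: lam_nz)
  have "(\<Prod>h<Suc k. lam (Suc D - h) ^ Q) = lam (Suc D) ^ Q * P ^ Q"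
    by (simp only: prod.lessThan_Suc_shift P_def prod_power_distrib diff_Suc_Suc diff_zero)
  then have "tail_product (Suc k) (Suc D) = (L * lam (Suc D)) / (L ^ Q * lam (Suc D) ^ Q) * (lam (Suc D) ^ Q * P ^ Q)"
    by (simp only: tail_product_def Q_def[symmetric] ell_Suc L_def power_mult_distrib)
  also have "\<dots> = L / L ^ Q * P ^ Q * lam (Suc D)" using l by simp
  finally have 1: "tail_product (Suc k) (Suc D) = L / L ^ Q * P ^ Q * lam (Suc D)" .
  have "lam (D - k) ^ Q = tt (Suc k) - tt (Suc D)" using False by (simp add: Q_def lam_power del: power_Suc)
  moreover have "(\<Prod>h<Suc k. lam (D - h) ^ Q) = P ^ Q * lam (D - k) ^ Q"
    by (simp only: prod.lessThan_Suc P_def prod_power_distrib)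
  ultimately have 2: "tail_product (Suc k) D = L / L ^ Q * P ^ Q * (tt (Suc k) - tt (Suc D))"
    by (simp only: tail_product_def Q_def[symmetric] L_def mult.assoc)
  have "tail_product k D ^ q = L ^ q / L ^ Q * P ^ Q"
    by (simp only: tail_product_def L_def P_def Q_def prod_power_distrib[symmetric] power_mult_distrib power_divide power_mult[symmetric] power_Suc2)
  moreover have "L ^ q = L ^ (q - 1) * L" using q_pos by (simp flip: power_Suc2)
  ultimately have "1 / L ^ (q - 1) * tail_product k D ^ q = L / L ^ Q * P ^ Q" using L by simp
  moreover have "x * a - x * b = (a - b) * x" for x a b :: "'a fls" by (simp add: algebra_simps)
  moreover have "lam (Suc D) - (tt (Suc k) - tt (Suc D)) = lam (Suc k)" by (simp add: lam_def)
  ultimately show ?thesis unfolding 1 2 L_def[symmetric] by (simp only:)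
qed

primrec tail_const :: "nat \<Rightarrow> 'a fls" where
  "tail_const 0 = 1"
| "tail_const (Suc k) = tail_const k ^ q / lam (Suc k)"

lemma lam_Kfield: "lam i \<in> Kfield"
  unfolding lam_def by (intro subfield_closed(7,9)[OF subfield_Kfield] theta_Kfield)

lemma tail_const: "tail_const k \<noteq> 0" "tail_const k \<in> Kfield"
proof -
  show "tail_const k \<noteq> 0" by (induction k) (simp_all add: lam_nz)
  show "tail_const k \<in> Kfield"
    by (induction k) (simp_all add: subfield_closed(2,8,9)[OF subfield_Kfield] lam_Kfield)
qed

text \<open>Multiplying all indices by q raises a partial value to the q-th power. The inner sum is
  thus a q-th power of the previous case, and the telescoping identity sums it over the outer
  degree.\<close>

lemma mz_partial_ctail: "mz_partial D (tail_indices k) = tail_const k * tail_product k D"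
proof (induction k arbitrary: D)
  case 0
  then show ?case by (simp add: tail_product_def)
next
  case (Suc k)
  have "mz_partial D (tail_indices (Suc k)) = (\<Sum>e<D. 1 / ell e ^ (q - 1) * (tail_const k * tail_product k e) ^ q)"
    using mz_partial_frobenius[of _ 1] Suc.IH q_ge_3 by (simp add: power_sum_small)
  also have "\<dots> = (\<Sum>e<D. tail_const (Suc k) * (tail_product (Suc k) (Suc e) - tail_product (Suc k) e))"
    by (intro sum.cong refl) (simp add: tail_product_telescope lam_nz power_mult_distrib)
  also have "\<dots> = tail_const (Suc k) * (tail_product (Suc k) D - tail_product (Suc k) 0)"
    by (simp only: sum_distrib_left[symmetric] sum_lessThan_telescope)
  finally show ?case by (simp add: tail_product_zero)
qed

lemma ell_split: "k \<le> e \<Longrightarrow> ell e = ell (e - k) * (\<Prod>h<k. lam (e - h))"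
proof (induction k)
  case (Suc k)
  then have "e - k = Suc (e - Suc k)" by simp
  then have "ell (e - k) = ell (e - Suc k) * lam (e - k)" by (simp only: ell_Suc)
  then show ?case using Suc by (simp add: mult_ac)
qed simp

lemma tail_product_ell: "tail_product k e / ell e = (if k \<le> e then 1 / ell (e - k) ^ (q ^ k) else 0)"
proof (cases "k \<le> e")
  case True
  have "tail_product k e / ell e = (\<Prod>h<k. lam (e - h)) ^ (q ^ k) / ell e ^ (q ^ k)"
    by (simp add: tail_product_def prod_power_distrib)
  moreover have "(\<Prod>h<k. lam (e - h)) \<noteq> 0" using ell_split[OF True] ell_nz[of e] by auto
  ultimately show ?thesis using True by (subst (asm) (2) ell_split[OF True]) (simp add: power_mult_distrib)
qed (simp add: tail_product_zero)

lemma mz_partial_1_ctail: "mz_partial d (1 # tail_indices k) = tail_const k * (\<Sum>e<d - k. 1 / ell e ^ (q ^ k))"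
proof -
  have "mz_partial d (1 # tail_indices k) = tail_const k * (\<Sum>e<d. tail_product k e / ell e)"
    using q_pos by (simp add: power_sum_small mz_partial_ctail sum_distrib_left)
  also have "(\<Sum>e<d. tail_product k e / ell e) = (\<Sum>e\<in>{k..<d}. 1 / ell (e - k) ^ (q ^ k))"
    unfolding tail_product_ell by (intro sum.mono_neutral_cong_right) auto
  also have "\<dots> = (\<Sum>e<d - k. 1 / ell e ^ (q ^ k))"
    by (rule sum.reindex_bij_witness[of _ "\<lambda>e. e + k" "\<lambda>e. e - k"]) auto
  finally show ?thesis .
qed

text \<open>Expresses 1 / ell_(d-i)^Q, for Q = q^(k+j) and i \<le> k, as a polynomial in theta^(q^d)
  divided by ell_d^Q; its factors take the values \<open>lam (d - h)\<close> to the power Q.\<close>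

definition shift_poly :: "nat \<Rightarrow> nat \<Rightarrow> nat \<Rightarrow> 'a fls poly" where
  "shift_poly k j i = (\<Prod>h<i. [:tt (k + j):] - monom 1 (q ^ (k - h + j)))"

lemma shift_poly_value:
  assumes "i \<le> k"
  shows "poly (shift_poly k j i) (tt d) / ell d ^ (q ^ (k + j)) = (if i \<le> d then 1 / ell (d - i) ^ (q ^ (k + j)) else 0)"
proof -
  have f: "tt (k + j) - tt d ^ (q ^ (k - h + j)) = lam (d - h) ^ (q ^ (k + j))" if "h < i" "h \<le> d" for h
  proof -
    have "tt d ^ (q ^ (k - h + j)) = theta ^ (q ^ (d + (k - h + j)))" by (simp add: power_mult[symmetric] power_add)
    moreover have "d + (k - h + j) = d - h + (k + j)" using that assms by simp
    ultimately show ?thesis by (simp add: lam_power)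
  qed
  have P: "poly (shift_poly k j i) (tt d) = (\<Prod>h<i. tt (k + j) - tt d ^ (q ^ (k - h + j)))"
    by (simp add: shift_poly_def poly_prod poly_monom)
  show ?thesis
  proof (cases "i \<le> d")
    case True
    have "poly (shift_poly k j i) (tt d) = (\<Prod>h<i. lam (d - h)) ^ (q ^ (k + j))"
      unfolding P prod_power_distrib using True by (intro prod.cong refl f) auto
    moreover have "(\<Prod>h<i. lam (d - h)) \<noteq> 0" using ell_split[OF True] ell_nz[of d] by auto
    ultimately show ?thesis using True by (simp add: ell_split[OF True] power_mult_distrib)
  next
    case False
    then have "poly (shift_poly k j i) (tt d) = 0"
      unfolding P using f[of d] q_pos by (intro prod_zero) (auto intro!: bexI[of _ d])
    then show ?thesis using False by simp
  qed
qed

lemma upart_shift: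
  assumes "m \<le> k"
  shows "upart (q ^ (k + j)) d - upart (q ^ (k + j)) (d - m) = (\<Sum>i=1..m. poly (shift_poly k j i) (tt d) / ell d ^ (q ^ (k + j)))"
  using assms
proof (induction m)
  case (Suc m)
  have "upart (q ^ (k + j)) (d - m) - upart (q ^ (k + j)) (d - Suc m) = poly (shift_poly k j (Suc m)) (tt d) / ell d ^ (q ^ (k + j))"
  proof (cases "Suc m \<le> d")
    case True
    then have "d - m = Suc (d - Suc m)" by simp
    then show ?thesis using True shift_poly_value[OF Suc.prems, of j d] by (simp add: upart_def)
  qed (use shift_poly_value[OF Suc.prems, of j d] in simp)
  then show ?case using Suc by (simp add: algebra_simps)
qed simp

lemma degree_PP:
  assumes "i \<le> k" shows "degree (shift_poly k j i) * (q - 1) \<le> q * q ^ (k + j)"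
proof -
  have "degree (shift_poly k j i) \<le> (\<Sum>h<i. degree ([:tt (k + j):] - monom 1 (q ^ (k - h + j))))"
    unfolding shift_poly_def using degree_prod_sum_le[of "{..<i}"] by (simp add: o_def)
  also have "\<dots> \<le> (\<Sum>h<i. q ^ (k - h + j))"
    by (intro sum_mono degree_diff_le) (auto simp: degree_monom_eq)
  also have "\<dots> \<le> (\<Sum>h<k. q ^ (k - h + j))" using assms by (intro sum_mono2) auto
  finally have "degree (shift_poly k j i) * (q - 1) \<le> (\<Sum>h<k. q ^ (k - h + j)) * (q - 1)" by (rule mult_le_mono1)
  moreover have "(\<Sum>h<k. q ^ (k - h + j)) * (q - 1) + q * q ^ j = q * q ^ (k + j)"
  proof (induction k)
    case (Suc k)
    have "(\<Sum>h<Suc k. q ^ (Suc k - h + j)) = q ^ (Suc k + j) + (\<Sum>h<k. q ^ (k - h + j))"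
      by (simp add: sum.lessThan_Suc_shift del: sum.lessThan_Suc)
    moreover have "q ^ (Suc k + j) * (q - 1) + q * q ^ (k + j) = q * q ^ (Suc k + j)"
      using q_pos by (cases q) simp_all
    ultimately show ?case using Suc by (simp only: add_mult_distrib)
  qed simp
  ultimately show ?thesis by linarith
qed

text \<open>Raising the inner bound from d - k to d costs only depth one terms: each of the k extra
  summands is a polynomial in theta^(q^d) divided by ell_d^Q.\<close>

lemma xpart_shift:
  "\<exists>z\<in>spn Kfield zvals. fconv (\<lambda>N. \<Sum>d<N. 1 / ell d * upart (q ^ (k + j)) (d - k)) (xval (q ^ (k + j)) - z)"
proof -
  let ?Q = "q ^ (k + j)"
  define P where "P = (\<Sum>i=1..k. shift_poly k j i)"
  have "polyover Kfield (shift_poly k j i)" for i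
  proof -
    note K = subfield_Kfield
    have t: "tt (k + j) \<in> Kfield" by (intro subfield_closed(9)[OF K] theta_Kfield)
    have "polyover Kfield (\<Prod>h\<in>S. [:tt (k + j):] - monom 1 (q ^ (k - h + j)))" if "finite S" for S
      using that by (induction S rule: finite_induct)
        (simp_all add: polyover_mult[OF K] polyover_diff[OF K] polyover_const[OF K] polyover_monom[OF K] polyover_1[OF K] subfield_closed(2)[OF K] t)
    then show ?thesis by (simp add: shift_poly_def)
  qed
  then have P1: "polyover Kfield P" unfolding P_def by (intro polyover_sum[OF subfield_Kfield])
  have "degree (shift_poly k j i) \<le> (q * ?Q) div (q - 1)" if "i \<le> k" for i
    using degree_PP[OF that, of j] q_pos by (simp add: less_eq_div_iff_mult_less_eq)
  then have "degree P \<le> (q * ?Q) div (q - 1)" unfolding P_def by (intro degree_sum_le) auto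
  then have "degree P * (q - 1) \<le> q * ?Q" using q_pos by (simp add: less_eq_div_iff_mult_less_eq)
  also have "\<dots> < (1 + ?Q) * q" using q_pos by (simp add: algebra_simps)
  finally obtain z where z: "z \<in> spn Kfield zvals" "fconv (\<lambda>N. \<Sum>d<N. poly P (tt d) / ell d ^ (1 + ?Q)) z"
    using zval_combination[OF P1] by blast
  have "1 / ell d * upart ?Q (d - k) = 1 / ell d * upart ?Q d - poly P (tt d) / ell d ^ (1 + ?Q)" for d
  proof -
    have "poly P (tt d) / ell d ^ ?Q = upart ?Q d - upart ?Q (d - k)"
      by (simp add: upart_shift P_def poly_sum sum_divide_distrib)
    then have "upart ?Q (d - k) = upart ?Q d - poly P (tt d) / ell d ^ ?Q" by simp
    then show ?thesis by (simp add: right_diff_distrib)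
  qed
  then have "(\<Sum>d<N. 1 / ell d * upart ?Q (d - k)) = xpart ?Q N - (\<Sum>d<N. poly P (tt d) / ell d ^ (1 + ?Q))" for N
    by (simp only: xpart_def sum_subtractf)
  then show ?thesis using fconv_diff[OF xpart_conv z(2)] z(1) by auto
qed

text \<open>With P = q^j the indices are 1, P, (q-1)P, ..., (q-1)q^(k-1)P; the inner nested sum is a
  P-th power. The depth depends on k alone, so j can vary.\<close>

theorem multizeta_xval:
  "\<exists>ns c z. length ns = k + 2 \<and> (\<forall>n\<in>set ns. n \<ge> 1) \<and> c \<in> Kfield \<and> c \<noteq> 0 \<and> z \<in> spn Kfield zvals \<and>
    multizeta ns = c * (xval (q ^ (k + j)) - z)"
proof -
  define ns where "ns = 1 # map (\<lambda>n. n * q ^ j) (1 # tail_indices k)"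
  define c where "c = tail_const k ^ (q ^ j)"
  have "length (tail_indices k) = k" by (induction k) auto
  then have "length ns = k + 2" by (simp add: ns_def)
  moreover have "\<forall>n\<in>set ns. n \<ge> 1"
  proof -
    have "\<forall>n\<in>set (tail_indices k). n \<ge> 1" using q_ge_3 by (induction k) auto
    then show ?thesis using q_pos by (auto simp: ns_def)
  qed
  moreover have "c \<in> Kfield" "c \<noteq> 0" unfolding c_def using tail_const subfield_closed(9)[OF subfield_Kfield] by auto
  moreover obtain z where z: "z \<in> spn Kfield zvals"
    "fconv (\<lambda>N. \<Sum>d<N. 1 / ell d * upart (q ^ (k + j)) (d - k)) (xval (q ^ (k + j)) - z)"
    using xpart_shift by blast
  have "mz_partial N ns = c * (\<Sum>d<N. 1 / ell d * upart (q ^ (k + j)) (d - k))" for N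
  proof -
    have "mz_partial d (map (\<lambda>n. n * q ^ j) (1 # tail_indices k)) = c * upart (q ^ (k + j)) (d - k)" for d
      unfolding mz_partial_frobenius mz_partial_1_ctail
      by (simp add: c_def upart_def power_mult_distrib frobenius_sum power_one_over power_mult[symmetric] power_add)
    then have "mz_partial N ns = (\<Sum>d<N. 1 / ell d * (c * upart (q ^ (k + j)) (d - k)))"
      using q_pos unfolding ns_def by (simp only: mz_partial.simps power_sum_small[of 1] power_one_right) 
    then show ?thesis by (simp add: sum_distrib_left mult_ac)
  qed
  then have "multizeta ns = c * (xval (q ^ (k + j)) - z)"
    using fconv_cmult[OF z(2), of c] by (intro fconv_multizeta) simp
  ultimately show ?thesis using z(1) by blast
qed

end

subsection \<open>Algebraic independence\<close>

lemma gen_field_finite_subset: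
  assumes "x \<in> gen_field (A \<union> B)" shows "\<exists>B0\<subseteq>B. finite B0 \<and> x \<in> gen_field (A \<union> B0)"
proof -
  define F where "F = {x. \<exists>B0\<subseteq>B. finite B0 \<and> x \<in> gen_field (A \<union> B0)}"
  note G = is_subfield_gen_field
  have FI: "x \<in> F" if "B0 \<subseteq> B" "finite B0" "x \<in> gen_field (A \<union> B0)" for B0 x
    unfolding F_def using that by blast
  have "is_subfield F"
    unfolding is_subfield_def
  proof (intro conjI ballI)
    show "0 \<in> F" "1 \<in> F" by (rule FI[of "{}"], auto intro: subfield_closed(1,2)[OF G])+
  next
    fix x y assume "x \<in> F" "y \<in> F"
    then obtain X Y where XY: "X \<subseteq> B" "finite X" "x \<in> gen_field (A \<union> X)" "Y \<subseteq> B" "finite Y" "y \<in> gen_field (A \<union> Y)"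
      by (auto simp: F_def)
    have "x \<in> gen_field (A \<union> (X \<union> Y))" "y \<in> gen_field (A \<union> (X \<union> Y))"
      using XY(3,6) gen_field_mono[of "A \<union> X" "A \<union> (X \<union> Y)"] gen_field_mono[of "A \<union> Y" "A \<union> (X \<union> Y)"] by blast+
    from subfield_closed(3,4)[OF G this]
    have "x + y \<in> gen_field (A \<union> (X \<union> Y))" "x * y \<in> gen_field (A \<union> (X \<union> Y))" .
    moreover have "X \<union> Y \<subseteq> B" "finite (X \<union> Y)" using XY by auto
    ultimately show "x + y \<in> F" "x * y \<in> F" using FI[of "X \<union> Y"] by blast+
  next
    fix x assume "x \<in> F"
    then obtain X where X: "X \<subseteq> B" "finite X" "x \<in> gen_field (A \<union> X)" by (auto simp: F_def)
    show "- x \<in> F" "inverse x \<in> F"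
      using X(1,2) subfield_closed(5,6)[OF G X(3)] FI[of X] by blast+
  qed
  moreover have "A \<union> B \<subseteq> F"
  proof
    fix x assume "x \<in> A \<union> B"
    then have "x \<in> gen_field (A \<union> (B \<inter> {x}))" using gen_field_superset[of "A \<union> (B \<inter> {x})"] by blast
    then show "x \<in> F" by (intro FI[of "B \<inter> {x}"]) auto
  qed
  ultimately show ?thesis using gen_field_least[of F "A \<union> B"] assms by (auto simp: F_def)
qed

lemma transcendental_over_finite_support:
  assumes "\<And>B0. B0 \<subseteq> B \<Longrightarrow> finite B0 \<Longrightarrow> transcendental_over (gen_field (A \<union> B0)) x"
  shows "transcendental_over (gen_field (A \<union> B)) x"
  unfolding transcendental_over_def
proof (intro allI impI)
  fix p assume p: "polyover (gen_field (A \<union> B)) p" "poly p x = 0"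
  have "\<forall>i. \<exists>B0. B0 \<subseteq> B \<and> finite B0 \<and> coeff p i \<in> gen_field (A \<union> B0)"
    using p(1) gen_field_finite_subset unfolding polyover_def by metis
  then obtain b where b: "\<And>i. b i \<subseteq> B" "\<And>i. finite (b i)" "\<And>i. coeff p i \<in> gen_field (A \<union> b i)" by metis
  define B0 where "B0 = (\<Union>i\<le>degree p. b i)"
  have "coeff p i \<in> gen_field (A \<union> B0)" for i
  proof (cases "i \<le> degree p")
    case True
    then have "A \<union> b i \<subseteq> A \<union> B0" by (auto simp: B0_def)
    then show ?thesis using b(3)[of i] gen_field_mono by blast
  qed (simp add: coeff_eq_0 subfield_closed(1)[OF is_subfield_gen_field])
  then have "polyover (gen_field (A \<union> B0)) p" by (simp add: polyover_def)
  moreover have "transcendental_over (gen_field (A \<union> B0)) x" using b(1,2) by (intro assms) (auto simp: B0_def)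
  ultimately show "p = 0" using p(2) unfolding transcendental_over_def by blast
qed

lemma transcendental_over_affine:
  assumes F: "is_subfield F" and t: "transcendental_over F t" and c: "c \<in> F" "c \<noteq> 0" "z \<in> F"
  shows "transcendental_over F (c * (t - z))"
  unfolding transcendental_over_def
proof (intro allI impI)
  fix p assume p: "polyover F p" "poly p (c * (t - z)) = 0"
  let ?r = "[:- (c * z), c:]"
  have "polyover F ?r" using c by (intro polyover_pCons[OF F] polyover_0[OF F] subfield_closed[OF F])
  then have "polyover F (pcompose p ?r)" using p(1) by (rule polyover_pcompose[OF F, rotated])
  moreover have "poly (pcompose p ?r) t = 0" using p(2) by (simp add: poly_pcompose algebra_simps)
  ultimately have "pcompose p ?r = 0" using t by (auto simp: transcendental_over_def)
  then show "p = 0" by (rule pcompose_eq_0) (use c in simp)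
qed

text \<open>Grouping monomials by the exponent of y gives a polynomial in y over the field generated
  by \<open>F\<close> and \<open>xs\<close>. It must be zero, and each of its coefficients is a
  relation between the \<open>xs\<close>.\<close>

lemma alg_indep_over_snoc:
  assumes xs: "alg_indep_over F xs" and F: "is_subfield F"
    and y: "transcendental_over (gen_field (F \<union> set xs)) y"
  shows "alg_indep_over F (xs @ [y])"
  unfolding alg_indep_over_def
proof (intro allI impI)
  fix M :: "(nat \<Rightarrow> nat) set" and c
  let ?n = "length xs" and ?G = "gen_field (F \<union> set xs)"
  assume M: "finite M" and supp: "\<forall>e\<in>M. \<forall>i\<ge>length (xs @ [y]). e i = 0" and cF: "\<forall>e\<in>M. c e \<in> F"
    and rel: "(\<Sum>e\<in>M. c e * (\<Prod>i<length (xs @ [y]). (xs @ [y]) ! i ^ e i)) = 0"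

  define w where "w = (\<lambda>e. \<Prod>i<?n. xs ! i ^ e i)"
  note G = is_subfield_gen_field[of "F \<union> set xs"]
  have sup: "F \<union> set xs \<subseteq> ?G" by (rule gen_field_superset)
  then have FG: "F \<subseteq> ?G" by simp
  have wG: "w e \<in> ?G" for e
    unfolding w_def
  proof (intro subfield_closed(9,12)[OF G])
    fix i assume "i \<in> {..<?n}"
    then have "xs ! i \<in> set xs" by simp
    then show "xs ! i \<in> ?G" using sup by blast
  qed
  define p where "p = (\<Sum>e\<in>M. monom (c e * w e) (e ?n))"
  have "(\<Prod>i<length (xs @ [y]). (xs @ [y]) ! i ^ e i) = w e * y ^ e ?n" for e
    by (simp add: w_def nth_append)
  then have "poly p y = 0" using rel by (simp only: p_def poly_sum poly_monom mult.assoc)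
  moreover have "polyover ?G p" unfolding p_def
  proof (intro polyover_sum[OF G] polyover_monom[OF G] subfield_closed(4)[OF G] wG)
    fix e assume "e \<in> M"
    then show "c e \<in> ?G" using cF FG by blast
  qed
  ultimately have p0: "p = 0" using y unfolding transcendental_over_def by blast
  show "\<forall>e\<in>M. c e = 0"
  proof
    fix e0 assume e0: "e0 \<in> M"
    define k where "k = e0 ?n"
    define M' where "M' = {e\<in>M. e ?n = k}"
    \<comment> \<open>\<open>r\<close> sets the last exponent to 0, which makes the group a relation
      in the variables of \<open>xs\<close>; \<open>s\<close> inverts it on
      \<open>M'\<close>.\<close>
    define r where "r = (\<lambda>e. e(?n := (0 :: nat)))"
    define s where "s = (\<lambda>e. e(?n := k))"
    have sr: "s (r e) = e" if "e \<in> M'" for e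
    proof -
      have "e ?n = k" using that by (simp add: M'_def)
      then show ?thesis unfolding s_def r_def fun_upd_upd by (metis fun_upd_triv)
    qed
    have inj: "inj_on r M'" by (rule inj_on_inverseI[of _ s]) (rule sr)
    have fM': "finite M'" using M by (simp add: M'_def)
    have "(\<Sum>e\<in>r ` M'. c (s e) * (\<Prod>i<?n. xs ! i ^ e i)) = (\<Sum>e\<in>M'. c e * w e)"
      unfolding sum.reindex[OF inj] o_def
    proof (rule sum.cong[OF refl])
      fix e assume "e \<in> M'"
      moreover have "(\<Prod>i<?n. xs ! i ^ r e i) = w e" unfolding w_def r_def by (intro prod.cong) auto
      ultimately show "c (s (r e)) * (\<Prod>i<?n. xs ! i ^ r e i) = c e * w e" by (simp only: sr)
    qed
    also have "\<dots> = coeff p k"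
      unfolding p_def coeff_sum M'_def sum.inter_filter[OF M] by (intro sum.cong) simp_all
    also have "\<dots> = 0" using p0 by simp
    finally have A3: "(\<Sum>e\<in>r ` M'. c (s e) * (\<Prod>i<?n. xs ! i ^ e i)) = 0" .
    have A1: "\<forall>e\<in>r ` M'. \<forall>i\<ge>?n. e i = 0"
    proof (intro ballI allI impI)
      fix e i assume "e \<in> r ` M'" and i: "?n \<le> i"
      then obtain e' where e': "e = r e'" "e' \<in> M" by (auto simp: M'_def)
      show "e i = 0"
      proof (cases "i = ?n")
        case False
        then have "i \<ge> length (xs @ [y])" using i by simp
        then show ?thesis using supp e' False by (simp add: r_def)
      qed (simp add: e'(1) r_def)
    qed
    have A2: "\<forall>e\<in>r ` M'. c (s e) \<in> F"
    proof (rule ballI, erule imageE)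
      fix e e' assume "e = r e'" "e' \<in> M'"
      then show "c (s e) \<in> F" using sr[of e'] cF by (simp add: M'_def)
    qed
    have "\<forall>e\<in>r ` M'. c (s e) = 0"
      by (rule xs[unfolded alg_indep_over_def, THEN spec, THEN spec, THEN mp, OF finite_imageI[OF fM'],
            THEN mp, OF A1, THEN mp, OF A2, THEN mp, OF A3])
    moreover have e0': "e0 \<in> M'" using e0 by (simp add: M'_def k_def)
    ultimately have "c (s (r e0)) = 0" by (rule bspec[OF _ imageI])
    then show "c e0 = 0" by (simp only: sr[OF e0'])
  qed
qed

lemma alg_indep_over_Nil: "alg_indep_over F []"
  unfolding alg_indep_over_def
proof (intro allI impI ballI)
  fix M :: "(nat \<Rightarrow> nat) set" and c :: "(nat \<Rightarrow> nat) \<Rightarrow> 'a" and e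
  assume M: "\<forall>e\<in>M. \<forall>i\<ge>length ([] :: 'a list). e i = 0" and e: "e \<in> M"
    and s: "(\<Sum>e\<in>M. c e * (\<Prod>i<length []. [] ! i ^ e i)) = 0"
  have "e' = (\<lambda>_. 0)" if "e' \<in> M" for e' using M that by (simp add: fun_eq_iff)
  then have "e' = e" if "e' \<in> M" for e' using that e by metis
  then have "M = {e}" using e by blast
  then show "c e = 0" using s by simp
qed

lemma alg_indep_over_sequence:
  assumes F: "is_subfield F"
  shows "(\<And>i. i < n \<Longrightarrow> transcendental_over (gen_field (F \<union> y ` {..<i})) (y i)) \<Longrightarrow>
    alg_indep_over F (map y [0..<n])"
proof (induction n)
  case (Suc n)
  have "alg_indep_over F (map y [0..<n] @ [y n])"
    by (rule alg_indep_over_snoc[OF Suc.IH F]) (use Suc.prems in \<open>auto simp: atLeast0LessThan\<close>)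
  then show ?case by simp
qed (simp add: alg_indep_over_Nil)

subsection \<open>Transcendence of the depth two values\<close>

context carlitz
begin

lemma spn_Ob_mono:
  assumes "x \<in> spn (Ob (int C * int (q ^ N))) S" "C \<le> C'" "S \<subseteq> S'"
  shows "x \<in> spn (Ob (int C' * int (q ^ N))) S'"
  using assms(1)
proof (rule spn_mono)
  have "int C * int (q ^ N) \<le> int C' * int (q ^ N)" using assms(2) by (intro mult_right_mono) auto
  then show "Ob (int C * int (q ^ N)) \<subseteq> Ob (int C' * int (q ^ N))" by (auto intro: Ob_mono)
qed (fact assms(3))

lemma Ob_ell_ratio: "d \<le> N \<Longrightarrow> (ell N / ell d) ^ n \<in> Ob (int (n * q) * int (q ^ N))"
  using Ob_power[OF Ob_ell_quotient, of d N n] by (simp add: mult.assoc)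

lemma Ob_ell_power: "ell N ^ n \<in> Ob (int (n * q) * int (q ^ N))"
  using Ob_ell_ratio[of 0 N n] by simp

text \<open>The factor ell_N^n clears every denominator of the partial sum, at the price of degrees
  O(q^N).\<close>

lemma evN_psi_span:
  assumes k: "k * (q - 1) < n * q" and N: "N \<ge> 1"
  shows "evN N (psi n k) \<in> spn (Ob (int (n * q + k) * int (q ^ N))) {1, zval n k}"
proof -
  let ?O = "Ob (int (n * q + k) * int (q ^ N))"
  have "ell N ^ n * zpart n k N \<in> ?O"
    unfolding zpart_def sum_distrib_left
  proof (rule Ob_sum)
    fix d assume d: "d \<in> {..<N}"
    then have "int k * int (q ^ d) \<le> int k * int (q ^ N)"
      using q_pos by (intro mult_left_mono of_nat_mono power_increasing) auto
    then have "theta ^ (k * q ^ d) \<in> Ob (int k * int (q ^ N))" by (intro Ob_theta_power) simp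
    from Ob_mult[OF this Ob_ell_ratio[of d N n]]
    have "theta ^ (k * q ^ d) * (ell N / ell d) ^ n \<in> ?O" using d by (simp add: distrib_right add.commute)
    then show "ell N ^ n * (theta ^ (k * q ^ d) / ell d ^ n) \<in> ?O" by (simp add: power_divide mult.commute)
  qed
  moreover have "ell N ^ n \<in> ?O" using Ob_ell_power by (rule Ob_mono) (simp add: distrib_right)
  ultimately have "ell N ^ n * zval n k + (- (ell N ^ n * zpart n k N)) * 1 \<in> spn ?O {1, zval n k}"
    by (intro spn_add spn_base Ob_uminus) auto
  then show ?thesis unfolding ev_psi[OF k N] by (simp add: right_diff_distrib)
qed

lemma evN_chi_span:
  assumes N: "N \<ge> 1"
  shows "evN N (chi Q) \<in> spn (Ob (int ((1 + Q) * q) * int (q ^ N))) {1, zval 1 0, xval Q}"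
proof -
  let ?O = "Ob (int ((1 + Q) * q) * int (q ^ N))" and ?L = "ell N ^ (1 + Q)"
  have r: "(ell N / ell d) * (ell N / ell e) ^ Q \<in> ?O" if "d \<le> N" "e \<le> N" for d e
    using Ob_mult[OF Ob_ell_ratio[OF that(1), of 1] Ob_ell_ratio[OF that(2), of Q]]
    by (simp add: algebra_simps)
  have "?L * upart Q N \<in> ?O"
    unfolding upart_def sum_distrib_left
  proof (rule Ob_sum)
    fix e assume "e \<in> {..<N}"
    then show "?L * (1 / ell e ^ Q) \<in> ?O" using r[of 0 e] by (simp add: power_divide)
  qed
  moreover have "?L * wpart Q N \<in> ?O"
    unfolding wpart_def zpart_def sum_distrib_left
  proof (intro Ob_sum)
    fix e d assume "e \<in> {..<N}" "d \<in> {..<Suc e}"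
    then show "?L * (1 / ell e ^ Q * (theta ^ (0 * q ^ d) / ell d ^ 1)) \<in> ?O"
      using r[of d e] by (simp add: power_divide mult_ac)
  qed
  moreover have "?L \<in> ?O" by (rule Ob_ell_power)
  ultimately have "?L * xval Q + ((- (?L * upart Q N)) * zval 1 0 + (?L * wpart Q N) * 1) \<in> spn ?O {1, zval 1 0, xval Q}"
    by (intro spn_add spn_base Ob_uminus) auto
  then show ?thesis unfolding ev_chi[OF N] by (simp add: algebra_simps)
qed

lemma ell_Kfield: "ell N \<in> Kfield"
  unfolding ell_def by (intro subfield_closed(12)[OF subfield_Kfield] lam_Kfield)

lemma zpart_Kfield: "zpart n k N \<in> Kfield" and upart_Kfield: "upart Q N \<in> Kfield"
  unfolding zpart_def upart_def
  by (intro subfield_closed(2,8,9,11)[OF subfield_Kfield] theta_Kfield ell_Kfield)+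

lemma wpart_Kfield: "wpart Q N \<in> Kfield"
  unfolding wpart_def
  by (intro subfield_closed(2,4,8,9,11)[OF subfield_Kfield] zpart_Kfield ell_Kfield)

lemma inverse_cancel: "L \<noteq> 0 \<Longrightarrow> inverse L * (L * c) = (c :: 'b::field)"
  by (simp flip: mult.assoc)

lemma zval_span:
  assumes k: "k * (q - 1) < n * q" and N: "N \<ge> 1"
  shows "zval n k \<in> spn Kfield {1, evN N (psi n k)}"
proof -
  note K = subfield_closed[OF subfield_Kfield]
  have "inverse (ell N ^ n) * evN N (psi n k) + zpart n k N * 1 \<in> spn Kfield {1, evN N (psi n k)}"
    by (intro spn_add spn_base K(6,9) ell_Kfield zpart_Kfield) auto
  moreover have "inverse (ell N ^ n) * evN N (psi n k) + zpart n k N * 1 = zval n k"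
    unfolding ev_psi[OF k N] by (subst inverse_cancel) simp_all
  ultimately show ?thesis by (simp only:)
qed

lemma xval_span:
  assumes N: "N \<ge> 1"
  shows "xval Q \<in> spn Kfield {1, evN N (psi 1 0), evN N (chi Q)}"
proof -
  note K = subfield_closed[OF subfield_Kfield]
  let ?S = "spn Kfield {1, evN N (psi 1 0), evN N (chi Q)}"
  have "zval 1 0 \<in> ?S"
    using zval_span[of 0 1, OF _ N] q_pos by (auto elim: spn_mono)
  then have "upart Q N * zval 1 0 \<in> ?S" by (rule spn_subfield_scale[OF subfield_Kfield _ upart_Kfield])
  moreover have "inverse (ell N ^ (1 + Q)) * evN N (chi Q) \<in> ?S" "(- wpart Q N) * 1 \<in> ?S"
    by (intro spn_base K(5,6,9) ell_Kfield wpart_Kfield; simp)+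
  ultimately have "inverse (ell N ^ (1 + Q)) * evN N (chi Q) + (upart Q N * zval 1 0 + (- wpart Q N) * 1) \<in> ?S"
    by (intro spn_add)
  moreover have "inverse (ell N ^ (1 + Q)) * evN N (chi Q) + (upart Q N * zval 1 0 + (- wpart Q N) * 1) = xval Q"
    unfolding ev_chi[OF N] by (subst inverse_cancel) simp_all
  ultimately show ?thesis by (simp only:)
qed

text \<open>The pair (1, 0) has to be present because the values of the functions chi involve
  \<open>zval 1 0\<close>.\<close>

lemma xval_transcendental_finite:
  assumes I: "finite I" "\<And>n k. (n, k) \<in> I \<Longrightarrow> k * (q - 1) < n * q" "(1, 0) \<in> I"
  shows "transcendental_over (gen_field (Kfield \<union> ((\<lambda>(n, k). zval n k) ` I \<union> (\<lambda>j. xval (q ^ Suc j)) ` {..<m})))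
    (xval (q ^ Suc m))"
proof -
  define \<Gamma> :: "(nat \<times> nat + nat) set" where "\<Gamma> = Inl ` I \<union> Inr ` {..<m}"
  define u where "u = case_sum (\<lambda>(n, k). psi n k) (\<lambda>j. chi (q ^ Suc j))"
  define z where "z = case_sum (\<lambda>(n, k). zval n k) (\<lambda>j. xval (q ^ Suc j))"
  \<comment> \<open>\<open>c\<close> and \<open>D\<close> are crude upper bounds: sums in place of
    maxima over the finitely many indices.\<close>
  define c where "c = int (\<Sum>p\<in>I. snd p)"
  define D where "D = (\<Sum>p\<in>I. fst p * q + snd p) + (\<Sum>j<Suc m. (1 + q ^ Suc j) * q)"
  have fin: "finite \<Gamma>" using I(1) by (simp add: \<Gamma>_def)
  have c0: "c \<ge> 0" unfolding c_def by (rule of_nat_0_le_iff)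
  have D1: "n * q + k \<le> D" "int k \<le> c" if "(n, k) \<in> I" for n k
  proof -
    have "fst (n, k) * q + snd (n, k) \<le> (\<Sum>p\<in>I. fst p * q + snd p)" using I(1) that by (intro member_le_sum) auto
    then show "n * q + k \<le> D" by (simp add: D_def)
    have "snd (n, k) \<le> (\<Sum>p\<in>I. snd p)" using I(1) that by (intro member_le_sum) auto
    then show "int k \<le> c" unfolding c_def by (simp only: snd_conv of_nat_le_iff)
  qed
  have D2: "(1 + q ^ Suc j) * q \<le> D" if "j \<le> m" for j
  proof -
    have "(1 + q ^ Suc j) * q \<le> (\<Sum>j<Suc m. (1 + q ^ Suc j) * q)" using that by (intro member_le_sum) auto
    then show ?thesis by (simp add: D_def)
  qed
  have z1: "zval 1 0 \<in> z ` \<Gamma>"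
    by (rule image_eqI[of _ _ "Inl (1, 0)"]) (use I(3) in \<open>auto simp: z_def \<Gamma>_def\<close>)
  have u1: "psi 1 0 \<in> u ` \<Gamma>"
    by (rule image_eqI[of _ _ "Inl (1, 0)"]) (use I(3) in \<open>auto simp: u_def \<Gamma>_def\<close>)
  have cases: "(\<exists>n k. (n, k) \<in> I \<and> u \<gamma> = psi n k \<and> z \<gamma> = zval n k) \<or> (\<exists>j<m. u \<gamma> = chi (q ^ Suc j) \<and> z \<gamma> = xval (q ^ Suc j))"
    if "\<gamma> \<in> \<Gamma>" for \<gamma>
    using that by (auto simp: \<Gamma>_def u_def z_def split: sum.splits)
  have "transcendental_over (gen_field (Kfield \<union> z ` \<Gamma>)) (xval (q ^ Suc m))"
  proof (rule value_transcendental[where u = u and c = c and C = D and X = "chi (q ^ Suc m)"])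
    show "finite \<Gamma>" "c \<ge> 0" by (fact fin c0)+
    show "CC c (chi (q ^ Suc m))" by (rule CC_mono[OF chi(1) c0])
  next
    fix \<gamma> assume \<gamma>: "\<gamma> \<in> \<Gamma>"
    show "CC c (u \<gamma>)"
      using cases[OF \<gamma>]
    proof (elim disjE exE conjE)
      fix n k assume "(n, k) \<in> I" "u \<gamma> = psi n k"
      then show ?thesis using psi(1)[OF I(2)] D1(2) CC_mono by metis
    next
      fix j assume "u \<gamma> = chi (q ^ Suc j)"
      moreover have "CC c (chi (q ^ Suc j))" by (rule CC_mono[OF chi(1) c0])
      ultimately show ?thesis by (simp only:)
    qed
  next
    fix N :: nat and \<gamma> assume N: "N \<ge> 1" and \<gamma>: "\<gamma> \<in> \<Gamma>"
    have z\<gamma>: "z \<gamma> \<in> z ` \<Gamma>" using \<gamma> by (rule imageI)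
    have u\<gamma>: "evN N (u \<gamma>) \<in> evN N ` u ` \<Gamma>" using \<gamma> by (intro imageI)
    show "evN N (u \<gamma>) \<in> spn (Ob (int D * int (q ^ N))) (insert 1 (insert (xval (q ^ Suc m)) (z ` \<Gamma>)))"
      using cases[OF \<gamma>]
    proof (elim disjE exE conjE)
      fix n k assume nk: "(n, k) \<in> I" "u \<gamma> = psi n k" "z \<gamma> = zval n k"
      show ?thesis unfolding nk(2)
        by (rule spn_Ob_mono[OF evN_psi_span[OF I(2)[OF nk(1)] N] D1(1)[OF nk(1)]]) (use z\<gamma> nk(3) in auto)
    next
      fix j assume j: "j < m" "u \<gamma> = chi (q ^ Suc j)" "z \<gamma> = xval (q ^ Suc j)"
      show ?thesis unfolding j(2)
        by (rule spn_Ob_mono[OF evN_chi_span[OF N] D2]) (use z\<gamma> z1 j(1,3) in \<open>auto simp del: power_Suc\<close>)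
    qed
    show "z \<gamma> \<in> spn Kfield (insert 1 (evN N ` u ` \<Gamma>))"
      using cases[OF \<gamma>]
    proof (elim disjE exE conjE)
      fix n k assume nk: "(n, k) \<in> I" "u \<gamma> = psi n k" "z \<gamma> = zval n k"
      show ?thesis unfolding nk(3)
        by (rule spn_mono[OF zval_span[OF I(2)[OF nk(1)] N] subset_refl]) (use u\<gamma> nk(2) in auto)
    next
      fix j assume j: "u \<gamma> = chi (q ^ Suc j)" "z \<gamma> = xval (q ^ Suc j)"
      have "evN N (psi 1 0) \<in> evN N ` u ` \<Gamma>" using u1 by (rule imageI)
      then show ?thesis unfolding j(2)
        by (intro spn_mono[OF xval_span[OF N] subset_refl]) (use u\<gamma> j(1) in \<open>auto simp del: power_Suc\<close>)
    qed
  next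
    fix N :: nat assume N: "N \<ge> 1"
    show "evN N (chi (q ^ Suc m)) \<in> spn (Ob (int D * int (q ^ N))) (insert 1 (insert (xval (q ^ Suc m)) (z ` \<Gamma>)))"
      by (rule spn_Ob_mono[OF evN_chi_span[OF N] D2[OF order_refl]]) (use z1 in auto)
  next
    show "transcendental_over (gen_field (range konst \<union> {xx} \<union> u ` \<Gamma>)) (chi (q ^ Suc m))"
    proof (rule chi_transcendental)
      have "u ` \<Gamma> \<subseteq> {psi n k | n k. k * (q - 1) < n * q} \<union> (\<lambda>j. chi (q ^ Suc j)) ` {..<m}"
        using cases I(2) by fastforce
      then show "range konst \<union> {xx} \<union> u ` \<Gamma> \<subseteq> range konst \<union> {xx} \<union> {psi n k |n k. k * (q - 1) < n * q} \<union> (\<lambda>j. chi (q ^ Suc j)) ` {..<m}"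
        by blast
    qed
  qed
  moreover have "z ` \<Gamma> = (\<lambda>(n, k). zval n k) ` I \<union> (\<lambda>j. xval (q ^ Suc j)) ` {..<m}"
    by (simp add: \<Gamma>_def z_def image_Un image_image)
  ultimately show ?thesis by (simp only:)
qed

lemma xval_transcendental:
  "transcendental_over (gen_field ((Kfield \<union> (\<lambda>j. xval (q ^ Suc j)) ` {..<m}) \<union> zvals)) (xval (q ^ Suc m))"
proof (rule transcendental_over_finite_support)
  fix B assume B: "B \<subseteq> zvals" "finite B"
  have "\<forall>b\<in>B. \<exists>p. b = (\<lambda>(n, k). zval n k) p \<and> snd p * (q - 1) < fst p * q"
    using B(1) by (auto simp: zvals_def)
  then obtain g where g: "\<And>b. b \<in> B \<Longrightarrow> b = (\<lambda>(n, k). zval n k) (g b)" "\<And>b. b \<in> B \<Longrightarrow> snd (g b) * (q - 1) < fst (g b) * q"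
    by metis
  define I where "I = insert (1, 0) (g ` B)"
  have "B \<subseteq> (\<lambda>(n, k). zval n k) ` I"
  proof
    fix b assume b: "b \<in> B"
    then have "g b \<in> I" by (simp add: I_def)
    from imageI[OF this, of "\<lambda>(n, k). zval n k"] show "b \<in> (\<lambda>(n, k). zval n k) ` I" by (simp only: g(1)[OF b, symmetric])
  qed
  moreover have "finite I" using B(2) by (simp add: I_def)
  moreover have "k * (q - 1) < n * q" if "(n, k) \<in> I" for n k
    using that g(2) q_pos by (auto simp: I_def) (metis fst_conv snd_conv)
  ultimately show "transcendental_over (gen_field ((Kfield \<union> (\<lambda>j. xval (q ^ Suc j)) ` {..<m}) \<union> B)) (xval (q ^ Suc m))"
    by (intro transcendental_over_mono[OF xval_transcendental_finite[of I m]] gen_field_mono) (auto simp: I_def)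
qed

theorem multizeta_infinite_trdeg: "infinite_trdeg (K_gen (k + 2)) (K_gen 1 :: 'a fls set)"
  unfolding infinite_trdeg_def
proof
  fix n
  define \<Phi> where "\<Phi> = (\<lambda>i ns c z. length ns = k + 2 \<and> (\<forall>n\<in>set ns. n \<ge> 1) \<and> c \<in> Kfield \<and> c \<noteq> 0 \<and> z \<in> spn Kfield zvals \<and>
    multizeta ns = c * (xval (q ^ Suc (k + i)) - z))"
  \<comment> \<open>The choice j = i + 1 gives the exponent Q = q^(k + i + 1), distinct for distinct
    i.\<close>
  have "\<exists>ns c z. \<Phi> i ns c z" for i using multizeta_xval[of k "Suc i"] unfolding \<Phi>_def by simp
  then obtain ns c z where *: "\<And>i. \<Phi> i (ns i) (c i) (z i)" by metis
  have ns: "length (ns i) = k + 2" "\<forall>n\<in>set (ns i). n \<ge> 1" and c: "c i \<in> Kfield" "c i \<noteq> 0"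
    and z: "z i \<in> spn Kfield zvals" and v: "multizeta (ns i) = c i * (xval (q ^ Suc (k + i)) - z i)" for i
    using *[of i] unfolding \<Phi>_def by simp_all
  define y where "y = (\<lambda>i. multizeta (ns i) :: 'a fls)"
  \<comment> \<open>\<open>E (k + i)\<close> contains \<open>K_gen 1\<close> and all earlier y, so
    transcendence of the i-th value over it passes down to the field they generate.\<close>
  define E where "E = (\<lambda>m. gen_field ((Kfield \<union> (\<lambda>j. xval (q ^ Suc j)) ` {..<m}) \<union> zvals))"
  have E: "is_subfield (E m)" for m unfolding E_def by (rule is_subfield_gen_field)
  have EE: "Kfield \<union> (\<lambda>j. xval (q ^ Suc j)) ` {..<m} \<union> zvals \<subseteq> E m" for m
    unfolding E_def by (rule gen_field_superset)
  have sup: "Kfield \<subseteq> E m" "zvals \<subseteq> E m" "j < m \<Longrightarrow> xval (q ^ Suc j) \<in> E m" for m j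
    using EE[of m] by blast+
  have spE: "x \<in> E m" if "x \<in> spn Kfield zvals" for x m
    using that
  proof induction
    case (step r s t)
    then have "r \<in> E m" "s \<in> E m" using sup(1,2)[of m] by blast+
    then show ?case using step by (intro subfield_closed(3,4)[OF E])
  qed (rule subfield_closed(1)[OF E])
  have K1: "K_gen 1 \<subseteq> E m" for m
    unfolding K_gen_def
  proof (rule gen_field_least[OF E])
    have "mzv_depth 1 \<subseteq> E m"
    proof
      fix x :: "'a fls" assume "x \<in> mzv_depth 1"
      then obtain n where "n \<ge> 1" "x = multizeta [n]" by (auto simp: mzv_depth_def length_Suc_conv)
      then show "x \<in> E m" using spE[OF multizeta_depth_1] by simp
    qed
    then show "Kfield \<union> mzv_depth 1 \<union> mzv_depth 1 \<subseteq> E m" using sup(1) by blast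
  qed
  have "alg_indep_over (K_gen 1) (map y [0..<n])"
  proof (rule alg_indep_over_sequence)
    show "is_subfield (K_gen 1 :: 'a fls set)" unfolding K_gen_def by (rule is_subfield_gen_field)
    fix i
    have "y j \<in> E (k + i)" if "j < i" for j
    proof -
      have "xval (q ^ Suc (k + j)) \<in> E (k + i)" using that by (intro sup(3)) simp
      then have "xval (q ^ Suc (k + j)) - z j \<in> E (k + i)" by (rule subfield_closed(7)[OF E _ spE[OF z]])
      then show ?thesis unfolding y_def v by (rule subfield_closed(4)[OF E subsetD[OF sup(1) c(1)]])
    qed
    then have "K_gen 1 \<union> y ` {..<i} \<subseteq> E (k + i)" using K1[of "k + i"] by blast
    then have "gen_field (K_gen 1 \<union> y ` {..<i}) \<subseteq> E (k + i)" by (rule gen_field_least[OF E])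
    moreover have "transcendental_over (E (k + i)) (y i)"
      unfolding y_def v
    proof (rule transcendental_over_affine[OF E _ subsetD[OF sup(1) c(1)] c(2) spE[OF z]])
      show "transcendental_over (E (k + i)) (xval (q ^ Suc (k + i)))"
        unfolding E_def by (rule xval_transcendental)
    qed
    ultimately show "transcendental_over (gen_field (K_gen 1 \<union> y ` {..<i})) (y i)"
      by (rule transcendental_over_mono[rotated])
  qed
  moreover have "set (map y [0..<n]) \<subseteq> K_gen (k + 2)"
  proof -
    have "y i \<in> mzv_depth (k + 2)" for i
      unfolding y_def mzv_depth_def by (intro CollectI exI[of _ "ns i"] conjI refl ns)
    moreover have "mzv_depth (k + 2) \<subseteq> (K_gen (k + 2) :: 'a fls set)"
      unfolding K_gen_def using gen_field_superset[of "Kfield \<union> mzv_depth 1 \<union> mzv_depth (k + 2)"] by blast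
    ultimately show ?thesis unfolding set_map by blast
  qed
  ultimately show "\<exists>xs. length xs = n \<and> set xs \<subseteq> K_gen (k + 2) \<and> alg_indep_over (K_gen 1) (xs :: 'a fls list)"
    by (intro exI[of _ "map y [0..<n]"] conjI) (simp_all only: length_map length_upt diff_zero)
qed

end

theorem theorem1p2:
  assumes "card (UNIV :: 'a::{field,finite} set) \<noteq> 2"
    and "(d::nat) \<ge> 2"
  shows "infinite_trdeg (K_gen d :: 'a fls set) (K_gen 1)"
proof -
  interpret carlitz "TYPE('a)" "card (UNIV :: 'a set)" by unfold_locales (use assms(1) in simp_all)
  have "d - 2 + 2 = d" using assms(2) by simp
  then show ?thesis using multizeta_infinite_trdeg[of "d - 2"] by (simp only:)
qed

end
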